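(* Let $X$ be a complex Banach space and let $-A\colon \mathsf D(A)\subseteq X\to X$ be the infinitesimal generator of a strongly measurable semigroup $(S(t))_{t\ge 0}$ on $X$ which is uniformly exponentially stable, i.e. there exist $M_0\in[1,\infty)$ and $w\in(0,\infty)$ with $\|S(t)\|_{\mathscr L(X)}\le M_0e^{-wt}$ for all $t\ge 0$. Let $t_0\in\mathbb R$, $s\in(0,\infty)$, $p\in[1,\infty]$, and suppose that either $p=1$ and $s\in[1,\infty)$, or $p\in(1,\infty)$ and $s\in(1/p,\infty)$. Let $g\in L^p(-\infty,t_0;X)$ and let $u$ be an $L^p$-solution to the Dirichlet problem $$\mathfrak D^su(t)=0,\quad t\in(t_0,\infty);\qquad u(t)=g(t),\quad t\in(-\infty,t_0].$$ Then $u$ is the mild solution to this Dirichlet problem. That is (identifying functions with their continuous representatives): $g\in C_{\mathrm b}((-\infty,t_0];X)\cap\mathsf D(\mathfrak D^{(s-1)\vee 0})$ and $\mathfrak D^{(s-1)\vee0}g\in C_{\mathrm b}((-\infty,t_0];X)$; $u\in C_{\mathrm b}(\mathbb R\setminus\{t_0\};X)$; $u(t)=g(t)$ for all $t\in(-\infty,t_0]$; and, for all $t\in(t_0,\infty)$, if $s\notin\mathbb N$, $$u(t)=\frac{\sin(\pi\{s\})}{\pi}\int_0^\infty\frac{\tau^{-\{s\}}}{\tau+1}S((t-t_0)(\tau+1))\,g(t_0-(t-t_0)\tau)\,\mathrm d\tau+\sum_{k=1}^{\lfloor s\rfloor}\frac{(t-t_0)^{\{s\}+k-1}}{\Gamma(\{s\}+k)}S(t-t_0)\,\mathfrak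 D^{\{s\}+k-1}g(t_0),$$ whereas if $s=n\in\mathbb N$, $$u(t)=\sum_{k=0}^{n-1}\frac{(t-t_0)^k}{k!}S(t-t_0)\,\mathfrak D^kg(t_0).$$
   Context: Semigroups: $(S(t))_{t\ge0}\subseteq\mathscr L(X)$ (bounded linear operators on $X$) is a strongly measurable semigroup if $S(0)=\mathrm{Id}_X$, $S(t+r)=S(t)S(r)$ for all $t,r\ge0$, and $t\mapsto S(t)x$ is strongly measurable on $[0,\infty)$ for every $x\in X$. If $\|S(t)\|\le M_0e^{-wt}$, a linear operator $G\colon\mathsf D(G)\subseteq X\to X$ is its infinitesimal generator if for all $\lambda\in\mathbb C$ with $\operatorname{Re}\lambda>w$ the operator $\lambda\,\mathrm{Id}_X-G$ has a bounded inverse and $\langle(\lambda\,\mathrm{Id}_X-G)^{-1}x,x^*\rangle=\int_0^\infty e^{-\lambda t}\langle S(t)x,x^*\rangle\,\mathrm dt$ for all $x\in X$, $x^*\in X^*$. (No strong continuity at $0$ and no density of $\mathsf D(A)$ is assumed.) Fractional parabolic calculus: let $I$ be $\mathbb R$ or $(-\infty,t_0]$. For $\sigma\in(0,\infty)$ and $v\in L^p(I;X)$ (Bochner space), put $\mathfrak I^\sigma v(t)=\frac1{\Gamma(\sigma)}\int_0^\infty\tau^{\sigma-1}S(\tau)v(t-\tau)\,\mathrm d\tau$ for $t\in I$, and $\mathfrak I^0=\mathrm{Id}$; this is a bounded operator on $L^p(I;X)$. The operator $\partial_t+A$ on $L^p(I;X)$ has domain $L^p(I;\mathsf D(A))\cap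 W^{1,p}(I;X)$ (graph norm on $\mathsf D(A)$; $\partial_t$ the weak derivative; $(Av)(t)=A(v(t))$), and its integer powers have their natural iterated domains. For $\sigma\in[0,\infty)$, $\mathfrak D^\sigma v=(\partial_t+A)^{\lceil\sigma\rceil}\mathfrak I^{\lceil\sigma\rceil-\sigma}v$ with domain $\mathsf D(\mathfrak D^\sigma)=\{v\in L^p(I;X):\mathfrak I^{\lceil\sigma\rceil-\sigma}v\in\mathsf D((\partial_t+A)^{\lceil\sigma\rceil})\}$. Applied to $g$, the operators are those with $I=(-\infty,t_0]$; applied to $u$, those with $I=\mathbb R$. $L^p$-solution: $u\in L^p(\mathbb R;X)$ is an $L^p$-solution if $u\in\mathsf D(\mathfrak D^s)$ (with $I=\mathbb R$), $\mathfrak D^su=0$ a.e. on $(t_0,\infty)$ and $u=g$ a.e. on $(-\infty,t_0]$. Notation: $\lfloor s\rfloor$, $\lceil s\rceil$ are floor and ceiling, $\{s\}=s-\lfloor s\rfloor$, $a\vee b=\max\{a,b\}$, $\mathbb N=\{1,2,\dots\}$, $C_{\mathrm b}$ denotes bounded continuous functions. Values at $t_0$ are those of continuous representatives. *)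

theory Defs
  imports "HOL-Analysis.Analysis"
begin

section \<open>Complex Banach spaces\<close>

class complex_banach = banach +
  fixes scaleC :: "complex \<Rightarrow> 'a \<Rightarrow> 'a" (infixr "*\<^sub>C" 75)
  assumes scaleC_add_right: "a *\<^sub>C (x + y) = a *\<^sub>C x + a *\<^sub>C y"
    and scaleC_add_left: "(a + b) *\<^sub>C x = a *\<^sub>C x + b *\<^sub>C x"
    and scaleC_scaleC: "a *\<^sub>C (b *\<^sub>C x) = (a * b) *\<^sub>C x"
    and scaleR_scaleC: "r *\<^sub>R x = complex_of_real r *\<^sub>C x"
    and norm_scaleC: "norm (a *\<^sub>C x) = cmod a * norm x"

instantiation complex :: complex_banach
begin

definition scaleC_complex :: "complex \<Rightarrow> complex \<Rightarrow> complex" where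
  "scaleC_complex a x = a * x"

instance
  by standard (auto simp: scaleC_complex_def algebra_simps norm_mult scaleR_conv_of_real)

end

text \<open>Together with the real linearity built into the type of bounded linear maps, this is
  complex linearity.\<close>

definition complex_homogeneous :: "('a::complex_banach \<Rightarrow>\<^sub>L 'b::complex_banach) \<Rightarrow> bool" where
  "complex_homogeneous T \<longleftrightarrow> (\<forall>c x. blinfun_apply T (c *\<^sub>C x) = c *\<^sub>C blinfun_apply T x)"

section \<open>Strong measurability and Bochner integral in arbitrary Banach spaces\<close>

text \<open>The Bochner integral of \<^theory>\<open>HOL-Analysis.Bochner_Integration\<close> is restricted to
  second countable range types. Here the Banach space need not be separable, so Borel
  measurability is replaced by strong measurability: a.e. limit of simple functions. The rest of
  the definition is the one of the library; lemma \<open>bochner_has_integral_iff\<close> below shows that both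
  agree on second countable spaces over a complete measure (such as \<^term>\<open>lebesgue_on I\<close>, the
  only kind of measure used here).\<close>

definition strongly_measurable :: "'m measure \<Rightarrow> ('m \<Rightarrow> 'a::real_normed_vector) \<Rightarrow> bool" where
  "strongly_measurable M f \<longleftrightarrow>
     (\<exists>s. (\<forall>n::nat. simple_function M (s n)) \<and> (AE x in M. (\<lambda>n. s n x) \<longlonglongrightarrow> f x))"

definition bochner_has_integral :: "'m measure \<Rightarrow> ('m \<Rightarrow> 'a::real_normed_vector) \<Rightarrow> 'a \<Rightarrow> bool" where
  "bochner_has_integral M f y \<longleftrightarrow> strongly_measurable M f \<and>
     (\<exists>s. (\<forall>n::nat. Bochner_Integration.simple_bochner_integrable M (s n)) \<and>
        (\<lambda>n. \<integral>\<^sup>+x. ennreal (norm (f x - s n x)) \<partial>M) \<longlonglongrightarrow> 0 \<and>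
        (\<lambda>n. Bochner_Integration.simple_bochner_integral M (s n)) \<longlonglongrightarrow> y)"

definition bochner_integrable :: "'m measure \<Rightarrow> ('m \<Rightarrow> 'a::real_normed_vector) \<Rightarrow> bool" where
  "bochner_integrable M f \<longleftrightarrow> (\<exists>y. bochner_has_integral M f y)"

definition bochner_integral :: "'m measure \<Rightarrow> ('m \<Rightarrow> 'a::real_normed_vector) \<Rightarrow> 'a" where
  "bochner_integral M f = (if bochner_integrable M f then THE y. bochner_has_integral M f y else 0)"

lemma strongly_measurable_iff_borel:
  fixes f :: "'m \<Rightarrow> 'a::{real_normed_vector, second_countable_topology}"
  assumes "complete_measure M"
  shows "strongly_measurable M f \<longleftrightarrow> f \<in> borel_measurable M"
proof
  assume "strongly_measurable M f"
  then obtain s where s: "\<And>n::nat. simple_function M (s n)"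
    and lim: "AE x in M. (\<lambda>n. s n x) \<longlonglongrightarrow> f x"
    unfolding strongly_measurable_def by auto
  from lim obtain N where N: "{x \<in> space M. \<not> (\<lambda>n. s n x) \<longlonglongrightarrow> f x} \<subseteq> N" "N \<in> null_sets M"
    by (auto elim!: AE_E simp: null_sets_def)
  have sub: "B \<in> sets M" if "B \<subseteq> N" for B
    using complete_measure.complete[OF assms that] N(2) by auto
  define h where "h x = (if x \<in> N then 0 else f x)" for x
  have h: "h \<in> borel_measurable M"
  proof (rule borel_measurable_LIMSEQ_metric)
    have Nm: "N \<in> sets M" using N(2) by auto
    show "(\<lambda>x. if x \<in> N then 0 else s n x) \<in> borel_measurable M" for n
      using borel_measurable_simple_function[OF s, of n] Nm
      by (intro measurable_If_set) auto
    show "(\<lambda>n. if x \<in> N then 0 else s n x) \<longlonglongrightarrow> h x" if "x \<in> space M" for x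
      using N(1) that by (auto simp: h_def)
  qed
  show "f \<in> borel_measurable M"
  proof (rule measurableI)
    fix A :: "'a set" assume A: "A \<in> sets borel"
    have "f -` A \<inter> space M = (h -` A \<inter> space M - N) \<union> (f -` A \<inter> space M \<inter> N)"
      by (auto simp: h_def)
    moreover have "h -` A \<inter> space M - N \<in> sets M"
      using measurable_sets[OF h A] N(2) by auto
    moreover have "f -` A \<inter> space M \<inter> N \<in> sets M" by (rule sub) auto
    ultimately show "f -` A \<inter> space M \<in> sets M" by (metis sets.Un)
  qed auto
next
  assume "f \<in> borel_measurable M"
  from borel_measurable_implies_sequence_metric[OF this, of 0]
  obtain F where "\<forall>i. simple_function M (F i)" "\<forall>x\<in>space M. (\<lambda>i. F i x) \<longlonglongrightarrow> f x"
    by auto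
  then show "strongly_measurable M f"
    unfolding strongly_measurable_def by (intro exI[of _ F]) auto
qed

lemma bochner_has_integral_iff:
  fixes f :: "'m \<Rightarrow> 'a::{real_normed_vector, second_countable_topology}"
  assumes "complete_measure M"
  shows "bochner_has_integral M f y \<longleftrightarrow> has_bochner_integral M f y"
  unfolding bochner_has_integral_def has_bochner_integral.simps
    strongly_measurable_iff_borel[OF assms] by auto

section \<open>Bochner spaces\<close>

definition Lp_finite :: "ennreal \<Rightarrow> 'm measure \<Rightarrow> ('m \<Rightarrow> real) \<Rightarrow> bool" where
  "Lp_finite p M r \<longleftrightarrow>
     (if p = \<infinity> then \<exists>C. AE x in M. \<bar>r x\<bar> \<le> C
      else (\<integral>\<^sup>+x. ennreal (\<bar>r x\<bar> powr enn2real p) \<partial>M) < \<infinity>)"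

text \<open>Elements of Bochner spaces are represented by functions on the whole real line, of which
  only the a.e. class on the interval \<open>I\<close> matters. Accordingly, operators between Bochner spaces
  whose values are determined only a.e. are represented by their graphs, i.e. by relations
  that are invariant under a.e. equality.\<close>

definition Lp :: "ennreal \<Rightarrow> real set \<Rightarrow> (real \<Rightarrow> 'a::complex_banach) \<Rightarrow> bool" where
  "Lp p I v \<longleftrightarrow> strongly_measurable (lebesgue_on I) v \<and> Lp_finite p (lebesgue_on I) (\<lambda>t. norm (v t))"

text \<open>An unbounded operator is a pair of a domain \<open>D\<close> and a function \<open>A\<close>, whose values outside
  \<open>D\<close> are irrelevant. \<open>Lp_dom p I D A v\<close> means that \<open>v\<close> lies in the Bochner space over \<open>I\<close> with values
  in \<open>D\<close> carrying the graph norm; strong measurability refers to this norm.\<close>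

definition Lp_dom ::
  "ennreal \<Rightarrow> real set \<Rightarrow> 'a set \<Rightarrow> ('a \<Rightarrow> 'a) \<Rightarrow> (real \<Rightarrow> 'a::complex_banach) \<Rightarrow> bool" where
  "Lp_dom p I D A v \<longleftrightarrow>
     (\<exists>s. (\<forall>n::nat. simple_function (lebesgue_on I) (s n) \<and> s n ` I \<subseteq> D) \<and>
        (AE t in lebesgue_on I. v t \<in> D \<and>
           (\<lambda>n. norm (s n t - v t) + norm (A (s n t) - A (v t))) \<longlonglongrightarrow> 0)) \<and>
     Lp_finite p (lebesgue_on I) (\<lambda>t. norm (v t) + norm (A (v t)))"

definition test_function :: "real set \<Rightarrow> (real \<Rightarrow> real) \<Rightarrow> bool" where
  "test_function I \<phi> \<longleftrightarrow>
     (\<forall>n x. (deriv ^^ n) \<phi> differentiable (at x)) \<and>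
     (\<exists>K. compact K \<and> K \<subseteq> interior I \<and> (\<forall>x. x \<notin> K \<longrightarrow> \<phi> x = 0))"

text \<open>\<open>W1p_deriv p I v v'\<close>: \<open>v\<close> is in the Sobolev space \<open>W\<^sup>1\<^sup>,\<^sup>p(I)\<close> and \<open>v'\<close> is its weak derivative.\<close>

definition W1p_deriv ::
  "ennreal \<Rightarrow> real set \<Rightarrow> (real \<Rightarrow> 'a::complex_banach) \<Rightarrow> (real \<Rightarrow> 'a) \<Rightarrow> bool" where
  "W1p_deriv p I v v' \<longleftrightarrow> Lp p I v \<and> Lp p I v' \<and>
     (\<forall>\<phi>. test_function I \<phi> \<longrightarrow>
        bochner_integral (lebesgue_on I) (\<lambda>t. deriv \<phi> t *\<^sub>R v t) =
        - bochner_integral (lebesgue_on I) (\<lambda>t. \<phi> t *\<^sub>R v' t))"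

section \<open>Semigroups and generators\<close>

definition strongly_measurable_semigroup :: "(real \<Rightarrow> ('a::complex_banach \<Rightarrow>\<^sub>L 'a)) \<Rightarrow> bool" where
  "strongly_measurable_semigroup S \<longleftrightarrow>
     (\<forall>t\<ge>0. complex_homogeneous (S t)) \<and>
     S 0 = id_blinfun \<and>
     (\<forall>t\<ge>0. \<forall>r\<ge>0. S (t + r) = S t o\<^sub>L S r) \<and>
     (\<forall>x. strongly_measurable (lebesgue_on {0..}) (\<lambda>t. blinfun_apply (S t) x))"

definition linear_operator :: "'a::complex_banach set \<Rightarrow> ('a \<Rightarrow> 'a) \<Rightarrow> bool" where
  "linear_operator D G \<longleftrightarrow> 0 \<in> D \<and>
     (\<forall>x\<in>D. \<forall>y\<in>D. x + y \<in> D \<and> G (x + y) = G x + G y) \<and>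
     (\<forall>c. \<forall>x\<in>D. c *\<^sub>C x \<in> D \<and> G (c *\<^sub>C x) = c *\<^sub>C G x)"

text \<open>The number \<open>w\<close> is the one of a given bound \<open>\<parallel>S(t)\<parallel> \<le> M\<^sub>0 exp(-wt)\<close>.\<close>

definition infinitesimal_generator ::
  "(real \<Rightarrow> ('a::complex_banach \<Rightarrow>\<^sub>L 'a)) \<Rightarrow> real \<Rightarrow> 'a set \<Rightarrow> ('a \<Rightarrow> 'a) \<Rightarrow> bool" where
  "infinitesimal_generator S w D G \<longleftrightarrow> linear_operator D G \<and>
     (\<forall>\<mu>::complex. Re \<mu> > w \<longrightarrow>
        (\<exists>R::'a \<Rightarrow>\<^sub>L 'a.
           (\<forall>x. blinfun_apply R x \<in> D \<and> \<mu> *\<^sub>C blinfun_apply R x - G (blinfun_apply R x) = x) \<and>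
           (\<forall>x\<in>D. blinfun_apply R (\<mu> *\<^sub>C x - G x) = x) \<and>
           (\<forall>x. \<forall>\<phi>::'a \<Rightarrow>\<^sub>L complex. complex_homogeneous \<phi> \<longrightarrow>
              blinfun_apply \<phi> (blinfun_apply R x) =
              (LINT t|lebesgue_on {0..}.
                 exp (- \<mu> * complex_of_real t) * blinfun_apply \<phi> (blinfun_apply (S t) x)))))"

section \<open>Fractional parabolic calculus\<close>

text \<open>For \<open>t \<in> I\<close> (where \<open>I\<close> is the real line or \<open>(-\<infinity>, t\<^sub>0]\<close>) only values of \<open>v\<close> on \<open>I\<close> enter. For
  \<open>v\<close> in a Bochner space over \<open>I\<close>, the integral exists for a.e. \<open>t \<in> I\<close>.\<close>

definition frac_integral ::
  "(real \<Rightarrow> ('a::complex_banach \<Rightarrow>\<^sub>L 'a)) \<Rightarrow> real \<Rightarrow> (real \<Rightarrow> 'a) \<Rightarrow> (real \<Rightarrow> 'a)" where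
  "frac_integral S \<sigma> v t =
     (if \<sigma> = 0 then v t
      else (1 / Gamma \<sigma>) *\<^sub>R
        bochner_integral (lebesgue_on {0..}) (\<lambda>\<tau>. \<tau> powr (\<sigma> - 1) *\<^sub>R blinfun_apply (S \<tau>) (v (t - \<tau>))))"

text \<open>\<open>parabolic_op p I D A v f\<close>: \<open>v\<close> is in the domain of \<open>\<partial>\<^sub>t + A\<close> and \<open>(\<partial>\<^sub>t + A)v = f\<close> a.e. on \<open>I\<close>.
  The next two definitions are to be read in the same way for \<open>(\<partial>\<^sub>t + A)\<^sup>n\<close> and for the fractional
  power of order \<open>\<sigma>\<close>.\<close>

definition parabolic_op ::
  "ennreal \<Rightarrow> real set \<Rightarrow> 'a set \<Rightarrow> ('a \<Rightarrow> 'a) \<Rightarrow>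
   (real \<Rightarrow> 'a::complex_banach) \<Rightarrow> (real \<Rightarrow> 'a) \<Rightarrow> bool" where
  "parabolic_op p I D A v f \<longleftrightarrow> Lp_dom p I D A v \<and> Lp p I f \<and>
     (\<exists>v'. W1p_deriv p I v v' \<and> (AE t in lebesgue_on I. f t = v' t + A (v t)))"

primrec parabolic_power ::
  "ennreal \<Rightarrow> real set \<Rightarrow> 'a set \<Rightarrow> ('a \<Rightarrow> 'a) \<Rightarrow> nat \<Rightarrow>
   (real \<Rightarrow> 'a::complex_banach) \<Rightarrow> (real \<Rightarrow> 'a) \<Rightarrow> bool" where
  "parabolic_power p I D A 0 v f \<longleftrightarrow> Lp p I v \<and> Lp p I f \<and> (AE t in lebesgue_on I. f t = v t)"
| "parabolic_power p I D A (Suc n) v f \<longleftrightarrow>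
     (\<exists>h. parabolic_power p I D A n v h \<and> parabolic_op p I D A h f)"

definition frac_parabolic ::
  "ennreal \<Rightarrow> real set \<Rightarrow> 'a set \<Rightarrow> ('a \<Rightarrow> 'a) \<Rightarrow> (real \<Rightarrow> ('a::complex_banach \<Rightarrow>\<^sub>L 'a)) \<Rightarrow> real \<Rightarrow>
   (real \<Rightarrow> 'a) \<Rightarrow> (real \<Rightarrow> 'a) \<Rightarrow> bool" where
  "frac_parabolic p I D A S \<sigma> v f \<longleftrightarrow> Lp p I v \<and>
     parabolic_power p I D A (nat \<lceil>\<sigma>\<rceil>) (frac_integral S (of_int \<lceil>\<sigma>\<rceil> - \<sigma>) v) f"

section \<open>Solutions of the Dirichlet problem\<close>

definition Lp_solution ::
  "ennreal \<Rightarrow> 'a set \<Rightarrow> ('a \<Rightarrow> 'a) \<Rightarrow> (real \<Rightarrow> ('a::complex_banach \<Rightarrow>\<^sub>L 'a)) \<Rightarrow> real \<Rightarrow> real \<Rightarrow>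
   (real \<Rightarrow> 'a) \<Rightarrow> (real \<Rightarrow> 'a) \<Rightarrow> bool" where
  "Lp_solution p D A S s t\<^sub>0 g u \<longleftrightarrow> Lp p UNIV u \<and>
     (\<exists>f. frac_parabolic p UNIV D A S s u f \<and> (AE t in lebesgue_on {t\<^sub>0<..}. f t = 0)) \<and>
     (AE t in lebesgue_on {..t\<^sub>0}. u t = g t)"

text \<open>Here \<open>gc\<close> and \<open>uc\<close> are the continuous representatives of \<open>g\<close> and \<open>u\<close> (the latter continuous off
  \<open>t\<^sub>0\<close>), and \<open>h \<sigma>\<close> is the continuous representative on \<open>(-\<infinity>, t\<^sub>0]\<close> of the fractional power of order
  \<open>\<sigma>\<close> applied to \<open>g\<close>, for those orders \<open>\<sigma>\<close> that occur. For a natural number \<open>s = n\<close> these are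
  \<open>0, \<dots>, n - 1\<close>, since then \<open>frac s = 0\<close>. That the integral exists is stated
  explicitly, because \<^const>\<open>bochner_integral\<close> is a total function.\<close>

definition mild_solution ::
  "ennreal \<Rightarrow> 'a set \<Rightarrow> ('a \<Rightarrow> 'a) \<Rightarrow> (real \<Rightarrow> ('a::complex_banach \<Rightarrow>\<^sub>L 'a)) \<Rightarrow> real \<Rightarrow> real \<Rightarrow>
   (real \<Rightarrow> 'a) \<Rightarrow> (real \<Rightarrow> 'a) \<Rightarrow> bool" where
  "mild_solution p D A S s t\<^sub>0 g u \<longleftrightarrow>
     (\<exists>gc uc h.
        (AE t in lebesgue_on {..t\<^sub>0}. g t = gc t) \<and>
        continuous_on {..t\<^sub>0} gc \<and> bounded (gc ` {..t\<^sub>0}) \<and>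
        (\<forall>\<sigma> \<in> {max (s - 1) 0} \<union> {frac s + real k - 1 | k. k \<in> {1..nat \<lfloor>s\<rfloor>}}.
           frac_parabolic p {..t\<^sub>0} D A S \<sigma> g (h \<sigma>) \<and> continuous_on {..t\<^sub>0} (h \<sigma>)) \<and>
        bounded (h (max (s - 1) 0) ` {..t\<^sub>0}) \<and>
        (AE t in lebesgue. u t = uc t) \<and>
        continuous_on (- {t\<^sub>0}) uc \<and> bounded (uc ` (- {t\<^sub>0})) \<and>
        (\<forall>t\<le>t\<^sub>0. uc t = gc t) \<and>
        (s \<notin> \<nat> \<longrightarrow>
          (\<forall>t>t\<^sub>0. let K = (\<lambda>\<tau>. (\<tau> powr (- frac s) / (\<tau> + 1)) *\<^sub>R
                        blinfun_apply (S ((t - t\<^sub>0) * (\<tau> + 1))) (gc (t\<^sub>0 - (t - t\<^sub>0) * \<tau>)))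
             in bochner_integrable (lebesgue_on {0..}) K \<and>
                uc t = (sin (pi * frac s) / pi) *\<^sub>R bochner_integral (lebesgue_on {0..}) K
                  + (\<Sum>k=1..nat \<lfloor>s\<rfloor>. ((t - t\<^sub>0) powr (frac s + real k - 1) / Gamma (frac s + real k)) *\<^sub>R
                       blinfun_apply (S (t - t\<^sub>0)) (h (frac s + real k - 1) t\<^sub>0)))) \<and>
        (\<forall>n::nat. s = real n \<longrightarrow>
          (\<forall>t>t\<^sub>0. uc t = (\<Sum>k<n. ((t - t\<^sub>0) ^ k / fact k) *\<^sub>R
                       blinfun_apply (S (t - t\<^sub>0)) (h (real k) t\<^sub>0)))))"

end

theory Submission imports Defs
begin

text \<open>Let \<open>f\<close> be the fractional power of order \<open>s\<close> applied to \<open>u\<close>, which vanishes after \<open>t\<^sub>0\<close>. The heart of the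
  matter is that \<open>u\<close> is the fractional integral of order \<open>s\<close> of \<open>f\<close> (\<open>solution_is_frac_integral\<close>). Everything
  else is read off from this representation.

  \<^item> \<open>u\<close> has a bounded continuous representative, because the kernel \<open>frac_kernel s\<close>, damped
    exponentially by the semigroup, lies in the dual of \<open>L\<^sup>p\<close> under the condition on \<open>p\<close> and \<open>s\<close>, and
    because translations are continuous in \<open>L\<^sup>p\<close> (\<open>frac_integral_Lp_bounded\<close>, \<open>frac_integral_Lp_continuous\<close>).

  \<^item> The fractional powers of \<open>g\<close> of the orders \<open>s - i\<close> are the fractional integrals of \<open>f\<close> of the natural orders
    \<open>i\<close>: these are the intermediate stages in forming the power of \<open>\<partial>\<^sub>t + A\<close> that defines \<open>f\<close>, and they
    may be restricted to \<open>(-\<infinity>, t\<^sub>0]\<close>, as \<open>\<partial>\<^sub>t + A\<close> is local and fractional integrals see the past only.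

  \<^item> At \<open>t = t\<^sub>0 + a\<close> the representation is an integral over the history, \<open>u(t) = \<integral>\<^sub>0\<^sup>\<infinity> frac_kernel s (a + r) S(a + r) f(t\<^sub>0 - r) dr\<close>.
    For natural \<open>s\<close> the binomial theorem expands the kernel in \<open>a\<close>, and every summand is \<open>S(a)\<close> applied to a
    fractional integral of \<open>f\<close> at \<open>t\<^sub>0\<close> (\<open>mild_formula_nat\<close>). For \<open>s = \<theta> + m\<close> with \<open>0 < \<theta> < 1\<close> the expansion of the
    kernel has a remainder, which is the convolution of \<open>frac_kernel s\<close> with \<open>memory_kernel \<theta> a\<close>
    (\<open>memory_kernel_convolution\<close>). Since the fractional integral of order \<open>s\<close> of \<open>f\<close> is \<open>u\<close> itself, the
    remainder contributes the integral over the values of \<open>g\<close> (\<open>mild_formula_frac\<close>).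

  To see that \<open>u\<close> is a fractional integral of \<open>f\<close>, one has to invert \<open>\<partial>\<^sub>t + A\<close> on the whole line. As orbits
  may fail to be differentiable, and even to be continuous at \<open>0\<close>, the argument takes place behind the bounded operator \<open>potential = \<integral>\<^sub>0\<^sup>\<infinity> S(r) dr\<close>, which inverts \<open>A\<close> on \<open>D\<close> and is injective by the
  resolvent identity (\<open>potential_generator\<close>). Integration by parts shows that \<open>potential\<close> maps the
  fractional integral of order \<open>1\<close> of a derivative \<open>V'\<close> to \<open>potential V\<close> minus that of \<open>V\<close>. For
  \<open>V' + A V = h\<close> it follows that \<open>V\<close> is the fractional integral of order \<open>1\<close> of \<open>h\<close> (\<open>parabolic_left_inverse\<close>), and
  similarly that this fractional integral is injective (\<open>frac_integral_1_injective\<close>). With \<open>n\<close> the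
  ceiling of \<open>s\<close>, the fractional integrals of order \<open>n - s\<close> of \<open>u\<close> and of order \<open>n\<close> of \<open>f\<close> therefore
  agree; as the orders of fractional integrals add up (\<open>frac_integral_compose\<close>), raising the order by
  \<open>1 - (n - s)\<close> and cancelling the fractional integral of order \<open>1\<close> gives the claim.

  As the Banach space may be non-separable, all identities between its elements are tested with real
  functionals (\<open>norming_functional\<close>), which turns vector integrals into Lebesgue integrals of
  Borel functions, where Fubini's theorem applies.\<close>

section \<open>Norming functionals\<close>

text \<open>Graphs of linear functionals on subspaces that are dominated by the norm. Domination at \<open>y = 0\<close> makes
  such a set single-valued, and extension of functionals becomes inclusion.\<close>

definition norm_dominated :: "('a::real_normed_vector \<times> real) set \<Rightarrow> bool" where
  "norm_dominated G \<longleftrightarrow> subspace G \<and> (\<forall>(y, a) \<in> G. a \<le> norm y)"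

text \<open>The extension step of the Hahn--Banach theorem. By the triangle inequality, the numbers
  \<open>a - norm (y - z)\<close> lie below the numbers \<open>norm (y + z) - a\<close>; any \<open>c\<close> in between is a possible value
  at \<open>z\<close>.\<close>

lemma norm_dominated_extend:
  fixes G :: "('a::real_normed_vector \<times> real) set"
  assumes G: "norm_dominated G"
  shows "\<exists>c. norm_dominated {(y + t *\<^sub>R z, a + t * c) | y a t. (y, a) \<in> G}"
proof -
  have sub: "subspace G" and le: "\<And>y a. (y, a) \<in> G \<Longrightarrow> a \<le> norm y"
    using G by (auto simp: norm_dominated_def)
  have sep: "a - norm (y - z) \<le> norm (y' + z) - a'" if "(y, a) \<in> G" "(y', a') \<in> G" for y a y' a'
  proof -
    have "(y, a) + (y', a') \<in> G" using sub that by (rule subspace_add)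
    then have "a + a' \<le> norm (y + y')" using le by auto
    also have "\<dots> \<le> norm (y - z) + norm (y' + z)"
      using norm_triangle_ineq[of "y - z" "y' + z"] by simp
    finally show ?thesis by simp
  qed
  define c where "c = (SUP (y, a) \<in> G. a - norm (y - z))"
  have G0: "(0, 0) \<in> G" using subspace_0[OF sub] by (simp add: zero_prod_def)
  have upper: "a - norm (y - z) \<le> c" if "(y, a) \<in> G" for y a
  proof -
    have "bdd_above ((\<lambda>(y, a). a - norm (y - z)) ` G)"
      using sep[OF _ G0] by (intro bdd_aboveI2[where M="norm (0 + z) - 0"]) auto
    from cSUP_upper[OF that this] show ?thesis by (simp add: c_def)
  qed
  have lower: "c \<le> norm (y + z) - a" if "(y, a) \<in> G" for y a
    unfolding c_def using G0 sep[OF _ that] by (intro cSUP_least) auto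
  have bound: "a + t * c \<le> norm (y + t *\<^sub>R z)" if "(y, a) \<in> G" for y a t
  proof -
    have scaled: "(r *\<^sub>R y, r * a) \<in> G" for r
      using subspace_scale[OF sub that, of r] by (simp add: scaleR_prod_def)
    consider "t = 0" | "t > 0" | "t < 0" by linarith
    then show ?thesis
    proof cases
      case 1 then show ?thesis using le[OF that] by simp
    next
      case 2
      have "t * c \<le> t * (norm ((1/t) *\<^sub>R y + z) - (1/t) * a)"
        using 2 lower[OF scaled[of "1/t"]] by (intro mult_left_mono) auto
      also have "\<dots> = norm (t *\<^sub>R ((1/t) *\<^sub>R y + z)) - a"
        using 2 by (simp add: right_diff_distrib)
      also have "t *\<^sub>R ((1/t) *\<^sub>R y + z) = y + t *\<^sub>R z" using 2 by (simp add: algebra_simps)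
      finally show ?thesis by simp
    next
      case 3
      have "(-t) * ((-1/t) * a - norm ((-1/t) *\<^sub>R y - z)) \<le> (-t) * c"
        using 3 upper[OF scaled[of "-1/t"]] by (intro mult_left_mono) auto
      moreover have "(-t) * norm ((-1/t) *\<^sub>R y - z) = norm ((-t) *\<^sub>R ((-1/t) *\<^sub>R y - z))"
        using 3 by simp
      moreover have "(-t) *\<^sub>R ((-1/t) *\<^sub>R y - z) = y + t *\<^sub>R z"
        using 3 by (simp add: algebra_simps)
      ultimately show ?thesis using 3 by (simp add: algebra_simps)
    qed
  qed
  have "subspace {(y + t *\<^sub>R z, a + t * c) | y a t. (y, a) \<in> G}" (is "subspace ?H")
  proof (rule subspaceI)
    have "0 = (0 + 0 *\<^sub>R z, 0 + 0 * c)" by (simp add: zero_prod_def)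
    then show "0 \<in> ?H" using G0 by blast
    fix p q assume "p \<in> ?H" "q \<in> ?H"
    then obtain y a t y' a' t' where *: "p = (y + t *\<^sub>R z, a + t * c)" "(y, a) \<in> G"
      "q = (y' + t' *\<^sub>R z, a' + t' * c)" "(y', a') \<in> G" by auto
    have "p + q = ((y + y') + (t + t') *\<^sub>R z, (a + a') + (t + t') * c)"
      by (simp add: * algebra_simps)
    moreover have "(y + y', a + a') \<in> G" using subspace_add[OF sub *(2) *(4)] by simp
    ultimately show "p + q \<in> ?H" by blast
  next
    fix r p assume "p \<in> ?H"
    then obtain y a t where *: "p = (y + t *\<^sub>R z, a + t * c)" "(y, a) \<in> G" by auto
    have "r *\<^sub>R p = (r *\<^sub>R y + (r * t) *\<^sub>R z, r * a + (r * t) * c)"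
      by (simp add: * algebra_simps scaleR_prod_def)
    moreover have "(r *\<^sub>R y, r * a) \<in> G"
      using subspace_scale[OF sub *(2), of r] by (simp add: scaleR_prod_def)
    ultimately show "r *\<^sub>R p \<in> ?H" by blast
  qed
  then show ?thesis unfolding norm_dominated_def using bound by (intro exI[of _ c]) auto
qed

text \<open>The Hahn--Banach theorem for the norm: a maximal dominated graph containing the line through \<open>x\<close> is
  defined everywhere, as it could be extended otherwise.\<close>

theorem norming_functional:
  fixes x :: "'a::real_normed_vector"
  obtains \<psi> :: "'a \<Rightarrow>\<^sub>L real" where "norm \<psi> \<le> 1" "\<psi> x = norm x"
proof -
  define G0 where "G0 = {(t *\<^sub>R x, t * norm x) | t. True}"
  have G0: "norm_dominated G0"
    unfolding norm_dominated_def
  proof (intro conjI subspaceI)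
    show "0 \<in> G0" by (auto simp: G0_def zero_prod_def intro: exI[of _ 0])
    show "p + q \<in> G0" if pq: "p \<in> G0" "q \<in> G0" for p q
    proof -
      obtain t r where "p = (t *\<^sub>R x, t * norm x)" "q = (r *\<^sub>R x, r * norm x)"
        using pq by (auto simp: G0_def)
      then have "p + q = ((t + r) *\<^sub>R x, (t + r) * norm x)" by (simp add: algebra_simps)
      then show ?thesis unfolding G0_def by blast
    qed
    show "r *\<^sub>R p \<in> G0" if p: "p \<in> G0" for r p
    proof -
      obtain t where "p = (t *\<^sub>R x, t * norm x)" using p by (auto simp: G0_def)
      then have "r *\<^sub>R p = ((r * t) *\<^sub>R x, (r * t) * norm x)" by (simp add: scaleR_prod_def)
      then show ?thesis unfolding G0_def by blast
    qed
    show "\<forall>(y, a)\<in>G0. a \<le> norm y" by (auto simp: G0_def mult_right_mono)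
  qed
  define \<A> where "\<A> = {G. norm_dominated G \<and> G0 \<subseteq> G}"
  have "\<exists>M\<in>\<A>. \<forall>X\<in>\<A>. M \<subseteq> X \<longrightarrow> X = M"
  proof (rule Zorn_Lemma2, intro ballI)
    fix C assume C: "C \<in> chains \<A>"
    show "\<exists>U\<in>\<A>. \<forall>X\<in>C. X \<subseteq> U"
    proof (cases "C = {}")
      case True then show ?thesis using G0 by (auto simp: \<A>_def)
    next
      case False
      have CA: "\<And>X. X \<in> C \<Longrightarrow> norm_dominated X \<and> G0 \<subseteq> X"
        and chain: "\<And>X Y. X \<in> C \<Longrightarrow> Y \<in> C \<Longrightarrow> X \<subseteq> Y \<or> Y \<subseteq> X"
        using C by (auto simp: chains_def chain_subset_def \<A>_def)
      have "subspace (\<Union>C)"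
      proof (rule subspaceI)
        show "0 \<in> \<Union>C" using False CA subspace_0 unfolding norm_dominated_def by blast
        show "r *\<^sub>R p \<in> \<Union>C" if "p \<in> \<Union>C" for r p
          using that CA subspace_scale unfolding norm_dominated_def by blast
        show "p + q \<in> \<Union>C" if pq: "p \<in> \<Union>C" "q \<in> \<Union>C" for p q
        proof -
          obtain X Y where XY: "X \<in> C" "p \<in> X" "Y \<in> C" "q \<in> Y" using pq by auto
          then obtain Z where "Z \<in> C" "p \<in> Z" "q \<in> Z" using chain[OF XY(1,3)] by auto
          then show ?thesis using CA[of Z] subspace_add unfolding norm_dominated_def by blast
        qed
      qed
      moreover have "\<forall>(y, a) \<in> \<Union>C. a \<le> norm y"
        using CA unfolding norm_dominated_def by blast
      ultimately have "norm_dominated (\<Union>C)" by (simp add: norm_dominated_def)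
      then show ?thesis using False CA by (intro bexI[of _ "\<Union>C"]) (auto simp: \<A>_def)
    qed
  qed
  then obtain G where G: "norm_dominated G" "G0 \<subseteq> G"
    and max: "\<And>X. norm_dominated X \<Longrightarrow> G \<subseteq> X \<Longrightarrow> X = G"
  proof -
    assume *: "\<And>G. norm_dominated G \<Longrightarrow> G0 \<subseteq> G \<Longrightarrow>
      (\<And>X. norm_dominated X \<Longrightarrow> G \<subseteq> X \<Longrightarrow> X = G) \<Longrightarrow> thesis"
      and ex: "\<exists>M\<in>\<A>. \<forall>X\<in>\<A>. M \<subseteq> X \<longrightarrow> X = M"
    from ex obtain M where M: "M \<in> \<A>" "\<And>X. X \<in> \<A> \<Longrightarrow> M \<subseteq> X \<Longrightarrow> X = M" by blast
    show thesis
    proof (rule *[of M])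
      show "X = M" if "norm_dominated X" "M \<subseteq> X" for X
        using that M by (intro M(2)) (auto simp: \<A>_def)
    qed (use M in \<open>auto simp: \<A>_def\<close>)
  qed
  have sub: "subspace G" and le: "\<And>y a. (y, a) \<in> G \<Longrightarrow> a \<le> norm y"
    using G by (auto simp: norm_dominated_def)
  have total: "\<exists>a. (z, a) \<in> G" for z
  proof -
    obtain c where c: "norm_dominated {(y + t *\<^sub>R z, a + t * c) | y a t. (y, a) \<in> G}" (is "norm_dominated ?H")
      using norm_dominated_extend[OF G(1)] by blast
    have "G \<subseteq> ?H"
    proof
      fix q assume "q \<in> G"
      then have "q = (fst q + 0 *\<^sub>R z, snd q + 0 * c) \<and> (fst q, snd q) \<in> G" by simp
      then show "q \<in> ?H" by blast
    qed
    then have "?H = G" by (rule max[OF c])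
    moreover have "(0 + 1 *\<^sub>R z, 0 + 1 * c) \<in> ?H"
      using subspace_0[OF sub] unfolding zero_prod_def by blast
    ultimately show ?thesis by auto
  qed
  have uniq: "a = b" if "(z, a) \<in> G" "(z, b) \<in> G" for z a b
    using le[of 0 "a - b"] le[of 0 "b - a"] subspace_diff[OF sub that] subspace_diff[OF sub that(2,1)]
    by simp
  define f where "f z = (THE a. (z, a) \<in> G)" for z
  have f: "(z, f z) \<in> G" for z
    unfolding f_def using total[of z] uniq by (metis theI)
  have feq: "f z = a" if "(z, a) \<in> G" for z a using uniq[OF f that] .
  have fbound: "\<bar>f y\<bar> \<le> norm y" for y
    using le[OF f[of y]] le[of "- y" "- f y"] subspace_neg[OF sub f[of y]] by (simp add: abs_le_iff)
  have bl: "bounded_linear f"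
  proof (rule bounded_linear_intro)
    show "f (y + z) = f y + f z" for y z
      using subspace_add[OF sub f[of y] f[of z]] by (intro feq) simp
    show "f (r *\<^sub>R y) = r *\<^sub>R f y" for r y
      using subspace_scale[OF sub f[of y], of r] by (intro feq) (simp add: scaleR_prod_def)
    show "norm (f y) \<le> norm y * 1" for y by (simp add: fbound)
  qed
  show ?thesis
  proof (rule that[of "Blinfun f"])
    show "norm (Blinfun f) \<le> 1"
      by (rule norm_blinfun_bound) (simp_all add: bounded_linear_Blinfun_apply[OF bl] fbound)
    have "(1 *\<^sub>R x, 1 * norm x) \<in> G" using G(2) unfolding G0_def by blast
    then show "Blinfun f x = norm x" 
      by (simp add: bounded_linear_Blinfun_apply[OF bl] feq)
  qed
qed

lemma functionals_separate:
  fixes x y :: "'a::real_normed_vector"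
  assumes "\<And>\<psi> :: 'a \<Rightarrow>\<^sub>L real. \<psi> x = \<psi> y"
  shows "x = y"
proof -
  obtain \<psi> :: "'a \<Rightarrow>\<^sub>L real" where "\<psi> (x - y) = norm (x - y)" by (rule norming_functional)
  then show ?thesis using assms[of \<psi>] by (simp add: blinfun.diff_right)
qed

section \<open>Strongly measurable functions\<close>

text \<open>Everywhere convergence, rather than convergence almost everywhere, makes strong measurability stable
  under composition with arbitrary measurable maps, such as projections and shifts in two variables.\<close>

definition smeas :: "'m measure \<Rightarrow> ('m \<Rightarrow> 'a::real_normed_vector) \<Rightarrow> bool" where
  "smeas M f \<longleftrightarrow>
     (\<exists>s. (\<forall>n::nat. simple_function M (s n)) \<and> (\<forall>x\<in>space M. (\<lambda>n. s n x) \<longlonglongrightarrow> f x))"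

lemma smeas_separable:
  assumes "smeas M f"
  obtains C where "countable C" "\<And>x. x \<in> space M \<Longrightarrow> f x \<in> closure C"
proof -
  obtain s where s: "\<And>n::nat. simple_function M (s n)" "\<And>x. x \<in> space M \<Longrightarrow> (\<lambda>n. s n x) \<longlonglongrightarrow> f x"
    using assms by (auto simp: smeas_def)
  have "countable (\<Union>n. s n ` space M)"
    using s(1) by (intro countable_UN) (auto intro!: countable_finite dest: simple_functionD)
  moreover have "f x \<in> closure (\<Union>n. s n ` space M)" if "x \<in> space M" for x
    using s(2)[OF that] that unfolding closure_sequential by (intro exI[of _ "\<lambda>n. s n x"]) auto
  ultimately show ?thesis by (rule that)
qed

lemma smeas_norm_diff:
  assumes "smeas M f"
  shows "(\<lambda>x. norm (f x - c)) \<in> borel_measurable M"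
proof -
  obtain s where s: "\<And>n::nat. simple_function M (s n)" "\<And>x. x \<in> space M \<Longrightarrow> (\<lambda>n. s n x) \<longlonglongrightarrow> f x"
    using assms by (auto simp: smeas_def)
  show ?thesis
  proof (rule borel_measurable_LIMSEQ_real)
    show "(\<lambda>n. norm (s n x - c)) \<longlonglongrightarrow> norm (f x - c)" if "x \<in> space M" for x
      by (intro tendsto_intros s(2) that)
    show "(\<lambda>x. norm (s n x - c)) \<in> borel_measurable M" for n
      using simple_function_compose1[OF s(1), where g="\<lambda>y. norm (y - c)"]
      by (rule borel_measurable_simple_function)
  qed
qed

text \<open>The approximating simple function picks, among the first points of a countable dense set, the
  one that is nearest to the value.\<close>

lemma smeasI:
  fixes f :: "'m \<Rightarrow> 'a::real_normed_vector"
  assumes C: "countable C" "\<And>x. x \<in> space M \<Longrightarrow> f x \<in> closure C"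
    and meas: "\<And>c. c \<in> C \<Longrightarrow> (\<lambda>x. norm (f x - c)) \<in> borel_measurable M"
  shows "smeas M f"
proof (cases "C = {}")
  case True
  then have "space M = {}" using C(2) by auto
  then show ?thesis unfolding smeas_def by (intro exI[of _ "\<lambda>n x. 0"]) auto
next
  case False
  define e where "e = from_nat_into C"
  have e: "e k \<in> C" for k unfolding e_def using False by (rule from_nat_into)
  define d where "d k x = norm (f x - e k)" for k x
  have [measurable]: "d k \<in> borel_measurable M" for k
    unfolding d_def by (rule meas[OF e])
  define i where "i n x = (LEAST k. k \<le> n \<and> (\<forall>j\<in>{..n}. d k x \<le> d j x))" for n x
  have i: "i n x \<le> n" "\<And>j. j \<le> n \<Longrightarrow> d (i n x) x \<le> d j x" for n x
  proof -
    obtain k where "k \<in> {..n}" "\<forall>j\<in>{..n}. d k x \<le> d j x"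
      using arg_min_if_finite[of "{..n}" "\<lambda>j. d j x"] by (metis finite_atMost atMost_iff empty_iff not_le zero_le)
    then have "k \<le> n \<and> (\<forall>j\<in>{..n}. d k x \<le> d j x)" by auto
    from LeastI[of "\<lambda>k. k \<le> n \<and> (\<forall>j\<in>{..n}. d k x \<le> d j x)", OF this]
    show "i n x \<le> n" "\<And>j. j \<le> n \<Longrightarrow> d (i n x) x \<le> d j x" unfolding i_def by auto
  qed
  have i_simple: "simple_function M (i n)" for n
  proof -
    have "i n ` space M \<subseteq> {..n}" using i(1) by auto
    moreover have "i n \<in> measurable M (count_space UNIV)"
      unfolding i_def[abs_def] by (intro measurable_Least) measurable
    ultimately show ?thesis by (auto simp: simple_function_eq_measurable intro: finite_subset)
  qed
  show ?thesis unfolding smeas_def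
  proof (intro exI[of _ "\<lambda>n x. e (i n x)"] conjI allI ballI)
    show "simple_function M (\<lambda>x. e (i n x))" for n
      by (rule simple_function_compose1[OF i_simple])
    fix x assume x: "x \<in> space M"
    show "(\<lambda>n. e (i n x)) \<longlonglongrightarrow> f x"
    proof (rule LIMSEQ_I)
      fix r :: real assume "0 < r"
      then obtain c where "c \<in> C" "dist c (f x) < r"
        using C(2)[OF x] by (auto simp: closure_approachable)
      moreover obtain k where "c = e k"
        using \<open>c \<in> C\<close> C(1) unfolding e_def by (metis from_nat_into_surj)
      ultimately have k: "d k x < r" by (simp add: d_def dist_norm norm_minus_commute)
      have "norm (e (i n x) - f x) < r" if "n \<ge> k" for n
        using i(2)[of k n x] that k by (simp add: d_def norm_minus_commute)
      then show "\<exists>no. \<forall>n\<ge>no. norm (e (i n x) - f x) < r" by blast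
    qed
  qed
qed

lemma smeas_cong_sets: "sets M = sets N \<Longrightarrow> smeas M f \<longleftrightarrow> smeas N f"
  unfolding smeas_def by (simp add: simple_function_cong_algebra[of M N] sets_eq_imp_space_eq[of M N])

lemma smeas_lborel [simp]: "smeas lborel f \<longleftrightarrow> smeas borel f"
  by (rule smeas_cong_sets) simp

lemma smeas_limit:
  fixes F :: "nat \<Rightarrow> 'm \<Rightarrow> 'a::real_normed_vector"
  assumes F: "\<And>n. smeas M (F n)" and lim: "\<And>x. x \<in> space M \<Longrightarrow> (\<lambda>n. F n x) \<longlonglongrightarrow> f x"
  shows "smeas M f"
proof -
  have "\<forall>n. \<exists>C. countable C \<and> (\<forall>x\<in>space M. F n x \<in> closure C)"
    using smeas_separable[OF F] by metis
  then obtain C where C: "\<And>n. countable (C n)" "\<And>n x. x \<in> space M \<Longrightarrow> F n x \<in> closure (C n)"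
    by metis
  show ?thesis
  proof (rule smeasI)
    show "countable (\<Union>n. C n)" using C(1) by auto
    show "f x \<in> closure (\<Union>n. C n)" if "x \<in> space M" for x
    proof (rule closed_sequentially[OF closed_closure _ lim[OF that]])
      show "F n x \<in> closure (\<Union>n. C n)" for n
        using C(2)[OF that] closure_mono[of "C n" "\<Union>n. C n"] by auto
    qed
    show "(\<lambda>x. norm (f x - c)) \<in> borel_measurable M" for c
    proof (rule borel_measurable_LIMSEQ_real)
      show "(\<lambda>n. norm (F n x - c)) \<longlonglongrightarrow> norm (f x - c)" if "x \<in> space M" for x
        by (intro tendsto_intros lim that)
    qed (rule smeas_norm_diff[OF F])
  qed
qed

lemma smeas_compose:
  assumes "smeas N f" "g \<in> measurable M N"
  shows "smeas M (\<lambda>x. f (g x))"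
proof -
  obtain s where s: "\<And>n::nat. simple_function N (s n)" "\<And>x. x \<in> space N \<Longrightarrow> (\<lambda>n. s n x) \<longlonglongrightarrow> f x"
    using assms(1) unfolding smeas_def by blast
  show ?thesis unfolding smeas_def
    using simple_function_comp[OF assms(2) s(1)] s(2) measurable_space[OF assms(2)]
    by (intro exI[of _ "\<lambda>n x. s n (g x)"]) auto
qed

lemma smeas_compose2:
  assumes "smeas M f" "smeas M g"
    and cont: "\<And>X Y x y. X \<longlonglongrightarrow> x \<Longrightarrow> Y \<longlonglongrightarrow> y \<Longrightarrow> (\<lambda>n::nat. p (X n) (Y n)) \<longlonglongrightarrow> p x y"
  shows "smeas M (\<lambda>x. p (f x) (g x))"
proof -
  obtain s where s: "\<And>n::nat. simple_function M (s n)" "\<And>x. x \<in> space M \<Longrightarrow> (\<lambda>n. s n x) \<longlonglongrightarrow> f x"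
    using assms(1) unfolding smeas_def by blast
  obtain r where r: "\<And>n::nat. simple_function M (r n)" "\<And>x. x \<in> space M \<Longrightarrow> (\<lambda>n. r n x) \<longlonglongrightarrow> g x"
    using assms(2) unfolding smeas_def by blast
  show ?thesis unfolding smeas_def
    by (intro exI[of _ "\<lambda>n x. p (s n x) (r n x)"] conjI allI ballI
        simple_function_compose2[OF s(1) r(1)] cont s(2) r(2))
qed

lemma smeas_const: "smeas M (\<lambda>x. c)"
  unfolding smeas_def by (intro exI[of _ "\<lambda>n x. c"]) auto

lemma smeas_real_iff:
  fixes f :: "'m \<Rightarrow> real"
  shows "smeas M f \<longleftrightarrow> f \<in> borel_measurable M"
proof
  assume "smeas M f"
  then obtain s where s: "\<And>n::nat. simple_function M (s n)" "\<And>x. x \<in> space M \<Longrightarrow> (\<lambda>n. s n x) \<longlonglongrightarrow> f x"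
    by (auto simp: smeas_def)
  show "f \<in> borel_measurable M"
    by (rule borel_measurable_LIMSEQ_real[OF s(2)]) (auto intro: borel_measurable_simple_function s(1))
next
  assume "f \<in> borel_measurable M"
  from borel_measurable_implies_sequence_metric[OF this, of 0] show "smeas M f"
    unfolding smeas_def by blast
qed

lemma smeas_diff: "smeas M f \<Longrightarrow> smeas M g \<Longrightarrow> smeas M (\<lambda>x. f x - g x)"
  by (rule smeas_compose2) (auto intro: tendsto_diff)

lemma smeas_scaleR: "f \<in> borel_measurable M \<Longrightarrow> smeas M g \<Longrightarrow> smeas M (\<lambda>x. f x *\<^sub>R g x)"
  unfolding smeas_real_iff[symmetric] by (rule smeas_compose2) (auto intro: tendsto_scaleR)

lemma smeas_blinfun: "smeas M f \<Longrightarrow> smeas M (\<lambda>x. blinfun_apply T (f x))"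
  using smeas_compose2[of M f f "\<lambda>x y. blinfun_apply T x"]
  by (simp add: blinfun.tendsto)

lemma smeas_functional: "smeas M f \<Longrightarrow> (\<lambda>x. blinfun_apply \<psi> (f x) :: real) \<in> borel_measurable M"
  unfolding smeas_real_iff[symmetric] by (rule smeas_blinfun)

lemma smeas_norm: "smeas M f \<Longrightarrow> (\<lambda>x. norm (f x)) \<in> borel_measurable M"
  using smeas_norm_diff[of M f 0] by simp

text \<open>On each of countably many measurable pieces the function agrees with one of the \<open>f i\<close>.\<close>

lemma smeas_compose_countable:
  assumes "\<And>i. i \<in> I \<Longrightarrow> smeas M (f i)" "g \<in> measurable M (count_space I)" "countable I"
  shows "smeas M (\<lambda>x. f (g x) x)"
proof -
  have "\<forall>i\<in>I. \<exists>C. countable C \<and> (\<forall>x\<in>space M. f i x \<in> closure C)"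
    using smeas_separable[OF assms(1)] by metis
  then obtain C where C: "\<And>i. i \<in> I \<Longrightarrow> countable (C i)"
    "\<And>i x. i \<in> I \<Longrightarrow> x \<in> space M \<Longrightarrow> f i x \<in> closure (C i)"
    by metis
  show ?thesis
  proof (rule smeasI)
    show "countable (\<Union>i\<in>I. C i)" using C(1) assms(3) by auto
    show "f (g x) x \<in> closure (\<Union>i\<in>I. C i)" if "x \<in> space M" for x
      using C(2)[OF _ that] measurable_space[OF assms(2) that] closure_mono[of "C (g x)" "\<Union>i\<in>I. C i"]
      by auto
    show "(\<lambda>x. norm (f (g x) x - c)) \<in> borel_measurable M" for c
      by (rule measurable_compose_countable'[OF _ assms(2,3), where f="\<lambda>i x. norm (f i x - c)"])
         (intro smeas_norm_diff assms(1))
  qed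
qed

text \<open>A simple function approximating \<open>v\<close> takes finitely many values, so that only finitely many orbits of
  \<open>T\<close> enter at a time; this does without joint measurability of \<open>(\<omega>, x) \<mapsto> T \<omega> x\<close>.\<close>

lemma smeas_apply:
  fixes T :: "'m \<Rightarrow> ('a::real_normed_vector \<Rightarrow>\<^sub>L 'b::real_normed_vector)"
  assumes T: "\<And>x. smeas M (\<lambda>\<omega>. T \<omega> x)" and v: "smeas M v"
  shows "smeas M (\<lambda>\<omega>. T \<omega> (v \<omega>))"
proof -
  obtain s where s: "\<And>n::nat. simple_function M (s n)" "\<And>x. x \<in> space M \<Longrightarrow> (\<lambda>n. s n x) \<longlonglongrightarrow> v x"
    using v by (auto simp: smeas_def)
  show ?thesis
  proof (rule smeas_limit)
    show "smeas M (\<lambda>\<omega>. T \<omega> (s n \<omega>))" for n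
    proof (rule smeas_compose_countable[where I="s n ` space M" and f="\<lambda>x \<omega>. T \<omega> x"])
      have "s n \<in> measurable M (count_space UNIV)" using s(1) by (rule measurable_simple_function)
      then show "s n \<in> measurable M (count_space (s n ` space M))"
        by (auto simp: measurable_def)
      show "countable (s n ` space M)" using s(1) by (auto intro!: countable_finite dest: simple_functionD)
    qed (rule T)
    show "(\<lambda>n. T \<omega> (s n \<omega>)) \<longlonglongrightarrow> T \<omega> (v \<omega>)" if "\<omega> \<in> space M" for \<omega>
      by (intro tendsto_intros s(2) that)
  qed
qed

lemma smeas_continuous_on:
  fixes f :: "real \<Rightarrow> 'a::real_normed_vector"
  assumes A: "A \<in> sets borel" and f: "continuous_on A f"
  shows "smeas borel (\<lambda>t. if t \<in> A then f t else 0)"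
proof -
  obtain Q where Q: "countable Q" "Q \<subseteq> A" "A \<subseteq> closure Q" by (rule separable)
  show ?thesis
  proof (rule smeasI)
    show "countable (insert 0 (f ` Q))" using Q(1) by auto
    show "(if t \<in> A then f t else 0) \<in> closure (insert 0 (f ` Q))" for t
    proof (cases "t \<in> A")
      case True
      then have "t \<in> closure Q" using Q(3) by blast
      then obtain q where q: "\<forall>n::nat. q n \<in> Q" "q \<longlonglongrightarrow> t"
        unfolding closure_sequential by blast
      have "(\<lambda>n. f (q n)) \<longlonglongrightarrow> f t"
        by (rule continuous_on_tendsto_compose[OF f q(2) True]) (use q(1) Q(2) in \<open>auto intro!: always_eventually\<close>)
      then have "\<exists>x. (\<forall>n. x n \<in> insert 0 (f ` Q)) \<and> x \<longlonglongrightarrow> f t"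
        using q(1) by (intro exI[of _ "\<lambda>n. f (q n)"]) auto
      then show ?thesis by (simp only: closure_sequential True if_True)
    next
      case False
      then show ?thesis using closure_subset[of "insert 0 (f ` Q)"] by auto
    qed
    show "(\<lambda>t. norm ((if t \<in> A then f t else 0) - c)) \<in> borel_measurable borel" for c
    proof -
      have "(\<lambda>t. if t \<in> A then norm (f t - c) else norm c) \<in> borel_measurable borel"
        by (intro borel_measurable_continuous_on_if A continuous_intros f)
      also have "(\<lambda>t. if t \<in> A then norm (f t - c) else norm c) = (\<lambda>t. norm ((if t \<in> A then f t else 0) - c))"
        by auto
      finally show ?thesis .
    qed
  qed
qed

lemma smeas_continuous:
  fixes f :: "real \<Rightarrow> 'a::real_normed_vector"
  assumes "continuous_on UNIV f"
  shows "smeas borel f"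
  using smeas_continuous_on[OF _ assms] by simp

text \<open>The functionals norm the points of a countable set in whose closure \<open>f\<close> takes its values: if all
  of them vanish at \<open>f x\<close>, then the length of \<open>f x\<close> is at most twice its distance to that set.\<close>

lemma smeas_separating_functionals:
  fixes f :: "'m \<Rightarrow> 'a::real_normed_vector"
  assumes "smeas M f"
  obtains \<psi> :: "nat \<Rightarrow> 'a \<Rightarrow>\<^sub>L real"
  where "\<And>x. x \<in> space M \<Longrightarrow> (\<And>n. \<psi> n (f x) = 0) \<Longrightarrow> f x = 0"
proof -
  obtain C where C: "countable C" "\<And>x. x \<in> space M \<Longrightarrow> f x \<in> closure C"
    using smeas_separable[OF assms] by blast
  have "\<forall>c. \<exists>\<psi>::'a \<Rightarrow>\<^sub>L real. norm \<psi> \<le> 1 \<and> blinfun_apply \<psi> c = norm c" using norming_functional by metis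
  then obtain N where N: "\<And>c. norm (N c :: 'a \<Rightarrow>\<^sub>L real) \<le> 1" "\<And>c. blinfun_apply (N c) c = norm c" by metis
  show ?thesis
  proof (rule that[of "\<lambda>n. N (from_nat_into C n)"])
    fix x assume x: "x \<in> space M" and zero: "\<And>n. N (from_nat_into C n) (f x) = 0"
    have "norm (f x) \<le> 0 + e" if "e > 0" for e
    proof -
      obtain c where c: "c \<in> C" "dist c (f x) < e / 2"
        using C(2)[OF x] \<open>e > 0\<close> by (meson closure_approachable half_gt_zero)
      have "N c (f x) = 0" using zero c(1) C(1) by (metis from_nat_into_surj)
      then have "norm c = \<bar>N c (c - f x)\<bar>" by (simp add: blinfun.diff_right N)
      also have "\<dots> \<le> norm (N c) * norm (c - f x)" using norm_blinfun[of "N c" "c - f x"] by simp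
      also have "\<dots> \<le> norm (c - f x)" using N(1)[of c] by (simp add: mult_left_le_one_le)
      finally show ?thesis
        using c(2) norm_triangle_sub[of "f x" c] by (simp add: dist_norm norm_minus_commute)
    qed
    then have "norm (f x) \<le> 0" by (rule field_le_epsilon)
    then show "f x = 0" by simp
  qed
qed

text \<open>The exceptional null set may depend on the functional; countably many functionals suffice.\<close>

lemma smeas_AE_zero:
  fixes f :: "'m \<Rightarrow> 'a::real_normed_vector"
  assumes "smeas M f" and "\<And>\<psi> :: 'a \<Rightarrow>\<^sub>L real. AE x in M. \<psi> (f x) = 0"
  shows "AE x in M. f x = 0"
proof -
  obtain \<psi> :: "nat \<Rightarrow> 'a \<Rightarrow>\<^sub>L real"
    where \<psi>: "\<And>x. x \<in> space M \<Longrightarrow> (\<And>n. \<psi> n (f x) = 0) \<Longrightarrow> f x = 0"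
    using smeas_separating_functionals[OF assms(1)] by blast
  have "AE x in M. \<forall>n. \<psi> n (f x) = 0" using assms(2) by (simp add: AE_all_countable)
  then show ?thesis using AE_space by eventually_elim (auto intro: \<psi>)
qed

lemma simple_function_lborel_lebesgue: "simple_function lborel s \<Longrightarrow> simple_function lebesgue s"
  by (auto simp: simple_function_def)

text \<open>Outside a single Borel null set, all approximating simple functions agree with Borel simple functions
  and the convergence holds.\<close>

lemma strongly_measurable_lebesgue_smeas:
  fixes f :: "real \<Rightarrow> 'a::real_normed_vector"
  assumes "strongly_measurable lebesgue f"
  obtains f' where "smeas borel f'" "AE t in lborel. f t = f' t"
proof -
  obtain s where s: "\<And>n::nat. simple_function lebesgue (s n)" "AE x in lebesgue. (\<lambda>n. s n x) \<longlonglongrightarrow> f x"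
    using assms by (auto simp: strongly_measurable_def)
  have "\<forall>n. \<exists>r. simple_function lborel r \<and> (AE x in lborel. s n x = r x)"
    using completion_ex_simple_function[OF s(1)] by blast
  then obtain r where r: "\<And>n. simple_function lborel (r n)" "\<And>n. AE x in lborel. s n x = r n x"
    by metis
  have "AE x in lborel. (\<forall>n. s n x = r n x) \<and> (\<lambda>n. s n x) \<longlonglongrightarrow> f x"
    using r(2) s(2) by (simp add: AE_all_countable AE_completion_iff)
  from AE_E[OF this] obtain N where
    "{x \<in> space lborel. \<not> ((\<forall>n. s n x = r n x) \<and> (\<lambda>n. s n x) \<longlonglongrightarrow> f x)} \<subseteq> N"
    "emeasure lborel N = 0" "N \<in> sets lborel" .
  then have N: "N \<in> null_sets lborel"
    "{x \<in> space lborel. \<not> ((\<forall>n. s n x = r n x) \<and> (\<lambda>n. s n x) \<longlonglongrightarrow> f x)} \<subseteq> N"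
    by (auto simp: null_sets_def)
  have good: "(\<lambda>n. r n x) \<longlonglongrightarrow> f x" if "x \<notin> N" for x
  proof -
    have "(\<lambda>n. s n x) = (\<lambda>n. r n x)" "(\<lambda>n. s n x) \<longlonglongrightarrow> f x" using N(2) that by auto
    then show ?thesis by simp
  qed
  define f' where "f' x = (if x \<in> N then 0 else f x)" for x
  have "smeas lborel f'" unfolding smeas_def
  proof (intro exI[of _ "\<lambda>n x. if x \<in> N then 0 else r n x"] conjI allI ballI)
    show "simple_function lborel (\<lambda>x. if x \<in> N then 0 else r n x)" for n
      using N(1) r(1) by (intro simple_function_If_set) (auto simp: null_sets_def)
    show "(\<lambda>n. if x \<in> N then 0 else r n x) \<longlonglongrightarrow> f' x" for x
      using good by (auto simp: f'_def)
  qed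
  moreover have "AE t in lborel. f t = f' t"
    using AE_not_in[OF N(1)] by eventually_elim (simp add: f'_def)
  ultimately show ?thesis by (intro that) simp_all
qed

lemma AE_lebesgue_on_iff:
  assumes "I \<in> sets lborel"
  shows "(AE t in lebesgue_on I. P t) \<longleftrightarrow> (AE t in lborel. t \<in> I \<longrightarrow> P t)"
  using assms by (subst AE_restrict_space_iff) (auto simp: AE_completion_iff)

lemma strongly_measurable_on_smeas:
  fixes f :: "real \<Rightarrow> 'a::real_normed_vector"
  assumes I: "I \<in> sets lborel" and "strongly_measurable (lebesgue_on I) f"
  obtains f' where "smeas borel f'" "AE t in lborel. t \<in> I \<longrightarrow> f t = f' t"
proof -
  obtain s where s: "\<And>n::nat. simple_function (lebesgue_on I) (s n)"
    "AE x in lborel. x \<in> I \<longrightarrow> (\<lambda>n. s n x) \<longlonglongrightarrow> f x"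
    using assms(2) unfolding strongly_measurable_def AE_lebesgue_on_iff[OF I] by blast
  have I': "I \<inter> space lebesgue \<in> sets lebesgue" using I by auto
  have "strongly_measurable lebesgue (\<lambda>x. indicator I x *\<^sub>R f x)"
    unfolding strongly_measurable_def
  proof (intro exI[of _ "\<lambda>n x. indicator I x *\<^sub>R s n x"] conjI allI)
    show "simple_function lebesgue (\<lambda>x. indicator I x *\<^sub>R s n x)" for n
      using s(1)[of n] unfolding simple_function_restrict_space[OF I'] .
    show "AE x in lebesgue. (\<lambda>n. indicator I x *\<^sub>R s n x) \<longlonglongrightarrow> indicator I x *\<^sub>R f x"
      using s(2) unfolding AE_completion_iff by eventually_elim (auto simp: indicator_def)
  qed
  from strongly_measurable_lebesgue_smeas[OF this] obtain f' where
    f': "smeas borel f'" "AE t in lborel. indicator I t *\<^sub>R f t = f' t" .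
  from f'(2) have "AE t in lborel. t \<in> I \<longrightarrow> f t = f' t" by eventually_elim auto
  with f'(1) show ?thesis by (rule that)
qed

lemma smeas_strongly_measurable_on:
  fixes f :: "real \<Rightarrow> 'a::real_normed_vector"
  assumes I: "I \<in> sets lborel" and "smeas borel f'" "AE t in lborel. t \<in> I \<longrightarrow> f t = f' t"
  shows "strongly_measurable (lebesgue_on I) f"
proof -
  have "smeas lborel f'" using assms(2) by simp
  then obtain s where s: "\<And>n::nat. simple_function lborel (s n)" "\<And>x. (\<lambda>n. s n x) \<longlonglongrightarrow> f' x"
    by (auto simp: smeas_def)
  have I': "I \<inter> space lebesgue \<in> sets lebesgue" using I by auto
  show ?thesis unfolding strongly_measurable_def
  proof (intro exI[of _ s] conjI allI)
    have "simple_function lborel (\<lambda>x. indicator I x *\<^sub>R s n x)" for n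
      by (rule simple_function_compose2[where h="(*\<^sub>R)", OF simple_function_indicator[OF I] s(1)])
    then show "simple_function (lebesgue_on I) (s n)" for n
      unfolding simple_function_restrict_space[OF I'] by (rule simple_function_lborel_lebesgue)
    show "AE x in lebesgue_on I. (\<lambda>n. s n x) \<longlonglongrightarrow> f x"
      using assms(3) unfolding AE_lebesgue_on_iff[OF I] by eventually_elim (simp add: s(2))
  qed
qed

section \<open>The Bochner integral, tested with functionals\<close>

text \<open>Approximating values that are too long are replaced by \<open>0\<close>, which concerns finitely many of them
  at points with \<open>f x \<noteq> 0\<close>.\<close>

lemma smeas_dominated_simple:
  fixes f :: "'m \<Rightarrow> 'a::real_normed_vector"
  assumes "smeas M f"
  obtains s where "\<And>n::nat. simple_function M (s n)"
    "\<And>x. x \<in> space M \<Longrightarrow> (\<lambda>n. s n x) \<longlonglongrightarrow> f x"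
    "\<And>n x. x \<in> space M \<Longrightarrow> norm (s n x) \<le> 2 * norm (f x)"
proof -
  obtain r where r: "\<And>n::nat. simple_function M (r n)" "\<And>x. x \<in> space M \<Longrightarrow> (\<lambda>n. r n x) \<longlonglongrightarrow> f x"
    using assms unfolding smeas_def by blast
  define s where "s n x = (if norm (r n x) \<le> 2 * norm (f x) then r n x else 0)" for n x
  have [measurable]: "(\<lambda>x. norm (f x)) \<in> borel_measurable M" by (rule smeas_norm[OF assms])
  have [measurable]: "(\<lambda>x. norm (r n x)) \<in> borel_measurable M" for n
    by (rule borel_measurable_simple_function[OF simple_function_compose1[OF r(1)]])
  show ?thesis
  proof (rule that[of s])
    show "simple_function M (s n)" for n
      unfolding s_def by (intro simple_function_If r(1)) auto
    show "norm (s n x) \<le> 2 * norm (f x)" for n x by (auto simp: s_def)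
    show "(\<lambda>n. s n x) \<longlonglongrightarrow> f x" if x: "x \<in> space M" for x
    proof (cases "f x = 0")
      case True
      then have "(\<lambda>n. s n x) = (\<lambda>_. 0)" by (auto simp: s_def)
      then show ?thesis using True by simp
    next
      case False
      have "(\<lambda>n. norm (r n x)) \<longlonglongrightarrow> norm (f x)" by (intro tendsto_norm r(2) x)
      then have "\<forall>\<^sub>F n in sequentially. norm (r n x) < 2 * norm (f x)"
        by (rule order_tendstoD) (use False in auto)
      then have "\<forall>\<^sub>F n in sequentially. r n x = s n x"
        by eventually_elim (simp add: s_def)
      then show ?thesis using r(2)[OF x] by (rule Lim_transform_eventually[rotated])
    qed
  qed
qed

lemma bochner_has_integral_functional:
  fixes \<psi> :: "'a::real_normed_vector \<Rightarrow>\<^sub>L real"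
  assumes bhi: "bochner_has_integral M f y" and f': "smeas M f'" "AE x in M. f x = f' x"
  shows "has_bochner_integral M (\<lambda>x. \<psi> (f' x)) (\<psi> y)"
proof -
  obtain s where s: "\<And>n::nat. Bochner_Integration.simple_bochner_integrable M (s n)"
    and lim: "(\<lambda>n. \<integral>\<^sup>+x. ennreal (norm (f x - s n x)) \<partial>M) \<longlonglongrightarrow> 0"
    and y: "(\<lambda>n. Bochner_Integration.simple_bochner_integral M (s n)) \<longlonglongrightarrow> y"
    using bhi unfolding bochner_has_integral_def by blast
  have simple: "simple_function M (s n)" for n using s by (auto elim: simple_bochner_integrable.cases)
  have lin: "linear (blinfun_apply \<psi>)" by (rule blinfun.bounded_linear_right[THEN bounded_linear.linear])
  show ?thesis
  proof (rule has_bochner_integral.intros)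
    show "(\<lambda>x. \<psi> (f' x)) \<in> borel_measurable M" by (rule smeas_functional[OF f'(1)])
    show "Bochner_Integration.simple_bochner_integrable M (\<lambda>x. \<psi> (s n x))" for n
      using simple_bochner_integrable_compose2[of "\<lambda>x y. \<psi> x", OF _ s[of n] s[of n]]
      by (simp add: blinfun.zero_right)
    have "(\<lambda>n. Bochner_Integration.simple_bochner_integral M (\<lambda>x. \<psi> (s n x)))
        = (\<lambda>n. \<psi> (Bochner_Integration.simple_bochner_integral M (s n)))"
      using simple_bochner_integral_linear[OF lin s] by simp
    then show "(\<lambda>n. Bochner_Integration.simple_bochner_integral M (\<lambda>x. \<psi> (s n x))) \<longlonglongrightarrow> \<psi> y"
      by (simp add: blinfun.tendsto y)
    have le: "(\<integral>\<^sup>+x. ennreal (norm (\<psi> (f' x) - \<psi> (s n x))) \<partial>M)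
        \<le> ennreal (norm \<psi>) * (\<integral>\<^sup>+x. ennreal (norm (f x - s n x)) \<partial>M)" for n
    proof -
      have "smeas M (s n)" unfolding smeas_def using simple by (intro exI[of _ "\<lambda>_. s n"]) auto
      then have [measurable]: "(\<lambda>x. norm (f' x - s n x)) \<in> borel_measurable M"
        by (intro smeas_norm smeas_diff f')
      have "(\<integral>\<^sup>+x. ennreal (norm (\<psi> (f' x) - \<psi> (s n x))) \<partial>M)
          \<le> (\<integral>\<^sup>+x. ennreal (norm \<psi>) * ennreal (norm (f' x - s n x)) \<partial>M)"
        by (intro nn_integral_mono)
           (simp flip: blinfun.diff_right ennreal_mult add: ennreal_leI norm_blinfun[of \<psi>, simplified])
      also have "\<dots> = ennreal (norm \<psi>) * (\<integral>\<^sup>+x. ennreal (norm (f' x - s n x)) \<partial>M)"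
        by (rule nn_integral_cmult) measurable
      also have "(\<integral>\<^sup>+x. ennreal (norm (f' x - s n x)) \<partial>M) = (\<integral>\<^sup>+x. ennreal (norm (f x - s n x)) \<partial>M)"
        using f'(2) by (intro nn_integral_cong_AE) auto
      finally show ?thesis .
    qed
    have "(\<lambda>n. ennreal (norm \<psi>) * (\<integral>\<^sup>+x. ennreal (norm (f x - s n x)) \<partial>M)) \<longlonglongrightarrow> ennreal (norm \<psi>) * 0"
      by (rule ennreal_tendsto_cmult[OF _ lim]) simp
    then have "(\<lambda>n. ennreal (norm \<psi>) * (\<integral>\<^sup>+x. ennreal (norm (f x - s n x)) \<partial>M)) \<longlonglongrightarrow> 0"
      by simp
    from tendsto_sandwich[OF always_eventually always_eventually tendsto_const this] le
    show "(\<lambda>n. \<integral>\<^sup>+x. ennreal (norm (\<psi> (f' x) - \<psi> (s n x))) \<partial>M) \<longlonglongrightarrow> 0"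
      by simp
  qed
qed

text \<open>By dominated convergence, the integrals of dominated simple approximations form a Cauchy sequence: a
  functional that norms their difference reduces the estimate to real simple functions.\<close>

lemma bochner_has_integral_exists:
  fixes f f' :: "'m \<Rightarrow> 'a::banach"
  assumes f': "smeas M f'" "AE x in M. f x = f' x" and fin: "(\<integral>\<^sup>+x. norm (f' x) \<partial>M) < \<infinity>"
  shows "\<exists>y. bochner_has_integral M f y"
proof -
  obtain s where s: "\<And>n::nat. simple_function M (s n)" "\<And>x. x \<in> space M \<Longrightarrow> (\<lambda>n. s n x) \<longlonglongrightarrow> f' x"
    and bd: "\<And>n x. x \<in> space M \<Longrightarrow> norm (s n x) \<le> 2 * norm (f' x)"
    by (rule smeas_dominated_simple[OF f'(1)]) blast
  have [measurable]: "(\<lambda>x. norm (f' x)) \<in> borel_measurable M" by (rule smeas_norm[OF f'(1)])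
  have sm: "smeas M (s n)" for n unfolding smeas_def using s(1) by (intro exI[of _ "\<lambda>_. s n"]) auto
  have [measurable]: "(\<lambda>x. norm (f' x - s n x)) \<in> borel_measurable M" for n
    by (intro smeas_norm smeas_diff f' sm)
  have sbi: "Bochner_Integration.simple_bochner_integrable M (s n)" for n
  proof (rule simple_bochner_integrableI_bounded[OF s(1)])
    have "(\<integral>\<^sup>+x. norm (s n x) \<partial>M) \<le> (\<integral>\<^sup>+x. ennreal (2 * norm (f' x)) \<partial>M)"
      by (rule nn_integral_mono) (rule ennreal_leI, rule bd)
    also have "\<dots> < \<infinity>" using fin by (simp add: ennreal_mult nn_integral_cmult ennreal_mult_less_top)
    finally show "(\<integral>\<^sup>+x. norm (s n x) \<partial>M) < \<infinity>" .
  qed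
  have lim: "(\<lambda>n. \<integral>\<^sup>+x. ennreal (norm (f' x - s n x)) \<partial>M) \<longlonglongrightarrow> (\<integral>\<^sup>+x. ennreal 0 \<partial>M)"
  proof (rule nn_integral_dominated_convergence[where w="\<lambda>x. ennreal (3 * norm (f' x))"])
    show "AE x in M. ennreal (norm (f' x - s n x)) \<le> ennreal (3 * norm (f' x))" for n
    proof (rule AE_I2, rule ennreal_leI)
      fix x assume "x \<in> space M"
      from bd[OF this, of n] show "norm (f' x - s n x) \<le> 3 * norm (f' x)"
        using norm_triangle_ineq4[of "f' x" "s n x"] by linarith
    qed
    show "(\<integral>\<^sup>+x. ennreal (3 * norm (f' x)) \<partial>M) < \<infinity>"
      using fin by (simp add: ennreal_mult nn_integral_cmult ennreal_mult_less_top)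
    show "AE x in M. (\<lambda>n. ennreal (norm (f' x - s n x))) \<longlonglongrightarrow> ennreal 0"
    proof (rule AE_I2, rule tendsto_ennrealI)
      fix x assume "x \<in> space M"
      then have "(\<lambda>n. norm (f' x - s n x)) \<longlonglongrightarrow> norm (f' x - f' x)" by (intro tendsto_intros s(2))
      then show "(\<lambda>n. norm (f' x - s n x)) \<longlonglongrightarrow> 0" by simp
    qed
  qed auto
  define J where "J n = Bochner_Integration.simple_bochner_integral M (s n)" for n
  have J_diff: "ennreal (norm (J m - J n)) \<le>
      (\<integral>\<^sup>+x. norm (f' x - s m x) \<partial>M) + (\<integral>\<^sup>+x. norm (f' x - s n x) \<partial>M)" for m n
  proof -
    obtain \<psi> :: "'a \<Rightarrow>\<^sub>L real" where \<psi>: "norm \<psi> \<le> 1" "\<psi> (J m - J n) = norm (J m - J n)"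
      by (rule norming_functional)
    have lin: "linear (blinfun_apply \<psi>)" by (rule blinfun.bounded_linear_right[THEN bounded_linear.linear])
    have sbi': "Bochner_Integration.simple_bochner_integrable M (\<lambda>x. \<psi> (s n x))" for n
      using simple_bochner_integrable_compose2[of "\<lambda>x y. \<psi> x", OF _ sbi[of n] sbi[of n]]
      by (simp add: blinfun.zero_right)
    have \<psi>_le: "\<bar>\<psi> x\<bar> \<le> norm x" for x
      using norm_blinfun[of \<psi> x] mult_right_mono[OF \<psi>(1), of "norm x"] by simp
    have mono: "(\<integral>\<^sup>+x. ennreal (norm (\<psi> (f' x) - \<psi> (s n x))) \<partial>M) \<le> (\<integral>\<^sup>+x. norm (f' x - s n x) \<partial>M)" for n
      by (intro nn_integral_mono ennreal_leI) (simp flip: blinfun.diff_right add: \<psi>_le)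
    have "norm (J m - J n) = norm (\<psi> (J m) - \<psi> (J n))" using \<psi>(2) by (simp add: blinfun.diff_right)
    also have "\<dots> = norm (Bochner_Integration.simple_bochner_integral M (\<lambda>x. \<psi> (s m x))
        - Bochner_Integration.simple_bochner_integral M (\<lambda>x. \<psi> (s n x)))"
      unfolding J_def simple_bochner_integral_linear[OF lin sbi] ..
    finally have "ennreal (norm (J m - J n)) \<le>
      (\<integral>\<^sup>+x. ennreal (norm (\<psi> (f' x) - \<psi> (s m x))) \<partial>M) + (\<integral>\<^sup>+x. ennreal (norm (\<psi> (f' x) - \<psi> (s n x))) \<partial>M)"
      using simple_bochner_integral_bounded[OF smeas_functional[OF f'(1)] sbi'[of m] sbi'[of n], of \<psi>] by simp
    also have "\<dots> \<le> (\<integral>\<^sup>+x. norm (f' x - s m x) \<partial>M) + (\<integral>\<^sup>+x. norm (f' x - s n x) \<partial>M)"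
      by (intro add_mono mono)
    finally show ?thesis .
  qed
  have "Cauchy J"
  proof (rule metric_CauchyI)
    fix e :: real assume "0 < e"
    then have "\<forall>\<^sub>F n in sequentially. (\<integral>\<^sup>+x. ennreal (norm (f' x - s n x)) \<partial>M) < ennreal (e / 2)"
      using lim by (intro order_tendstoD(2)[where y="\<integral>\<^sup>+x. ennreal 0 \<partial>M"]) auto
    then obtain N where N: "\<And>n. n \<ge> N \<Longrightarrow> (\<integral>\<^sup>+x. ennreal (norm (f' x - s n x)) \<partial>M) < ennreal (e / 2)"
      by (auto simp: eventually_sequentially)
    have "dist (J m) (J n) < e" if "m \<ge> N" "n \<ge> N" for m n
    proof -
      have "ennreal (norm (J m - J n)) < ennreal (e / 2) + ennreal (e / 2)"
        using J_diff[of m n] N[OF that(1)] N[OF that(2)]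
        by (meson add_strict_mono order_le_less_trans)
      then show ?thesis using \<open>0 < e\<close> by (simp add: dist_norm ennreal_less_iff flip: ennreal_plus)
    qed
    then show "\<exists>N. \<forall>m\<ge>N. \<forall>n\<ge>N. dist (J m) (J n) < e" by blast
  qed
  then obtain y where y: "J \<longlonglongrightarrow> y" using Cauchy_convergent_iff convergent_def by blast
  have "(\<lambda>n. \<integral>\<^sup>+x. ennreal (norm (f x - s n x)) \<partial>M) = (\<lambda>n. \<integral>\<^sup>+x. ennreal (norm (f' x - s n x)) \<partial>M)"
    using f'(2) by (intro ext nn_integral_cong_AE) auto
  moreover have "AE x in M. (\<lambda>n. s n x) \<longlonglongrightarrow> f x"
    using f'(2) AE_space by eventually_elim (simp add: s(2))
  ultimately show ?thesis
    unfolding bochner_has_integral_def strongly_measurable_def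
    using s(1) sbi lim y unfolding J_def by (intro exI[of _ y] conjI exI[of _ s]) auto
qed

text \<open>Continuous functionals commute with the integral; vector integrals are computed through their values
  under functionals.\<close>

lemma bochner_integral_functional:
  fixes f f' :: "'m \<Rightarrow> 'a::banach" and \<psi> :: "'a \<Rightarrow>\<^sub>L real"
  assumes f': "smeas M f'" "AE x in M. f x = f' x" and fin: "(\<integral>\<^sup>+x. norm (f' x) \<partial>M) < \<infinity>"
  shows "bochner_integrable M f"
    and "has_bochner_integral M (\<lambda>x. \<psi> (f' x)) (\<psi> (bochner_integral M f))"
proof -
  obtain y where y: "bochner_has_integral M f y"
    using bochner_has_integral_exists[OF assms] by blast
  then show ble: "bochner_integrable M f" by (auto simp: bochner_integrable_def)
  have uniq: "z = y" if z: "bochner_has_integral M f z" for z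
  proof (rule functionals_separate)
    show "\<psi> z = \<psi> y" for \<psi> :: "'a \<Rightarrow>\<^sub>L real"
      by (rule has_bochner_integral_eq[OF bochner_has_integral_functional[OF z f'] bochner_has_integral_functional[OF y f']])
  qed
  have "(THE z. bochner_has_integral M f z) = y" by (rule the_equality) (fact y, rule uniq)
  then have "bochner_integral M f = y" unfolding bochner_integral_def using ble by simp
  then show "has_bochner_integral M (\<lambda>x. \<psi> (f' x)) (\<psi> (bochner_integral M f))"
    using bochner_has_integral_functional[OF y f'] by simp
qed

lemma bochner_integral_on:
  fixes f f' :: "real \<Rightarrow> 'a::banach" and \<psi> :: "'a \<Rightarrow>\<^sub>L real"
  assumes I: "I \<in> sets borel" and f': "smeas borel f'" "AE t in lborel. t \<in> I \<longrightarrow> f t = f' t"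
    and fin: "(\<integral>\<^sup>+t. indicator I t * ennreal (norm (f' t)) \<partial>lborel) < \<infinity>"
  shows "bochner_integrable (lebesgue_on I) f"
    and "has_bochner_integral lborel (\<lambda>t. indicator I t * \<psi> (f' t)) (\<psi> (bochner_integral (lebesgue_on I) f))"
proof -
  have I': "I \<in> sets lborel" "I \<inter> space lebesgue \<in> sets lebesgue" using I by auto
  have m: "(\<lambda>t. t) \<in> measurable (lebesgue_on I) borel"
    by (rule measurable_restrict_space1, rule measurable_completion) simp
  have sm: "smeas (lebesgue_on I) f'" using smeas_compose[OF f'(1) m] .
  have ae: "AE x in lebesgue_on I. f x = f' x" using f'(2) I' by (simp add: AE_lebesgue_on_iff)
  have [measurable]: "(\<lambda>x. norm (f' x)) \<in> borel_measurable borel" "(\<lambda>x. \<psi> (f' x)) \<in> borel_measurable borel"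
    using smeas_norm[OF f'(1)] smeas_functional[OF f'(1)] by auto
  have "(\<integral>\<^sup>+x. norm (f' x) \<partial>lebesgue_on I) = (\<integral>\<^sup>+x. ennreal (norm (f' x)) * indicator I x \<partial>lebesgue)"
    by (rule nn_integral_restrict_space[OF I'(2)])
  also have "\<dots> < \<infinity>" using fin by (simp add: nn_integral_completion mult.commute)
  finally have fin': "(\<integral>\<^sup>+x. norm (f' x) \<partial>lebesgue_on I) < \<infinity>" .
  show "bochner_integrable (lebesgue_on I) f" by (rule bochner_integral_functional(1)[OF sm ae fin'])
  have "has_bochner_integral (lebesgue_on I) (\<lambda>x. \<psi> (f' x)) (\<psi> (bochner_integral (lebesgue_on I) f))"
    by (rule bochner_integral_functional(2)[OF sm ae fin'])
  then have "integrable (lebesgue_on I) (\<lambda>x. \<psi> (f' x))"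
    "(LINT x|lebesgue_on I. \<psi> (f' x)) = \<psi> (bochner_integral (lebesgue_on I) f)"
    by (auto simp: has_bochner_integral_iff)
  then have "integrable lebesgue (\<lambda>x. indicator I x *\<^sub>R \<psi> (f' x))"
    "(LINT x|lebesgue. indicator I x *\<^sub>R \<psi> (f' x)) = \<psi> (bochner_integral (lebesgue_on I) f)"
    using I'(2) by (simp_all add: integrable_restrict_space integral_restrict_space set_integrable_def)
  moreover have [measurable]: "I \<in> sets borel" by fact
  ultimately show "has_bochner_integral lborel (\<lambda>t. indicator I t * \<psi> (f' t)) (\<psi> (bochner_integral (lebesgue_on I) f))"
    by (simp add: has_bochner_integral_iff integrable_completion integral_completion)
qed

lemma norm_bochner_integral_on_le:
  fixes f f' :: "real \<Rightarrow> 'a::banach"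
  assumes I: "I \<in> sets borel" and f': "smeas borel f'" "AE t in lborel. t \<in> I \<longrightarrow> f t = f' t"
    and le: "(\<integral>\<^sup>+t. indicator I t * ennreal (norm (f' t)) \<partial>lborel) \<le> ennreal K" and K: "0 \<le> K"
  shows "norm (bochner_integral (lebesgue_on I) f) \<le> K"
proof -
  let ?y = "bochner_integral (lebesgue_on I) f"
  obtain \<psi> :: "'a \<Rightarrow>\<^sub>L real" where \<psi>: "norm \<psi> \<le> 1" "\<psi> ?y = norm ?y" by (rule norming_functional)
  have \<psi>_le: "\<bar>\<psi> x\<bar> \<le> norm x" for x
    using norm_blinfun[of \<psi> x] mult_right_mono[OF \<psi>(1), of "norm x"] by simp
  have fin: "(\<integral>\<^sup>+t. indicator I t * ennreal (norm (f' t)) \<partial>lborel) < \<infinity>"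
    using le by (auto intro: le_less_trans)
  have hbi: "has_bochner_integral lborel (\<lambda>t. indicator I t * \<psi> (f' t)) (\<psi> ?y)"
    by (rule bochner_integral_on(2)[OF I f' fin])
  then have int: "integrable lborel (\<lambda>t. indicator I t * \<psi> (f' t))" by (simp add: has_bochner_integral_iff)
  have "ennreal (norm ?y) = ennreal (norm (LINT t|lborel. indicator I t * \<psi> (f' t)))"
    using hbi \<psi>(2) by (simp add: has_bochner_integral_iff)
  also have "\<dots> \<le> (\<integral>\<^sup>+t. ennreal (norm (indicator I t * \<psi> (f' t))) \<partial>lborel)"
    by (rule integral_norm_bound_ennreal[OF int])
  also have "\<dots> \<le> (\<integral>\<^sup>+t. indicator I t * ennreal (norm (f' t)) \<partial>lborel)"
    by (intro nn_integral_mono) (auto simp: indicator_def \<psi>_le intro: ennreal_leI)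
  also note le
  finally show ?thesis using K by simp
qed

lemma bochner_has_integral_cong_AE:
  assumes "AE x in M. f x = g x" "bochner_has_integral M f y"
  shows "bochner_has_integral M g y"
proof -
  obtain s where s: "\<And>n::nat. simple_function M (s n)" "AE x in M. (\<lambda>n. s n x) \<longlonglongrightarrow> f x"
    using assms(2) unfolding bochner_has_integral_def strongly_measurable_def by blast
  obtain r where r: "\<And>n::nat. Bochner_Integration.simple_bochner_integrable M (r n)"
    "(\<lambda>n. \<integral>\<^sup>+x. ennreal (norm (f x - r n x)) \<partial>M) \<longlonglongrightarrow> 0"
    "(\<lambda>n. Bochner_Integration.simple_bochner_integral M (r n)) \<longlonglongrightarrow> y"
    using assms(2) unfolding bochner_has_integral_def by blast
  have "AE x in M. (\<lambda>n. s n x) \<longlonglongrightarrow> g x" using assms(1) s(2) by eventually_elim simp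
  moreover have "(\<lambda>n. \<integral>\<^sup>+x. ennreal (norm (f x - r n x)) \<partial>M) = (\<lambda>n. \<integral>\<^sup>+x. ennreal (norm (g x - r n x)) \<partial>M)"
  proof
    fix n
    show "(\<integral>\<^sup>+x. ennreal (norm (f x - r n x)) \<partial>M) = (\<integral>\<^sup>+x. ennreal (norm (g x - r n x)) \<partial>M)"
      by (rule nn_integral_cong_AE) (use assms(1) in eventually_elim, simp)
  qed
  ultimately show ?thesis using s(1) r
    unfolding bochner_has_integral_def strongly_measurable_def by auto
qed

lemma bochner_integral_cong_AE:
  assumes "AE x in M. f x = g x"
  shows "bochner_integral M f = bochner_integral M g"
proof -
  have "AE x in M. g x = f x" using assms by eventually_elim simp
  then have "bochner_has_integral M f = bochner_has_integral M g"
    using bochner_has_integral_cong_AE[OF assms] bochner_has_integral_cong_AE by blast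
  then show ?thesis by (simp add: bochner_integral_def bochner_integrable_def)
qed

section \<open>Continuity of translations\<close>

lemma tendsto_zero_ennrealI:
  fixes X :: "'b \<Rightarrow> ennreal"
  assumes "\<And>e::real. 0 < e \<Longrightarrow> \<forall>\<^sub>F n in F. X n \<le> ennreal e"
  shows "(X \<longlongrightarrow> 0) F"
proof (rule order_tendstoI)
  fix a :: ennreal assume "0 < a"
  then obtain b where b: "0 < b" "b < a" using dense by blast
  then obtain e where e: "b = ennreal e" "0 < e" by (cases b) auto
  from assms[OF e(2)] show "\<forall>\<^sub>F n in F. X n < a"
    by eventually_elim (use b e in auto)
qed auto

lemma AE_lborel_affine:
  fixes P :: "real \<Rightarrow> bool"
  assumes "AE t in lborel. P t" and "c \<noteq> 0"
  shows "AE r in lborel. P (a + c * r)"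
proof -
  from AE_E[OF assms(1)] obtain N where
    N: "{x \<in> space lborel. \<not> P x} \<subseteq> N" "emeasure lborel N = 0" "N \<in> sets lborel" .
  have [measurable]: "N \<in> sets borel" using N by simp
  have "N \<in> null_sets lborel" using N by auto
  then have "AE t in lborel. t \<notin> N" by (rule AE_not_in)
  then have "AE r in lborel. a + c * r \<notin> N" by (intro AE_borel_affine assms) auto
  then show ?thesis by eventually_elim (use N(1) in auto)
qed

lemma AE_lborel_reflect:
  assumes "AE t in lborel. P t"
  shows "AE r in lborel. P (a - r :: real)"
  using AE_lborel_affine[OF assms, of "-1" a] by simp

lemma nn_integral_lborel_shift:
  fixes a :: real
  assumes "f \<in> borel_measurable borel"
  shows "(\<integral>\<^sup>+x. f (x + a) \<partial>lborel) = (\<integral>\<^sup>+x. f x \<partial>lborel)"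
  using nn_integral_real_affine[OF assms, of 1 a] by (simp add: add.commute)

lemma nn_integral_lborel_reflect:
  fixes a :: real
  assumes "f \<in> borel_measurable borel"
  shows "(\<integral>\<^sup>+x. f (a - x) \<partial>lborel) = (\<integral>\<^sup>+x. f x \<partial>lborel)"
  using nn_integral_real_affine[OF assms, of "-1" a] by simp

text \<open>Points of an open set of finite measure stay in it under small shifts, and \<open>E\<close> differs little from
  such a set. Leaving \<open>E\<close> under one shift is the same as entering it under the opposite one.\<close>

lemma emeasure_shift_tendsto_zero:
  fixes E :: "real set"
  assumes [measurable]: "E \<in> sets borel" and fin: "emeasure lborel E < \<infinity>" and h: "h \<longlonglongrightarrow> 0"
  shows "(\<lambda>n. emeasure lborel {t. (t + h n \<in> E) \<noteq> (t \<in> E)}) \<longlonglongrightarrow> 0"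
proof (rule tendsto_zero_ennrealI)
  fix e :: real assume e: "0 < e"
  then obtain U where U: "open U" "E \<subseteq> U" "emeasure lborel (U - E) < ennreal (e / 4)"
    using outer_regular_lborel[of E "e / 4"] by auto
  have [measurable]: "U \<in> sets borel" using U(1) by simp
  have "emeasure lborel U \<le> emeasure lborel E + emeasure lborel (U - E)"
    using U(2) emeasure_subadditive[of E lborel "U - E"] by (simp add: Un_absorb1)
  also have "\<dots> < \<infinity>" using fin U(3) by (simp add: less_top order.strict_trans)
  finally have Ufin: "emeasure lborel U < \<infinity>" .
  have exit: "\<forall>\<^sub>F n in sequentially. emeasure lborel {t. t \<in> E \<and> t + g n \<notin> E} \<le> ennreal (e / 2)"
    if g: "g \<longlonglongrightarrow> 0" for g :: "nat \<Rightarrow> real"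
  proof -
    have "(\<lambda>n. \<integral>\<^sup>+t. indicator {t. t \<in> U \<and> t + g n \<notin> U} t \<partial>lborel) \<longlonglongrightarrow> (\<integral>\<^sup>+t. 0 \<partial>(lborel :: real measure))"
    proof (rule nn_integral_dominated_convergence[where w="indicator U" and u'="\<lambda>_. 0"
          and u="\<lambda>n t. indicator {t. t \<in> U \<and> t + g n \<notin> U} t"])
      show "(\<integral>\<^sup>+x. indicator U x \<partial>lborel) < \<infinity>" using Ufin by simp
      show "AE t in lborel. (\<lambda>n. indicator {t. t \<in> U \<and> t + g n \<notin> U} t) \<longlonglongrightarrow> (0 :: ennreal)"
      proof (rule AE_I2)
        fix t
        have "\<forall>\<^sub>F n in sequentially. indicator {t. t \<in> U \<and> t + g n \<notin> U} t = (0 :: ennreal)"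
        proof (cases "t \<in> U")
          case True
          have "(\<lambda>n. t + g n) \<longlonglongrightarrow> t + 0" by (intro tendsto_intros g)
          then have "\<forall>\<^sub>F n in sequentially. t + g n \<in> U"
            using topological_tendstoD[OF _ U(1), of "\<lambda>n. t + g n" t] True by simp
          then show ?thesis by eventually_elim auto
        qed auto
        then show "(\<lambda>n. indicator {t. t \<in> U \<and> t + g n \<notin> U} t) \<longlonglongrightarrow> (0 :: ennreal)"
          by (rule tendsto_eventually)
      qed
    qed (auto simp: indicator_def)
    then have "(\<lambda>n. emeasure lborel {t. t \<in> U \<and> t + g n \<notin> U}) \<longlonglongrightarrow> 0" by simp
    then have "\<forall>\<^sub>F n in sequentially. emeasure lborel {t. t \<in> U \<and> t + g n \<notin> U} < ennreal (e / 4)"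
      by (rule order_tendstoD) (use e in simp)
    then show ?thesis
    proof eventually_elim
      case (elim n)
      have "emeasure lborel {t. t \<in> E \<and> t + g n \<notin> E}
          \<le> emeasure lborel ({t. t \<in> U \<and> t + g n \<notin> U} \<union> {t. t + g n \<in> U - E})"
        using U(2) by (intro emeasure_mono) auto
      also have "\<dots> \<le> emeasure lborel {t. t \<in> U \<and> t + g n \<notin> U} + emeasure lborel {t. t + g n \<in> U - E}"
        by (rule emeasure_subadditive) auto
      also have "emeasure lborel {t. t + g n \<in> U - E} = emeasure lborel (U - E)"
      proof -
        have "emeasure lborel {t. t + g n \<in> U - E} = (\<integral>\<^sup>+t. indicator {t. t + g n \<in> U - E} t \<partial>lborel)"
          by (rule nn_integral_indicator[symmetric]) simp
        also have "\<dots> = (\<integral>\<^sup>+t. indicator (U - E) (t + g n) \<partial>lborel)"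
          by (intro nn_integral_cong) (auto simp: indicator_def)
        also have "\<dots> = (\<integral>\<^sup>+t. indicator (U - E) t \<partial>lborel)" by (rule nn_integral_lborel_shift) auto
        finally show ?thesis by simp
      qed
      also have "emeasure lborel {t. t \<in> U \<and> t + g n \<notin> U} + emeasure lborel (U - E)
          \<le> ennreal (e / 4) + ennreal (e / 4)"
        using elim U(3) by (intro add_mono) auto
      finally show ?case using e by (simp flip: ennreal_plus)
    qed
  qed
  have "(\<lambda>n. - h n) \<longlonglongrightarrow> 0" using tendsto_minus[OF h] by simp
  from exit[OF h] exit[OF this]
  show "\<forall>\<^sub>F n in sequentially. emeasure lborel {t. (t + h n \<in> E) \<noteq> (t \<in> E)} \<le> ennreal e"
  proof eventually_elim
    case (elim n)
    have "emeasure lborel {t. t + h n \<in> E \<and> t \<notin> E}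
        = (\<integral>\<^sup>+t. indicator {t. t + h n \<in> E \<and> t \<notin> E} t \<partial>lborel)"
      by (rule nn_integral_indicator[symmetric]) simp
    also have "\<dots> = (\<integral>\<^sup>+t. indicator {t. t \<in> E \<and> t + - h n \<notin> E} (t + h n) \<partial>lborel)"
      by (intro nn_integral_cong) (auto simp: indicator_def)
    also have "\<dots> = emeasure lborel {t. t \<in> E \<and> t + - h n \<notin> E}"
      by (subst nn_integral_lborel_shift) auto
    finally have enter: "emeasure lborel {t. t + h n \<in> E \<and> t \<notin> E} \<le> ennreal (e / 2)" using elim by simp
    have "emeasure lborel {t. (t + h n \<in> E) \<noteq> (t \<in> E)}
        \<le> emeasure lborel ({t. t \<in> E \<and> t + h n \<notin> E} \<union> {t. t + h n \<in> E \<and> t \<notin> E})"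
      by (intro emeasure_mono) auto
    also have "\<dots> \<le> emeasure lborel {t. t \<in> E \<and> t + h n \<notin> E} + emeasure lborel {t. t + h n \<in> E \<and> t \<notin> E}"
      by (rule emeasure_subadditive) auto
    also have "\<dots> \<le> ennreal (e / 2) + ennreal (e / 2)" by (intro add_mono elim enter)
    finally show ?case using e by (simp flip: ennreal_plus)
  qed
qed

lemma powr_add3_le:
  fixes a b c p :: real
  assumes "0 \<le> a" "0 \<le> b" "0 \<le> c" "0 < p"
  shows "(a + b + c) powr p \<le> 3 powr p * (a powr p + b powr p + c powr p)"
proof -
  define m where "m = max a (max b c)"
  have "(a + b + c) powr p \<le> (3 * m) powr p"
    using assms by (intro powr_mono2) (auto simp: m_def)
  also have "\<dots> = 3 powr p * m powr p" using assms by (simp add: powr_mult)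
  also have "m powr p \<le> a powr p + b powr p + c powr p"
    using assms by (auto simp: m_def max_def intro: add_increasing add_increasing2)
  finally show ?thesis by (simp add: mult_left_mono)
qed

text \<open>A simple function with finite \<open>L\<^sup>p\<close> norm changes under a small shift only on a small set, by a bounded
  amount. It approximates \<open>f\<close> in the \<open>L\<^sup>p\<close> norm, and shifting both does not change their distance.\<close>

theorem Lp_translation_continuous:
  fixes f :: "real \<Rightarrow> 'a::real_normed_vector"
  assumes f: "smeas borel f" and p: "0 < p"
    and fin: "(\<integral>\<^sup>+t. ennreal (norm (f t) powr p) \<partial>lborel) < \<infinity>" and h: "h \<longlonglongrightarrow> 0"
  shows "(\<lambda>n. \<integral>\<^sup>+t. ennreal (norm (f (t + h n) - f t) powr p) \<partial>lborel) \<longlonglongrightarrow> 0"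
proof -
  have "smeas lborel f" using f by simp
  then obtain s where s: "\<And>k::nat. simple_function lborel (s k)" "\<And>x. (\<lambda>k. s k x) \<longlonglongrightarrow> f x"
    and bd: "\<And>k x. norm (s k x) \<le> 2 * norm (f x)"
    by (rule smeas_dominated_simple) (auto intro: that)
  have sm: "smeas borel (s k)" for k
  proof -
    have "smeas lborel (s k)" unfolding smeas_def using s(1) by (intro exI[of _ "\<lambda>_. s k"]) auto
    then show ?thesis by simp
  qed
  have [measurable]: "(\<lambda>x. norm (f x)) \<in> borel_measurable borel" by (rule smeas_norm[OF f])
  have [measurable]: "(\<lambda>x. norm (f x - s k x)) \<in> borel_measurable borel" for k
    by (intro smeas_norm smeas_diff f sm)
  define D where "D k = (\<integral>\<^sup>+t. ennreal (norm (f t - s k t) powr p) \<partial>lborel)" for k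
  have "D \<longlonglongrightarrow> (\<integral>\<^sup>+t. ennreal 0 \<partial>(lborel :: real measure))" unfolding D_def
  proof (rule nn_integral_dominated_convergence[where w="\<lambda>t. ennreal (3 powr p) * ennreal (norm (f t) powr p)"])
    show "AE x in lborel. ennreal (norm (f x - s k x) powr p) \<le> ennreal (3 powr p) * ennreal (norm (f x) powr p)" for k
    proof (rule AE_I2)
      fix x
      have "norm (f x - s k x) \<le> 3 * norm (f x)"
        using bd[of k x] norm_triangle_ineq4[of "f x" "s k x"] by linarith
      then have "norm (f x - s k x) powr p \<le> (3 * norm (f x)) powr p"
        using p by (intro powr_mono2) auto
      then show "ennreal (norm (f x - s k x) powr p) \<le> ennreal (3 powr p) * ennreal (norm (f x) powr p)"
        by (simp add: powr_mult ennreal_leI flip: ennreal_mult)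
    qed
    show "(\<integral>\<^sup>+t. ennreal (3 powr p) * ennreal (norm (f t) powr p) \<partial>lborel) < \<infinity>"
      using fin by (simp add: nn_integral_cmult ennreal_mult_less_top)
    show "AE x in lborel. (\<lambda>k. ennreal (norm (f x - s k x) powr p)) \<longlonglongrightarrow> ennreal 0"
    proof (rule AE_I2, rule tendsto_ennrealI)
      fix x
      have "(\<lambda>k. norm (f x - s k x)) \<longlonglongrightarrow> norm (f x - f x)" by (intro tendsto_intros s(2))
      then have "(\<lambda>k. norm (f x - s k x)) \<longlonglongrightarrow> 0" by simp
      from tendsto_powr'[OF this tendsto_const[of p]] p
      show "(\<lambda>k. norm (f x - s k x) powr p) \<longlonglongrightarrow> 0" by simp
    qed
  qed auto
  then have D: "D \<longlonglongrightarrow> 0" by simp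
  have simple: "(\<lambda>n. emeasure lborel {t. s k (t + h n) \<noteq> s k t}) \<longlonglongrightarrow> 0" for k
  proof -
    define R where "R = s k ` UNIV - {0}"
    have fR: "finite R" using simple_functionD(1)[OF s(1)[of k]] by (simp add: R_def)
    define E where "E x = {t. s k t = x}" for x
    have Em [measurable]: "E x \<in> sets borel" for x
      using simple_functionD(2)[OF s(1)[of k], of "{x}"] by (simp add: E_def vimage_def)
    have "emeasure lborel {t\<in>space lborel. ennreal (norm (s k t) powr p) \<noteq> 0} \<noteq> \<infinity>"
    proof (rule simple_function_finite_support)
      show "simple_function lborel (\<lambda>t. ennreal (norm (s k t) powr p))"
        by (rule simple_function_compose1[OF s(1), where g="\<lambda>x. ennreal (norm x powr p)"])
      have "(\<integral>\<^sup>+t. ennreal (norm (s k t) powr p) \<partial>lborel)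
          \<le> (\<integral>\<^sup>+t. ennreal (2 powr p) * ennreal (norm (f t) powr p) \<partial>lborel)"
      proof (rule nn_integral_mono)
        fix t
        have "norm (s k t) powr p \<le> (2 * norm (f t)) powr p"
          using p bd by (intro powr_mono2) auto
        then show "ennreal (norm (s k t) powr p) \<le> ennreal (2 powr p) * ennreal (norm (f t) powr p)"
          by (simp add: powr_mult ennreal_leI flip: ennreal_mult)
      qed
      also have "\<dots> < \<infinity>" using fin by (simp add: nn_integral_cmult ennreal_mult_less_top)
      finally show "(\<integral>\<^sup>+t. ennreal (norm (s k t) powr p) \<partial>lborel) < \<infinity>" .
    qed simp
    moreover have "{t\<in>space lborel. ennreal (norm (s k t) powr p) \<noteq> 0} = {t. s k t \<noteq> 0}"
      by (auto simp: ennreal_eq_0_iff)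
    ultimately have supp: "emeasure lborel {t. s k t \<noteq> 0} < \<infinity>" by (simp add: less_top)
    have supp_meas: "{t. s k t \<noteq> 0} \<in> sets lborel"
      using sets.compl_sets[OF Em[of 0]] by (simp add: E_def Collect_neg_eq Compl_eq_Diff_UNIV)
    have Efin: "emeasure lborel (E x) < \<infinity>" if "x \<in> R" for x
    proof -
      have "emeasure lborel (E x) \<le> emeasure lborel {t. s k t \<noteq> 0}"
        using that by (intro emeasure_mono supp_meas) (auto simp: E_def R_def)
      then show ?thesis using supp by simp
    qed
    have "(\<lambda>n. \<Sum>x\<in>R. emeasure lborel {t. (t + h n \<in> E x) \<noteq> (t \<in> E x)}) \<longlonglongrightarrow> (\<Sum>x\<in>R. 0)"
      by (intro tendsto_sum emeasure_shift_tendsto_zero Em Efin h)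
    moreover have "emeasure lborel {t. s k (t + h n) \<noteq> s k t}
        \<le> (\<Sum>x\<in>R. emeasure lborel {t. (t + h n \<in> E x) \<noteq> (t \<in> E x)})" for n
    proof -
      have "emeasure lborel {t. s k (t + h n) \<noteq> s k t}
          \<le> emeasure lborel (\<Union>x\<in>R. {t. (t + h n \<in> E x) \<noteq> (t \<in> E x)})"
      proof (rule emeasure_mono)
        show "{t. s k (t + h n) \<noteq> s k t} \<subseteq> (\<Union>x\<in>R. {t. (t + h n \<in> E x) \<noteq> (t \<in> E x)})"
        proof
          fix t assume "t \<in> {t. s k (t + h n) \<noteq> s k t}"
          then show "t \<in> (\<Union>x\<in>R. {t. (t + h n \<in> E x) \<noteq> (t \<in> E x)})"
            by (cases "s k t = 0") (auto simp: E_def R_def)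
        qed
        show "(\<Union>x\<in>R. {t. (t + h n \<in> E x) \<noteq> (t \<in> E x)}) \<in> sets lborel"
          using fR by (intro sets.finite_UN) auto
      qed
      also have "\<dots> \<le> (\<Sum>x\<in>R. emeasure lborel {t. (t + h n \<in> E x) \<noteq> (t \<in> E x)})"
        using fR by (intro emeasure_subadditive_finite) auto
      finally show ?thesis .
    qed
    ultimately have lim: "(\<lambda>n. \<Sum>x\<in>R. emeasure lborel {t. (t + h n \<in> E x) \<noteq> (t \<in> E x)}) \<longlonglongrightarrow> 0"
      and le: "emeasure lborel {t. s k (t + h n) \<noteq> s k t}
        \<le> (\<Sum>x\<in>R. emeasure lborel {t. (t + h n \<in> E x) \<noteq> (t \<in> E x)})" for n by simp_all
    from tendsto_sandwich[OF always_eventually always_eventually tendsto_const lim] le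
    show ?thesis by simp
  qed
  show ?thesis
  proof (rule tendsto_zero_ennrealI)
    fix e :: real assume e: "0 < e"
    define c where "c = 3 powr p"
    have c: "0 < c" by (simp add: c_def)
    have "\<forall>\<^sub>F k in sequentially. D k < ennreal (e / (4 * c))"
      by (rule order_tendstoD(2)[OF D]) (use e c in simp)
    then obtain k where k: "D k < ennreal (e / (4 * c))" by (auto dest: eventually_happens)
    define B where "B = (2 * Max ((\<lambda>t. norm (s k t)) ` UNIV)) powr p"
    have "finite ((\<lambda>t. norm (s k t)) ` UNIV)"
      using simple_functionD(1)[OF simple_function_compose1[OF s(1)[of k], where g=norm]] by simp
    then have Mx: "norm (s k t) \<le> Max ((\<lambda>t. norm (s k t)) ` UNIV)" for t by (intro Max_ge) auto
    have sB: "norm (s k t - s k r) powr p \<le> B" for t r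
      unfolding B_def using p Mx[of t] Mx[of r] norm_triangle_ineq4[of "s k t" "s k r"]
      by (intro powr_mono2) auto
    have "0 \<le> B" by (simp add: B_def)
    have "(\<lambda>n. ennreal B * emeasure lborel {t. s k (t + h n) \<noteq> s k t}) \<longlonglongrightarrow> ennreal B * 0"
      by (rule ennreal_tendsto_cmult[OF _ simple]) simp
    then have "(\<lambda>n. ennreal B * emeasure lborel {t. s k (t + h n) \<noteq> s k t}) \<longlonglongrightarrow> 0" by simp
    then have "\<forall>\<^sub>F n in sequentially. ennreal B * emeasure lborel {t. s k (t + h n) \<noteq> s k t} < ennreal (e / (2 * c))"
      by (rule order_tendstoD) (use e c in simp)
    then show "\<forall>\<^sub>F n in sequentially. (\<integral>\<^sup>+t. ennreal (norm (f (t + h n) - f t) powr p) \<partial>lborel) \<le> ennreal e"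
    proof eventually_elim
      case (elim n)
      let ?F = "\<lambda>t. ennreal (norm (f t - s k t) powr p)"
      let ?A = "{t. s k (t + h n) \<noteq> s k t}"
      have sh: "smeas borel (\<lambda>t. s k (t + h n))" by (rule smeas_compose[OF sm]) simp
      have [measurable]: "?A \<in> sets borel"
      proof -
        have "(\<lambda>t. norm (s k (t + h n) - s k t)) \<in> borel_measurable borel"
          by (intro smeas_norm smeas_diff sm sh)
        then have "{t \<in> space borel. norm (s k (t + h n) - s k t) \<noteq> 0} \<in> sets borel" by measurable
        then show ?thesis by simp
      qed
      have pw: "ennreal (norm (f (t + h n) - f t) powr p)
          \<le> ennreal c * (?F (t + h n) + ennreal B * indicator ?A t + ?F t)" for t
      proof -
        have "norm (f (t + h n) - f t) \<le>
            norm (f (t + h n) - s k (t + h n)) + norm (s k (t + h n) - s k t) + norm (f t - s k t)"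
        proof -
          have "f (t + h n) - f t = (f (t + h n) - s k (t + h n)) + (s k (t + h n) - s k t) - (f t - s k t)"
            by simp
          then show ?thesis
            using norm_triangle_ineq4[of "(f (t + h n) - s k (t + h n)) + (s k (t + h n) - s k t)" "f t - s k t"]
              norm_triangle_ineq[of "f (t + h n) - s k (t + h n)" "s k (t + h n) - s k t"] by simp
        qed
        then have "norm (f (t + h n) - f t) powr p \<le>
            (norm (f (t + h n) - s k (t + h n)) + norm (s k (t + h n) - s k t) + norm (f t - s k t)) powr p"
          using p by (intro powr_mono2) auto
        also have "\<dots> \<le> c * (norm (f (t + h n) - s k (t + h n)) powr p
            + norm (s k (t + h n) - s k t) powr p + norm (f t - s k t) powr p)"
          unfolding c_def by (intro powr_add3_le p) auto
        also have "\<dots> \<le> c * (norm (f (t + h n) - s k (t + h n)) powr p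
            + B * indicator ?A t + norm (f t - s k t) powr p)"
          using c sB[of "t + h n" t] p by (intro mult_left_mono add_mono) (auto simp: indicator_def)
        finally have "ennreal (norm (f (t + h n) - f t) powr p) \<le> ennreal \<dots>" by (rule ennreal_leI)
        also have "\<dots> = ennreal c * (?F (t + h n) + ennreal B * indicator ?A t + ?F t)"
        proof -
          have split: "ennreal (c * (x + y + z)) = ennreal c * (ennreal x + ennreal y + ennreal z)"
            if "0 \<le> x" "0 \<le> y" "0 \<le> z" for x y z
            using c that by (simp add: ennreal_mult)
          have "ennreal (B * indicator ?A t) = ennreal B * indicator ?A t" by (auto simp: indicator_def)
          then show ?thesis using \<open>0 \<le> B\<close> by (subst split) auto
        qed
        finally show ?thesis .
      qed
      have "(\<integral>\<^sup>+t. ennreal (norm (f (t + h n) - f t) powr p) \<partial>lborel)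
          \<le> (\<integral>\<^sup>+t. ennreal c * (?F (t + h n) + ennreal B * indicator ?A t + ?F t) \<partial>lborel)"
        by (intro nn_integral_mono pw)
      also have "\<dots> = ennreal c * ((\<integral>\<^sup>+t. ?F (t + h n) \<partial>lborel) + ennreal B * emeasure lborel ?A + D k)"
      proof -
        have [measurable]: "(\<lambda>t. norm (f (t + h n) - s k (t + h n))) \<in> borel_measurable borel"
          by (rule measurable_compose[of "\<lambda>t. t + h n" borel borel]) auto
        show ?thesis unfolding D_def
          by (subst nn_integral_cmult, measurable, subst nn_integral_add, measurable,
              subst nn_integral_add, measurable, subst nn_integral_cmult_indicator) auto
      qed
      also have "(\<integral>\<^sup>+t. ?F (t + h n) \<partial>lborel) = D k"
        unfolding D_def by (rule nn_integral_lborel_shift) measurable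
      also have "ennreal c * (D k + ennreal B * emeasure lborel ?A + D k) \<le>
          ennreal c * (ennreal (e / (4 * c)) + ennreal (e / (2 * c)) + ennreal (e / (4 * c)))"
        using k elim by (intro mult_left_mono add_mono) auto
      also have "\<dots> = ennreal e"
        using c e by (simp add: ennreal_mult[symmetric] ennreal_plus[symmetric] field_simps del: ennreal_plus)
      finally show ?case .
    qed
  qed
qed

section \<open>Fractional kernels\<close>

text \<open>The kernel of the Riemann--Liouville fractional integral, extended by \<open>0\<close> so that integrals over
  times and convolutions can be taken over the whole line.\<close>

definition frac_kernel :: "real \<Rightarrow> real \<Rightarrow> real" where
  "frac_kernel \<sigma> r = (if 0 < r then r powr (\<sigma> - 1) / Gamma \<sigma> else 0)"

lemma frac_kernel_measurable [measurable]: "frac_kernel \<sigma> \<in> borel_measurable borel"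
  unfolding frac_kernel_def[abs_def] by measurable

lemma frac_kernel_nonneg: "0 < \<sigma> \<Longrightarrow> 0 \<le> frac_kernel \<sigma> r"
  by (simp add: frac_kernel_def)

lemma frac_kernel_1: "frac_kernel 1 r = (if 0 < r then 1 else 0)"
  by (simp add: frac_kernel_def)

lemma nn_integral_frac_kernel_exp_finite:
  assumes "0 < \<sigma>" "0 < c"
  shows "(\<integral>\<^sup>+r. ennreal (frac_kernel \<sigma> r * exp (- c * r)) \<partial>lborel) < \<infinity>"
proof -
  have "(\<integral>\<^sup>+t. ennreal (t powr (\<sigma> - 1) / exp t) * indicator {0..} t \<partial>lborel) = ennreal (Gamma \<sigma>)"
    unfolding Gamma_conv_nn_integral_real[OF assms(1)]
    by (intro nn_integral_cong) (auto simp: indicator_def)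
  then have "(\<integral>\<^sup>+t. ennreal (t powr (\<sigma> - 1) / exp t) * indicator {0..} t \<partial>lborel) < \<infinity>" by simp
  moreover have "(\<integral>\<^sup>+t. ennreal (t powr (\<sigma> - 1) / exp t) * indicator {0..} t \<partial>lborel)
     = ennreal c * (\<integral>\<^sup>+r. ennreal ((c * r) powr (\<sigma> - 1) / exp (c * r)) * indicator {0..} (c * r) \<partial>lborel)"
    using assms nn_integral_real_affine[of "\<lambda>t. ennreal (t powr (\<sigma> - 1) / exp t) * indicator {0..} t" c 0] by simp
  ultimately have fin: "(\<integral>\<^sup>+r. ennreal ((c * r) powr (\<sigma> - 1) / exp (c * r)) * indicator {0..} (c * r) \<partial>lborel) < \<infinity>"
    using assms by (auto simp: ennreal_mult_less_top)
  have "(\<integral>\<^sup>+r. ennreal (frac_kernel \<sigma> r * exp (- c * r)) \<partial>lborel)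
     \<le> (\<integral>\<^sup>+r. ennreal (1 / (c powr (\<sigma> - 1) * Gamma \<sigma>)) *
          (ennreal ((c * r) powr (\<sigma> - 1) / exp (c * r)) * indicator {0..} (c * r)) \<partial>lborel)"
    using assms by (intro nn_integral_mono)
      (auto simp: frac_kernel_def indicator_def powr_mult exp_minus field_simps zero_le_mult_iff
        simp flip: ennreal_mult)
  also have "\<dots> < \<infinity>" using fin assms
    by (simp add: nn_integral_cmult ennreal_mult_less_top del: ennreal_1)
  finally show ?thesis .
qed

lemma powr_times_exp_bounded:
  fixes a c :: real
  assumes "0 \<le> a" "0 < c"
  shows "\<exists>K\<ge>0. \<forall>r>0. r powr a * exp (- c * r) \<le> K"
proof (cases "a = 0")
  case True
  then show ?thesis using assms by (intro exI[of _ 1]) auto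
next
  case False
  then have a: "0 < a" using assms by simp
  show ?thesis
  proof (intro exI[of _ "exp (a * ln (a / c) - a)"] conjI allI impI)
    fix r :: real assume r: "0 < r"
    have "ln (c * r / a) \<le> c * r / a - 1" using a assms r by (intro ln_le_minus_one) auto
    then have "a * ln (c * r / a) \<le> c * r - a" using a by (simp add: field_simps)
    moreover have "ln (c * r / a) = ln r - ln (a / c)" using a assms r by (simp add: ln_div ln_mult)
    ultimately have "a * ln r - c * r \<le> a * ln (a / c) - a" by (simp add: algebra_simps)
    then show "r powr a * exp (- c * r) \<le> exp (a * ln (a / c) - a)"
      using r by (simp add: powr_def exp_add[symmetric])
  qed simp
qed

definition admissible :: "real \<Rightarrow> real \<Rightarrow> bool" where
  "admissible p \<sigma> \<longleftrightarrow> (p = 1 \<and> 1 \<le> \<sigma>) \<or> (1 < p \<and> 1 / p < \<sigma>)"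

lemma admissible_pos: "admissible p \<sigma> \<Longrightarrow> 0 < \<sigma>" "admissible p \<sigma> \<Longrightarrow> 1 \<le> p"
  by (auto simp: admissible_def intro: less_trans[of 0 "1/p"])

lemma admissible_ge_1: "1 \<le> p \<Longrightarrow> 1 \<le> \<sigma> \<Longrightarrow> admissible p \<sigma>"
  using less_le_trans[of "1 / p" 1 \<sigma>] by (cases "p = 1") (auto simp: admissible_def)

text \<open>Admissibility of the order means that the exponentially damped kernel lies in the dual
  Lebesgue space. Young's inequality then bounds its pairing with \<open>d\<close>; the first summand can be
  made small at the expense of the constant in the second.\<close>

lemma frac_kernel_Young:
  assumes adm: "admissible p \<sigma>" and w: "0 < w" and \<epsilon>: "0 < \<epsilon>"
  obtains C where "0 \<le> C" "\<And>d. d \<in> borel_measurable borel \<Longrightarrow> (\<And>r. 0 \<le> d r) \<Longrightarrow>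
    (\<integral>\<^sup>+r. ennreal (frac_kernel \<sigma> r * exp (- w * r) * d r) \<partial>lborel)
      \<le> ennreal \<epsilon> + ennreal C * (\<integral>\<^sup>+r. ennreal (d r powr p) \<partial>lborel)"
proof -
  have \<sigma>: "0 < \<sigma>" by (rule admissible_pos(1)[OF adm])
  consider "p = 1" "1 \<le> \<sigma>" | "1 < p" "1 / p < \<sigma>" using adm by (auto simp: admissible_def)
  then show ?thesis
  proof cases
    case 1
    obtain K where K: "0 \<le> K" "\<And>r. 0 < r \<Longrightarrow> r powr (\<sigma> - 1) * exp (- w * r) \<le> K"
      using powr_times_exp_bounded[of "\<sigma> - 1" w] 1 w by auto
    show ?thesis
    proof (rule that[of "K / Gamma \<sigma>"])
      show "0 \<le> K / Gamma \<sigma>" using K \<sigma> by simp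
      fix d :: "real \<Rightarrow> real" assume [measurable]: "d \<in> borel_measurable borel" and d: "\<And>r. 0 \<le> d r"
      have "(\<integral>\<^sup>+r. ennreal (frac_kernel \<sigma> r * exp (- w * r) * d r) \<partial>lborel)
          \<le> (\<integral>\<^sup>+r. ennreal (K / Gamma \<sigma>) * ennreal (d r powr p) \<partial>lborel)"
      proof (rule nn_integral_mono)
        fix r
        have "frac_kernel \<sigma> r * exp (- w * r) \<le> K / Gamma \<sigma>"
          using K \<sigma> by (auto simp: frac_kernel_def divide_right_mono)
        then have "frac_kernel \<sigma> r * exp (- w * r) * d r \<le> K / Gamma \<sigma> * d r"
          using d by (intro mult_right_mono) auto
        then show "ennreal (frac_kernel \<sigma> r * exp (- w * r) * d r) \<le> ennreal (K / Gamma \<sigma>) * ennreal (d r powr p)"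
          using d K \<sigma> 1 by (simp add: ennreal_leI flip: ennreal_mult)
      qed
      also have "\<dots> = ennreal (K / Gamma \<sigma>) * (\<integral>\<^sup>+r. ennreal (d r powr p) \<partial>lborel)"
        by (rule nn_integral_cmult) measurable
      finally show "(\<integral>\<^sup>+r. ennreal (frac_kernel \<sigma> r * exp (- w * r) * d r) \<partial>lborel)
          \<le> ennreal \<epsilon> + ennreal (K / Gamma \<sigma>) * (\<integral>\<^sup>+r. ennreal (d r powr p) \<partial>lborel)"
        by (simp add: add_increasing)
    qed
  next
    case 2
    define q where "q = p / (p - 1)"
    have q: "1 < q" "1 / p + 1 / q = 1" using 2 by (auto simp: q_def field_simps)
    \<comment> \<open>The power \<open>q\<close> of the kernel of order \<open>\<sigma>\<close> is a multiple of the kernel of order \<open>b\<close>, and \<open>b > 0\<close> is admissibility.\<close>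
    define b where "b = (\<sigma> - 1) * q + 1"
    have b: "0 < b"
    proof -
      have "(1 - \<sigma>) * q < (1 - 1 / p) * q" using 2 q by (intro mult_strict_right_mono) auto
      also have "\<dots> = 1" using q by (simp add: field_simps)
      finally show ?thesis by (simp add: b_def algebra_simps)
    qed
    let ?\<kappa> = "\<lambda>r. frac_kernel \<sigma> r * exp (- w * r)"
    have \<kappa>_nn: "0 \<le> ?\<kappa> r" for r using frac_kernel_nonneg[OF \<sigma>] by simp
    have \<kappa>_powr: "?\<kappa> r powr q = (Gamma b / Gamma \<sigma> powr q) * (frac_kernel b r * exp (- (w * q) * r))" for r
    proof (cases "0 < r")
      case True
      have "?\<kappa> r powr q = (r powr (\<sigma> - 1)) powr q * exp (- w * r) powr q / Gamma \<sigma> powr q"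
        using True by (simp add: frac_kernel_def powr_mult powr_divide)
      also have "(r powr (\<sigma> - 1)) powr q = r powr (b - 1)" by (simp add: powr_powr b_def)
      also have "exp (- w * r) powr q = exp (- (w * q) * r)" by (simp add: exp_powr_real mult_ac)
      finally show ?thesis using True Gamma_real_pos[OF b] by (simp add: frac_kernel_def)
    qed (simp add: frac_kernel_def)
    obtain K where K: "0 \<le> K" "(\<integral>\<^sup>+r. ennreal (?\<kappa> r powr q) \<partial>lborel) = ennreal K"
    proof -
      have "(\<integral>\<^sup>+r. ennreal (?\<kappa> r powr q) \<partial>lborel)
         = (\<integral>\<^sup>+r. ennreal (Gamma b / Gamma \<sigma> powr q) * ennreal (frac_kernel b r * exp (- (w * q) * r)) \<partial>lborel)"
        using b \<sigma> unfolding \<kappa>_powr by (intro nn_integral_cong) (simp add: ennreal_mult' del: times_divide_eq_left)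
      also have "\<dots> < \<infinity>"
        using nn_integral_frac_kernel_exp_finite[OF b, of "w * q"] w q
        by (simp add: nn_integral_cmult ennreal_mult_less_top)
      finally have "(\<integral>\<^sup>+r. ennreal (?\<kappa> r powr q) \<partial>lborel) < top" by simp
      then show ?thesis
        by (intro that[of "enn2real (\<integral>\<^sup>+r. ennreal (?\<kappa> r powr q) \<partial>lborel)"]) (simp_all only: enn2real_nonneg ennreal_enn2real)
    qed
    \<comment> \<open>The weight \<open>\<eta>\<close> in Young's inequality makes the part coming from the kernel at most \<open>\<epsilon>\<close>.\<close>
    define \<eta> where "\<eta> = (\<epsilon> / (K + 1)) powr (1 / q)"
    have \<eta>: "0 < \<eta>" "\<eta> powr q * K \<le> \<epsilon>"
      using \<epsilon> K q by (auto simp: \<eta>_def powr_powr field_simps)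
    show ?thesis
    proof (rule that[of "(1 / \<eta>) powr p"])
      fix d :: "real \<Rightarrow> real" assume [measurable]: "d \<in> borel_measurable borel" and d: "\<And>r. 0 \<le> d r"
      have "(\<integral>\<^sup>+r. ennreal (?\<kappa> r * d r) \<partial>lborel)
          \<le> (\<integral>\<^sup>+r. ennreal (\<eta> powr q) * ennreal (?\<kappa> r powr q) + ennreal ((1 / \<eta>) powr p) * ennreal (d r powr p) \<partial>lborel)"
      proof (rule nn_integral_mono)
        fix r
        have "?\<kappa> r * d r = (\<eta> * ?\<kappa> r) * (1 / \<eta> * d r)" using \<eta> by simp
        also have "\<dots> \<le> (\<eta> * ?\<kappa> r) powr q / q + (1 / \<eta> * d r) powr p / p"
          using q 2 \<eta> d \<kappa>_nn by (intro Youngs_inequality) (auto simp: add.commute)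
        also have "\<dots> \<le> (\<eta> * ?\<kappa> r) powr q + (1 / \<eta> * d r) powr p"
        proof -
          have "x / y \<le> x" if "0 \<le> x" "1 < y" for x y :: real
            using that mult_left_mono[of 1 y x] by (simp add: divide_le_eq)
          then show ?thesis using q 2 by (intro add_mono) auto
        qed
        also have "\<dots> = \<eta> powr q * ?\<kappa> r powr q + (1 / \<eta>) powr p * d r powr p"
          using \<eta> d[of r] \<kappa>_nn[of r] by (metis less_imp_le powr_mult zero_le_divide_1_iff)
        finally have "ennreal (?\<kappa> r * d r) \<le> ennreal (\<eta> powr q * ?\<kappa> r powr q + (1 / \<eta>) powr p * d r powr p)"
          by (rule ennreal_leI)
        also have "\<dots> = ennreal (\<eta> powr q) * ennreal (?\<kappa> r powr q) + ennreal ((1 / \<eta>) powr p) * ennreal (d r powr p)"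
          by (simp add: ennreal_mult)
        finally show "ennreal (?\<kappa> r * d r) \<le> \<dots>" .
      qed
      also have "\<dots> = ennreal (\<eta> powr q) * ennreal K + ennreal ((1 / \<eta>) powr p) * (\<integral>\<^sup>+r. ennreal (d r powr p) \<partial>lborel)"
        unfolding K(2)[symmetric]
        by (subst nn_integral_add, measurable, subst nn_integral_cmult, measurable, subst nn_integral_cmult) auto
      also have "ennreal (\<eta> powr q) * ennreal K \<le> ennreal \<epsilon>"
        using \<eta> K by (simp add: ennreal_leI flip: ennreal_mult)
      finally show "(\<integral>\<^sup>+r. ennreal (?\<kappa> r * d r) \<partial>lborel)
          \<le> ennreal \<epsilon> + ennreal ((1 / \<eta>) powr p) * (\<integral>\<^sup>+r. ennreal (d r powr p) \<partial>lborel)" by simp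
    qed simp
  qed
qed

section \<open>Exponentially stable semigroups\<close>

locale stable_semigroup =
  fixes S :: "real \<Rightarrow> ('a::complex_banach \<Rightarrow>\<^sub>L 'a)" and M w :: real
  assumes semigroup: "strongly_measurable_semigroup S"
    and M: "1 \<le> M" and w: "0 < w"
    and S_bound: "\<And>t. 0 \<le> t \<Longrightarrow> norm (S t) \<le> M * exp (- w * t)"
begin

lemma S_add: "0 \<le> t \<Longrightarrow> 0 \<le> r \<Longrightarrow> S (t + r) x = S t (S r x)"
  using semigroup by (simp add: strongly_measurable_semigroup_def)

lemma S_norm: "0 \<le> t \<Longrightarrow> norm (S t x) \<le> M * exp (- w * t) * norm x"
  using norm_blinfun[of "S t" x] mult_right_mono[OF S_bound[of t], of "norm x"] by simp

lemma S_norm': "0 \<le> t \<Longrightarrow> norm (S t x) \<le> M * norm x"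
proof -
  assume t: "0 \<le> t"
  then have "M * exp (- w * t) * norm x \<le> M * 1 * norm x"
    using M w by (intro mult_right_mono mult_left_mono) auto
  with S_norm[OF t, of x] show ?thesis by simp
qed

text \<open>By the semigroup law, the increment of an orbit is an image of earlier increments; averaging
  these over time bounds it by the translation error of an integrable function.\<close>

lemma S_strongly_continuous: "continuous_on {0<..} (\<lambda>t. S t x)"
proof (rule continuous_on_sequentiallyI)
  fix u :: "nat \<Rightarrow> real" and t :: real
  assume u: "\<forall>n. u n \<in> {0<..}" and t: "t \<in> {0<..}" and ut: "u \<longlonglongrightarrow> t"
  have "strongly_measurable (lebesgue_on {0..}) (\<lambda>t. S t x)"
    using semigroup by (simp add: strongly_measurable_semigroup_def)
  then obtain f where f: "smeas borel f" "AE t in lborel. t \<in> {0..} \<longrightarrow> S t x = f t"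
    using strongly_measurable_on_smeas[of "{0..}"] by (metis atLeast_borel sets_lborel)
  define F where "F r = indicator {0<..<2 * t} r *\<^sub>R f r" for r
  have F: "smeas borel F" unfolding F_def by (intro smeas_scaleR f) measurable
  have SF: "AE r in lborel. r \<in> {0<..<2 * t} \<longrightarrow> S r x = F r"
    using f(2) by eventually_elim (auto simp: F_def)
  have F_le: "AE r in lborel. norm (F r) \<le> M * norm x * indicator {0<..<2 * t} r"
    using f(2)
  proof eventually_elim
    case (elim r)
    then show ?case using S_norm'[of r x] by (auto simp: F_def indicator_def)
  qed
  have [measurable]: "(\<lambda>r. norm (F r)) \<in> borel_measurable borel" by (rule smeas_norm[OF F])
  have "(\<integral>\<^sup>+r. ennreal (norm (F r) powr 1) \<partial>lborel)
      \<le> (\<integral>\<^sup>+r. ennreal (M * norm x) * indicator {0<..<2 * t} r \<partial>lborel)"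
    using F_le by (intro nn_integral_mono_AE, eventually_elim) (auto simp: indicator_def ennreal_leI split: if_splits)
  also have "\<dots> < \<infinity>" using t by (simp add: nn_integral_cmult_indicator ennreal_mult_less_top)
  finally have fin: "(\<integral>\<^sup>+r. ennreal (norm (F r) powr 1) \<partial>lborel) < \<infinity>" .
  define h where "h n = u n - t" for n
  have h: "h \<longlonglongrightarrow> 0" using tendsto_diff[OF ut tendsto_const[of t]] by (simp add: h_def[abs_def])
  have T: "(\<lambda>n. \<integral>\<^sup>+r. ennreal (norm (F (r + h n) - F r)) \<partial>lborel) \<longlonglongrightarrow> 0"
    using Lp_translation_continuous[OF F _ fin h] by simp
  have est: "ennreal (t / 2) * ennreal (norm (S (u n) x - S t x))
      \<le> ennreal M * (\<integral>\<^sup>+r. ennreal (norm (F (r + h n) - F r)) \<partial>lborel)"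
    if n: "t / 2 < u n" "u n < 2 * t" for n
  proof -
    let ?c = "norm (S (u n) x - S t x)"
    have [measurable]: "(\<lambda>r. norm (F (r + h n) - F r)) \<in> borel_measurable borel"
      by (intro smeas_norm smeas_diff F smeas_compose[OF F]) simp
    have pw: "AE r in lborel. ennreal ?c * indicator {t / 2<..<t} r \<le> ennreal (M * norm (F (r + h n) - F r))"
      using SF AE_lborel_affine[OF SF one_neq_zero, of "h n"]
    proof eventually_elim
      case (elim r)
      show ?case
      proof (cases "r \<in> {t / 2<..<t}")
        case True
        have r: "S r x = F r" "S (h n + r) x = F (h n + r)"
          using elim True n t by (auto simp: h_def)
        have "S (u n) x = S (t - r) (S (h n + r) x)"
          using S_add[of "t - r" "h n + r" x] True n by (simp add: h_def)
        moreover have "S t x = S (t - r) (S r x)"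
          using S_add[of "t - r" r x] True t by simp
        ultimately have "?c = norm (S (t - r) (F (r + h n) - F r))"
          unfolding add.commute[of r] blinfun.diff_right r by simp
        also have "\<dots> \<le> M * norm (F (r + h n) - F r)" using True by (intro S_norm') simp
        finally show ?thesis using True by (simp add: ennreal_leI)
      qed simp
    qed
    have "ennreal (t / 2) * ennreal ?c = (\<integral>\<^sup>+r. ennreal ?c * indicator {t / 2<..<t} r \<partial>lborel)"
      by (subst nn_integral_cmult_indicator) (use t in \<open>simp_all add: mult.commute\<close>)
    also have "\<dots> \<le> (\<integral>\<^sup>+r. ennreal M * ennreal (norm (F (r + h n) - F r)) \<partial>lborel)"
      using pw by (intro nn_integral_mono_AE) (use M in \<open>simp add: ennreal_mult\<close>)
    also have "\<dots> = ennreal M * (\<integral>\<^sup>+r. ennreal (norm (F (r + h n) - F r)) \<partial>lborel)"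
      by (rule nn_integral_cmult) measurable
    finally show ?thesis .
  qed
  have ev: "\<forall>\<^sub>F n in sequentially. t / 2 < u n \<and> u n < 2 * t"
    using order_tendstoD(1)[OF ut, of "t / 2"] order_tendstoD(2)[OF ut, of "2 * t"] t
    by (intro eventually_conj) simp_all
  show "(\<lambda>n. S (u n) x) \<longlonglongrightarrow> S t x"
  proof (rule tendstoI)
    fix e :: real assume e: "0 < e"
    have "\<forall>\<^sub>F n in sequentially. (\<integral>\<^sup>+r. ennreal (norm (F (r + h n) - F r)) \<partial>lborel) < ennreal (t / 2 * e / M)"
      using order_tendstoD(2)[OF T, of "ennreal (t / 2 * e / M)"] e t M by simp
    then show "\<forall>\<^sub>F n in sequentially. dist (S (u n) x) (S t x) < e"
      using ev
    proof eventually_elim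
      case (elim n)
      have "ennreal (t / 2) * ennreal (norm (S (u n) x - S t x))
        \<le> ennreal M * (\<integral>\<^sup>+r. ennreal (norm (F (r + h n) - F r)) \<partial>lborel)" using elim by (intro est) auto
      also have "\<dots> < ennreal M * ennreal (t / 2 * e / M)"
        using elim(1) M by (intro ennreal_mult_strict_left_mono) auto
      also have "\<dots> = ennreal (t / 2 * e)" using M e t by (simp flip: ennreal_mult)
      finally have "t / 2 * norm (S (u n) x - S t x) < t / 2 * e"
        using t e by (simp add: ennreal_less_iff flip: ennreal_mult)
      then show ?case using t by (simp add: dist_norm)
    qed
  qed
qed

text \<open>The semigroup, cut off so that orbits are strongly measurable functions on the whole line. Orbits need
  not be continuous at \<open>0\<close>, and their value there does not matter under an integral.\<close>

definition Sp :: "real \<Rightarrow> 'a \<Rightarrow>\<^sub>L 'a" where "Sp t = (if 0 < t then S t else 0)"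

lemma Sp_norm: "norm (Sp t x) \<le> M * exp (- w * t) * norm x"
  using S_norm[of t x] M by (auto simp: Sp_def)

lemma Sp_smeas: "smeas borel (\<lambda>t. Sp t x)"
proof -
  have "(\<lambda>t. Sp t x) = (\<lambda>t. if t \<in> {0<..} then S t x else 0)" by (auto simp: Sp_def)
  then show ?thesis using smeas_continuous_on[OF _ S_strongly_continuous, of x] by simp
qed

lemma Sp_apply_smeas:
  assumes "g \<in> measurable N borel" "smeas N v"
  shows "smeas N (\<lambda>\<omega>. Sp (g \<omega>) (v \<omega>))"
  by (rule smeas_apply[OF smeas_compose[OF Sp_smeas assms(1)] assms(2)])

lemma Sp_add: "0 < t \<Longrightarrow> 0 < r \<Longrightarrow> Sp (t + r) x = Sp t (Sp r x)"
  by (simp add: Sp_def S_add)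

text \<open>The integrand is the bound that exponential stability gives for the norm of the integrand of the
  fractional integral, up to the factor \<open>M\<close>.\<close>

definition frac_norm :: "real \<Rightarrow> (real \<Rightarrow> 'a) \<Rightarrow> real \<Rightarrow> ennreal" where
  "frac_norm \<sigma> v t = (\<integral>\<^sup>+r. ennreal (frac_kernel \<sigma> r * exp (- w * r) * norm (v (t - r))) \<partial>lborel)"

lemma frac_integral_smeas:
  assumes v: "smeas borel v"
  shows "smeas borel (\<lambda>r. frac_kernel \<sigma> r *\<^sub>R Sp r (v (t - r)))"
  by (intro smeas_scaleR Sp_apply_smeas smeas_compose[OF v]) measurable

lemma frac_integral_functional:
  fixes \<psi> :: "'a \<Rightarrow>\<^sub>L real"
  assumes \<sigma>: "0 < \<sigma>" and v: "smeas borel v" "AE x in lborel. x \<le> t \<longrightarrow> v' x = v x"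
    and fin: "frac_norm \<sigma> v t < \<infinity>"
  shows "has_bochner_integral lborel (\<lambda>r. frac_kernel \<sigma> r * \<psi> (Sp r (v (t - r)))) (\<psi> (frac_integral S \<sigma> v' t))"
    and "frac_norm \<sigma> v t \<le> ennreal K \<Longrightarrow> 0 \<le> K \<Longrightarrow> norm (frac_integral S \<sigma> v' t) \<le> M * K"
proof -
  let ?f = "\<lambda>\<tau>. \<tau> powr (\<sigma> - 1) *\<^sub>R S \<tau> (v' (t - \<tau>))"
  let ?f' = "\<lambda>r. Gamma \<sigma> *\<^sub>R (frac_kernel \<sigma> r *\<^sub>R Sp r (v (t - r)))"
  have G: "0 < Gamma \<sigma>" using \<sigma> by simp
  have f': "smeas borel ?f'" by (rule smeas_scaleR[OF _ frac_integral_smeas[OF v(1)]]) simp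
  have ae: "AE r in lborel. r \<in> {0..} \<longrightarrow> ?f r = ?f' r"
    using AE_lborel_reflect[OF v(2), of t] AE_lborel_singleton[of 0]
  proof eventually_elim
    case (elim r)
    then show ?case using G by (auto simp: frac_kernel_def Sp_def)
  qed
  have le: "(\<integral>\<^sup>+r. indicator {0..} r * ennreal (norm (?f' r)) \<partial>lborel) \<le> ennreal (Gamma \<sigma> * M) * frac_norm \<sigma> v t"
  proof -
    have [measurable]: "(\<lambda>r. norm (v (t - r))) \<in> borel_measurable borel"
      by (rule smeas_norm[OF smeas_compose[OF v(1)]]) simp
    have "(\<integral>\<^sup>+r. indicator {0..} r * ennreal (norm (?f' r)) \<partial>lborel)
        \<le> (\<integral>\<^sup>+r. ennreal (Gamma \<sigma> * M) * ennreal (frac_kernel \<sigma> r * exp (- w * r) * norm (v (t - r))) \<partial>lborel)"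
    proof (rule nn_integral_mono)
      fix r
      have "norm (?f' r) = Gamma \<sigma> * frac_kernel \<sigma> r * norm (Sp r (v (t - r)))"
        using G frac_kernel_nonneg[OF \<sigma>, of r] by simp
      also have "\<dots> \<le> Gamma \<sigma> * frac_kernel \<sigma> r * (M * exp (- w * r) * norm (v (t - r)))"
        using G frac_kernel_nonneg[OF \<sigma>, of r] by (intro mult_left_mono Sp_norm) auto
      finally have "ennreal (norm (?f' r)) \<le> ennreal ((Gamma \<sigma> * M) * (frac_kernel \<sigma> r * exp (- w * r) * norm (v (t - r))))"
        by (intro ennreal_leI) (simp add: mult_ac)
      also have "\<dots> = ennreal (Gamma \<sigma> * M) * ennreal (frac_kernel \<sigma> r * exp (- w * r) * norm (v (t - r)))"
        using G M by (intro ennreal_mult') auto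
      finally show "indicator {0..} r * ennreal (norm (?f' r))
        \<le> ennreal (Gamma \<sigma> * M) * ennreal (frac_kernel \<sigma> r * exp (- w * r) * norm (v (t - r)))"
        by (auto simp: indicator_def)
    qed
    also have "\<dots> = ennreal (Gamma \<sigma> * M) * frac_norm \<sigma> v t"
      unfolding frac_norm_def by (rule nn_integral_cmult) measurable
    finally show ?thesis .
  qed
  also have "\<dots> < \<infinity>" using fin by (simp add: ennreal_mult_less_top)
  finally have fin': "(\<integral>\<^sup>+r. indicator {0..} r * ennreal (norm (?f' r)) \<partial>lborel) < \<infinity>" .
  have "has_bochner_integral lborel (\<lambda>r. indicator {0..} r * \<psi> (?f' r)) (\<psi> (bochner_integral (lebesgue_on {0..}) ?f))"
    by (rule bochner_integral_on(2)[OF _ f' ae fin']) simp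
  then have "has_bochner_integral lborel (\<lambda>r. (1 / Gamma \<sigma>) * (indicator {0..} r * \<psi> (?f' r)))
      ((1 / Gamma \<sigma>) * \<psi> (bochner_integral (lebesgue_on {0..}) ?f))"
    by (rule has_bochner_integral_mult_right)
  moreover have "(1 / Gamma \<sigma>) * (indicator {0..} r * \<psi> (?f' r)) = frac_kernel \<sigma> r * \<psi> (Sp r (v (t - r)))" for r
    using G by (simp add: blinfun.scaleR_right frac_kernel_def indicator_def)
  ultimately show "has_bochner_integral lborel (\<lambda>r. frac_kernel \<sigma> r * \<psi> (Sp r (v (t - r)))) (\<psi> (frac_integral S \<sigma> v' t))"
    using \<sigma> by (simp add: frac_integral_def blinfun.scaleR_right)
  assume K: "frac_norm \<sigma> v t \<le> ennreal K" "0 \<le> K"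
  have "(\<integral>\<^sup>+r. indicator {0..} r * ennreal (norm (?f' r)) \<partial>lborel) \<le> ennreal (Gamma \<sigma> * M) * ennreal K"
    using le K(1) by (meson mult_left_mono order_trans zero_le)
  also have "\<dots> = ennreal (Gamma \<sigma> * M * K)" using G M K by (simp flip: ennreal_mult)
  finally have "norm (bochner_integral (lebesgue_on {0..}) ?f) \<le> Gamma \<sigma> * M * K"
    using G M K by (intro norm_bochner_integral_on_le[OF _ f' ae]) auto
  then show "norm (frac_integral S \<sigma> v' t) \<le> M * K"
    using \<sigma> G by (simp add: frac_integral_def field_simps)
qed

end

section \<open>Convolution of kernels\<close>

text \<open>Substitute \<open>r = \<tau> + \<rho>\<close> in the inner integral and exchange the order of integration.\<close>

lemma nn_integral_convolution:
  fixes P Q :: "real \<Rightarrow> ennreal"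
  assumes [measurable]: "P \<in> borel_measurable borel" "Q \<in> borel_measurable borel" "F \<in> borel_measurable borel"
  shows "(\<integral>\<^sup>+\<tau>. P \<tau> * (\<integral>\<^sup>+\<rho>. Q \<rho> * F (\<tau> + \<rho>) \<partial>lborel) \<partial>lborel)
       = (\<integral>\<^sup>+r. (\<integral>\<^sup>+\<tau>. P \<tau> * Q (r - \<tau>) \<partial>lborel) * F r \<partial>lborel)"
proof -
  have "(\<integral>\<^sup>+\<tau>. P \<tau> * (\<integral>\<^sup>+\<rho>. Q \<rho> * F (\<tau> + \<rho>) \<partial>lborel) \<partial>lborel)
      = (\<integral>\<^sup>+\<tau>. (\<integral>\<^sup>+r. P \<tau> * Q (r - \<tau>) * F r \<partial>lborel) \<partial>lborel)"
  proof (rule nn_integral_cong)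
    fix \<tau>
    have "(\<integral>\<^sup>+\<rho>. Q \<rho> * F (\<tau> + \<rho>) \<partial>lborel) = (\<integral>\<^sup>+r. Q (r - \<tau>) * F r \<partial>lborel)"
      using nn_integral_lborel_shift[of "\<lambda>r. Q (r - \<tau>) * F r" \<tau>] by (simp add: add.commute)
    then show "P \<tau> * (\<integral>\<^sup>+\<rho>. Q \<rho> * F (\<tau> + \<rho>) \<partial>lborel) = (\<integral>\<^sup>+r. P \<tau> * Q (r - \<tau>) * F r \<partial>lborel)"
      by (simp add: nn_integral_cmult[symmetric] mult.assoc)
  qed
  also have "\<dots> = (\<integral>\<^sup>+r. (\<integral>\<^sup>+\<tau>. P \<tau> * Q (r - \<tau>) * F r \<partial>lborel) \<partial>lborel)"
    by (rule lborel_pair.Fubini') measurable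
  also have "\<dots> = (\<integral>\<^sup>+r. (\<integral>\<^sup>+\<tau>. P \<tau> * Q (r - \<tau>) \<partial>lborel) * F r \<partial>lborel)"
    by (intro nn_integral_cong nn_integral_multc) measurable
  finally show ?thesis .
qed

lemma integral_convolution:
  fixes P Q C F :: "real \<Rightarrow> real"
  assumes [measurable]: "P \<in> borel_measurable borel" "Q \<in> borel_measurable borel"
      "C \<in> borel_measurable borel" "F \<in> borel_measurable borel"
    and nn: "\<And>r. 0 \<le> P r" "\<And>r. 0 \<le> Q r" "\<And>r. 0 \<le> C r"
    and C: "\<And>r. (\<integral>\<^sup>+\<tau>. ennreal (P \<tau>) * ennreal (Q (r - \<tau>)) \<partial>lborel) = ennreal (C r)"
    and fin: "(\<integral>\<^sup>+r. ennreal (C r * \<bar>F r\<bar>) \<partial>lborel) < \<infinity>"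
  shows "(LINT \<tau>|lborel. P \<tau> * (LINT \<rho>|lborel. Q \<rho> * F (\<tau> + \<rho>))) = (LINT r|lborel. C r * F r)"
proof -
  let ?G = "\<lambda>r \<tau>. P \<tau> * Q (r - \<tau>) * F r"
  have "(\<integral>\<^sup>+z. ennreal (norm (case_prod ?G z)) \<partial>(lborel \<Otimes>\<^sub>M lborel))
      = (\<integral>\<^sup>+r. (\<integral>\<^sup>+\<tau>. ennreal (norm (?G r \<tau>)) \<partial>lborel) \<partial>lborel)"
    by (subst lborel.nn_integral_fst[symmetric]) auto
  also have "\<dots> = (\<integral>\<^sup>+r. ennreal (C r * \<bar>F r\<bar>) \<partial>lborel)"
  proof (rule nn_integral_cong)
    fix r
    have "(\<integral>\<^sup>+\<tau>. ennreal (norm (?G r \<tau>)) \<partial>lborel) = (\<integral>\<^sup>+\<tau>. (ennreal (P \<tau>) * ennreal (Q (r - \<tau>))) * ennreal \<bar>F r\<bar> \<partial>lborel)"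
      using nn by (intro nn_integral_cong) (simp add: abs_mult ennreal_mult)
    also have "\<dots> = (\<integral>\<^sup>+\<tau>. ennreal (P \<tau>) * ennreal (Q (r - \<tau>)) \<partial>lborel) * ennreal \<bar>F r\<bar>"
      by (rule nn_integral_multc) measurable
    also have "\<dots> = ennreal (C r * \<bar>F r\<bar>)" unfolding C using nn by (simp add: ennreal_mult)
    finally show "(\<integral>\<^sup>+\<tau>. ennreal (norm (?G r \<tau>)) \<partial>lborel) = ennreal (C r * \<bar>F r\<bar>)" .
  qed
  also note fin
  finally have int: "integrable (lborel \<Otimes>\<^sub>M lborel) (case_prod ?G)"
    by (intro integrableI_bounded) auto
  have "(LINT \<tau>|lborel. P \<tau> * (LINT \<rho>|lborel. Q \<rho> * F (\<tau> + \<rho>))) = (LINT \<tau>|lborel. (LINT r|lborel. ?G r \<tau>))"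
  proof (rule Bochner_Integration.integral_cong)
    fix \<tau> :: real
    have "(LINT \<rho>|lborel. Q \<rho> * F (\<tau> + \<rho>)) = (LINT r|lborel. Q (r - \<tau>) * F r)"
      using lborel_integral_real_affine[of 1 "\<lambda>r. Q (r - \<tau>) * F r" \<tau>] by simp
    then show "P \<tau> * (LINT \<rho>|lborel. Q \<rho> * F (\<tau> + \<rho>)) = (LINT r|lborel. ?G r \<tau>)"
      by (simp add: mult.assoc)
  qed simp
  also have "\<dots> = (LINT r|lborel. (LINT \<tau>|lborel. ?G r \<tau>))"
    by (rule lborel_pair.Fubini_integral[OF int])
  also have "\<dots> = (LINT r|lborel. C r * F r)"
  proof (rule Bochner_Integration.integral_cong)
    fix r :: real
    have "(LINT \<tau>|lborel. P \<tau> * Q (r - \<tau>)) = C r"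
      using C[of r] nn by (intro integral_eq_nn_integral[THEN trans]) (simp_all add: ennreal_mult)
    then show "(LINT \<tau>|lborel. ?G r \<tau>) = C r * F r" by simp
  qed simp
  finally show ?thesis .
qed

lemma nn_integral_Beta:
  fixes a b :: real
  assumes "0 < a" "0 < b"
  shows "(\<integral>\<^sup>+x. ennreal (x powr (a - 1) * (1 - x) powr (b - 1)) * indicator {0..1} x \<partial>lborel) = ennreal (Beta a b)"
  using nn_integral_has_integral_lebesgue[OF _ has_integral_Beta_real[OF assms]]
  by (simp add: mult.commute nn_integral_completion flip: ennreal_indicator ennreal_mult')

text \<open>Scaling the integration variable by \<open>r\<close> leaves the integral of the Beta function.\<close>

lemma frac_kernel_convolution:
  assumes a: "0 < a" and b: "0 < b"
  shows "(\<integral>\<^sup>+\<tau>. ennreal (frac_kernel a \<tau>) * ennreal (frac_kernel b (r - \<tau>)) \<partial>lborel) = ennreal (frac_kernel (a + b) r)"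
proof (cases "0 < r")
  case False
  then have "(\<integral>\<^sup>+\<tau>. ennreal (frac_kernel a \<tau>) * ennreal (frac_kernel b (r - \<tau>)) \<partial>lborel) = (\<integral>\<^sup>+\<tau>. 0 \<partial>(lborel::real measure))"
    by (intro nn_integral_cong) (auto simp: frac_kernel_def)
  then show ?thesis using False by (simp add: frac_kernel_def)
next
  case True
  define c where "c = r powr (a + b - 1) / (Gamma a * Gamma b)"
  have c: "0 \<le> c" using a b by (simp add: c_def)
  have "(\<integral>\<^sup>+\<tau>. ennreal (frac_kernel a \<tau>) * ennreal (frac_kernel b (r - \<tau>)) \<partial>lborel)
     = ennreal r * (\<integral>\<^sup>+x. ennreal (frac_kernel a (r * x)) * ennreal (frac_kernel b (r - r * x)) \<partial>lborel)"
    using True nn_integral_real_affine[of "\<lambda>\<tau>. ennreal (frac_kernel a \<tau>) * ennreal (frac_kernel b (r - \<tau>))" r 0] by simp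
  also have "\<dots> = (\<integral>\<^sup>+x. ennreal r * (ennreal (frac_kernel a (r * x)) * ennreal (frac_kernel b (r - r * x))) \<partial>lborel)"
    by (rule nn_integral_cmult[symmetric]) measurable
  also have "\<dots> = (\<integral>\<^sup>+x. ennreal c * (ennreal (x powr (a - 1) * (1 - x) powr (b - 1)) * indicator {0..1} x) \<partial>lborel)"
  proof (rule nn_integral_cong_AE, rule AE_mp[OF AE_lborel_singleton[of 0]], rule AE_mp[OF AE_lborel_singleton[of 1]], rule AE_I2, intro impI)
    fix x :: real assume x: "x \<noteq> 1" "x \<noteq> 0"
    show "ennreal r * (ennreal (frac_kernel a (r * x)) * ennreal (frac_kernel b (r - r * x)))
      = ennreal c * (ennreal (x powr (a - 1) * (1 - x) powr (b - 1)) * indicator {0..1} x)"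
    proof (cases "0 < x \<and> x < 1")
      case 1: True
      have rx: "r - r * x = r * (1 - x)" by (simp add: algebra_simps)
      have "r * (r powr (a - 1) * r powr (b - 1)) = r powr 1 * (r powr (a - 1) * r powr (b - 1))" using True by simp
      also have "\<dots> = r powr (a + b - 1)" unfolding powr_add[symmetric] by (simp add: algebra_simps)
      finally have "r * (frac_kernel a (r * x) * frac_kernel b (r - r * x)) = c * (x powr (a - 1) * (1 - x) powr (b - 1))"
        using True 1 unfolding rx by (simp add: frac_kernel_def powr_mult c_def)
      then have "ennreal (r * (frac_kernel a (r * x) * frac_kernel b (r - r * x))) = ennreal (c * (x powr (a - 1) * (1 - x) powr (b - 1)))"
        by simp
      then show ?thesis using True 1 c frac_kernel_nonneg[OF a] frac_kernel_nonneg[OF b]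
        by (simp add: ennreal_mult)
    next
      case False
      then have "frac_kernel a (r * x) = 0 \<or> frac_kernel b (r - r * x) = 0"
        using x True by (auto simp: frac_kernel_def zero_less_mult_iff)
      then show ?thesis using False x by auto
    qed
  qed
  also have "\<dots> = ennreal c * ennreal (Beta a b)"
    by (subst nn_integral_cmult) (simp_all add: nn_integral_Beta[OF a b])
  also have "\<dots> = ennreal (frac_kernel (a + b) r)"
    using True a b c Gamma_real_pos[OF a, THEN less_imp_neq] Gamma_real_pos[OF b, THEN less_imp_neq]
    by (simp add: frac_kernel_def c_def Beta_def flip: ennreal_mult)
  finally show ?thesis .
qed

section \<open>Properties of fractional integrals\<close>

lemma frac_integral_cong_history:
  assumes "AE x in lborel. x \<le> t \<longrightarrow> v x = v' x" and "\<sigma> \<noteq> 0"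
  shows "frac_integral S \<sigma> v t = frac_integral S \<sigma> v' t"
proof -
  have "AE \<tau> in lborel. \<tau> \<in> {0..} \<longrightarrow> \<tau> powr (\<sigma> - 1) *\<^sub>R blinfun_apply (S \<tau>) (v (t - \<tau>)) = \<tau> powr (\<sigma> - 1) *\<^sub>R blinfun_apply (S \<tau>) (v' (t - \<tau>))"
    using AE_lborel_reflect[OF assms(1), of t] by eventually_elim simp
  then have "AE \<tau> in lebesgue_on {0..}. \<tau> powr (\<sigma> - 1) *\<^sub>R blinfun_apply (S \<tau>) (v (t - \<tau>)) = \<tau> powr (\<sigma> - 1) *\<^sub>R blinfun_apply (S \<tau>) (v' (t - \<tau>))"
    by (subst AE_lebesgue_on_iff) auto
  from bochner_integral_cong_AE[OF this] show ?thesis by (simp add: frac_integral_def assms(2))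
qed

context stable_semigroup
begin

lemma frac_integral_diff:
  assumes \<sigma>: "0 < \<sigma>" and v: "smeas borel v1" "smeas borel v2"
    and fin: "frac_norm \<sigma> v1 t < \<infinity>" "frac_norm \<sigma> v2 t < \<infinity>" "frac_norm \<sigma> (\<lambda>x. v1 x - v2 x) t < \<infinity>"
  shows "frac_integral S \<sigma> (\<lambda>x. v1 x - v2 x) t = frac_integral S \<sigma> v1 t - frac_integral S \<sigma> v2 t"
proof (rule functionals_separate)
  fix \<psi> :: "'a \<Rightarrow>\<^sub>L real"
  have "has_bochner_integral lborel
      (\<lambda>r. frac_kernel \<sigma> r * \<psi> (Sp r (v1 (t - r))) - frac_kernel \<sigma> r * \<psi> (Sp r (v2 (t - r))))
      (\<psi> (frac_integral S \<sigma> v1 t) - \<psi> (frac_integral S \<sigma> v2 t))"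
    by (intro has_bochner_integral_diff frac_integral_functional(1)[OF \<sigma> v(1) _ fin(1)]
        frac_integral_functional(1)[OF \<sigma> v(2) _ fin(2)]) auto
  moreover have "frac_kernel \<sigma> r * \<psi> (Sp r (v1 (t - r))) - frac_kernel \<sigma> r * \<psi> (Sp r (v2 (t - r)))
      = frac_kernel \<sigma> r * \<psi> (Sp r (v1 (t - r) - v2 (t - r)))" for r
    by (simp add: blinfun.diff_right algebra_simps)
  ultimately have "has_bochner_integral lborel (\<lambda>r. frac_kernel \<sigma> r * \<psi> (Sp r (v1 (t - r) - v2 (t - r))))
      (\<psi> (frac_integral S \<sigma> v1 t) - \<psi> (frac_integral S \<sigma> v2 t))" by simp
  from has_bochner_integral_eq[OF frac_integral_functional(1)[OF \<sigma> smeas_diff[OF v] _ fin(3), where v'="\<lambda>x. v1 x - v2 x"] this]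
  show "\<psi> (frac_integral S \<sigma> (\<lambda>x. v1 x - v2 x) t) = \<psi> (frac_integral S \<sigma> v1 t - frac_integral S \<sigma> v2 t)"
    by (simp add: blinfun.diff_right)
qed

lemma frac_norm_diff_le:
  assumes \<sigma>: "0 < \<sigma>" and v: "smeas borel v1" "smeas borel v2"
  shows "frac_norm \<sigma> (\<lambda>x. v1 x - v2 x) t \<le> frac_norm \<sigma> v1 t + frac_norm \<sigma> v2 t"
proof -
  have [measurable]: "(\<lambda>r. norm (v1 (t - r))) \<in> borel_measurable borel" "(\<lambda>r. norm (v2 (t - r))) \<in> borel_measurable borel"
    by (intro smeas_norm smeas_compose[OF v(1)] smeas_compose[OF v(2)]; simp)+
  have "frac_norm \<sigma> (\<lambda>x. v1 x - v2 x) t \<le>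
     (\<integral>\<^sup>+r. ennreal (frac_kernel \<sigma> r * exp (- w * r) * norm (v1 (t - r))) +
        ennreal (frac_kernel \<sigma> r * exp (- w * r) * norm (v2 (t - r))) \<partial>lborel)"
    unfolding frac_norm_def
  proof (rule nn_integral_mono)
    fix r
    have k: "0 \<le> frac_kernel \<sigma> r * exp (- w * r)" using frac_kernel_nonneg[OF \<sigma>] by simp
    have "frac_kernel \<sigma> r * exp (- w * r) * norm (v1 (t - r) - v2 (t - r))
       \<le> frac_kernel \<sigma> r * exp (- w * r) * (norm (v1 (t - r)) + norm (v2 (t - r)))"
      by (intro mult_left_mono norm_triangle_ineq4 k)
    then have "ennreal (frac_kernel \<sigma> r * exp (- w * r) * norm (v1 (t - r) - v2 (t - r))) \<le>
       ennreal (frac_kernel \<sigma> r * exp (- w * r) * norm (v1 (t - r))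
         + frac_kernel \<sigma> r * exp (- w * r) * norm (v2 (t - r)))"
      by (intro ennreal_leI) (simp add: distrib_left)
    also have "\<dots> = ennreal (frac_kernel \<sigma> r * exp (- w * r) * norm (v1 (t - r))) +
        ennreal (frac_kernel \<sigma> r * exp (- w * r) * norm (v2 (t - r)))"
      by (rule ennreal_plus) (rule mult_nonneg_nonneg[OF k norm_ge_zero])+
    finally show "ennreal (frac_kernel \<sigma> r * exp (- w * r) * norm (v1 (t - r) - v2 (t - r))) \<le> \<dots>" .
  qed
  also have "\<dots> = frac_norm \<sigma> v1 t + frac_norm \<sigma> v2 t"
    unfolding frac_norm_def by (rule nn_integral_add) measurable
  finally show ?thesis .
qed

lemma frac_norm_shift: "frac_norm \<sigma> (\<lambda>x. v (x + c)) t = frac_norm \<sigma> v (t + c)"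
  unfolding frac_norm_def by (simp add: algebra_simps)

lemma frac_integral_shift: "frac_integral S \<sigma> (\<lambda>x. v (x + c)) t = frac_integral S \<sigma> v (t + c)"
  unfolding frac_integral_def by (simp add: algebra_simps)

lemma frac_norm_bounded_function:
  assumes \<sigma>: "0 < \<sigma>" and B: "\<And>x. norm (v x) \<le> B"
  shows "\<exists>K\<ge>0. \<forall>t. frac_norm \<sigma> v t \<le> ennreal K"
proof -
  let ?I = "\<integral>\<^sup>+r. ennreal (frac_kernel \<sigma> r * exp (- w * r)) \<partial>lborel"
  have B0: "0 \<le> B" using B[of 0] norm_ge_zero order_trans by blast
  have fin: "ennreal B * ?I < \<infinity>"
    using nn_integral_frac_kernel_exp_finite[OF \<sigma> w] by (simp add: ennreal_mult_less_top)
  have "frac_norm \<sigma> v t \<le> ennreal B * ?I" for t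
  proof -
    have "frac_norm \<sigma> v t \<le> (\<integral>\<^sup>+r. ennreal B * ennreal (frac_kernel \<sigma> r * exp (- w * r)) \<partial>lborel)"
      unfolding frac_norm_def
    proof (rule nn_integral_mono)
      fix r
      have "frac_kernel \<sigma> r * exp (- w * r) * norm (v (t - r)) \<le> frac_kernel \<sigma> r * exp (- w * r) * B"
        using frac_kernel_nonneg[OF \<sigma>] by (intro mult_left_mono B) auto
      then show "ennreal (frac_kernel \<sigma> r * exp (- w * r) * norm (v (t - r))) \<le> ennreal B * ennreal (frac_kernel \<sigma> r * exp (- w * r))"
        using B0 frac_kernel_nonneg[OF \<sigma>, of r] by (subst ennreal_mult[symmetric]) (auto intro!: ennreal_leI simp: mult.commute)
    qed
    also have "\<dots> = ennreal B * ?I" by (rule nn_integral_cmult) measurable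
    finally show ?thesis .
  qed
  then show ?thesis using fin
    by (intro exI[of _ "enn2real (ennreal B * ?I)"]) (simp add: ennreal_enn2real)
qed

text \<open>The semigroup law turns the iterated integral into one whose integrand depends on the sum of the
  two integration variables only, so that everything reduces to the convolution of the kernels.\<close>

theorem frac_integral_compose:
  assumes a: "0 < a" and b: "0 < b" and v: "smeas borel v" and fin: "frac_norm (a + b) v t < \<infinity>"
    and u: "smeas borel u" "AE x in lborel. x \<le> t \<longrightarrow> u x = frac_integral S b v x"
  shows "frac_norm a u t < \<infinity>" and "frac_integral S a u t = frac_integral S (a + b) v t"
proof -
  have [measurable]: "(\<lambda>r. norm (v (x - r))) \<in> borel_measurable borel" for x
    by (rule smeas_norm[OF smeas_compose[OF v]]) simp
  have [measurable]: "(\<lambda>r. norm (u (t - r))) \<in> borel_measurable borel"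
    by (rule smeas_norm[OF smeas_compose[OF u(1)]]) simp
  define F where "F r = exp (- w * r) * norm (v (t - r))" for r
  have [measurable]: "F \<in> borel_measurable borel" unfolding F_def by measurable
  have ka: "0 \<le> frac_kernel a r" and kb: "0 \<le> frac_kernel b r" and kab: "0 \<le> frac_kernel (a + b) r" for r
    using frac_kernel_nonneg a b by auto
  let ?H = "\<lambda>\<tau>. \<integral>\<^sup>+\<rho>. ennreal (frac_kernel b \<rho>) * ennreal (F (\<tau> + \<rho>)) \<partial>lborel"
  have "(\<integral>\<^sup>+\<tau>. ennreal (frac_kernel a \<tau>) * ?H \<tau> \<partial>lborel)
      = (\<integral>\<^sup>+r. ennreal (frac_kernel (a + b) r) * ennreal (F r) \<partial>lborel)"
    unfolding nn_integral_convolution[of "\<lambda>r. ennreal (frac_kernel a r)" "\<lambda>r. ennreal (frac_kernel b r)" "\<lambda>r. ennreal (F r)", simplified]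
      frac_kernel_convolution[OF a b] ..
  also have "\<dots> = frac_norm (a + b) v t"
    unfolding frac_norm_def F_def using kab by (intro nn_integral_cong) (simp add: mult.assoc flip: ennreal_mult)
  finally have tot: "(\<integral>\<^sup>+\<tau>. ennreal (frac_kernel a \<tau>) * ?H \<tau> \<partial>lborel) = frac_norm (a + b) v t" .
  have norm_b: "frac_norm b v (t - \<tau>) = ennreal (exp (w * \<tau>)) * ?H \<tau>" for \<tau>
  proof -
    have "frac_norm b v (t - \<tau>) = (\<integral>\<^sup>+\<rho>. ennreal (exp (w * \<tau>)) * (ennreal (frac_kernel b \<rho>) * ennreal (F (\<tau> + \<rho>))) \<partial>lborel)"
      unfolding frac_norm_def F_def
    proof (rule nn_integral_cong)
      fix \<rho>
      have "exp (- w * \<rho>) = exp (w * \<tau>) * exp (- w * (\<tau> + \<rho>))" by (simp add: exp_add[symmetric] algebra_simps)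
      then have "frac_kernel b \<rho> * exp (- w * \<rho>) * norm (v (t - \<tau> - \<rho>))
        = exp (w * \<tau>) * (frac_kernel b \<rho> * (exp (- w * (\<tau> + \<rho>)) * norm (v (t - (\<tau> + \<rho>)))))"
        by (simp add: diff_diff_eq)
      then show "ennreal (frac_kernel b \<rho> * exp (- w * \<rho>) * norm (v (t - \<tau> - \<rho>)))
        = ennreal (exp (w * \<tau>)) * (ennreal (frac_kernel b \<rho>) * ennreal (exp (- w * (\<tau> + \<rho>)) * norm (v (t - (\<tau> + \<rho>)))))"
        by (simp only:) (subst ennreal_mult', simp, subst ennreal_mult', rule kb, rule refl)
    qed
    also have "\<dots> = ennreal (exp (w * \<tau>)) * ?H \<tau>" by (rule nn_integral_cmult) measurable
    finally show ?thesis .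
  qed
  have "AE \<tau> in lborel. ennreal (frac_kernel a \<tau>) * ?H \<tau> \<noteq> \<infinity>"
    using tot fin by (intro nn_integral_PInf_AE) auto
  moreover have uJ: "AE \<tau> in lborel. t - \<tau> \<le> t \<longrightarrow> u (t - \<tau>) = frac_integral S b v (t - \<tau>)"
    by (rule AE_lborel_reflect[OF u(2)])
  ultimately have good: "AE \<tau> in lborel. 0 < \<tau> \<longrightarrow> frac_norm b v (t - \<tau>) < \<infinity> \<and> u (t - \<tau>) = frac_integral S b v (t - \<tau>)"
  proof eventually_elim
    case (elim \<tau>)
    show ?case
    proof (intro impI conjI)
      assume \<tau>: "0 < \<tau>"
      then have "0 < frac_kernel a \<tau>" using a by (simp add: frac_kernel_def)
      then have "?H \<tau> < \<infinity>" using elim(1) by (auto simp: ennreal_mult_eq_top_iff less_top)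
      then show "frac_norm b v (t - \<tau>) < \<infinity>" unfolding norm_b by (simp add: ennreal_mult_less_top)
      show "u (t - \<tau>) = frac_integral S b v (t - \<tau>)" using elim(2) \<tau> by simp
    qed
  qed
  have "frac_norm a u t \<le> (\<integral>\<^sup>+\<tau>. ennreal M * (ennreal (frac_kernel a \<tau>) * ?H \<tau>) \<partial>lborel)"
    unfolding frac_norm_def
  proof (rule nn_integral_mono_AE, use good in eventually_elim)
    case (elim \<tau>)
    show ?case
    proof (cases "0 < \<tau>")
      case True
      define K where "K = enn2real (?H \<tau>)"
      have H: "?H \<tau> = ennreal K" unfolding K_def
        using elim True unfolding norm_b by (auto simp: ennreal_mult_less_top intro!: ennreal_enn2real[symmetric])
      have K0: "0 \<le> K" by (simp add: K_def)
      have "frac_norm b v (t - \<tau>) \<le> ennreal (exp (w * \<tau>) * K)" unfolding norm_b H by (simp add: ennreal_mult K0)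
      then have "norm (u (t - \<tau>)) \<le> M * (exp (w * \<tau>) * K)"
        using elim True K0 frac_integral_functional(2)[OF b v, of "t - \<tau>" v "exp (w * \<tau>) * K"] by auto
      then have "frac_kernel a \<tau> * exp (- w * \<tau>) * norm (u (t - \<tau>))
          \<le> frac_kernel a \<tau> * exp (- w * \<tau>) * (M * (exp (w * \<tau>) * K))"
        using ka by (intro mult_left_mono) auto
      also have "\<dots> = M * (frac_kernel a \<tau> * K)" by (simp add: exp_minus field_simps)
      finally have "ennreal (frac_kernel a \<tau> * exp (- w * \<tau>) * norm (u (t - \<tau>))) \<le> ennreal (M * (frac_kernel a \<tau> * K))"
        by (rule ennreal_leI)
      also have "\<dots> = ennreal M * (ennreal (frac_kernel a \<tau>) * ?H \<tau>)"
        unfolding H using M ka K0 by (simp add: ennreal_mult)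
      finally show ?thesis .
    qed (simp add: frac_kernel_def)
  qed
  also have "\<dots> = ennreal M * frac_norm (a + b) v t" unfolding tot[symmetric] by (rule nn_integral_cmult) measurable
  also have "\<dots> < \<infinity>" using fin by (simp add: ennreal_mult_less_top)
  finally show fin_u: "frac_norm a u t < \<infinity>" .
  show "frac_integral S a u t = frac_integral S (a + b) v t"
  proof (rule functionals_separate)
    fix \<psi> :: "'a \<Rightarrow>\<^sub>L real"
    define G where "G r = \<psi> (Sp r (v (t - r)))" for r
    have [measurable]: "G \<in> borel_measurable borel" unfolding G_def
      by (intro smeas_functional Sp_apply_smeas smeas_compose[OF v]) measurable
    have hv: "has_bochner_integral lborel (\<lambda>r. frac_kernel (a + b) r * G r) (\<psi> (frac_integral S (a + b) v t))"
      unfolding G_def by (rule frac_integral_functional(1)) (use a b v fin in auto)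
    have hu: "has_bochner_integral lborel (\<lambda>r. frac_kernel a r * \<psi> (Sp r (u (t - r)))) (\<psi> (frac_integral S a u t))"
      by (rule frac_integral_functional(1)[OF a u(1) _ fin_u]) simp
    have "\<psi> (frac_integral S a u t) = (LINT \<tau>|lborel. frac_kernel a \<tau> * \<psi> (Sp \<tau> (u (t - \<tau>))))"
      using hu by (simp add: has_bochner_integral_iff)
    also have "\<dots> = (LINT \<tau>|lborel. frac_kernel a \<tau> * (LINT \<rho>|lborel. frac_kernel b \<rho> * G (\<tau> + \<rho>)))"
    proof (rule integral_cong_AE)
      show "(\<lambda>\<tau>. frac_kernel a \<tau> * \<psi> (Sp \<tau> (u (t - \<tau>)))) \<in> borel_measurable lborel"
        by (rule borel_measurable_has_bochner_integral[OF hu])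
      show "AE \<tau> in lborel. frac_kernel a \<tau> * \<psi> (Sp \<tau> (u (t - \<tau>))) = frac_kernel a \<tau> * (LINT \<rho>|lborel. frac_kernel b \<rho> * G (\<tau> + \<rho>))"
        using good
      proof eventually_elim
        case (elim \<tau>)
        show ?case
        proof (cases "0 < \<tau>")
          case True
          have "has_bochner_integral lborel (\<lambda>\<rho>. frac_kernel b \<rho> * (\<psi> o\<^sub>L Sp \<tau>) (Sp \<rho> (v (t - \<tau> - \<rho>)))) ((\<psi> o\<^sub>L Sp \<tau>) (frac_integral S b v (t - \<tau>)))"
            by (rule frac_integral_functional(1)) (use b v elim True in auto)
          moreover have eq: "frac_kernel b \<rho> * (\<psi> o\<^sub>L Sp \<tau>) (Sp \<rho> (v (t - \<tau> - \<rho>))) = frac_kernel b \<rho> * G (\<tau> + \<rho>)" for \<rho>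
            using True Sp_add[of \<tau> \<rho>] by (cases "0 < \<rho>") (simp_all add: G_def frac_kernel_def diff_diff_eq)
          ultimately have "has_bochner_integral lborel (\<lambda>\<rho>. frac_kernel b \<rho> * G (\<tau> + \<rho>)) ((\<psi> o\<^sub>L Sp \<tau>) (frac_integral S b v (t - \<tau>)))"
            unfolding eq by simp
          then have "(LINT \<rho>|lborel. frac_kernel b \<rho> * G (\<tau> + \<rho>)) = \<psi> (Sp \<tau> (u (t - \<tau>)))"
            using elim True by (simp add: has_bochner_integral_iff)
          then show ?thesis by simp
        qed (simp add: frac_kernel_def)
      qed
    qed measurable
    also have "\<dots> = (LINT r|lborel. frac_kernel (a + b) r * G r)"
    proof (rule integral_convolution[OF _ _ _ _ ka kb kab])
      have "integrable lborel (\<lambda>r. frac_kernel (a + b) r * G r)" using hv by (simp add: has_bochner_integral_iff)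
      then show "(\<integral>\<^sup>+r. ennreal (frac_kernel (a + b) r * \<bar>G r\<bar>) \<partial>lborel) < \<infinity>"
        using kab by (simp add: integrable_iff_bounded abs_mult)
    qed (use frac_kernel_convolution[OF a b] in auto)
    also have "\<dots> = \<psi> (frac_integral S (a + b) v t)" using hv by (simp add: has_bochner_integral_iff)
    finally show "\<psi> (frac_integral S a u t) = \<psi> (frac_integral S (a + b) v t)" .
  qed
qed

definition Lp_fun :: "real \<Rightarrow> (real \<Rightarrow> 'a) \<Rightarrow> bool" where
  "Lp_fun p v \<longleftrightarrow> smeas borel v \<and> (\<integral>\<^sup>+t. ennreal (norm (v t) powr p) \<partial>lborel) < \<infinity>"

lemma frac_norm_Young:
  assumes "admissible p \<sigma>" "0 < \<epsilon>"
  obtains C where "0 \<le> C" "\<And>v t. smeas borel v \<Longrightarrow>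
    frac_norm \<sigma> v t \<le> ennreal \<epsilon> + ennreal C * (\<integral>\<^sup>+x. ennreal (norm (v x) powr p) \<partial>lborel)"
proof -
  obtain C where C: "0 \<le> C" "\<And>d. d \<in> borel_measurable borel \<Longrightarrow> (\<And>r. 0 \<le> d r) \<Longrightarrow>
    (\<integral>\<^sup>+r. ennreal (frac_kernel \<sigma> r * exp (- w * r) * d r) \<partial>lborel)
      \<le> ennreal \<epsilon> + ennreal C * (\<integral>\<^sup>+r. ennreal (d r powr p) \<partial>lborel)"
    using frac_kernel_Young[OF assms(1) w assms(2)] by blast
  show ?thesis
  proof (rule that[OF C(1)])
    fix v :: "real \<Rightarrow> 'a" and t assume v: "smeas borel v"
    have [measurable]: "(\<lambda>x. norm (v x)) \<in> borel_measurable borel" by (rule smeas_norm[OF v])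
    have m: "(\<lambda>r. norm (v (t - r))) \<in> borel_measurable borel"
      by (rule smeas_norm[OF smeas_compose[OF v]]) simp
    have "(\<integral>\<^sup>+r. ennreal (norm (v (t - r)) powr p) \<partial>lborel) = (\<integral>\<^sup>+x. ennreal (norm (v x) powr p) \<partial>lborel)"
      by (rule nn_integral_lborel_reflect) measurable
    then show "frac_norm \<sigma> v t \<le> ennreal \<epsilon> + ennreal C * (\<integral>\<^sup>+x. ennreal (norm (v x) powr p) \<partial>lborel)"
      using C(2)[OF m] unfolding frac_norm_def by simp
  qed
qed

lemma frac_norm_Lp_bounded:
  assumes "admissible p \<sigma>" "Lp_fun p v"
  shows "\<exists>K\<ge>0. \<forall>t. frac_norm \<sigma> v t \<le> ennreal K"
proof -
  let ?I = "\<integral>\<^sup>+x. ennreal (norm (v x) powr p) \<partial>lborel"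
  obtain C where C: "0 \<le> C" "\<And>t. frac_norm \<sigma> v t \<le> ennreal 1 + ennreal C * ?I"
    using frac_norm_Young[OF assms(1), of 1] assms(2) unfolding Lp_fun_def by (metis zero_less_one)
  have "ennreal 1 + ennreal C * ?I < \<infinity>" using assms(2) by (simp add: Lp_fun_def ennreal_mult_less_top)
  then show ?thesis using C(2)
    by (intro exI[of _ "enn2real (ennreal 1 + ennreal C * ?I)"]) (simp add: ennreal_enn2real)
qed

lemma frac_norm_Lp_finite:
  assumes "admissible p \<sigma>" "Lp_fun p v"
  shows "frac_norm \<sigma> v t < \<infinity>"
  using frac_norm_Lp_bounded[OF assms] by (metis ennreal_less_top infinity_ennreal_def le_less_trans)

lemma frac_integral_Lp_bounded:
  assumes "admissible p \<sigma>" "Lp_fun p v"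
  shows "\<exists>K. \<forall>t. norm (frac_integral S \<sigma> v t) \<le> K"
proof -
  obtain K where K: "0 \<le> K" "\<And>t. frac_norm \<sigma> v t \<le> ennreal K"
    using frac_norm_Lp_bounded[OF assms] by blast
  have v: "smeas borel v" using assms(2) by (simp add: Lp_fun_def)
  have "norm (frac_integral S \<sigma> v t) \<le> M * K" for t
    by (rule frac_integral_functional(2)[OF admissible_pos(1)[OF assms(1)] v _ frac_norm_Lp_finite[OF assms] K(2) K(1)]) simp
  then show ?thesis by blast
qed

text \<open>An increment of the fractional integral is the fractional integral of an increment of \<open>v\<close>. Young's
  inequality bounds it by an arbitrarily small number and a multiple of a translation error of \<open>v\<close>.\<close>

lemma frac_integral_Lp_continuous:
  assumes adm: "admissible p \<sigma>" and v: "Lp_fun p v"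
  shows "continuous_on UNIV (frac_integral S \<sigma> v)"
proof (rule continuous_on_sequentiallyI)
  fix u :: "nat \<Rightarrow> real" and t assume ut: "u \<longlonglongrightarrow> t"
  have \<sigma>: "0 < \<sigma>" and p: "1 \<le> p" using admissible_pos[OF adm] by auto
  have sm: "smeas borel v" and fin: "(\<integral>\<^sup>+t. ennreal (norm (v t) powr p) \<partial>lborel) < \<infinity>"
    using v by (auto simp: Lp_fun_def)
  have smh: "smeas borel (\<lambda>x. v (x + c))" for c by (rule smeas_compose[OF sm]) simp
  define h where "h n = u n - t" for n
  have h: "h \<longlonglongrightarrow> 0" using tendsto_diff[OF ut tendsto_const[of t]] by (simp add: h_def[abs_def])
  show "(\<lambda>n. frac_integral S \<sigma> v (u n)) \<longlonglongrightarrow> frac_integral S \<sigma> v t"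
  proof (rule tendstoI)
    fix e :: real assume e: "0 < e"
    define \<epsilon> where "\<epsilon> = e / (4 * M)"
    have \<epsilon>: "0 < \<epsilon>" using e M by (simp add: \<epsilon>_def)
    obtain C where C: "0 \<le> C" "\<And>v t. smeas borel v \<Longrightarrow>
        frac_norm \<sigma> v t \<le> ennreal \<epsilon> + ennreal C * (\<integral>\<^sup>+x. ennreal (norm (v x) powr p) \<partial>lborel)"
      using frac_norm_Young[OF adm \<epsilon>] by blast
    let ?I = "\<lambda>n. \<integral>\<^sup>+x. ennreal (norm (v (x + h n) - v x) powr p) \<partial>lborel"
    have "?I \<longlonglongrightarrow> 0" by (rule Lp_translation_continuous[OF sm _ fin h]) (use p in simp)
    then have "(\<lambda>n. ennreal C * ?I n) \<longlonglongrightarrow> ennreal C * 0" by (rule ennreal_tendsto_cmult[rotated]) simp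
    then have "(\<lambda>n. ennreal C * ?I n) \<longlonglongrightarrow> 0" by simp
    then have "\<forall>\<^sub>F n in sequentially. ennreal C * ?I n < ennreal \<epsilon>"
      by (rule order_tendstoD) (use \<epsilon> in simp)
    then show "\<forall>\<^sub>F n in sequentially. dist (frac_integral S \<sigma> v (u n)) (frac_integral S \<sigma> v t) < e"
    proof eventually_elim
      case (elim n)
      let ?d = "\<lambda>x. v (x + h n) - v x"
      have sd: "smeas borel ?d" by (intro smeas_diff smh sm)
      have "frac_norm \<sigma> ?d t \<le> ennreal \<epsilon> + ennreal C * ?I n" by (rule C(2)[OF sd])
      also have "\<dots> \<le> ennreal \<epsilon> + ennreal \<epsilon>" using elim by (intro add_left_mono) simp
      finally have le: "frac_norm \<sigma> ?d t \<le> ennreal (2 * \<epsilon>)" using \<epsilon> by (simp flip: ennreal_plus)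
      then have find: "frac_norm \<sigma> ?d t < \<infinity>" by (metis ennreal_less_top infinity_ennreal_def le_less_trans)
      have "frac_integral S \<sigma> ?d t = frac_integral S \<sigma> (\<lambda>x. v (x + h n)) t - frac_integral S \<sigma> v t"
        using find frac_norm_Lp_finite[OF adm v] by (intro frac_integral_diff \<sigma> smh sm) (auto simp: frac_norm_shift)
      also have "frac_integral S \<sigma> (\<lambda>x. v (x + h n)) t = frac_integral S \<sigma> v (u n)"
        by (simp add: frac_integral_shift h_def)
      finally have "dist (frac_integral S \<sigma> v (u n)) (frac_integral S \<sigma> v t) = norm (frac_integral S \<sigma> ?d t)"
        by (simp add: dist_norm)
      also have "\<dots> \<le> M * (2 * \<epsilon>)"
        by (rule frac_integral_functional(2)[OF \<sigma> sd _ find le]) (use \<epsilon> in auto)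
      also have "\<dots> < e" using e M by (simp add: \<epsilon>_def)
      finally show ?case .
    qed
  qed
qed

end

section \<open>Antiderivatives\<close>

lemma enn2real_inject: "a < top \<Longrightarrow> b < top \<Longrightarrow> enn2real a = enn2real b \<Longrightarrow> a = b"
  by (metis ennreal_enn2real)

text \<open>The positive and the negative part of \<open>f\<close>, restricted to a bounded interval, are densities of finite
  measures that agree on half-lines and hence are equal.\<close>

lemma AE_zero_if_interval_integrals_zero:
  fixes f :: "real \<Rightarrow> real"
  assumes [measurable]: "f \<in> borel_measurable borel"
    and loc: "\<And>a b. (\<integral>\<^sup>+x. indicator {a..b} x * ennreal \<bar>f x\<bar> \<partial>lborel) < \<infinity>"
    and zero: "\<And>a b. a < b \<Longrightarrow> (LINT x|lborel. indicator {a<..b} x * f x) = 0"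
  shows "AE x in lborel. f x = 0"
proof -
  have "AE x in lborel. x \<in> {- real n<..real n} \<longrightarrow> f x = 0" for n
  proof -
    define g where "g x = indicator {- real n<..real n} x * f x" for x
    have [measurable]: "g \<in> borel_measurable borel" unfolding g_def by measurable
    have "(\<integral>\<^sup>+x. ennreal (norm (g x)) \<partial>lborel) \<le> (\<integral>\<^sup>+x. indicator {- real n..real n} x * ennreal \<bar>f x\<bar> \<partial>lborel)"
      by (intro nn_integral_mono) (auto simp: g_def indicator_def)
    also have "\<dots> < \<infinity>" by (rule loc)
    finally have fin: "(\<integral>\<^sup>+x. ennreal (norm (g x)) \<partial>lborel) < \<infinity>" .
    have part_fin: "(\<integral>\<^sup>+x. ennreal (s * g x) * indicator A x \<partial>lborel) < \<infinity>" if "\<bar>s\<bar> = 1" for s A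
    proof -
      have "(\<integral>\<^sup>+x. ennreal (s * g x) * indicator A x \<partial>lborel) \<le> (\<integral>\<^sup>+x. ennreal (norm (g x)) \<partial>lborel)"
        using that by (intro nn_integral_mono) (auto simp: indicator_def abs_if split: if_splits intro!: ennreal_leI)
      then show ?thesis using fin by (rule le_less_trans)
    qed
    let ?P = "density lborel (\<lambda>x. ennreal (g x))" and ?Q = "density lborel (\<lambda>x. ennreal (- g x))"
    have "?P = ?Q"
    proof (rule measure_eqI_lessThan)
      show "emeasure ?P {y<..} < \<infinity>" for y
        using part_fin[of 1 "{y<..}"] by (simp add: emeasure_density)
      fix y
      have int: "integrable lborel (\<lambda>x. indicator {y<..} x * g x)"
      proof (rule integrableI_bounded)
        have "(\<integral>\<^sup>+x. ennreal (norm (indicator {y<..} x * g x)) \<partial>lborel) \<le> (\<integral>\<^sup>+x. ennreal (norm (g x)) \<partial>lborel)"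
          by (intro nn_integral_mono) (auto simp: indicator_def)
        then show "(\<integral>\<^sup>+x. ennreal (norm (indicator {y<..} x * g x)) \<partial>lborel) < \<infinity>" using fin by (rule le_less_trans)
      qed measurable
      have "(LINT x|lborel. indicator {y<..} x * g x) = (LINT x|lborel. indicator {max y (- real n)<..real n} x * f x)"
        by (intro Bochner_Integration.integral_cong) (auto simp: g_def indicator_def)
      also have "\<dots> = 0"
      proof (cases "max y (- real n) < real n")
        case True then show ?thesis by (rule zero)
      next
        case False
        then have "real n \<le> max y (- real n)" by (simp only: not_less)
        then have e: "{max y (- real n)<..real n} = {}" by (rule greaterThanAtMost_empty)
        show ?thesis unfolding e by simp
      qed
      finally have "enn2real (\<integral>\<^sup>+x. ennreal (indicator {y<..} x * g x) \<partial>lborel)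
          = enn2real (\<integral>\<^sup>+x. ennreal (- (indicator {y<..} x * g x)) \<partial>lborel)"
        using real_lebesgue_integral_def[OF int] by simp
      moreover have "(\<integral>\<^sup>+x. ennreal (indicator {y<..} x * g x) \<partial>lborel) = (\<integral>\<^sup>+x. ennreal (1 * g x) * indicator {y<..} x \<partial>lborel)"
        by (intro nn_integral_cong) (auto simp: indicator_def)
      moreover have "(\<integral>\<^sup>+x. ennreal (- (indicator {y<..} x * g x)) \<partial>lborel) = (\<integral>\<^sup>+x. ennreal (-1 * g x) * indicator {y<..} x \<partial>lborel)"
        by (intro nn_integral_cong) (auto simp: indicator_def)
      ultimately have *: "enn2real (\<integral>\<^sup>+x. ennreal (1 * g x) * indicator {y<..} x \<partial>lborel) = enn2real (\<integral>\<^sup>+x. ennreal (-1 * g x) * indicator {y<..} x \<partial>lborel)" by simp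
      have "(\<integral>\<^sup>+x. ennreal (1 * g x) * indicator {y<..} x \<partial>lborel) < top" "(\<integral>\<^sup>+x. ennreal (-1 * g x) * indicator {y<..} x \<partial>lborel) < top"
        using part_fin[of 1 "{y<..}"] part_fin[of "-1" "{y<..}"] by simp_all
      from enn2real_inject[OF this *] have "(\<integral>\<^sup>+x. ennreal (1 * g x) * indicator {y<..} x \<partial>lborel) = (\<integral>\<^sup>+x. ennreal (-1 * g x) * indicator {y<..} x \<partial>lborel)"
        .
      then show "emeasure ?P {y<..} = emeasure ?Q {y<..}" by (simp add: emeasure_density)
    qed auto
    moreover have "?P = ?Q \<longleftrightarrow> (AE x in lborel. ennreal (g x) = ennreal (- g x))"
      by (rule finite_density_unique) (use part_fin[of 1 UNIV] in auto)
    ultimately have "AE x in lborel. ennreal (g x) = ennreal (- g x)" by simp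
    then show ?thesis
    proof eventually_elim
      case (elim x)
      then have "g x = 0" by (cases "g x \<ge> 0") (auto simp: ennreal_neg ennreal_eq_0_iff)
      then show ?case by (auto simp: g_def)
    qed
  qed
  then have "AE x in lborel. \<forall>n. x \<in> {- real n<..real n} \<longrightarrow> f x = 0"
    unfolding AE_all_countable by (rule allI)
  then show ?thesis
  proof eventually_elim
    case (elim x)
    obtain n where "\<bar>x\<bar> < real n" using reals_Archimedean2 by blast
    then show ?case using elim[rule_format, of n] by (auto simp: abs_less_iff)
  qed
qed

text \<open>An antiderivative is specified through its increments, tested with functionals, as this is how it
  enters computations; it is unique up to a constant.\<close>

definition antiderivative :: "(real \<Rightarrow> 'a::real_normed_vector) \<Rightarrow> (real \<Rightarrow> 'a) \<Rightarrow> bool" where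
  "antiderivative v N \<longleftrightarrow> continuous_on UNIV N \<and>
     (\<forall>a b. \<forall>\<psi> :: 'a \<Rightarrow>\<^sub>L real. a \<le> b \<longrightarrow>
        has_bochner_integral lborel (\<lambda>x. indicator {a<..b} x * \<psi> (v x)) (\<psi> (N b - N a)))"

lemma antiderivativeD:
  fixes \<psi> :: "'a::real_normed_vector \<Rightarrow>\<^sub>L real"
  assumes "antiderivative v N"
  shows "continuous_on UNIV N"
    and "a \<le> b \<Longrightarrow> has_bochner_integral lborel (\<lambda>x. indicator {a<..b} x * blinfun_apply \<psi> (v x)) (\<psi> (N b - N a))"
  using assms unfolding antiderivative_def by blast+

lemma antiderivative_exists:
  fixes v :: "real \<Rightarrow> 'a::banach"
  assumes v: "smeas borel v" and loc: "\<And>a b. (\<integral>\<^sup>+x. indicator {a..b} x * ennreal (norm (v x)) \<partial>lborel) < \<infinity>"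
  obtains N where "antiderivative v N"
proof -
  have loc': "(\<integral>\<^sup>+x. indicator {a<..b} x * ennreal (norm (v x)) \<partial>lborel) < \<infinity>" for a b
  proof -
    have "(\<integral>\<^sup>+x. indicator {a<..b} x * ennreal (norm (v x)) \<partial>lborel) \<le> (\<integral>\<^sup>+x. indicator {a..b} x * ennreal (norm (v x)) \<partial>lborel)"
      by (intro nn_integral_mono) (auto simp: indicator_def)
    then show ?thesis using loc by (rule le_less_trans)
  qed
  have [measurable]: "(\<lambda>x. norm (v x)) \<in> borel_measurable borel" by (rule smeas_norm[OF v])
  define N where "N t = bochner_integral (lebesgue_on {0<..t}) v - bochner_integral (lebesgue_on {t<..0}) v" for t
  have incr: "has_bochner_integral lborel (\<lambda>x. indicator {a<..b} x * \<psi> (v x)) (\<psi> (N b - N a))"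
    if "a \<le> b" for a b and \<psi> :: "'a \<Rightarrow>\<^sub>L real"
  proof -
    have piece: "has_bochner_integral lborel (\<lambda>x. indicator {a<..b} x * \<psi> (v x)) (\<psi> (bochner_integral (lebesgue_on {a<..b}) v))" for a b
      by (rule bochner_integral_on(2)[OF _ v _ loc']) auto
    have "has_bochner_integral lborel
      (\<lambda>x. (indicator {0<..b} x * \<psi> (v x) - indicator {b<..0} x * \<psi> (v x)) - (indicator {0<..a} x * \<psi> (v x) - indicator {a<..0} x * \<psi> (v x)))
      (\<psi> (N b - N a))"
      unfolding N_def blinfun.diff_right by (intro has_bochner_integral_diff piece)
    moreover have "(\<lambda>x. (indicator {0<..b} x * \<psi> (v x) - indicator {b<..0} x * \<psi> (v x)) - (indicator {0<..a} x * \<psi> (v x) - indicator {a<..0} x * \<psi> (v x)))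
      = (\<lambda>x. indicator {a<..b} x * \<psi> (v x))"
      using that by (intro ext) (auto simp: indicator_def)
    ultimately show ?thesis by simp
  qed
  have norm_incr: "ennreal (norm (N b - N a)) \<le> (\<integral>\<^sup>+x. indicator {a<..b} x * ennreal (norm (v x)) \<partial>lborel)"
    if "a \<le> b" for a b
  proof -
    obtain \<psi> :: "'a \<Rightarrow>\<^sub>L real" where \<psi>: "norm \<psi> \<le> 1" "\<psi> (N b - N a) = norm (N b - N a)" by (rule norming_functional)
    have \<psi>_le: "\<bar>\<psi> x\<bar> \<le> norm x" for x
      using norm_blinfun[of \<psi> x] mult_right_mono[OF \<psi>(1), of "norm x"] by simp
    have int: "integrable lborel (\<lambda>x. indicator {a<..b} x * \<psi> (v x))"
      and eq: "(LINT x|lborel. indicator {a<..b} x * \<psi> (v x)) = norm (N b - N a)"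
      using incr[OF that, of \<psi>] \<psi>(2) by (auto simp: has_bochner_integral_iff)
    have "ennreal (norm (N b - N a)) \<le> (\<integral>\<^sup>+x. ennreal (norm (indicator {a<..b} x * \<psi> (v x))) \<partial>lborel)"
      using integral_norm_bound_ennreal[OF int] unfolding eq by simp
    also have "\<dots> \<le> (\<integral>\<^sup>+x. indicator {a<..b} x * ennreal (norm (v x)) \<partial>lborel)"
      by (intro nn_integral_mono) (auto simp: indicator_def \<psi>_le intro: ennreal_leI)
    finally show ?thesis .
  qed
  have "continuous_on UNIV N"
  proof (rule continuous_on_sequentiallyI)
    fix u :: "nat \<Rightarrow> real" and t assume u: "u \<longlonglongrightarrow> t"
    let ?I = "\<lambda>n. {min t (u n)<..max t (u n)}"
    have "(\<lambda>n. \<integral>\<^sup>+x. indicator {t - 1..t + 1} x * (indicator (?I n) x * ennreal (norm (v x))) \<partial>lborel) \<longlonglongrightarrow> (\<integral>\<^sup>+x. 0 \<partial>(lborel :: real measure))"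
    proof (rule nn_integral_dominated_convergence[where w="\<lambda>x. indicator {t - 1..t + 1} x * ennreal (norm (v x))"])
      show "AE x in lborel. (\<lambda>n. indicator {t - 1..t + 1} x * (indicator (?I n) x * ennreal (norm (v x)))) \<longlonglongrightarrow> 0"
        using AE_lborel_singleton[of t]
      proof eventually_elim
        case (elim x)
        have "\<forall>\<^sub>F n in sequentially. dist (u n) t < \<bar>x - t\<bar>"
          by (rule tendstoD[OF u]) (use elim in auto)
        then have "\<forall>\<^sub>F n in sequentially. indicator {t - 1..t + 1} x * (indicator (?I n) x * ennreal (norm (v x))) = 0"
          by eventually_elim (auto simp: indicator_def dist_real_def min_def max_def split: if_splits)
        then show ?case by (rule tendsto_eventually)
      qed
    qed (use loc in \<open>auto simp: indicator_def\<close>)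
    then have lim: "(\<lambda>n. \<integral>\<^sup>+x. indicator {t - 1..t + 1} x * (indicator (?I n) x * ennreal (norm (v x))) \<partial>lborel) \<longlonglongrightarrow> 0" by simp
    show "(\<lambda>n. N (u n)) \<longlonglongrightarrow> N t"
    proof (rule tendstoI)
      fix e :: real assume e: "0 < e"
      have "\<forall>\<^sub>F n in sequentially. (\<integral>\<^sup>+x. indicator {t - 1..t + 1} x * (indicator (?I n) x * ennreal (norm (v x))) \<partial>lborel) < ennreal e"
        by (rule order_tendstoD(2)[OF lim]) (use e in simp)
      moreover have "\<forall>\<^sub>F n in sequentially. dist (u n) t < 1" by (rule tendstoD[OF u]) simp
      ultimately show "\<forall>\<^sub>F n in sequentially. dist (N (u n)) (N t) < e"
      proof eventually_elim
        case (elim n)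
        have "dist (N (u n)) (N t) = norm (N (max t (u n)) - N (min t (u n)))"
          by (auto simp: dist_norm min_def max_def norm_minus_commute)
        then have "ennreal (dist (N (u n)) (N t)) \<le> (\<integral>\<^sup>+x. indicator (?I n) x * ennreal (norm (v x)) \<partial>lborel)"
          using norm_incr[of "min t (u n)" "max t (u n)"] by simp
        also have "\<dots> = (\<integral>\<^sup>+x. indicator {t - 1..t + 1} x * (indicator (?I n) x * ennreal (norm (v x))) \<partial>lborel)"
          using elim(2) by (intro nn_integral_cong) (auto simp: indicator_def dist_real_def)
        also have "\<dots> < ennreal e" by (rule elim(1))
        finally show ?case by (simp add: ennreal_less_iff)
      qed
    qed
  qed
  then show ?thesis using incr by (intro that[of N]) (auto simp: antiderivative_def)
qed

lemma antiderivative_constant_AE_zero: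
  fixes v :: "real \<Rightarrow> 'a::banach"
  assumes v: "smeas borel v" and loc: "\<And>a b. (\<integral>\<^sup>+x. indicator {a..b} x * ennreal (norm (v x)) \<partial>lborel) < \<infinity>"
    and N: "antiderivative v N" and const: "\<And>a b. a < b \<Longrightarrow> N a = N b"
  shows "AE x in lborel. v x = 0"
proof -
  have "AE x in lborel. \<psi> (v x) = 0" for \<psi> :: "'a \<Rightarrow>\<^sub>L real"
  proof (rule AE_zero_if_interval_integrals_zero)
    have [measurable]: "(\<lambda>x. norm (v x)) \<in> borel_measurable borel" by (rule smeas_norm[OF v])
    show "(\<lambda>x. \<psi> (v x)) \<in> borel_measurable borel" by (rule smeas_functional[OF v])
    show "(\<integral>\<^sup>+x. indicator {a..b} x * ennreal \<bar>\<psi> (v x)\<bar> \<partial>lborel) < \<infinity>" for a b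
    proof -
      have "(\<integral>\<^sup>+x. indicator {a..b} x * ennreal \<bar>\<psi> (v x)\<bar> \<partial>lborel)
         \<le> (\<integral>\<^sup>+x. ennreal (norm \<psi>) * (indicator {a..b} x * ennreal (norm (v x))) \<partial>lborel)"
        using norm_blinfun[of \<psi>]
        by (intro nn_integral_mono) (auto simp: indicator_def ennreal_leI simp flip: ennreal_mult)
      also have "\<dots> < \<infinity>" using loc by (simp add: nn_integral_cmult ennreal_mult_less_top)
      finally show ?thesis .
    qed
    show "(LINT x|lborel. indicator {a<..b} x * \<psi> (v x)) = 0" if "a < b" for a b
    proof -
      have "has_bochner_integral lborel (\<lambda>x. indicator {a<..b} x * \<psi> (v x)) (\<psi> (N b - N a))"
        by (rule antiderivativeD(2)[OF N less_imp_le[OF that]])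
      from has_bochner_integral_integral_eq[OF this]
      show ?thesis by (simp only: const[OF that] diff_self blinfun.zero_right)
    qed
  qed
  note ae = this
  show ?thesis by (rule smeas_AE_zero[OF _ ae]) (simp add: v)
qed

lemma antiderivative_diff:
  assumes "antiderivative v N" "antiderivative u K"
  shows "antiderivative (\<lambda>x. v x - u x) (\<lambda>x. N x - K x)"
  unfolding antiderivative_def
proof (intro conjI allI impI)
  show "continuous_on UNIV (\<lambda>x. N x - K x)"
    by (intro continuous_intros antiderivativeD(1)[OF assms(1)] antiderivativeD(1)[OF assms(2)])
  fix a b :: real and \<psi> :: "'a \<Rightarrow>\<^sub>L real" assume "a \<le> b"
  then have *: "has_bochner_integral lborel (\<lambda>x. indicator {a<..b} x * \<psi> (v x) - indicator {a<..b} x * \<psi> (u x)) (\<psi> (N b - N a) - \<psi> (K b - K a))"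
    by (intro has_bochner_integral_diff antiderivativeD(2)[OF assms(1)] antiderivativeD(2)[OF assms(2)])
  then show "has_bochner_integral lborel (\<lambda>x. indicator {a<..b} x * \<psi> (v x - u x)) (\<psi> (N b - K b - (N a - K a)))"
  proof -
    have "\<psi> (N b - K b - (N a - K a)) = \<psi> (N b - N a) - \<psi> (K b - K a)" by (simp add: blinfun.diff_right)
    moreover have "(\<lambda>x. indicator {a<..b} x * \<psi> (v x - u x)) =
        (\<lambda>x. indicator {a<..b} x * \<psi> (v x) - indicator {a<..b} x * \<psi> (u x))"
      by (simp add: blinfun.diff_right right_diff_distrib)
    ultimately show ?thesis using * by simp
  qed
qed

lemma antiderivative_shift:
  assumes "antiderivative v N"
  shows "antiderivative (\<lambda>x. v (x - c)) (\<lambda>x. N (x - c))"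
  unfolding antiderivative_def
proof (intro conjI allI impI)
  show "continuous_on UNIV (\<lambda>x. N (x - c))"
    by (intro continuous_on_compose2[OF antiderivativeD(1)[OF assms]] continuous_intros) auto
  fix a b :: real and \<psi> :: "'a \<Rightarrow>\<^sub>L real" assume "a \<le> b"
  then have h: "has_bochner_integral lborel (\<lambda>x. indicator {a - c<..b - c} x * \<psi> (v x)) (\<psi> (N (b - c) - N (a - c)))"
    by (intro antiderivativeD(2)[OF assms]) simp
  have eq: "(\<lambda>x. indicator {a - c<..b - c} (- c + 1 * x) * \<psi> (v (- c + 1 * x))) = (\<lambda>x. indicator {a<..b} x * \<psi> (v (x - c)))"
  proof
    fix x
    have "- c + 1 * x = x - c" by simp
    then show "indicator {a - c<..b - c} (- c + 1 * x) * \<psi> (v (- c + 1 * x)) = indicator {a<..b} x * \<psi> (v (x - c))"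
      by (simp only:) (simp add: indicator_def)
  qed
  show "has_bochner_integral lborel (\<lambda>x. indicator {a<..b} x * \<psi> (v (x - c))) (\<psi> (N (b - c) - N (a - c)))"
    using h lborel_integral_real_affine[of 1 "\<lambda>x. indicator {a - c<..b - c} x * \<psi> (v x)" "- c"]
      lborel_integrable_real_affine[of "\<lambda>x. indicator {a - c<..b - c} x * \<psi> (v x)" 1 "- c"]
    unfolding has_bochner_integral_iff eq by simp
qed

section \<open>The inverse of the generator\<close>

context stable_semigroup
begin

lemma frac_norm_const: "\<exists>K\<ge>0. \<forall>x t. frac_norm 1 (\<lambda>_. x) t \<le> ennreal (K * norm x)"
proof -
  let ?I = "\<integral>\<^sup>+r. ennreal (frac_kernel 1 r * exp (- w * r)) \<partial>lborel"
  have I: "?I < top" using nn_integral_frac_kernel_exp_finite[OF zero_less_one w] by simp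
  have "frac_norm 1 (\<lambda>_. x) t = ennreal (enn2real ?I * norm x)" for x t
  proof -
    have "frac_norm 1 (\<lambda>_. x) t = (\<integral>\<^sup>+r. ennreal (norm x) * ennreal (frac_kernel 1 r * exp (- w * r)) \<partial>lborel)"
      unfolding frac_norm_def using frac_kernel_nonneg[of 1]
      by (intro nn_integral_cong) (simp add: mult.commute flip: ennreal_mult)
    also have "\<dots> = ennreal (norm x) * ?I" by (rule nn_integral_cmult) measurable
    also have "?I = ennreal (enn2real ?I)" using ennreal_enn2real[OF I] by simp
    finally show ?thesis by (simp add: ennreal_mult mult.commute)
  qed
  then show ?thesis by (intro exI[of _ "enn2real ?I"]) simp
qed

lemma frac_norm_const_finite: "frac_norm 1 (\<lambda>_. x) t < \<infinity>"
  using frac_norm_const by (metis ennreal_less_top infinity_ennreal_def le_less_trans)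

text \<open>The integral of the orbits over all times; for a generated semigroup it inverts the negative
  of the generator.\<close>

definition potential :: "'a \<Rightarrow>\<^sub>L 'a" where
  "potential = Blinfun (\<lambda>x. frac_integral S 1 (\<lambda>_. x) 0)"

text \<open>The fractional integral of order \<open>1\<close> of a constant function is the integral of an orbit. It is
  linear in that constant, and exponential stability bounds it.\<close>

lemma potential_functional:
  fixes \<psi> :: "'a \<Rightarrow>\<^sub>L real"
  shows "has_bochner_integral lborel (\<lambda>r. frac_kernel 1 r * \<psi> (Sp r x)) (\<psi> (potential x))"
proof -
  let ?B = "\<lambda>x. frac_integral S 1 (\<lambda>_. x) 0"
  have h: "has_bochner_integral lborel (\<lambda>r. frac_kernel 1 r * \<psi> (Sp r x)) (\<psi> (?B x))" for x and \<psi> :: "'a \<Rightarrow>\<^sub>L real"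
    by (rule frac_integral_functional(1)[OF zero_less_one smeas_const _ frac_norm_const_finite]) simp
  obtain K where K: "0 \<le> K" "\<And>x t. frac_norm 1 (\<lambda>_. x) t \<le> ennreal (K * norm x)"
    using frac_norm_const by blast
  have "bounded_linear ?B"
  proof (rule bounded_linear_intro)
    show "?B (x + y) = ?B x + ?B y" for x y
    proof (rule functionals_separate)
      fix \<psi> :: "'a \<Rightarrow>\<^sub>L real"
      have "has_bochner_integral lborel (\<lambda>r. frac_kernel 1 r * \<psi> (Sp r x) + frac_kernel 1 r * \<psi> (Sp r y)) (\<psi> (?B x) + \<psi> (?B y))"
        by (intro has_bochner_integral_add h)
      then have "has_bochner_integral lborel (\<lambda>r. frac_kernel 1 r * \<psi> (Sp r (x + y))) (\<psi> (?B x + ?B y))"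
        by (simp add: blinfun.add_right distrib_left)
      then show "\<psi> (?B (x + y)) = \<psi> (?B x + ?B y)" by (rule has_bochner_integral_eq[OF h])
    qed
    show "?B (c *\<^sub>R x) = c *\<^sub>R ?B x" for c x
    proof (rule functionals_separate)
      fix \<psi> :: "'a \<Rightarrow>\<^sub>L real"
      have "has_bochner_integral lborel (\<lambda>r. c * (frac_kernel 1 r * \<psi> (Sp r x))) (c * \<psi> (?B x))"
        by (intro has_bochner_integral_mult_right h)
      then have "has_bochner_integral lborel (\<lambda>r. frac_kernel 1 r * \<psi> (Sp r (c *\<^sub>R x))) (\<psi> (c *\<^sub>R ?B x))"
        by (simp add: blinfun.scaleR_right mult.left_commute)
      then show "\<psi> (?B (c *\<^sub>R x)) = \<psi> (c *\<^sub>R ?B x)" by (rule has_bochner_integral_eq[OF h])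
    qed
    show "norm (?B x) \<le> norm x * (M * K)" for x
      using K(1) by (intro order_trans[OF frac_integral_functional(2)[OF zero_less_one smeas_const _ frac_norm_const_finite K(2)]])
        (auto simp: mult_ac)
  qed
  then show ?thesis using h by (simp add: potential_def bounded_linear_Blinfun_apply)
qed

lemma potential_Sp: "potential (Sp r x) = Sp r (potential x)"
proof (cases "0 < r")
  case True
  show ?thesis
  proof (rule functionals_separate)
    fix \<psi> :: "'a \<Rightarrow>\<^sub>L real"
    have "(\<lambda>\<rho>. frac_kernel 1 \<rho> * (\<psi> o\<^sub>L Sp r) (Sp \<rho> x)) = (\<lambda>\<rho>. frac_kernel 1 \<rho> * \<psi> (Sp \<rho> (Sp r x)))"
    proof
      fix \<rho>
      show "frac_kernel 1 \<rho> * (\<psi> o\<^sub>L Sp r) (Sp \<rho> x) = frac_kernel 1 \<rho> * \<psi> (Sp \<rho> (Sp r x))"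
        using True Sp_add[of r \<rho> x] Sp_add[of \<rho> r x]
        by (cases "0 < \<rho>") (simp_all add: frac_kernel_def add.commute)
    qed
    then have "has_bochner_integral lborel (\<lambda>\<rho>. frac_kernel 1 \<rho> * \<psi> (Sp \<rho> (Sp r x))) ((\<psi> o\<^sub>L Sp r) (potential x))"
      using potential_functional[of "\<psi> o\<^sub>L Sp r" x] by (simp only:)
    then show "\<psi> (potential (Sp r x)) = \<psi> (Sp r (potential x))"
      using has_bochner_integral_eq[OF potential_functional] by simp
  qed
qed (simp add: Sp_def blinfun.zero_right)

lemma potential_frac_integral:
  assumes \<sigma>: "0 < \<sigma>" and v: "smeas borel v" and fin: "frac_norm \<sigma> v t < \<infinity>" "frac_norm \<sigma> (\<lambda>x. potential (v x)) t < \<infinity>"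
  shows "potential (frac_integral S \<sigma> v t) = frac_integral S \<sigma> (\<lambda>x. potential (v x)) t"
proof (rule functionals_separate)
  fix \<psi> :: "'a \<Rightarrow>\<^sub>L real"
  have "has_bochner_integral lborel (\<lambda>r. frac_kernel \<sigma> r * (\<psi> o\<^sub>L potential) (Sp r (v (t - r)))) ((\<psi> o\<^sub>L potential) (frac_integral S \<sigma> v t))"
    by (rule frac_integral_functional(1)[OF \<sigma> v _ fin(1)]) simp
  then have "has_bochner_integral lborel (\<lambda>r. frac_kernel \<sigma> r * \<psi> (Sp r (potential (v (t - r))))) (\<psi> (potential (frac_integral S \<sigma> v t)))"
    by (simp add: potential_Sp)
  moreover have "has_bochner_integral lborel (\<lambda>r. frac_kernel \<sigma> r * \<psi> (Sp r (potential (v (t - r))))) (\<psi> (frac_integral S \<sigma> (\<lambda>x. potential (v x)) t))"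
    by (rule frac_integral_functional(1)[OF \<sigma> smeas_blinfun[OF v] _ fin(2)]) simp
  ultimately show "\<psi> (potential (frac_integral S \<sigma> v t)) = \<psi> (frac_integral S \<sigma> (\<lambda>x. potential (v x)) t)"
    by (rule has_bochner_integral_eq)
qed

lemma nn_integral_Sp_functional_finite:
  fixes \<psi> :: "'a \<Rightarrow>\<^sub>L real"
  shows "(\<integral>\<^sup>+r. ennreal (frac_kernel 1 r * \<bar>\<psi> (Sp r x)\<bar>) \<partial>lborel) < \<infinity>"
proof -
  have "integrable lborel (\<lambda>r. frac_kernel 1 r * \<psi> (Sp r x))"
    using potential_functional by (simp add: has_bochner_integral_iff)
  then show ?thesis using frac_kernel_nonneg[of 1] by (simp add: integrable_iff_bounded abs_mult)
qed

end

text \<open>The kernel behind the product of the resolvents at \<open>\<mu>\<close> and at \<open>0\<close>.\<close>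

lemma exp_convolution:
  fixes \<mu> r :: real
  assumes \<mu>: "0 < \<mu>"
  defines "E \<equiv> \<lambda>r. frac_kernel 1 r * exp (- \<mu> * r)"
  shows "(\<integral>\<^sup>+\<tau>. ennreal (E \<tau>) * ennreal (frac_kernel 1 (r - \<tau>)) \<partial>lborel) = ennreal (frac_kernel 1 r * ((1 - exp (- \<mu> * r)) / \<mu>))"
    and "(\<integral>\<^sup>+\<tau>. ennreal (frac_kernel 1 \<tau>) * ennreal (E (r - \<tau>)) \<partial>lborel) = ennreal (frac_kernel 1 r * ((1 - exp (- \<mu> * r)) / \<mu>))"
proof -
  have [measurable]: "E \<in> borel_measurable borel" unfolding E_def by measurable
  show *: "(\<integral>\<^sup>+\<tau>. ennreal (E \<tau>) * ennreal (frac_kernel 1 (r - \<tau>)) \<partial>lborel) = ennreal (frac_kernel 1 r * ((1 - exp (- \<mu> * r)) / \<mu>))"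
  proof (cases "0 < r")
    case True
    have "(\<integral>\<^sup>+\<tau>. ennreal (E \<tau>) * ennreal (frac_kernel 1 (r - \<tau>)) \<partial>lborel)
      = (\<integral>\<^sup>+\<tau>. ennreal (exp (- \<mu> * \<tau>)) * indicator {0..r} \<tau> \<partial>lborel)"
      by (rule nn_integral_cong_AE, rule AE_mp[OF AE_lborel_singleton[of 0]], rule AE_mp[OF AE_lborel_singleton[of r]], rule AE_I2)
         (auto simp: E_def frac_kernel_1 indicator_def)
    also have "\<dots> = ennreal (- exp (- \<mu> * r) / \<mu> - - exp (- \<mu> * 0) / \<mu>)"
      by (rule nn_integral_FTC_Icc) (use \<mu> True in \<open>auto intro!: derivative_eq_intros\<close>)
    also have "- exp (- \<mu> * r) / \<mu> - - exp (- \<mu> * 0) / \<mu> = (1 - exp (- \<mu> * r)) / \<mu>"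
      using \<mu> by (simp add: field_simps)
    finally show ?thesis using True by (simp add: frac_kernel_1)
  next
    case False
    then have "(\<integral>\<^sup>+\<tau>. ennreal (E \<tau>) * ennreal (frac_kernel 1 (r - \<tau>)) \<partial>lborel) = (\<integral>\<^sup>+\<tau>. 0 \<partial>(lborel :: real measure))"
      by (intro nn_integral_cong) (auto simp: E_def frac_kernel_1)
    then show ?thesis using False by (simp add: frac_kernel_1)
  qed
  have "(\<integral>\<^sup>+\<tau>. ennreal (frac_kernel 1 \<tau>) * ennreal (E (r - \<tau>)) \<partial>lborel)
      = (\<integral>\<^sup>+\<tau>. ennreal (E \<tau>) * ennreal (frac_kernel 1 (r - \<tau>)) \<partial>lborel)"
    using nn_integral_lborel_reflect[of "\<lambda>\<tau>. ennreal (E \<tau>) * ennreal (frac_kernel 1 (r - \<tau>))" r]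
    by (simp add: mult.commute)
  then show "(\<integral>\<^sup>+\<tau>. ennreal (frac_kernel 1 \<tau>) * ennreal (E (r - \<tau>)) \<partial>lborel) = ennreal (frac_kernel 1 r * ((1 - exp (- \<mu> * r)) / \<mu>))"
    using * by simp
qed

lemma scaleC_real: "complex_of_real c *\<^sub>C x = c *\<^sub>R x"
  by (simp add: scaleR_scaleC)

text \<open>The classical formula \<open>\<phi> x = \<psi> x - \<i> \<psi> (\<i> x)\<close>, which allows complex functionals to be replaced by real ones.\<close>

lemma complex_functional:
  fixes \<psi> :: "'a::complex_banach \<Rightarrow>\<^sub>L real"
  obtains \<phi> :: "'a \<Rightarrow>\<^sub>L complex" where "complex_homogeneous \<phi>" "\<And>x. Re (\<phi> x) = \<psi> x"
proof -
  let ?f = "\<lambda>x. Complex (\<psi> x) (- \<psi> (\<i> *\<^sub>C x))"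
  have "bounded_linear ?f"
  proof (rule bounded_linear_intro)
    show "?f (x + y) = ?f x + ?f y" for x y
      by (simp add: blinfun.add_right scaleC_add_right complex_eq_iff)
    show "?f (r *\<^sub>R x) = r *\<^sub>R ?f x" for r x
    proof -
      have "\<i> *\<^sub>C (r *\<^sub>R x) = r *\<^sub>R (\<i> *\<^sub>C x)"
        unfolding scaleR_scaleC scaleC_scaleC by (simp add: mult.commute)
      then show ?thesis by (simp add: blinfun.scaleR_right complex_eq_iff)
    qed
    show "norm (?f x) \<le> norm x * (2 * norm \<psi>)" for x
    proof -
      have "norm (?f x) \<le> \<bar>\<psi> x\<bar> + \<bar>\<psi> (\<i> *\<^sub>C x)\<bar>" using cmod_le[of "?f x"] by simp
      also have "\<dots> \<le> norm \<psi> * norm x + norm \<psi> * norm (\<i> *\<^sub>C x)"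
        using norm_blinfun[of \<psi> x] norm_blinfun[of \<psi> "\<i> *\<^sub>C x"] by simp
      finally show ?thesis by (simp add: norm_scaleC mult_ac)
    qed
  qed
  then have app: "blinfun_apply (Blinfun ?f) = ?f" by (rule bounded_linear_Blinfun_apply)
  show ?thesis
  proof (rule that[of "Blinfun ?f"])
    show "complex_homogeneous (Blinfun ?f)" unfolding complex_homogeneous_def app
    proof (intro allI)
      fix c :: complex and x :: 'a
      have c: "c = complex_of_real (Re c) + complex_of_real (Im c) * \<i>" by (simp add: complex_eq_iff)
      have e1: "c *\<^sub>C x = Re c *\<^sub>R x + Im c *\<^sub>R (\<i> *\<^sub>C x)"
        by (subst c) (simp add: scaleC_add_left scaleR_scaleC scaleC_scaleC)
      have e2: "\<i> *\<^sub>C (c *\<^sub>C x) = Re c *\<^sub>R (\<i> *\<^sub>C x) - Im c *\<^sub>R x"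
      proof -
        have "\<i> * c = complex_of_real (Re c) * \<i> + complex_of_real (- Im c)" by (simp add: complex_eq_iff)
        then have "\<i> *\<^sub>C (c *\<^sub>C x) = Re c *\<^sub>R (\<i> *\<^sub>C x) + (- Im c) *\<^sub>R x"
          unfolding scaleC_scaleC by (simp only: scaleC_add_left scaleR_scaleC scaleC_scaleC)
        then show ?thesis by simp
      qed
      show "?f (c *\<^sub>C x) = c *\<^sub>C ?f x"
        unfolding e2 unfolding e1
        by (simp add: scaleC_complex_def blinfun.add_right blinfun.diff_right blinfun.scaleR_right complex_eq_iff algebra_simps)
    qed
    show "Re (Blinfun ?f x) = \<psi> x" for x by (simp add: app)
  qed
qed

locale generated_semigroup = stable_semigroup S M w
  for S :: "real \<Rightarrow> ('a::complex_banach \<Rightarrow>\<^sub>L 'a)" and M w :: real +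
  fixes D :: "'a set" and A :: "'a \<Rightarrow> 'a"
  assumes generator: "infinitesimal_generator S w D (\<lambda>x. - A x)"
begin

text \<open>The resolvent at one real point, as a real Laplace transform. Any \<open>\<mu> > w\<close> would do.\<close>

lemma resolvent_exists:
  obtains R :: "'a \<Rightarrow>\<^sub>L 'a" and \<mu> :: real where "0 < \<mu>"
    "\<And>x. R x \<in> D" "\<And>x. \<mu> *\<^sub>R R x + A (R x) = x" "\<And>x. x \<in> D \<Longrightarrow> R (\<mu> *\<^sub>R x + A x) = x"
    "\<And>(\<psi> :: 'a \<Rightarrow>\<^sub>L real) x. \<psi> (R x) = (LINT t|lborel. frac_kernel 1 t * exp (- \<mu> * t) * \<psi> (Sp t x))"
proof -
  define \<mu> where "\<mu> = w + 1"
  have \<mu>: "w < Re (complex_of_real \<mu>)" "0 < \<mu>" using w by (auto simp: \<mu>_def)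
  obtain R :: "'a \<Rightarrow>\<^sub>L 'a" where R: "\<And>x. R x \<in> D" "\<And>x. complex_of_real \<mu> *\<^sub>C R x - - A (R x) = x"
      "\<And>x. x \<in> D \<Longrightarrow> R (complex_of_real \<mu> *\<^sub>C x - - A x) = x"
    and L: "\<And>x (\<phi> :: 'a \<Rightarrow>\<^sub>L complex). complex_homogeneous \<phi> \<Longrightarrow>
      \<phi> (R x) = (LINT t|lebesgue_on {0..}. exp (- complex_of_real \<mu> * complex_of_real t) * \<phi> (S t x))"
    using generator \<mu>(1) unfolding infinitesimal_generator_def by blast
  show ?thesis
  proof (rule that[OF \<mu>(2) R(1)])
    show "\<mu> *\<^sub>R R x + A (R x) = x" for x using R(2)[of x] by (simp add: scaleC_real)
    show "x \<in> D \<Longrightarrow> R (\<mu> *\<^sub>R x + A x) = x" for x using R(3)[of x] by (simp add: scaleC_real)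
    fix \<psi> :: "'a \<Rightarrow>\<^sub>L real" and x
    obtain \<phi> :: "'a \<Rightarrow>\<^sub>L complex" where \<phi>: "complex_homogeneous \<phi>" "\<And>x. Re (\<phi> x) = \<psi> x"
      by (rule complex_functional[of \<psi>]) blast
    define G where "G t = (frac_kernel 1 t * exp (- \<mu> * t)) *\<^sub>R \<phi> (Sp t x)" for t
    define H where "H t = G t + indicator {0} t *\<^sub>R \<phi> x" for t
    have "smeas borel (\<lambda>t. \<phi> (Sp t x))" by (intro smeas_blinfun Sp_smeas)
    then obtain s where s: "\<And>n::nat. simple_function borel (s n)" "\<And>t. (\<lambda>n. s n t) \<longlonglongrightarrow> \<phi> (Sp t x)"
      by (auto simp: smeas_def)
    have [measurable]: "(\<lambda>t. \<phi> (Sp t x)) \<in> borel_measurable borel"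
      by (rule borel_measurable_LIMSEQ_metric[OF borel_measurable_simple_function[OF s(1)] s(2)])
    have [measurable]: "G \<in> borel_measurable borel" "H \<in> borel_measurable borel"
      unfolding H_def G_def by measurable
    have eq: "indicator {0..} t *\<^sub>R (exp (- complex_of_real \<mu> * complex_of_real t) * \<phi> (S t x)) = H t" for t
    proof -
      have "exp (- complex_of_real \<mu> * complex_of_real t) = complex_of_real (exp (- \<mu> * t))"
        by (simp add: exp_of_real[symmetric])
      moreover have "S 0 x = x" using semigroup by (simp add: strongly_measurable_semigroup_def)
      ultimately show ?thesis
        by (auto simp: H_def G_def frac_kernel_1 Sp_def indicator_def scaleR_conv_of_real)
    qed
    have "\<phi> (R x) = (LINT t|lebesgue. H t)"
      unfolding L[OF \<phi>(1)] by (subst integral_restrict_space, simp, simp only: eq)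
    also have "\<dots> = (LINT t|lborel. H t)" by (rule integral_completion) measurable
    also have "\<dots> = (LINT t|lborel. G t)"
    proof (rule integral_cong_AE)
      show "AE t in lborel. H t = G t"
        using AE_lborel_singleton[of 0] by eventually_elim (auto simp: H_def)
    qed measurable
    finally have "\<psi> (R x) = Re (LINT t|lborel. G t)" using \<phi>(2)[of "R x"] by simp
    also have "\<dots> = (LINT t|lborel. Re (G t))"
    proof (rule integral_Re[symmetric], rule integrableI_bounded)
      have "(\<integral>\<^sup>+t. ennreal (norm (G t)) \<partial>lborel) \<le>
          (\<integral>\<^sup>+t. ennreal (norm \<phi> * (M * norm x)) * ennreal (frac_kernel 1 t * exp (- w * t)) \<partial>lborel)"
      proof (rule nn_integral_mono)
        fix t
        have k: "0 \<le> frac_kernel 1 t" by (rule frac_kernel_nonneg) simp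
        have "norm (G t) = frac_kernel 1 t * exp (- \<mu> * t) * norm (\<phi> (Sp t x))" using k by (simp add: G_def)
        also have "\<dots> \<le> frac_kernel 1 t * 1 * (norm \<phi> * (M * exp (- w * t) * norm x))"
        proof (rule mult_mono)
          show "norm (\<phi> (Sp t x)) \<le> norm \<phi> * (M * exp (- w * t) * norm x)"
            using norm_blinfun[of \<phi> "Sp t x"] mult_left_mono[OF Sp_norm[of t x], of "norm \<phi>"] by simp
          show "frac_kernel 1 t * exp (- \<mu> * t) \<le> frac_kernel 1 t * 1"
            using k \<mu>(2) by (auto simp: frac_kernel_1)
        qed (use k in auto)
        also have "\<dots> = (norm \<phi> * (M * norm x)) * (frac_kernel 1 t * exp (- w * t))" by (simp add: mult_ac)
        finally have "ennreal (norm (G t)) \<le> ennreal \<dots>" by (rule ennreal_leI)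
        also have "\<dots> = ennreal (norm \<phi> * (M * norm x)) * ennreal (frac_kernel 1 t * exp (- w * t))"
          using M by (intro ennreal_mult') simp
        finally show "ennreal (norm (G t)) \<le> \<dots>" .
      qed
      also have "\<dots> < \<infinity>"
        using nn_integral_frac_kernel_exp_finite[OF zero_less_one w] by (simp add: nn_integral_cmult ennreal_mult_less_top)
      finally show "(\<integral>\<^sup>+t. ennreal (norm (G t)) \<partial>lborel) < \<infinity>" .
    qed measurable
    also have "\<dots> = (LINT t|lborel. frac_kernel 1 t * exp (- \<mu> * t) * \<psi> (Sp t x))"
      by (simp add: G_def \<phi>(2))
    finally show "\<psi> (R x) = (LINT t|lborel. frac_kernel 1 t * exp (- \<mu> * t) * \<psi> (Sp t x))" .
  qed
qed

text \<open>Both facts come from the resolvent identity between \<open>\<mu>\<close> and \<open>0\<close>, where the potential takes the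
  place of the resolvent at \<open>0\<close>.\<close>

lemma potential_generator:
  shows "x \<in> D \<Longrightarrow> potential (A x) = x" and "potential y = 0 \<Longrightarrow> y = 0"
proof -
  obtain R :: "'a \<Rightarrow>\<^sub>L 'a" and \<mu> :: real where \<mu>: "0 < \<mu>"
    and R: "\<And>x. R x \<in> D" "\<And>x. \<mu> *\<^sub>R R x + A (R x) = x" "\<And>x. x \<in> D \<Longrightarrow> R (\<mu> *\<^sub>R x + A x) = x"
    and L: "\<And>(\<psi> :: 'a \<Rightarrow>\<^sub>L real) x. \<psi> (R x) = (LINT t|lborel. frac_kernel 1 t * exp (- \<mu> * t) * \<psi> (Sp t x))"
    by (rule resolvent_exists) blast
  have k: "0 \<le> frac_kernel 1 t" for t by (rule frac_kernel_nonneg) simp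
  let ?E = "\<lambda>t. frac_kernel 1 t * exp (- \<mu> * t)"
  let ?C = "\<lambda>r. frac_kernel 1 r * ((1 - exp (- \<mu> * r)) / \<mu>)"
  have C0: "0 \<le> ?C r" for r using \<mu> by (auto simp: frac_kernel_1)
  have fin: "(\<integral>\<^sup>+r. ennreal (?C r * \<bar>\<psi> (Sp r x)\<bar>) \<partial>lborel) < \<infinity>" for \<psi> :: "'a \<Rightarrow>\<^sub>L real" and x
  proof -
    have [measurable]: "(\<lambda>r. \<psi> (Sp r x)) \<in> borel_measurable borel" by (intro smeas_functional Sp_smeas)
    have "(\<integral>\<^sup>+r. ennreal (?C r * \<bar>\<psi> (Sp r x)\<bar>) \<partial>lborel)
      \<le> (\<integral>\<^sup>+r. ennreal (1 / \<mu>) * ennreal (frac_kernel 1 r * \<bar>\<psi> (Sp r x)\<bar>) \<partial>lborel)"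
      using \<mu> by (intro nn_integral_mono) (auto simp: frac_kernel_1 divide_right_mono mult_right_mono ennreal_leI
        simp flip: ennreal_mult intro!: mult_right_mono[of _ 1, simplified])
    also have "\<dots> < \<infinity>"
      using nn_integral_Sp_functional_finite[of \<psi> x] by (simp add: nn_integral_cmult ennreal_mult_less_top)
    finally show ?thesis .
  qed
  have C_int: "(LINT r|lborel. ?C r * \<psi> (Sp r x)) = \<psi> ((1 / \<mu>) *\<^sub>R (potential x - R x))" for \<psi> :: "'a \<Rightarrow>\<^sub>L real" and x
  proof -
    have [measurable]: "(\<lambda>r. \<psi> (Sp r x)) \<in> borel_measurable borel" by (intro smeas_functional Sp_smeas)
    have i1: "integrable lborel (\<lambda>r. frac_kernel 1 r * \<psi> (Sp r x))"
      using potential_functional by (simp add: has_bochner_integral_iff)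
    have i2: "integrable lborel (\<lambda>r. ?E r * \<psi> (Sp r x))"
    proof (rule Bochner_Integration.integrable_bound[OF i1])
      show "AE r in lborel. norm (?E r * \<psi> (Sp r x)) \<le> norm (frac_kernel 1 r * \<psi> (Sp r x))"
      proof (rule AE_I2)
        fix r
        have "\<bar>?E r\<bar> \<le> \<bar>frac_kernel 1 r\<bar>" using \<mu> by (auto simp: frac_kernel_1)
        then show "norm (?E r * \<psi> (Sp r x)) \<le> norm (frac_kernel 1 r * \<psi> (Sp r x))"
          unfolding real_norm_def abs_mult by (intro mult_right_mono) auto
      qed
    qed measurable
    have "(LINT r|lborel. ?C r * \<psi> (Sp r x)) = (LINT r|lborel. (1 / \<mu>) * (frac_kernel 1 r * \<psi> (Sp r x) - ?E r * \<psi> (Sp r x)))"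
      using \<mu> by (intro Bochner_Integration.integral_cong) (auto simp: field_simps)
    also have "\<dots> = (1 / \<mu>) * ((LINT r|lborel. frac_kernel 1 r * \<psi> (Sp r x)) - (LINT r|lborel. ?E r * \<psi> (Sp r x)))"
      using i1 i2 by simp
    also have "\<dots> = (1 / \<mu>) * (\<psi> (potential x) - \<psi> (R x))"
      using has_bochner_integral_integral_eq[OF potential_functional] L[of \<psi> x] by simp
    finally show ?thesis by (simp add: blinfun.scaleR_right blinfun.diff_right)
  qed
  have BR: "potential (R x) = (1 / \<mu>) *\<^sub>R (potential x - R x)" for x
  proof (rule functionals_separate)
    fix \<psi> :: "'a \<Rightarrow>\<^sub>L real"
    have [measurable]: "(\<lambda>r. \<psi> (Sp r x)) \<in> borel_measurable borel" by (intro smeas_functional Sp_smeas)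
    have "\<psi> (potential (R x)) = (LINT r|lborel. frac_kernel 1 r * \<psi> (Sp r (R x)))"
      using has_bochner_integral_integral_eq[OF potential_functional] by simp
    also have "\<dots> = (LINT r|lborel. frac_kernel 1 r * (LINT t|lborel. ?E t * \<psi> (Sp (r + t) x)))"
    proof (rule Bochner_Integration.integral_cong)
      fix r
      show "frac_kernel 1 r * \<psi> (Sp r (R x)) = frac_kernel 1 r * (LINT t|lborel. ?E t * \<psi> (Sp (r + t) x))"
      proof (cases "0 < r")
        case True
        have "\<psi> (Sp r (R x)) = (LINT t|lborel. ?E t * \<psi> (Sp r (Sp t x)))" using L[of "\<psi> o\<^sub>L Sp r" x] by simp
        also have "\<dots> = (LINT t|lborel. ?E t * \<psi> (Sp (r + t) x))"
          using True Sp_add by (intro Bochner_Integration.integral_cong) (auto simp: frac_kernel_1)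
        finally show ?thesis by simp
      qed (simp add: frac_kernel_1)
    qed simp
    also have "\<dots> = (LINT r|lborel. ?C r * \<psi> (Sp r x))"
      by (rule integral_convolution[OF _ _ _ _ k _ C0 exp_convolution(2)[OF \<mu>] fin]) (use k in auto)
    also note C_int
    finally show "\<psi> (potential (R x)) = \<psi> ((1 / \<mu>) *\<^sub>R (potential x - R x))" .
  qed
  have RB: "R (potential x) = (1 / \<mu>) *\<^sub>R (potential x - R x)" for x
  proof (rule functionals_separate)
    fix \<psi> :: "'a \<Rightarrow>\<^sub>L real"
    have [measurable]: "(\<lambda>r. \<psi> (Sp r x)) \<in> borel_measurable borel" by (intro smeas_functional Sp_smeas)
    have "\<psi> (R (potential x)) = (LINT r|lborel. ?E r * \<psi> (Sp r (potential x)))" by (rule L)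
    also have "\<dots> = (LINT r|lborel. ?E r * (LINT t|lborel. frac_kernel 1 t * \<psi> (Sp (r + t) x)))"
    proof (rule Bochner_Integration.integral_cong)
      fix r
      show "?E r * \<psi> (Sp r (potential x)) = ?E r * (LINT t|lborel. frac_kernel 1 t * \<psi> (Sp (r + t) x))"
      proof (cases "0 < r")
        case True
        have "\<psi> (Sp r (potential x)) = (LINT t|lborel. frac_kernel 1 t * \<psi> (Sp r (Sp t x)))"
          using has_bochner_integral_integral_eq[OF potential_functional[of "\<psi> o\<^sub>L Sp r" x]] by simp
        also have "\<dots> = (LINT t|lborel. frac_kernel 1 t * \<psi> (Sp (r + t) x))"
          using True Sp_add by (intro Bochner_Integration.integral_cong) (auto simp: frac_kernel_1)
        finally show ?thesis by simp
      qed (simp add: frac_kernel_1)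
    qed simp
    also have "\<dots> = (LINT r|lborel. ?C r * \<psi> (Sp r x))"
      by (rule integral_convolution[OF _ _ _ _ _ k C0 exp_convolution(1)[OF \<mu>] fin]) (use k in auto)
    also note C_int
    finally show "\<psi> (R (potential x)) = \<psi> ((1 / \<mu>) *\<^sub>R (potential x - R x))" .
  qed
  show "potential (A x) = x" if "x \<in> D"
  proof -
    let ?y = "\<mu> *\<^sub>R x + A x"
    have "\<mu> *\<^sub>R potential (R ?y) = potential ?y - R ?y" using \<mu> by (simp add: BR)
    then have "\<mu> *\<^sub>R potential x = \<mu> *\<^sub>R potential x + potential (A x) - x"
      unfolding R(3)[OF that] by (simp add: blinfun.add_right blinfun.scaleR_right)
    then show ?thesis by (simp add: algebra_simps)
  qed
  show "y = 0" if "potential y = 0"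
  proof -
    have Ry: "R y = 0" using RB[of y] \<mu> by (simp add: that blinfun.zero_right)
    have lin: "linear_operator D (\<lambda>x. - A x)" using generator by (simp add: infinitesimal_generator_def)
    then have "0 \<in> D" "- A (0 + 0) = - A 0 + - A 0" unfolding linear_operator_def by blast+
    then have "A 0 = 0" by simp
    then show ?thesis using R(2)[of y] Ry by simp
  qed
qed

end

section \<open>Inverting the parabolic operator\<close>

context stable_semigroup
begin

lemma frac_norm_cong_AE:
  assumes "AE x in lborel. u x = v x"
  shows "frac_norm \<sigma> u t = frac_norm \<sigma> v t"
  unfolding frac_norm_def
  by (rule nn_integral_cong_AE) (use AE_lborel_reflect[OF assms, of t] in eventually_elim, simp)

lemma abs_functional_Sp_le: "\<bar>blinfun_apply \<psi> (Sp r x) :: real\<bar> \<le> norm \<psi> * M * exp (- w * r) * norm x"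
  using norm_blinfun[of \<psi> "Sp r x"] mult_left_mono[OF Sp_norm[of r x], of "norm \<psi>"] by (simp add: mult.assoc)

text \<open>Integration by parts. As \<open>potential (S \<rho> x)\<close> is the integral of \<open>S r x\<close> over \<open>r > \<rho>\<close>, the left-hand side is a double
  integral over \<open>0 < \<rho> < r\<close>; integrating over \<open>\<rho>\<close> first gives \<open>S r (V t - V (t - r))\<close>.\<close>

theorem potential_frac_integral_derivative:
  assumes v: "smeas borel v" and V: "antiderivative v V"
    and fin: "frac_norm 1 v t < \<infinity>" "frac_norm 1 V t < \<infinity>"
  shows "potential (frac_integral S 1 v t) = potential (V t) - frac_integral S 1 V t"
proof (rule functionals_separate)
  fix \<psi> :: "'a \<Rightarrow>\<^sub>L real"
  have VM: "smeas borel V" by (rule smeas_continuous[OF antiderivativeD(1)[OF V]])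
  have k: "0 \<le> frac_kernel 1 r" for r by (rule frac_kernel_nonneg) simp
  have [measurable]: "(\<lambda>r. norm (v (t - r))) \<in> borel_measurable borel"
    by (rule smeas_norm[OF smeas_compose[OF v]]) simp
  let ?G = "\<lambda>r \<rho>. frac_kernel 1 \<rho> * (frac_kernel 1 (r - \<rho>) * \<psi> (Sp r (v (t - \<rho>))))"
  have [measurable]: "(\<lambda>z. \<psi> (Sp (fst z) (v (t - snd z)))) \<in> borel_measurable (lborel \<Otimes>\<^sub>M lborel)"
    by (intro smeas_functional Sp_apply_smeas smeas_compose[OF v]) measurable
  have Gm: "case_prod ?G \<in> borel_measurable (lborel \<Otimes>\<^sub>M lborel)"
    unfolding split_beta' by measurable
  let ?I = "\<integral>\<^sup>+r. ennreal (frac_kernel 1 r * exp (- w * r)) \<partial>lborel"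
  have "(\<integral>\<^sup>+z. ennreal (norm (case_prod ?G z)) \<partial>(lborel \<Otimes>\<^sub>M lborel))
      = (\<integral>\<^sup>+\<rho>. (\<integral>\<^sup>+r. ennreal (norm (?G r \<rho>)) \<partial>lborel) \<partial>lborel)"
    using Gm by (subst lborel_pair.nn_integral_snd[symmetric]) (auto simp: split_beta')
  also have "\<dots> \<le> (\<integral>\<^sup>+\<rho>. ennreal (norm \<psi> * M) * ?I * ennreal (frac_kernel 1 \<rho> * exp (- w * \<rho>) * norm (v (t - \<rho>))) \<partial>lborel)"
  proof (rule nn_integral_mono)
    fix \<rho>
    let ?c = "frac_kernel 1 \<rho> * exp (- w * \<rho>) * norm (v (t - \<rho>))"
    have c: "0 \<le> ?c" using k by simp
    have "(\<integral>\<^sup>+r. ennreal (norm (?G r \<rho>)) \<partial>lborel)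
      \<le> (\<integral>\<^sup>+r. ennreal (norm \<psi> * M * ?c) * ennreal (frac_kernel 1 (r - \<rho>) * exp (- w * (r - \<rho>))) \<partial>lborel)"
    proof (rule nn_integral_mono)
      fix r
      have "norm (?G r \<rho>) \<le> frac_kernel 1 \<rho> * (frac_kernel 1 (r - \<rho>) * (norm \<psi> * M * exp (- w * r) * norm (v (t - \<rho>))))"
        using k unfolding real_norm_def abs_mult by (intro mult_mono abs_functional_Sp_le) auto
      also have "exp (- w * r) = exp (- w * \<rho>) * exp (- w * (r - \<rho>))"
        by (simp add: exp_add[symmetric] algebra_simps)
      finally have "norm (?G r \<rho>) \<le> (norm \<psi> * M * ?c) * (frac_kernel 1 (r - \<rho>) * exp (- w * (r - \<rho>)))"
        by (simp add: mult_ac)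
      then have "ennreal (norm (?G r \<rho>)) \<le> ennreal \<dots>" by (rule ennreal_leI)
      also have "\<dots> = ennreal (norm \<psi> * M * ?c) * ennreal (frac_kernel 1 (r - \<rho>) * exp (- w * (r - \<rho>)))"
        using M c by (intro ennreal_mult') simp
      finally show "ennreal (norm (?G r \<rho>)) \<le> \<dots>" .
    qed
    also have "\<dots> = ennreal (norm \<psi> * M * ?c) * (\<integral>\<^sup>+r. ennreal (frac_kernel 1 (r - \<rho>) * exp (- w * (r - \<rho>))) \<partial>lborel)"
      by (rule nn_integral_cmult) measurable
    also have "(\<integral>\<^sup>+r. ennreal (frac_kernel 1 (r - \<rho>) * exp (- w * (r - \<rho>))) \<partial>lborel) = ?I"
      using nn_integral_lborel_shift[of "\<lambda>r. ennreal (frac_kernel 1 r * exp (- w * r))" "- \<rho>"] by simp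
    also have "ennreal (norm \<psi> * M * ?c) * ?I = ennreal (norm \<psi> * M) * ?I * ennreal ?c"
      using M c by (simp add: ennreal_mult' mult_ac)
    finally show "(\<integral>\<^sup>+r. ennreal (norm (?G r \<rho>)) \<partial>lborel) \<le> ennreal (norm \<psi> * M) * ?I * ennreal ?c" .
  qed
  also have "\<dots> = ennreal (norm \<psi> * M) * ?I * frac_norm 1 v t"
    unfolding frac_norm_def by (rule nn_integral_cmult) measurable
  also have "\<dots> < \<infinity>"
    using fin(1) nn_integral_frac_kernel_exp_finite[OF zero_less_one w] by (simp add: ennreal_mult_less_top)
  finally have int: "integrable (lborel \<Otimes>\<^sub>M lborel) (case_prod ?G)"
    by (intro integrableI_bounded Gm)
  have "\<psi> (potential (frac_integral S 1 v t)) = (LINT \<rho>|lborel. frac_kernel 1 \<rho> * (\<psi> o\<^sub>L potential) (Sp \<rho> (v (t - \<rho>))))"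
    using has_bochner_integral_integral_eq[OF frac_integral_functional(1)[OF zero_less_one v _ fin(1), of v "\<psi> o\<^sub>L potential"]] by simp
  also have "\<dots> = (LINT \<rho>|lborel. (LINT r|lborel. ?G r \<rho>))"
  proof (rule Bochner_Integration.integral_cong)
    fix \<rho>
    show "frac_kernel 1 \<rho> * (\<psi> o\<^sub>L potential) (Sp \<rho> (v (t - \<rho>))) = (LINT r|lborel. ?G r \<rho>)"
    proof (cases "0 < \<rho>")
      case True
      have "(\<psi> o\<^sub>L potential) (Sp \<rho> (v (t - \<rho>))) = (LINT r|lborel. frac_kernel 1 r * \<psi> (Sp r (Sp \<rho> (v (t - \<rho>)))))"
        using has_bochner_integral_integral_eq[OF potential_functional] by simp
      also have "\<dots> = (LINT r|lborel. frac_kernel 1 r * \<psi> (Sp (\<rho> + r) (v (t - \<rho>))))"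
        using True Sp_add by (intro Bochner_Integration.integral_cong) (auto simp: frac_kernel_1 add.commute)
      also have "\<dots> = (LINT r|lborel. frac_kernel 1 (r - \<rho>) * \<psi> (Sp r (v (t - \<rho>))))"
        using lborel_integral_real_affine[of 1 "\<lambda>r. frac_kernel 1 (r - \<rho>) * \<psi> (Sp r (v (t - \<rho>)))" \<rho>] by simp
      finally show ?thesis by simp
    qed (simp add: frac_kernel_1)
  qed simp
  also have "\<dots> = (LINT r|lborel. (LINT \<rho>|lborel. ?G r \<rho>))"
    by (rule lborel_pair.Fubini_integral[OF int])
  also have "\<dots> = (LINT r|lborel. frac_kernel 1 r * \<psi> (Sp r (V t)) - frac_kernel 1 r * \<psi> (Sp r (V (t - r))))"
  proof (rule Bochner_Integration.integral_cong)
    fix r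
    show "(LINT \<rho>|lborel. ?G r \<rho>) = frac_kernel 1 r * \<psi> (Sp r (V t)) - frac_kernel 1 r * \<psi> (Sp r (V (t - r)))"
    proof (cases "0 < r")
      case True
      have [measurable]: "(\<lambda>\<rho>. \<psi> (Sp r (v (t - \<rho>)))) \<in> borel_measurable borel"
        by (intro smeas_functional smeas_blinfun smeas_compose[OF v]) simp
      have "(LINT \<rho>|lborel. ?G r \<rho>) = (LINT \<rho>|lborel. indicator {t - r<..t} (t + (-1) * \<rho>) * (\<psi> o\<^sub>L Sp r) (v (t + (-1) * \<rho>)))"
      proof (rule integral_cong_AE)
        show "AE \<rho> in lborel. ?G r \<rho> = indicator {t - r<..t} (t + (-1) * \<rho>) * (\<psi> o\<^sub>L Sp r) (v (t + (-1) * \<rho>))"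
          using AE_lborel_singleton[of 0] by eventually_elim (auto simp: frac_kernel_1 indicator_def)
      qed simp_all
      also have "\<dots> = (LINT x|lborel. indicator {t - r<..t} x * (\<psi> o\<^sub>L Sp r) (v x))"
        using lborel_integral_real_affine[of "-1" "\<lambda>x. indicator {t - r<..t} x * (\<psi> o\<^sub>L Sp r) (v x)" t] by simp
      also have "\<dots> = (\<psi> o\<^sub>L Sp r) (V t - V (t - r))"
        using True by (intro has_bochner_integral_integral_eq antiderivativeD(2)[OF V]) simp
      finally show ?thesis using True by (simp add: frac_kernel_1 blinfun.diff_right)
    next
      case False
      then have "(LINT \<rho>|lborel. ?G r \<rho>) = (LINT \<rho>|(lborel :: real measure). 0)"
        by (intro Bochner_Integration.integral_cong) (auto simp: frac_kernel_1)
      then show ?thesis using False by (simp add: frac_kernel_1)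
    qed
  qed simp
  also have "\<dots> = \<psi> (potential (V t)) - \<psi> (frac_integral S 1 V t)"
    by (intro has_bochner_integral_integral_eq has_bochner_integral_diff potential_functional
        frac_integral_functional(1)[OF zero_less_one VM _ fin(2)]) simp
  finally show "\<psi> (potential (frac_integral S 1 v t)) = \<psi> (potential (V t) - frac_integral S 1 V t)"
    by (simp add: blinfun.diff_right)
qed

text \<open>Functions with a bounded majorant of their fractional integral of order \<open>1\<close>. This covers \<open>L\<^sup>p\<close> functions
  and bounded functions alike, and it is closed under differences, even of one function from each class.\<close>

definition tame :: "(real \<Rightarrow> 'a) \<Rightarrow> bool" where
  "tame v \<longleftrightarrow> smeas borel v \<and> (\<exists>K\<ge>0. \<forall>t. frac_norm 1 v t \<le> ennreal K)"

lemma tame_smeas: "tame v \<Longrightarrow> smeas borel v"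
  by (simp add: tame_def)

lemma tame_finite: "tame v \<Longrightarrow> frac_norm 1 v t < \<infinity>"
  unfolding tame_def by (metis ennreal_less_top infinity_ennreal_def le_less_trans)

lemma tame_Lp: "1 \<le> p \<Longrightarrow> Lp_fun p v \<Longrightarrow> tame v"
  unfolding tame_def using frac_norm_Lp_bounded[OF admissible_ge_1[of p 1], of v] by (simp add: Lp_fun_def)

lemma tame_bounded: "smeas borel v \<Longrightarrow> (\<And>x. norm (v x) \<le> B) \<Longrightarrow> tame v"
  unfolding tame_def using frac_norm_bounded_function[of 1 v B] by simp

lemma tame_diff:
  assumes "tame u" "tame v"
  shows "tame (\<lambda>x. u x - v x)"
proof -
  obtain K where K: "0 \<le> K" "\<And>t. frac_norm 1 u t \<le> ennreal K" using assms(1) by (auto simp: tame_def)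
  obtain L where L: "0 \<le> L" "\<And>t. frac_norm 1 v t \<le> ennreal L" using assms(2) by (auto simp: tame_def)
  have "frac_norm 1 (\<lambda>x. u x - v x) t \<le> ennreal (K + L)" for t
  proof -
    have "frac_norm 1 (\<lambda>x. u x - v x) t \<le> frac_norm 1 u t + frac_norm 1 v t"
      using assms by (intro frac_norm_diff_le tame_smeas) auto
    also have "\<dots> \<le> ennreal K + ennreal L" by (intro add_mono K L)
    finally show ?thesis using K L by simp
  qed
  then show ?thesis using K L assms unfolding tame_def
    by (intro conjI smeas_diff exI[of _ "K + L"]) auto
qed

lemma tame_shift: "tame v \<Longrightarrow> tame (\<lambda>x. v (x - c))"
proof -
  assume v: "tame v"
  have "smeas borel (\<lambda>x. v (x - c))" by (rule smeas_compose[OF tame_smeas[OF v]]) simp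
  moreover have "frac_norm 1 (\<lambda>x. v (x - c)) t = frac_norm 1 v (t - c)" for t
    using frac_norm_shift[of 1 v "- c" t] by simp
  ultimately show ?thesis using v by (auto simp: tame_def)
qed

text \<open>The damped kernel of order \<open>1\<close> is bounded below on bounded intervals.\<close>

lemma tame_local:
  assumes "tame v"
  shows "\<exists>K\<ge>0. \<forall>a b. (\<integral>\<^sup>+x. indicator {a..b} x * ennreal (norm (v x)) \<partial>lborel) \<le> ennreal (exp (w * (b - a)) * K)"
proof -
  obtain K where K: "0 \<le> K" "\<And>t. frac_norm 1 v t \<le> ennreal K" using assms by (auto simp: tame_def)
  have [measurable]: "(\<lambda>x. norm (v x)) \<in> borel_measurable borel" by (rule smeas_norm[OF tame_smeas[OF assms]])
  have "(\<integral>\<^sup>+x. indicator {a..b} x * ennreal (norm (v x)) \<partial>lborel) \<le> ennreal (exp (w * (b - a)) * K)" for a b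
  proof -
    let ?F = "\<lambda>x. ennreal (exp (w * (b - a))) * ennreal (frac_kernel 1 (b - x) * exp (- w * (b - x)) * norm (v x))"
    have "(\<integral>\<^sup>+x. indicator {a..b} x * ennreal (norm (v x)) \<partial>lborel) \<le> (\<integral>\<^sup>+x. ?F x \<partial>lborel)"
    proof (rule nn_integral_mono_AE, use AE_lborel_singleton[of b] in eventually_elim)
      case (elim x)
      show ?case
      proof (cases "x \<in> {a..b}")
        case True
        then have "w * (b - x) \<le> w * (b - a)" using w by (intro mult_left_mono) auto
        then have "1 * norm (v x) \<le> exp (w * (b - a) - w * (b - x)) * norm (v x)"
          by (intro mult_right_mono) auto
        also have "exp (w * (b - a) - w * (b - x)) = exp (w * (b - a)) * exp (- w * (b - x))"
          by (simp add: exp_diff exp_minus field_simps)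
        finally have "norm (v x) \<le> exp (w * (b - a)) * (frac_kernel 1 (b - x) * exp (- w * (b - x)) * norm (v x))"
          using True elim by (simp add: frac_kernel_1 mult.assoc)
        then show ?thesis using True
          by (subst ennreal_mult'[symmetric]) (auto intro!: ennreal_leI)
      qed simp
    qed
    also have "\<dots> = ennreal (exp (w * (b - a))) * (\<integral>\<^sup>+x. ennreal (frac_kernel 1 (b - x) * exp (- w * (b - x)) * norm (v x)) \<partial>lborel)"
      by (rule nn_integral_cmult) measurable
    also have "(\<integral>\<^sup>+x. ennreal (frac_kernel 1 (b - x) * exp (- w * (b - x)) * norm (v x)) \<partial>lborel) = frac_norm 1 v b"
      unfolding frac_norm_def
      using nn_integral_lborel_reflect[of "\<lambda>x. ennreal (frac_kernel 1 (b - x) * exp (- w * (b - x)) * norm (v x))" b] by simp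
    also have "ennreal (exp (w * (b - a))) * frac_norm 1 v b \<le> ennreal (exp (w * (b - a))) * ennreal K"
      by (intro mult_left_mono K) simp
    finally show ?thesis using K by (simp add: ennreal_mult)
  qed
  then show ?thesis using K(1) by blast
qed

lemma tame_locally_integrable:
  "tame v \<Longrightarrow> (\<integral>\<^sup>+x. indicator {a..b} x * ennreal (norm (v x)) \<partial>lborel) < \<infinity>"
  using tame_local by (metis ennreal_less_top infinity_ennreal_def le_less_trans)

lemma tame_antiderivative:
  assumes "tame v"
  obtains N where "antiderivative v N"
  using antiderivative_exists[OF tame_smeas[OF assms] tame_locally_integrable[OF assms]] by blast

end

context generated_semigroup
begin

text \<open>If \<open>v'\<close> is the derivative of \<open>V\<close> and \<open>f = v' + A V\<close>, then \<open>potential (f - v') = V\<close>, since the potential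
  inverts \<open>A\<close>; the integration by parts turns this into equality of the potentials of \<open>V\<close> and of the
  fractional integral of \<open>f\<close>.\<close>

theorem parabolic_left_inverse:
  assumes f: "tame f" and v': "tame v'" and V: "antiderivative v' V" "tame V"
    and eq: "AE x in lborel. V x \<in> D \<and> A (V x) = f x - v' x"
  shows "V t = frac_integral S 1 f t"
proof -
  have P: "AE x in lborel. potential (f x - v' x) = V x"
    using eq by eventually_elim (metis potential_generator(1))
  have d: "tame (\<lambda>x. f x - v' x)" by (rule tame_diff[OF f v'])
  have P_fin: "frac_norm 1 (\<lambda>x. potential (f x - v' x)) t < \<infinity>"
    unfolding frac_norm_cong_AE[OF P] by (rule tame_finite[OF V(2)])
  have "potential (frac_integral S 1 f t) - potential (frac_integral S 1 v' t)
      = potential (frac_integral S 1 (\<lambda>x. f x - v' x) t)"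
    using frac_integral_diff[OF zero_less_one tame_smeas[OF f] tame_smeas[OF v'] tame_finite[OF f] tame_finite[OF v'] tame_finite[OF d]]
    by (simp add: blinfun.diff_right)
  also have "\<dots> = frac_integral S 1 (\<lambda>x. potential (f x - v' x)) t"
    by (rule potential_frac_integral[OF zero_less_one tame_smeas[OF d] tame_finite[OF d] P_fin])
  also have "\<dots> = frac_integral S 1 V t"
    by (rule frac_integral_cong_history) (use P in \<open>auto elim: eventually_mono\<close>)
  finally have "potential (frac_integral S 1 f t) = frac_integral S 1 V t + potential (frac_integral S 1 v' t)"
    by (simp add: algebra_simps)
  also have "\<dots> = potential (V t)"
    using potential_frac_integral_derivative[OF tame_smeas[OF v'] V(1) tame_finite[OF v'] tame_finite[OF V(2)]] by simp
  finally have "potential (V t - frac_integral S 1 f t) = 0" by (simp add: blinfun.diff_right)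
  then show ?thesis using potential_generator(2) by fastforce
qed

text \<open>Integrals of \<open>z\<close> over intervals of a fixed length \<open>c\<close> again have vanishing fractional integral, by
  Fubini, and so has their derivative \<open>z - z (\<cdot> - c)\<close>; integration by parts then says that their
  potential vanishes.\<close>

theorem frac_integral_1_injective:
  assumes z: "tame z" and zero: "\<And>t. frac_integral S 1 z t = 0"
  shows "AE x in lborel. z x = 0"
proof -
  obtain N where N: "antiderivative z N" by (rule tame_antiderivative[OF z])
  have k: "0 \<le> frac_kernel 1 r" for r by (rule frac_kernel_nonneg) simp
  obtain K where K: "0 \<le> K" "\<And>t. frac_norm 1 z t \<le> ennreal K" using z by (auto simp: tame_def)
  obtain L where L: "0 \<le> L" "\<And>a b. (\<integral>\<^sup>+x. indicator {a..b} x * ennreal (norm (z x)) \<partial>lborel) \<le> ennreal (exp (w * (b - a)) * L)"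
    using tame_local[OF z] by blast
  have V0: "N t - N (t - c) = 0" if c: "0 < c" for c t
  proof -
    define V where "V x = N x - N (x - c)" for x
    let ?v = "\<lambda>x. z x - z (x - c)"
    have V: "antiderivative ?v V"
      unfolding V_def by (intro antiderivative_diff antiderivative_shift N)
    have v: "tame ?v" by (intro tame_diff z tame_shift)
    have VM: "smeas borel V" by (rule smeas_continuous[OF antiderivativeD(1)[OF V]])
    have V_le: "norm (V x) \<le> exp (w * c) * L" for x
    proof -
      obtain \<psi> :: "'a \<Rightarrow>\<^sub>L real" where \<psi>: "norm \<psi> \<le> 1" "\<psi> (V x) = norm (V x)" by (rule norming_functional)
      have \<psi>_le: "\<bar>\<psi> y\<bar> \<le> norm y" for y
        using norm_blinfun[of \<psi> y] mult_right_mono[OF \<psi>(1), of "norm y"] by simp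
      have h: "has_bochner_integral lborel (\<lambda>y. indicator {x - c<..x} y * \<psi> (z y)) (norm (V x))"
        using antiderivativeD(2)[OF N, of "x - c" x \<psi>] c \<psi>(2) by (simp add: V_def)
      have "ennreal (norm (V x)) \<le> (\<integral>\<^sup>+y. ennreal (norm (indicator {x - c<..x} y * \<psi> (z y))) \<partial>lborel)"
        using integral_norm_bound_ennreal[of lborel "\<lambda>y. indicator {x - c<..x} y * \<psi> (z y)"] h
        by (simp add: has_bochner_integral_iff)
      also have "\<dots> \<le> (\<integral>\<^sup>+y. indicator {x - c..x} y * ennreal (norm (z y)) \<partial>lborel)"
        by (intro nn_integral_mono) (auto simp: indicator_def \<psi>_le intro: ennreal_leI)
      also have "\<dots> \<le> ennreal (exp (w * c) * L)" using L(2)[of "x - c" x] by simp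
      finally show ?thesis using L(1) by simp
    qed
    have Vt: "tame V" by (rule tame_bounded[OF VM V_le])
    have "frac_integral S 1 V t = 0"
    proof (rule functionals_separate)
      fix \<psi> :: "'a \<Rightarrow>\<^sub>L real"
      let ?G = "\<lambda>r y. frac_kernel 1 r * (indicator {t - c<..t} y * \<psi> (Sp r (z (y - r))))"
      have [measurable]: "(\<lambda>q. \<psi> (Sp (fst q) (z (snd q - fst q)))) \<in> borel_measurable (lborel \<Otimes>\<^sub>M lborel)"
        by (intro smeas_functional Sp_apply_smeas smeas_compose[OF tame_smeas[OF z]]) measurable
      have Gm: "case_prod ?G \<in> borel_measurable (lborel \<Otimes>\<^sub>M lborel)"
        unfolding split_beta' by measurable
      have "(\<integral>\<^sup>+q. ennreal (norm (case_prod ?G q)) \<partial>(lborel \<Otimes>\<^sub>M lborel))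
          = (\<integral>\<^sup>+y. (\<integral>\<^sup>+r. ennreal (norm (?G r y)) \<partial>lborel) \<partial>lborel)"
        using Gm by (subst lborel_pair.nn_integral_snd[symmetric]) (auto simp: split_beta')
      also have "\<dots> \<le> (\<integral>\<^sup>+y. ennreal (norm \<psi> * M * K) * indicator {t - c<..t} y \<partial>lborel)"
      proof (rule nn_integral_mono)
        fix y
        have [measurable]: "(\<lambda>r. norm (z (y - r))) \<in> borel_measurable borel"
          by (rule smeas_norm[OF smeas_compose[OF tame_smeas[OF z]]]) simp
        have "(\<integral>\<^sup>+r. ennreal (norm (?G r y)) \<partial>lborel) \<le>
           (\<integral>\<^sup>+r. (ennreal (norm \<psi> * M) * indicator {t - c<..t} y) * ennreal (frac_kernel 1 r * exp (- w * r) * norm (z (y - r))) \<partial>lborel)"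
        proof (rule nn_integral_mono)
          fix r
          have "norm (frac_kernel 1 r * \<psi> (Sp r (z (y - r)))) \<le> frac_kernel 1 r * (norm \<psi> * M * exp (- w * r) * norm (z (y - r)))"
            using k unfolding real_norm_def abs_mult by (intro mult_mono abs_functional_Sp_le) auto
          also have "\<dots> = (norm \<psi> * M) * (frac_kernel 1 r * exp (- w * r) * norm (z (y - r)))" by (simp add: mult_ac)
          finally have "ennreal (norm (frac_kernel 1 r * \<psi> (Sp r (z (y - r))))) \<le> ennreal \<dots>" by (rule ennreal_leI)
          also have "\<dots> = ennreal (norm \<psi> * M) * ennreal (frac_kernel 1 r * exp (- w * r) * norm (z (y - r)))"
            using M by (intro ennreal_mult') simp
          finally show "ennreal (norm (?G r y)) \<le> (ennreal (norm \<psi> * M) * indicator {t - c<..t} y) * ennreal (frac_kernel 1 r * exp (- w * r) * norm (z (y - r)))"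
            by (auto simp: indicator_def)
        qed
        also have "\<dots> = (ennreal (norm \<psi> * M) * indicator {t - c<..t} y) * frac_norm 1 z y"
          unfolding frac_norm_def by (rule nn_integral_cmult) measurable
        also have "\<dots> \<le> (ennreal (norm \<psi> * M) * indicator {t - c<..t} y) * ennreal K"
          by (intro mult_left_mono K) simp
        also have "\<dots> = ennreal (norm \<psi> * M * K) * indicator {t - c<..t} y"
          using M K by (auto simp: indicator_def ennreal_mult)
        finally show "(\<integral>\<^sup>+r. ennreal (norm (?G r y)) \<partial>lborel) \<le> ennreal (norm \<psi> * M * K) * indicator {t - c<..t} y" .
      qed
      also have "\<dots> < \<infinity>" using c by (simp add: nn_integral_cmult_indicator ennreal_mult_less_top)
      finally have int: "integrable (lborel \<Otimes>\<^sub>M lborel) (case_prod ?G)" by (intro integrableI_bounded Gm)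
      have "\<psi> (frac_integral S 1 V t) = (LINT r|lborel. frac_kernel 1 r * \<psi> (Sp r (V (t - r))))"
        using has_bochner_integral_integral_eq[OF frac_integral_functional(1)[OF zero_less_one VM _ tame_finite[OF Vt], of t V \<psi>]] by simp
      also have "\<dots> = (LINT r|lborel. (LINT y|lborel. ?G r y))"
      proof (rule Bochner_Integration.integral_cong)
        fix r
        have "(\<psi> o\<^sub>L Sp r) (V (t - r)) = (LINT x|lborel. indicator {t - r - c<..t - r} x * (\<psi> o\<^sub>L Sp r) (z x))"
          unfolding V_def using c by (intro has_bochner_integral_integral_eq[symmetric] antiderivativeD(2)[OF N]) simp
        also have "\<dots> = (LINT y|lborel. indicator {t - r - c<..t - r} (- r + 1 * y) * (\<psi> o\<^sub>L Sp r) (z (- r + 1 * y)))"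
          using lborel_integral_real_affine[of 1 "\<lambda>x. indicator {t - r - c<..t - r} x * (\<psi> o\<^sub>L Sp r) (z x)" "- r"] by simp
        also have "\<dots> = (LINT y|lborel. indicator {t - c<..t} y * \<psi> (Sp r (z (y - r))))"
          by (intro Bochner_Integration.integral_cong) (auto simp: indicator_def)
        finally show "frac_kernel 1 r * \<psi> (Sp r (V (t - r))) = (LINT y|lborel. ?G r y)" by simp
      qed simp
      also have "\<dots> = (LINT y|lborel. (LINT r|lborel. ?G r y))"
        by (rule lborel_pair.Fubini_integral[OF int, symmetric])
      also have "\<dots> = (LINT y|(lborel :: real measure). 0)"
      proof (rule Bochner_Integration.integral_cong)
        fix y
        have "(LINT r|lborel. ?G r y) = indicator {t - c<..t} y * (LINT r|lborel. frac_kernel 1 r * \<psi> (Sp r (z (y - r))))"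
          by (subst integral_mult_right_zero[symmetric]) (simp add: mult_ac)
        also have "(LINT r|lborel. frac_kernel 1 r * \<psi> (Sp r (z (y - r)))) = \<psi> (frac_integral S 1 z y)"
          by (rule has_bochner_integral_integral_eq, rule frac_integral_functional(1)[OF zero_less_one tame_smeas[OF z] _ tame_finite[OF z]]) simp
        finally show "(LINT r|lborel. ?G r y) = 0" by (simp add: zero blinfun.zero_right)
      qed simp
      finally show "\<psi> (frac_integral S 1 V t) = \<psi> 0" by (simp add: blinfun.zero_right)
    qed
    moreover have "frac_integral S 1 ?v t = 0"
    proof -
      have sh: "frac_integral S 1 (\<lambda>x. z (x - c)) t = frac_integral S 1 z (t - c)"
        using frac_integral_shift[of 1 z "- c" t] by simp
      show ?thesis
        using frac_integral_diff[OF zero_less_one tame_smeas[OF z] tame_smeas[OF tame_shift[OF z]] tame_finite[OF z]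
            tame_finite[OF tame_shift[OF z]] tame_finite[OF v]] by (simp add: sh zero)
    qed
    ultimately have "potential (V t) = 0"
      using potential_frac_integral_derivative[OF tame_smeas[OF v] V tame_finite[OF v] tame_finite[OF Vt], of t]
      by (simp add: blinfun.zero_right)
    then have "V t = 0" by (rule potential_generator(2))
    then show ?thesis by (simp add: V_def)
  qed
  show ?thesis
  proof (rule antiderivative_constant_AE_zero[OF tame_smeas[OF z] tame_locally_integrable[OF z] N])
    fix a b :: real assume "a < b"
    then show "N a = N b" using V0[of "b - a" b] by simp
  qed
qed

end

section \<open>Weak derivatives\<close>

lemma iterated_deriv_differentiable:
  fixes C :: "(real \<Rightarrow> real) set"
  assumes C: "\<And>f. f \<in> C \<Longrightarrow> \<exists>f'\<in>C. \<forall>x. (f has_real_derivative f' x) (at x)" and f: "f \<in> C"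
  shows "(deriv ^^ n) f differentiable (at x)"
  using f
proof (induction n arbitrary: f)
  case 0
  then obtain f' where "(f has_real_derivative f' x) (at x)" using C by blast
  then show ?case by (auto simp: real_differentiable_def)
next
  case (Suc n)
  then obtain f' where f': "f' \<in> C" "\<And>x. (f has_real_derivative f' x) (at x)" using C by blast
  have "deriv f = f'" using f'(2) by (intro ext DERIV_imp_deriv)
  then show ?case using Suc.IH[OF f'(1)] by (simp add: funpow_swap1)
qed

text \<open>The functions obtained from \<open>exp (- c / x)\<close> by repeated differentiation are among these.\<close>

definition flat :: "real \<Rightarrow> real poly \<Rightarrow> real \<Rightarrow> real" where
  "flat c p x = (if 0 < x then poly p (1 / x) * exp (- c / x) else 0)"

lemma poly_times_exp_tendsto_0:
  fixes p :: "real poly"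
  assumes c: "0 < c"
  shows "((\<lambda>y. poly p y * exp (- c * y)) \<longlongrightarrow> 0) at_top"
proof -
  have "((\<lambda>y. coeff p i / c ^ i * ((c * y) ^ i / exp (c * y))) \<longlongrightarrow> coeff p i / c ^ i * 0) at_top" for i
  proof (intro tendsto_intros)
    have "filterlim (\<lambda>y. c * y) at_top at_top"
      by (rule filterlim_tendsto_pos_mult_at_top[OF tendsto_const c filterlim_ident])
    then show "((\<lambda>y. (c * y) ^ i / exp (c * y)) \<longlongrightarrow> 0) at_top"
      by (rule filterlim_compose[OF tendsto_power_div_exp_0])
  qed
  then have "((\<lambda>y. \<Sum>i\<le>degree p. coeff p i / c ^ i * ((c * y) ^ i / exp (c * y))) \<longlongrightarrow> (\<Sum>i\<le>degree p. coeff p i / c ^ i * 0)) at_top"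
    by (intro tendsto_sum)
  moreover have "(\<Sum>i\<le>degree p. coeff p i / c ^ i * ((c * y) ^ i / exp (c * y))) = poly p y * exp (- c * y)" for y
  proof -
    have "coeff p i / c ^ i * ((c * y) ^ i / exp (c * y)) = coeff p i * y ^ i * exp (- c * y)" for i
      using c by (simp add: power_mult_distrib exp_minus divide_inverse)
    then show ?thesis by (simp only: poly_altdef sum_distrib_right)
  qed
  ultimately show ?thesis by simp
qed

lemma flat_has_derivative:
  assumes c: "0 < c"
  shows "(flat c p has_real_derivative flat c ([:0, 0, 1:] * (smult c p - pderiv p)) x) (at x)"
proof -
  consider "x > 0" | "x < 0" | "x = 0" by linarith
  then show ?thesis
  proof cases
    case 1
    have "((\<lambda>x. poly p (1 / x) * exp (- c / x)) has_real_derivative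
        poly p (1 / x) * (exp (- c / x) * (c / x\<^sup>2)) + poly (pderiv p) (1 / x) * (- 1 / x\<^sup>2) * exp (- c / x)) (at x)"
      using 1 by (auto intro!: derivative_eq_intros DERIV_chain'[where g="poly p", OF _ poly_DERIV]
          simp: power2_eq_square field_simps)
    also have "poly p (1 / x) * (exp (- c / x) * (c / x\<^sup>2)) + poly (pderiv p) (1 / x) * (- 1 / x\<^sup>2) * exp (- c / x)
       = flat c ([:0, 0, 1:] * (smult c p - pderiv p)) x"
      using 1 by (simp add: flat_def power2_eq_square field_simps)
    finally show ?thesis
      by (rule has_field_derivative_transform_within_open[of _ _ _ "{0<..}"]) (use 1 in \<open>auto simp: flat_def\<close>)
  next
    case 2
    have "((\<lambda>x. 0) has_real_derivative 0) (at x)" by simp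
    then have "(flat c p has_real_derivative 0) (at x)"
      by (rule has_field_derivative_transform_within_open[of _ _ _ "{..<0}"]) (use 2 in \<open>auto simp: flat_def\<close>)
    then show ?thesis using 2 by (simp add: flat_def)
  next
    case 3
    have "((\<lambda>y. flat c p y / y) \<longlongrightarrow> 0) (at_right 0)"
    proof -
      have "((\<lambda>x. poly (pCons 0 p) (inverse x) * exp (- c * inverse x)) \<longlongrightarrow> 0) (at_right 0)"
        by (rule filterlim_compose[OF poly_times_exp_tendsto_0[OF c] filterlim_inverse_at_top_right])
      then show ?thesis
        by (rule Lim_transform_eventually) (auto simp: eventually_at_right_field flat_def field_simps intro!: exI[of _ 1])
    qed
    moreover have "((\<lambda>y. flat c p y / y) \<longlongrightarrow> 0) (at_left 0)"
      by (rule tendsto_eventually) (auto simp: eventually_at_left_field flat_def intro!: exI[of _ "-1"])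
    ultimately have "((\<lambda>y. flat c p y / y) \<longlongrightarrow> 0) (at 0)" by (simp add: filterlim_split_at)
    then show ?thesis using 3 by (simp add: has_field_derivative_iff flat_def)
  qed
qed

text \<open>Lists of polynomials make this class closed under differentiation, so that its members are smooth.\<close>

definition bump_sums :: "real \<Rightarrow> real \<Rightarrow> real \<Rightarrow> (real \<Rightarrow> real) set" where
  "bump_sums c a b = range (\<lambda>L x. \<Sum>(p, q)\<leftarrow>L. flat c p (x - a) * flat c q (b - x))"

lemma bump_sums_derivative:
  assumes c: "0 < c" and f: "f \<in> bump_sums c a b"
  shows "\<exists>f'\<in>bump_sums c a b. \<forall>x. (f has_real_derivative f' x) (at x)"
proof -
  let ?F = "\<lambda>L x. \<Sum>(p, q)\<leftarrow>L. flat c p (x - a) * flat c q (b - x)"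
  let ?d = "\<lambda>p. [:0, 0, 1:] * (smult c p - pderiv p)"
  have neg: "flat c (- p) x = - flat c p x" for p x by (simp add: flat_def)
  have "\<exists>L'. \<forall>x. (?F L has_real_derivative ?F L' x) (at x)" for L
  proof (induction L)
    case Nil
    show ?case by (intro exI[of _ "[]"]) simp
  next
    case (Cons pq L)
    then obtain L' where L': "\<And>x. (?F L has_real_derivative ?F L' x) (at x)" by blast
    obtain p q where pq: "pq = (p, q)" by (cases pq)
    have d1: "((\<lambda>x. flat c p (x - a)) has_real_derivative flat c (?d p) (x - a)) (at x)" for x
    proof -
      have "((\<lambda>x. x - a) has_real_derivative 1) (at x)" by (auto intro!: derivative_eq_intros)
      from DERIV_chain2[OF flat_has_derivative[OF c] this] show ?thesis by simp
    qed
    have d2: "((\<lambda>x. flat c q (b - x)) has_real_derivative flat c (- ?d q) (b - x)) (at x)" for x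
    proof -
      have "((\<lambda>x. b - x) has_real_derivative -1) (at x)" by (auto intro!: derivative_eq_intros)
      from DERIV_chain2[OF flat_has_derivative[OF c] this] show ?thesis unfolding neg by simp
    qed
    have "(?F (pq # L) has_real_derivative ?F ((?d p, q) # (p, - ?d q) # L') x) (at x)" for x
      using DERIV_add[OF DERIV_mult[OF d1[of x] d2[of x]] L'[of x]] by (simp add: pq algebra_simps)
    then show ?case by blast
  qed
  note step = this
  obtain L where L: "f = ?F L" using f by (auto simp: bump_sums_def)
  obtain L' where L': "\<forall>x. (?F L has_real_derivative ?F L' x) (at x)" using step by blast
  have "?F L' \<in> bump_sums c a b" unfolding bump_sums_def by (rule rangeI)
  with L' show ?thesis unfolding L by (rule bexI)
qed

text \<open>A smooth function that is positive exactly on \<open>{a<..<b}\<close>; it tends to the indicator of this interval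
  for \<open>c \<rightarrow> 0\<close>.\<close>

definition bump :: "real \<Rightarrow> real \<Rightarrow> real \<Rightarrow> real \<Rightarrow> real" where
  "bump c a b x = flat c 1 (x - a) * flat c 1 (b - x)"

lemma bump_in: "bump c a b \<in> bump_sums c a b"
  unfolding bump_sums_def by (rule image_eqI[of _ _ "[(1, 1)]"]) (auto simp: bump_def)

lemma bump_props:
  assumes c: "0 < c"
  shows "continuous_on UNIV (bump c a b)" and "0 \<le> bump c a b x" and "bump c a b x \<le> indicator {a<..<b} x"
proof -
  obtain f' where "\<And>x. (bump c a b has_real_derivative f' x) (at x)"
    using bump_sums_derivative[OF c bump_in] by blast
  then show "continuous_on UNIV (bump c a b)" by (auto intro!: DERIV_continuous_on)
  have "0 \<le> flat c 1 x" "flat c 1 x \<le> 1" for x using c by (auto simp: flat_def)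
  then show "0 \<le> bump c a b x" "bump c a b x \<le> indicator {a<..<b} x"
    by (auto simp: bump_def indicator_def intro: mult_le_one) (auto simp: flat_def)
qed

lemma bump_tendsto_indicator: "(\<lambda>n. bump (1 / real (Suc n)) a b x) \<longlonglongrightarrow> indicator {a<..<b} x"
proof (cases "x \<in> {a<..<b}")
  case True
  have e: "(\<lambda>n. exp (- (1 / real (Suc n)) / y)) \<longlonglongrightarrow> exp (- 0 / y)" if "0 < y" for y
    by (intro tendsto_intros LIMSEQ_Suc[OF lim_1_over_n]) (use that in auto)
  have "(\<lambda>n. exp (- (1 / real (Suc n)) / (x - a)) * exp (- (1 / real (Suc n)) / (b - x))) \<longlonglongrightarrow> exp (- 0 / (x - a)) * exp (- 0 / (b - x))"
    using True by (intro tendsto_mult e) auto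
  then show ?thesis using True by (simp add: bump_def flat_def)
qed (auto simp: bump_def flat_def)

text \<open>An antiderivative \<open>E\<close> of a bump is constant on both sides of the bump, so that its increments over the
  length \<open>r\<close> have compact support. Testing a weak derivative with them amounts to testing increments of
  the function with the bump itself.\<close>

lemma bump_increment_test_function:
  assumes c: "0 < c" and r: "0 < r" and E: "\<And>x. (E has_real_derivative bump c a b x) (at x)"
  defines "H \<equiv> \<lambda>x. E x - E (x + r)"
  shows "test_function UNIV H" and "deriv H = (\<lambda>x. bump c a b x - bump c a b (x + r))"
proof -
  have dH: "(H has_real_derivative bump c a b x - bump c a b (x + r)) (at x)" for x
  proof -
    have "((\<lambda>x. x + r) has_real_derivative 1) (at x)" by (auto intro!: derivative_eq_intros)
    from DERIV_diff[OF E DERIV_chain2[OF E this]] show ?thesis unfolding H_def by simp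
  qed
  then show "deriv H = (\<lambda>x. bump c a b x - bump c a b (x + r))" by (intro ext DERIV_imp_deriv)
  let ?C = "insert H {\<lambda>x. f x - g (x + r) | f g. f \<in> bump_sums c a b \<and> g \<in> bump_sums c a b}"
  have "\<exists>f'\<in>?C. \<forall>x. (f has_real_derivative f' x) (at x)" if "f \<in> ?C" for f
  proof (cases "f = H")
    case True
    then show ?thesis using dH bump_in
      by (intro bexI[of _ "\<lambda>x. bump c a b x - bump c a b (x + r)"]) blast+
  next
    case False
    then obtain g h where gh: "g \<in> bump_sums c a b" "h \<in> bump_sums c a b" "f = (\<lambda>x. g x - h (x + r))"
      using \<open>f \<in> ?C\<close> by blast
    obtain g' where g': "g' \<in> bump_sums c a b" "\<And>x. (g has_real_derivative g' x) (at x)"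
      using bump_sums_derivative[OF c gh(1)] by blast
    obtain h' where h': "h' \<in> bump_sums c a b" "\<And>x. (h has_real_derivative h' x) (at x)"
      using bump_sums_derivative[OF c gh(2)] by blast
    have "(f has_real_derivative g' x - h' (x + r)) (at x)" for x
    proof -
      have "((\<lambda>x. x + r) has_real_derivative 1) (at x)" by (auto intro!: derivative_eq_intros)
      from DERIV_diff[OF g'(2) DERIV_chain2[OF h'(2) this]] show ?thesis unfolding gh(3) by simp
    qed
    then show ?thesis using g'(1) h'(1) by (intro bexI[of _ "\<lambda>x. g' x - h' (x + r)"]) blast+
  qed
  then have smooth: "\<forall>n x. (deriv ^^ n) H differentiable (at x)"
    using iterated_deriv_differentiable[of ?C H] by blast
  have const: "E x = E y" if "\<And>z. z \<in> {x<..<y} \<Longrightarrow> bump c a b z = 0" "x < y" for x y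
  proof -
    have "continuous_on {x..y} E" using E by (intro DERIV_continuous_on) (auto intro: DERIV_subset)
    moreover have "(E has_real_derivative 0) (at z)" if "x < z" "z < y" for z
      using E[of z] that \<open>\<And>z. z \<in> {x<..<y} \<Longrightarrow> bump c a b z = 0\<close> by simp
    ultimately show ?thesis using \<open>x < y\<close> DERIV_isconst_end[of x y E] by simp
  qed
  have out: "bump c a b z = 0" if "z \<notin> {a<..<b}" for z
    using bump_props(2,3)[OF c, of a b z] that by simp
  have "H x = 0" if "x \<notin> {a - r..b}" for x
    unfolding H_def using that r by (subst const[of x "x + r"]) (auto intro!: out)
  then show "test_function UNIV H"
    unfolding test_function_def using smooth by (intro conjI exI[of _ "{a - r..b}"]) auto
qed

text \<open>Letting \<open>c\<close> tend to \<open>0\<close> in the bumps gives the integrals over intervals.\<close>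

lemma AE_zero_if_bump_integrals_zero:
  fixes f :: "real \<Rightarrow> real"
  assumes [measurable]: "f \<in> borel_measurable borel"
    and loc: "\<And>a b. (\<integral>\<^sup>+x. indicator {a..b} x * ennreal \<bar>f x\<bar> \<partial>lborel) < \<infinity>"
    and zero: "\<And>c a b. 0 < c \<Longrightarrow> (LINT x|lborel. bump c a b x * f x) = 0"
  shows "AE x in lborel. f x = 0"
proof (rule AE_zero_if_interval_integrals_zero[OF _ loc])
  fix a b :: real
  have [measurable]: "bump c a b \<in> borel_measurable borel" if "0 < c" for c
    by (rule borel_measurable_continuous_onI[OF bump_props(1)[OF that]])
  have "(\<lambda>n. LINT x|lborel. bump (1 / real (Suc n)) a b x * f x) \<longlonglongrightarrow> (LINT x|lborel. indicator {a<..<b} x * f x)"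
  proof (rule integral_dominated_convergence[where w="\<lambda>x. indicator {a..b} x * \<bar>f x\<bar>"])
    have "(\<integral>\<^sup>+x. ennreal (norm (indicator {a..b} x * \<bar>f x\<bar>)) \<partial>lborel) = (\<integral>\<^sup>+x. indicator {a..b} x * ennreal \<bar>f x\<bar> \<partial>lborel)"
      by (intro nn_integral_cong) (auto simp: indicator_def)
    then show "integrable lborel (\<lambda>x. indicator {a..b} x * \<bar>f x\<bar>)"
      using loc[of a b] by (intro integrableI_bounded) auto
    show "AE x in lborel. (\<lambda>n. bump (1 / real (Suc n)) a b x * f x) \<longlonglongrightarrow> indicator {a<..<b} x * f x"
      by (intro AE_I2 tendsto_mult tendsto_const bump_tendsto_indicator)
    show "AE x in lborel. norm (bump (1 / real (Suc n)) a b x * f x) \<le> indicator {a..b} x * \<bar>f x\<bar>" for n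
    proof (rule AE_I2)
      fix x
      have "\<bar>bump (1 / real (Suc n)) a b x\<bar> \<le> indicator {a..b} x"
        using bump_props(2,3)[of "1 / real (Suc n)" a b x]
        by (cases "x \<in> {a<..<b}") (auto simp: indicator_def)
      then show "norm (bump (1 / real (Suc n)) a b x * f x) \<le> indicator {a..b} x * \<bar>f x\<bar>"
        by (simp add: abs_mult mult_right_mono)
    qed
  qed measurable
  then have "(LINT x|lborel. indicator {a<..<b} x * f x) = 0"
    using zero by (simp add: LIMSEQ_const_iff)
  moreover have "(LINT x|lborel. indicator {a<..b} x * f x) = (LINT x|lborel. indicator {a<..<b} x * f x)"
    by (rule integral_cong_AE) (use AE_lborel_singleton[of b] in \<open>auto elim!: eventually_mono simp: indicator_def\<close>)
  ultimately show "(LINT x|lborel. indicator {a<..b} x * f x) = 0" by simp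
qed measurable

text \<open>Let \<open>N\<close> be an antiderivative of \<open>m'\<close> and \<open>y = m - N\<close>. Testing with increments of antiderivatives of bumps
  shows that, for every \<open>r\<close>, the increments of \<open>y\<close> over the length \<open>r\<close> vanish almost everywhere. By Fubini
  there is a point \<open>t0\<close> such that \<open>y t0 = y (t0 - r)\<close> for almost every \<open>r\<close>, so that \<open>y\<close> is constant almost
  everywhere.\<close>

theorem weak_derivative_antiderivative:
  fixes m m' :: "real \<Rightarrow> 'a::banach"
  assumes m: "smeas borel m" and m': "smeas borel m'"
    and loc: "\<And>a b. (\<integral>\<^sup>+x. indicator {a..b} x * ennreal (norm (m x)) \<partial>lborel) < \<infinity>"
    and loc': "\<And>a b. (\<integral>\<^sup>+x. indicator {a..b} x * ennreal (norm (m' x)) \<partial>lborel) < \<infinity>"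
    and weak: "\<And>\<phi> (\<psi> :: 'a \<Rightarrow>\<^sub>L real). test_function UNIV \<phi> \<Longrightarrow>
      (LINT t|lborel. deriv \<phi> t * \<psi> (m t)) = - (LINT t|lborel. \<phi> t * \<psi> (m' t))"
  obtains V where "antiderivative m' V" "AE t in lborel. m t = V t"
proof -
  obtain N where N: "antiderivative m' N" by (rule antiderivative_exists[OF m' loc'])
  have NM: "smeas borel N" by (rule smeas_continuous[OF antiderivativeD(1)[OF N]])
  define y where "y t = m t - N t" for t
  have y: "smeas borel y" unfolding y_def by (intro smeas_diff m NM)
  have [measurable]: "(\<lambda>t. norm (m t)) \<in> borel_measurable borel" by (rule smeas_norm[OF m])
  have loc_\<psi>: "(\<integral>\<^sup>+x. indicator {a..b} x * ennreal \<bar>\<psi> (u x)\<bar> \<partial>lborel) < \<infinity>"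
    if u: "smeas borel u" "(\<integral>\<^sup>+x. indicator {a..b} x * ennreal (norm (u x)) \<partial>lborel) < \<infinity>"
    for u :: "real \<Rightarrow> 'a" and \<psi> :: "'a \<Rightarrow>\<^sub>L real" and a b
  proof -
    have [measurable]: "(\<lambda>t. norm (u t)) \<in> borel_measurable borel" by (rule smeas_norm[OF u(1)])
    have "(\<integral>\<^sup>+x. indicator {a..b} x * ennreal \<bar>\<psi> (u x)\<bar> \<partial>lborel)
       \<le> (\<integral>\<^sup>+x. ennreal (norm \<psi>) * (indicator {a..b} x * ennreal (norm (u x))) \<partial>lborel)"
      using norm_blinfun[of \<psi>]
      by (intro nn_integral_mono) (auto simp: indicator_def ennreal_leI simp flip: ennreal_mult)
    also have "\<dots> < \<infinity>" using u(2) by (simp add: nn_integral_cmult ennreal_mult_less_top)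
    finally show ?thesis .
  qed
  have int_prod: "integrable lborel (\<lambda>x. \<eta> x * u x)"
    if "continuous_on UNIV \<eta>" "\<And>x. x \<notin> {a..b} \<Longrightarrow> \<eta> x = 0" "u \<in> borel_measurable borel"
      "(\<integral>\<^sup>+x. indicator {a..b} x * ennreal \<bar>u x\<bar> \<partial>lborel) < \<infinity>"
    for \<eta> u :: "real \<Rightarrow> real" and a b
  proof (rule integrableI_bounded)
    have [measurable]: "\<eta> \<in> borel_measurable borel" "u \<in> borel_measurable borel"
      using that by (auto intro: borel_measurable_continuous_onI)
    show "(\<lambda>x. \<eta> x * u x) \<in> borel_measurable lborel" by measurable
    have "compact (\<eta> ` {a..b})" using that(1) by (intro compact_continuous_image) (auto intro: continuous_on_subset)
    then obtain B where B: "\<And>x. x \<in> {a..b} \<Longrightarrow> \<bar>\<eta> x\<bar> \<le> B" using compact_imp_bounded bounded_iff by (metis imageI real_norm_def)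
    have "(\<integral>\<^sup>+x. ennreal (norm (\<eta> x * u x)) \<partial>lborel) \<le> (\<integral>\<^sup>+x. ennreal \<bar>B\<bar> * (indicator {a..b} x * ennreal \<bar>u x\<bar>) \<partial>lborel)"
    proof (rule nn_integral_mono)
      fix x
      show "ennreal (norm (\<eta> x * u x)) \<le> ennreal \<bar>B\<bar> * (indicator {a..b} x * ennreal \<bar>u x\<bar>)"
      proof (cases "x \<in> {a..b}")
        case True
        then have "\<bar>\<eta> x\<bar> * \<bar>u x\<bar> \<le> \<bar>B\<bar> * \<bar>u x\<bar>" using B[of x] by (intro mult_right_mono) auto
        then show ?thesis using True by (simp add: abs_mult ennreal_leI flip: ennreal_mult)
      qed (use that(2) in simp)
    qed
    also have "\<dots> < \<infinity>" using that(4) by (simp add: nn_integral_cmult ennreal_mult_less_top)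
    finally show "(\<integral>\<^sup>+x. ennreal (norm (\<eta> x * u x)) \<partial>lborel) < \<infinity>" .
  qed
  have incr: "AE t in lborel. y t - y (t - r) = 0" if r: "0 < r" for r
  proof (rule smeas_AE_zero)
    show "smeas lborel (\<lambda>t. y t - y (t - r))" unfolding smeas_lborel by (intro smeas_diff y smeas_compose[OF y]) simp
    fix \<psi> :: "'a \<Rightarrow>\<^sub>L real"
    have [measurable]: "(\<lambda>t. \<psi> (m t)) \<in> borel_measurable borel" "(\<lambda>t. \<psi> (m' t)) \<in> borel_measurable borel"
        "(\<lambda>t. \<psi> (N t)) \<in> borel_measurable borel" "(\<lambda>t. \<psi> (m (t - r))) \<in> borel_measurable borel"
        "(\<lambda>t. \<psi> (N (t - r))) \<in> borel_measurable borel"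
      by (intro smeas_functional m m' NM smeas_compose[OF m] smeas_compose[OF NM]; simp)+
    define P where "P t = \<psi> (m t) - \<psi> (m (t - r))" for t
    define Q where "Q t = \<psi> (N t) - \<psi> (N (t - r))" for t
    have [measurable]: "P \<in> borel_measurable borel" "Q \<in> borel_measurable borel"
      unfolding P_def Q_def by measurable
    have Q_cont: "continuous_on UNIV Q" unfolding Q_def
      by (intro continuous_intros continuous_on_compose2[OF antiderivativeD(1)[OF N]]
          continuous_on_compose2[OF linear_continuous_on[OF blinfun.bounded_linear_right]] antiderivativeD(1)[OF N]) auto
    have loc_m: "(\<integral>\<^sup>+x. indicator {a..b} x * ennreal \<bar>\<psi> (m x)\<bar> \<partial>lborel) < \<infinity>" for a b
      by (rule loc_\<psi>[OF m loc])
    have loc_mr: "(\<integral>\<^sup>+x. indicator {a..b} x * ennreal \<bar>\<psi> (m (x - r))\<bar> \<partial>lborel) < \<infinity>" for a b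
    proof -
      have "(\<integral>\<^sup>+x. indicator {a..b} x * ennreal \<bar>\<psi> (m (x - r))\<bar> \<partial>lborel) = (\<integral>\<^sup>+x. indicator {a - r..b - r} (x + - r) * ennreal \<bar>\<psi> (m (x + - r))\<bar> \<partial>lborel)"
        by (intro nn_integral_cong) (auto simp: indicator_def)
      also have "\<dots> = (\<integral>\<^sup>+x. indicator {a - r..b - r} x * ennreal \<bar>\<psi> (m x)\<bar> \<partial>lborel)"
        by (rule nn_integral_lborel_shift) measurable
      finally show ?thesis using loc_m by simp
    qed
    have loc_Q: "(\<integral>\<^sup>+x. indicator {a..b} x * ennreal \<bar>Q x\<bar> \<partial>lborel) < \<infinity>" for a b
    proof -
      have "compact (Q ` {a..b})" using Q_cont by (intro compact_continuous_image) (auto intro: continuous_on_subset)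
      then obtain B where B: "\<And>x. x \<in> {a..b} \<Longrightarrow> \<bar>Q x\<bar> \<le> B" using compact_imp_bounded bounded_iff by (metis imageI real_norm_def)
      have "(\<integral>\<^sup>+x. indicator {a..b} x * ennreal \<bar>Q x\<bar> \<partial>lborel) \<le> (\<integral>\<^sup>+x. ennreal B * indicator {a..b} x \<partial>lborel)"
        using B by (intro nn_integral_mono) (auto simp: indicator_def intro: ennreal_leI)
      also have "\<dots> < \<infinity>" by (cases "a \<le> b") (auto simp: nn_integral_cmult_indicator ennreal_mult_less_top)
      finally show ?thesis .
    qed
    have "AE t in lborel. P t - Q t = 0"
    proof (rule AE_zero_if_bump_integrals_zero)
      fix a b
      have "(\<integral>\<^sup>+x. indicator {a..b} x * ennreal \<bar>P x - Q x\<bar> \<partial>lborel)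
         \<le> (\<integral>\<^sup>+x. indicator {a..b} x * ennreal \<bar>\<psi> (m x)\<bar> + (indicator {a..b} x * ennreal \<bar>\<psi> (m (x - r))\<bar> + indicator {a..b} x * ennreal \<bar>Q x\<bar>) \<partial>lborel)"
        by (intro nn_integral_mono) (auto simp: indicator_def P_def simp flip: ennreal_plus intro!: ennreal_leI)
      also have "\<dots> = (\<integral>\<^sup>+x. indicator {a..b} x * ennreal \<bar>\<psi> (m x)\<bar> \<partial>lborel) +
          ((\<integral>\<^sup>+x. indicator {a..b} x * ennreal \<bar>\<psi> (m (x - r))\<bar> \<partial>lborel) + (\<integral>\<^sup>+x. indicator {a..b} x * ennreal \<bar>Q x\<bar> \<partial>lborel))"
        by (subst nn_integral_add, measurable, subst nn_integral_add) auto
      also have "\<dots> < \<infinity>" using loc_m loc_mr loc_Q by (simp add: less_top)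
      finally show "(\<integral>\<^sup>+x. indicator {a..b} x * ennreal \<bar>P x - Q x\<bar> \<partial>lborel) < \<infinity>" .
    next
      fix c a b :: real assume c: "0 < c"
      let ?\<eta> = "bump c a b"
      have \<eta>_cont: "continuous_on UNIV ?\<eta>" by (rule bump_props(1)[OF c])
      have [measurable]: "?\<eta> \<in> borel_measurable borel" by (rule borel_measurable_continuous_onI[OF \<eta>_cont])
      have \<eta>_out: "?\<eta> x = 0" if "x \<notin> {a..b}" for x
        using bump_props(2,3)[OF c, of a b x] that by (auto simp: indicator_def)
      have \<eta>_nn: "0 \<le> ?\<eta> x" and \<eta>_le: "?\<eta> x \<le> indicator {a..b} x" for x
        using bump_props(2,3)[OF c, of a b x] by (cases "x \<in> {a<..<b}"; auto simp: indicator_def)+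
      obtain E where E: "\<And>x. (E has_real_derivative ?\<eta> x) (at x)"
      proof -
        have "\<exists>F. \<forall>x::real. ereal x < \<infinity> \<longrightarrow> - \<infinity> < ereal x \<longrightarrow> (F has_vector_derivative ?\<eta> x) (at x)"
          using einterval_antiderivative[of "-\<infinity>" "\<infinity>" ?\<eta>] \<eta>_cont by (auto simp: continuous_on_eq_continuous_at)
        then show ?thesis using that by (auto simp: has_real_derivative_iff_has_vector_derivative)
      qed
      define H where "H x = E x - E (x + r)" for x
      have T: "test_function UNIV H" "deriv H = (\<lambda>x. ?\<eta> x - ?\<eta> (x + r))"
        using bump_increment_test_function[OF c r E] unfolding H_def[abs_def] by auto
      have H_eq: "H t = - (LINT x|lborel. indicator {t..t + r} x * ?\<eta> x)" for t
      proof -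
        have "(LINT x|lborel. ?\<eta> x * indicator {t..t + r} x) = E (t + r) - E t"
          using r E \<eta>_cont by (intro integral_FTC_Icc_real) (auto simp: continuous_on_eq_continuous_at)
        then show ?thesis by (simp add: H_def mult.commute)
      qed
      have "(LINT t|lborel. ?\<eta> t * P t) = (LINT t|lborel. ?\<eta> t * \<psi> (m t)) - (LINT t|lborel. ?\<eta> t * \<psi> (m (t - r)))"
        unfolding P_def right_diff_distrib
        by (intro Bochner_Integration.integral_diff int_prod[OF \<eta>_cont \<eta>_out _ loc_m] int_prod[OF \<eta>_cont \<eta>_out _ loc_mr]) auto
      also have "(LINT t|lborel. ?\<eta> t * \<psi> (m (t - r))) = (LINT t|lborel. ?\<eta> (t + r) * \<psi> (m t))"
        using lborel_integral_real_affine[of 1 "\<lambda>t. ?\<eta> t * \<psi> (m (t - r))" r] by (simp add: add.commute)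
      also have "(LINT t|lborel. ?\<eta> t * \<psi> (m t)) - (LINT t|lborel. ?\<eta> (t + r) * \<psi> (m t)) = (LINT t|lborel. deriv H t * \<psi> (m t))"
        unfolding T(2) left_diff_distrib
      proof (rule Bochner_Integration.integral_diff[symmetric])
        show "integrable lborel (\<lambda>t. ?\<eta> t * \<psi> (m t))" by (rule int_prod[OF \<eta>_cont \<eta>_out _ loc_m]) auto
        have "continuous_on UNIV (\<lambda>t. ?\<eta> (t + r))"
          by (rule continuous_on_compose2[OF \<eta>_cont]) (auto intro!: continuous_intros)
        then show "integrable lborel (\<lambda>t. ?\<eta> (t + r) * \<psi> (m t))"
          by (rule int_prod[where a="a - r" and b="b - r"]) (use loc_m[of "a - r" "b - r"] in \<open>auto intro!: \<eta>_out\<close>)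
      qed
      also have "\<dots> = - (LINT t|lborel. H t * \<psi> (m' t))" by (rule weak[OF T(1)])
      also have "\<dots> = (LINT t|lborel. (LINT x|lborel. indicator {t..t + r} x * ?\<eta> x * \<psi> (m' t)))"
        unfolding H_eq by simp
      also have "\<dots> = (LINT x|lborel. (LINT t|lborel. indicator {t..t + r} x * ?\<eta> x * \<psi> (m' t)))"
      proof (rule lborel_pair.Fubini_integral)
        let ?G = "\<lambda>(x, t). indicator {t..t + r} x * ?\<eta> x * \<psi> (m' t)"
        have ind: "indicator {t..t + r} x = (if t \<le> x \<and> x \<le> t + r then 1 else 0 :: real)" for t x
          by (auto simp: indicator_def)
        have Gm: "?G \<in> borel_measurable (lborel \<Otimes>\<^sub>M lborel)"
          unfolding split_beta' ind by measurable
        have "(\<integral>\<^sup>+q. ennreal (norm (?G q)) \<partial>(lborel \<Otimes>\<^sub>M lborel))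
            = (\<integral>\<^sup>+t. (\<integral>\<^sup>+x. ennreal (norm (?G (x, t))) \<partial>lborel) \<partial>lborel)"
          using Gm by (subst lborel_pair.nn_integral_snd[symmetric]) (auto simp: split_beta')
        also have "\<dots> \<le> (\<integral>\<^sup>+t. ennreal r * (indicator {a - r..b} t * ennreal \<bar>\<psi> (m' t)\<bar>) \<partial>lborel)"
        proof (rule nn_integral_mono)
          fix t
          have "(\<integral>\<^sup>+x. ennreal (norm (?G (x, t))) \<partial>lborel) \<le>
              (\<integral>\<^sup>+x. (indicator {a - r..b} t * ennreal \<bar>\<psi> (m' t)\<bar>) * indicator {t..t + r} x \<partial>lborel)"
          proof (rule nn_integral_mono)
            fix x
            have "norm (?G (x, t)) \<le> indicator {a - r..b} t * \<bar>\<psi> (m' t)\<bar> * indicator {t..t + r} x"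
              using \<eta>_nn[of x] \<eta>_le[of x] order_trans[OF \<eta>_le[of x], of 1]
              by (auto simp: indicator_def abs_mult mult_left_le_one_le split: if_splits)
            then have "ennreal (norm (?G (x, t))) \<le> ennreal (indicator {a - r..b} t * \<bar>\<psi> (m' t)\<bar> * indicator {t..t + r} x)"
              by (rule ennreal_leI)
            then show "ennreal (norm (?G (x, t))) \<le> (indicator {a - r..b} t * ennreal \<bar>\<psi> (m' t)\<bar>) * indicator {t..t + r} x"
              by (auto simp: indicator_def split: if_splits)
          qed
          also have "\<dots> = ennreal r * (indicator {a - r..b} t * ennreal \<bar>\<psi> (m' t)\<bar>)"
            using r by (subst nn_integral_cmult_indicator) (auto simp: mult.commute)
          finally show "(\<integral>\<^sup>+x. ennreal (norm (?G (x, t))) \<partial>lborel) \<le> ennreal r * (indicator {a - r..b} t * ennreal \<bar>\<psi> (m' t)\<bar>)" .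
        qed
        also have "\<dots> < \<infinity>" using loc_\<psi>[OF m' loc', of "a - r" b \<psi>] by (simp add: nn_integral_cmult ennreal_mult_less_top)
        finally show "integrable (lborel \<Otimes>\<^sub>M lborel) ?G" by (intro integrableI_bounded Gm)
      qed
      also have "\<dots> = (LINT x|lborel. ?\<eta> x * Q x)"
      proof (rule Bochner_Integration.integral_cong)
        fix x
        have "(LINT t|lborel. indicator {t..t + r} x * ?\<eta> x * \<psi> (m' t)) = (LINT t|lborel. ?\<eta> x * (indicator {x - r<..x} t * \<psi> (m' t)))"
        proof (rule integral_cong_AE)
          have ind: "indicator {t..t + r} x = (if t \<le> x \<and> x \<le> t + r then 1 else 0 :: real)" for t
            by (auto simp: indicator_def)
          show "(\<lambda>t. indicator {t..t + r} x * ?\<eta> x * \<psi> (m' t)) \<in> borel_measurable lborel" unfolding ind by measurable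
          show "AE t in lborel. indicator {t..t + r} x * ?\<eta> x * \<psi> (m' t) = ?\<eta> x * (indicator {x - r<..x} t * \<psi> (m' t))"
            using AE_lborel_singleton[of "x - r"] by eventually_elim (auto simp: indicator_def)
        qed measurable
        also have "\<dots> = ?\<eta> x * (\<psi> (N x - N (x - r)))"
          using has_bochner_integral_integral_eq[OF antiderivativeD(2)[OF N, of "x - r" x \<psi>]] r by simp
        finally show "(LINT t|lborel. indicator {t..t + r} x * ?\<eta> x * \<psi> (m' t)) = ?\<eta> x * Q x"
          by (simp add: Q_def blinfun.diff_right)
      qed simp
      finally have PQ: "(LINT t|lborel. ?\<eta> t * P t) = (LINT x|lborel. ?\<eta> x * Q x)" .
      have "integrable lborel (\<lambda>t. ?\<eta> t * \<psi> (m t) - ?\<eta> t * \<psi> (m (t - r)))"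
        by (intro Bochner_Integration.integrable_diff int_prod[OF \<eta>_cont \<eta>_out _ loc_m] int_prod[OF \<eta>_cont \<eta>_out _ loc_mr]) auto
      then have "integrable lborel (\<lambda>t. ?\<eta> t * P t)" by (simp add: P_def right_diff_distrib)
      moreover have "integrable lborel (\<lambda>t. ?\<eta> t * Q t)" by (rule int_prod[OF \<eta>_cont \<eta>_out _ loc_Q]) auto
      ultimately show "(LINT t|lborel. ?\<eta> t * (P t - Q t)) = 0" using PQ by (simp add: right_diff_distrib)
    qed measurable
    then show "AE t in lborel. \<psi> (y t - y (t - r)) = 0"
      by eventually_elim (simp add: P_def Q_def y_def blinfun.diff_right)
  qed
  have incr': "AE t in lborel. y t = y (t - r)" for r
  proof -
    consider "0 < r" | "r = 0" | "0 < - r" by linarith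
    then show ?thesis
    proof cases
      case 1
      from incr[OF this] show ?thesis by eventually_elim simp
    next
      case 3
      from AE_lborel_affine[OF incr[OF this] one_neq_zero, of "- r"] show ?thesis
        by eventually_elim (simp add: add.commute)
    qed simp
  qed
  have "AE r in lborel. AE t in lborel. norm (y t - y (t - r)) = 0"
  proof (rule AE_I2)
    show "AE t in lborel. norm (y t - y (t - r)) = 0" for r
      using incr'[of r] by eventually_elim simp
  qed
  moreover have "{q \<in> space (lborel \<Otimes>\<^sub>M lborel). norm (y (snd q) - y (snd q - fst q)) = 0} \<in> sets (lborel \<Otimes>\<^sub>M lborel)"
  proof -
    have [measurable]: "(\<lambda>q. norm (y (snd q) - y (snd q - fst q))) \<in> borel_measurable (lborel \<Otimes>\<^sub>M lborel)"
      by (intro smeas_norm smeas_diff smeas_compose[OF y]) measurable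
    show ?thesis by measurable
  qed
  ultimately have "AE t in lborel. AE r in lborel. norm (y t - y (t - r)) = 0"
    using lborel_pair.AE_commute[of "\<lambda>r t. norm (y t - y (t - r)) = 0"] by blast
  note ae = this
  have "ae_filter (lborel :: real measure) \<noteq> bot" by (simp add: ae_filter_eq_bot_iff)
  from eventually_happens'[OF this ae] have "\<exists>t. AE r in lborel. norm (y t - y (t - r)) = 0" .
  then obtain t0 where "AE r in lborel. norm (y t0 - y (t0 - r)) = 0" by blast
  from AE_lborel_reflect[OF this, of t0] have "AE x in lborel. y x = y t0"
    by eventually_elim simp
  then have "AE x in lborel. m x = N x + y t0"
    by eventually_elim (simp add: y_def algebra_simps)
  moreover have "antiderivative m' (\<lambda>x. N x + y t0)"
    unfolding antiderivative_def
  proof (intro conjI allI impI)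
    show "continuous_on UNIV (\<lambda>x. N x + y t0)" by (intro continuous_intros antiderivativeD(1)[OF N])
    fix a b :: real and \<psi> :: "'a \<Rightarrow>\<^sub>L real" assume "a \<le> b"
    from antiderivativeD(2)[OF N this, of \<psi>]
    show "has_bochner_integral lborel (\<lambda>x. indicator {a<..b} x * \<psi> (m' x)) (\<psi> (N b + y t0 - (N a + y t0)))" by simp
  qed
  ultimately show ?thesis by (intro that) 
qed

section \<open>A Taylor formula for fractional kernels\<close>

text \<open>The weight with which the state at time \<open>t\<^sub>0 - \<tau>\<close> enters the solution at time \<open>t\<^sub>0 + a\<close>; for \<open>\<tau> = a x\<close> it is
  a constant multiple of the weight \<open>x powr (- \<theta>) / (x + 1)\<close> in the mild solution.\<close>

definition memory_kernel :: "real \<Rightarrow> real \<Rightarrow> real \<Rightarrow> real" where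
  "memory_kernel \<theta> a \<tau> =
     (if 0 < \<tau> then sin (pi * \<theta>) / pi * (\<tau> powr (- \<theta>) * a powr \<theta> / (\<tau> + a)) else 0)"

lemma memory_kernel_measurable [measurable]: "memory_kernel \<theta> a \<in> borel_measurable borel"
  unfolding memory_kernel_def[abs_def] by measurable

lemma sin_pi_pos: "0 < \<theta> \<Longrightarrow> \<theta> < 1 \<Longrightarrow> 0 < sin (pi * \<theta>)"
  by (rule sin_gt_zero) (auto simp: pi_gt_zero)

text \<open>Euler's reflection formula.\<close>

lemma sin_pi_Gamma:
  fixes \<theta> :: real
  assumes "0 < \<theta>" "\<theta> < 1"
  shows "sin (pi * \<theta>) / pi * Beta (1 - \<theta>) \<theta> = 1"
proof -
  have "Gamma (complex_of_real \<theta>) * Gamma (1 - complex_of_real \<theta>) = of_real pi / sin (of_real pi * complex_of_real \<theta>)"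
    by (rule Gamma_reflection_complex)
  then have "complex_of_real (Gamma \<theta> * Gamma (1 - \<theta>)) = complex_of_real (pi / sin (pi * \<theta>))"
    by (simp flip: Gamma_complex_of_real sin_of_real add: Gamma_complex_of_real[symmetric] sin_of_real[symmetric])
  then have "Gamma \<theta> * Gamma (1 - \<theta>) = pi / sin (pi * \<theta>)" by (simp only: of_real_eq_iff)
  then show ?thesis using sin_pi_pos[OF assms] by (simp add: Beta_def mult.commute)
qed

lemma memory_kernel_nonneg: "0 < \<theta> \<Longrightarrow> \<theta> < 1 \<Longrightarrow> 0 < a \<Longrightarrow> 0 \<le> memory_kernel \<theta> a \<tau>"
  using sin_pi_pos[of \<theta>] by (simp add: memory_kernel_def)

text \<open>The substitution \<open>\<tau> = a r x / (a + r - r x)\<close> maps \<open>[0, 1]\<close> onto \<open>[0, r]\<close> and turns the integrand into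
  that of a Beta integral.\<close>

lemma memory_kernel_convolution_base:
  assumes \<theta>: "0 < \<theta>" "\<theta> < 1" and a: "0 < a" and r: "0 < r"
  shows "(\<integral>\<^sup>+\<tau>. ennreal (memory_kernel \<theta> a \<tau>) * ennreal (frac_kernel \<theta> (r - \<tau>)) \<partial>lborel) = ennreal (frac_kernel \<theta> (a + r))"
proof -
  define d where "d x = a + r - r * x" for x
  define g where "g x = a * r * x / d x" for x
  define g' where "g' x = a * r * (a + r) / (d x)\<^sup>2" for x
  define f where "f \<tau> = memory_kernel \<theta> a \<tau> * frac_kernel \<theta> (r - \<tau>)" for \<tau>
  define C where "C = sin (pi * \<theta>) / pi * ((a + r) powr (\<theta> - 1) / Gamma \<theta>)"
  have [measurable]: "f \<in> borel_measurable borel" unfolding f_def by measurable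
  have C0: "0 \<le> C" using sin_pi_pos[OF \<theta>] \<theta> by (simp add: C_def)
  have mk: "0 \<le> memory_kernel \<theta> a \<tau>" "0 \<le> frac_kernel \<theta> \<tau>" for \<tau>
    using memory_kernel_nonneg[OF \<theta> a] frac_kernel_nonneg[OF \<theta>(1)] by auto
  have d_pos: "0 < d x" if "x \<in> {0..1}" for x
  proof -
    have "r * x \<le> r * 1" using that r by (intro mult_left_mono) auto
    then show ?thesis using a by (simp add: d_def)
  qed
  have g_ends: "g 0 = 0" "g 1 = r" using a by (auto simp: g_def d_def)
  have subst: "(\<integral>\<^sup>+x. f x * indicator {g 0..g 1} x \<partial>lborel) = (\<integral>\<^sup>+x. f (g x) * g' x * indicator {0..1} x \<partial>lborel)"
  proof (rule nn_integral_substitution)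
    show "set_borel_measurable borel {g 0..g 1} f" unfolding set_borel_measurable_def by measurable
    show "(g has_real_derivative g' x) (at x)" if "x \<in> {0..1}" for x
    proof -
      have "(g has_real_derivative (a * r * d x - a * r * x * (- r)) / (d x * d x)) (at x)"
        unfolding g_def d_def using d_pos[OF that]
        by (intro derivative_eq_intros refl) (auto simp: d_def)
      moreover have "a * r * d x - a * r * x * (- r) = a * r * (a + r)" by (simp add: d_def algebra_simps)
      ultimately show ?thesis by (simp add: g'_def power2_eq_square)
    qed
    have "continuous_on {0..1} d" unfolding d_def by (intro continuous_intros)
    moreover have "\<forall>x\<in>{0..1}. (d x)\<^sup>2 \<noteq> 0" using d_pos by fastforce
    ultimately show "continuous_on {0..1} g'" unfolding g'_def by (intro continuous_intros)
    show "0 \<le> g' x" for x using a r by (simp add: g'_def)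
  qed simp
  have "(\<integral>\<^sup>+\<tau>. ennreal (memory_kernel \<theta> a \<tau>) * ennreal (frac_kernel \<theta> (r - \<tau>)) \<partial>lborel)
      = (\<integral>\<^sup>+x. f x * indicator {g 0..g 1} x \<partial>lborel)"
    unfolding g_ends
  proof (rule nn_integral_cong)
    fix \<tau>
    have "f \<tau> * indicator {0..r} \<tau> = f \<tau>"
      by (auto simp: f_def indicator_def memory_kernel_def frac_kernel_def)
    then show "ennreal (memory_kernel \<theta> a \<tau>) * ennreal (frac_kernel \<theta> (r - \<tau>)) = ennreal (f \<tau> * indicator {0..r} \<tau>)"
      by (simp only: f_def ennreal_mult[OF mk])
  qed
  also have "\<dots> = (\<integral>\<^sup>+x. ennreal C * (ennreal (x powr ((1 - \<theta>) - 1) * (1 - x) powr (\<theta> - 1)) * indicator {0..1} x) \<partial>lborel)"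
    unfolding subst
  proof (rule nn_integral_cong_AE, rule AE_mp[OF AE_lborel_singleton[of 0]], rule AE_mp[OF AE_lborel_singleton[of 1]], rule AE_I2, intro impI)
    fix x :: real assume x: "x \<noteq> 1" "x \<noteq> 0"
    show "ennreal (f (g x) * g' x * indicator {0..1} x) = ennreal C * (ennreal (x powr ((1 - \<theta>) - 1) * (1 - x) powr (\<theta> - 1)) * indicator {0..1} x)"
    proof (cases "x \<in> {0..1}")
      case True
      then have x': "0 < x" "x < 1" using x by auto
      have d: "0 < d x" by (rule d_pos[OF True])
      have gp: "0 < g x" using a r x' d by (simp add: g_def)
      have ga: "g x + a = a * (a + r) / d x" using d by (simp add: g_def d_def field_simps)
      have rg: "r - g x = r * (a + r) * (1 - x) / d x" using d by (simp add: g_def d_def field_simps)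
      have rgp: "0 < r - g x" unfolding rg using a r x' d by simp
      have "f (g x) * g' x = sin (pi * \<theta>) / pi * (1 / Gamma \<theta>) *
         ((g x powr (- \<theta>) * a powr \<theta> / (g x + a)) * (r - g x) powr (\<theta> - 1) * g' x)"
        using gp rgp by (simp add: f_def memory_kernel_def frac_kernel_def) (simp add: mult_ac)
      also have "(g x powr (- \<theta>) * a powr \<theta> / (g x + a)) * (r - g x) powr (\<theta> - 1) * g' x
         = (a + r) powr (\<theta> - 1) * (x powr (- \<theta>) * (1 - x) powr (\<theta> - 1))"
      proof -
        have e1: "g x powr (- \<theta>) = exp (- \<theta> * (ln a + ln r + ln x - ln (d x)))"
          unfolding powr_def g_def using a r x' d by (simp add: ln_div ln_mult)
        have e2: "a powr \<theta> = exp (\<theta> * ln a)" using a by (simp add: powr_def)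
        have e3: "1 / (g x + a) = exp (ln (d x) - ln a - ln (a + r))"
          unfolding ga using a r d by (simp add: exp_diff)
        have e4: "(r - g x) powr (\<theta> - 1) = exp ((\<theta> - 1) * (ln r + ln (a + r) + ln (1 - x) - ln (d x)))"
          unfolding powr_def rg using a r x' d by (simp add: ln_div ln_mult)
        have e5: "g' x = exp (ln a + ln r + ln (a + r) - 2 * ln (d x))"
        proof -
          have "exp (2 * ln (d x)) = (d x)\<^sup>2" using d by (simp add: exp_double)
          then show ?thesis unfolding g'_def using a r by (simp add: exp_diff exp_add)
        qed
        have "(g x powr (- \<theta>) * a powr \<theta> / (g x + a)) * (r - g x) powr (\<theta> - 1) * g' x
            = g x powr (- \<theta>) * a powr \<theta> * (1 / (g x + a)) * (r - g x) powr (\<theta> - 1) * g' x" by simp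
        also have "\<dots> = exp ((\<theta> - 1) * ln (a + r)) * (exp (- \<theta> * ln x) * exp ((\<theta> - 1) * ln (1 - x)))"
          unfolding e1 e2 e3 e4 e5 exp_add[symmetric] by (simp add: algebra_simps)
        also have "\<dots> = (a + r) powr (\<theta> - 1) * (x powr (- \<theta>) * (1 - x) powr (\<theta> - 1))"
          using a r x' by (simp add: powr_def)
        finally show ?thesis .
      qed
      finally have "f (g x) * g' x = C * (x powr ((1 - \<theta>) - 1) * (1 - x) powr (\<theta> - 1))"
        by (simp add: C_def)
      then show ?thesis using True C0 by (simp add: ennreal_mult)
    qed simp
  qed
  also have "\<dots> = ennreal C * ennreal (Beta (1 - \<theta>) \<theta>)"
    using nn_integral_Beta[of "1 - \<theta>" \<theta>] \<theta> by (subst nn_integral_cmult) auto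
  also have "\<dots> = ennreal (C * Beta (1 - \<theta>) \<theta>)"
    using C0 \<theta> by (intro ennreal_mult[symmetric]) (auto simp: Beta_def)
  also have "C * Beta (1 - \<theta>) \<theta> = (sin (pi * \<theta>) / pi * Beta (1 - \<theta>) \<theta>) * ((a + r) powr (\<theta> - 1) / Gamma \<theta>)"
    by (simp add: C_def)
  also have "\<dots> = frac_kernel \<theta> (a + r)" unfolding sin_pi_Gamma[OF \<theta>] using a r by (simp add: frac_kernel_def)
  finally show ?thesis .
qed

text \<open>The Taylor polynomial of the kernel of order \<open>\<theta> + m\<close> at \<open>a\<close>, with the powers of \<open>r\<close> written as kernels of
  natural order.\<close>

definition taylor_part :: "real \<Rightarrow> nat \<Rightarrow> real \<Rightarrow> real \<Rightarrow> real" where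
  "taylor_part \<theta> m a r = (\<Sum>k=1..m. a powr (\<theta> + real k - 1) / Gamma (\<theta> + real k) * frac_kernel (real (m - k + 1)) r)"

lemma taylor_part_measurable [measurable]: "taylor_part \<theta> m a \<in> borel_measurable borel"
  unfolding taylor_part_def[abs_def] by measurable

lemma taylor_part_nonneg: "0 < \<theta> \<Longrightarrow> 0 \<le> taylor_part \<theta> m a r"
  unfolding taylor_part_def by (intro sum_nonneg mult_nonneg_nonneg divide_nonneg_nonneg frac_kernel_nonneg) auto

text \<open>Integrating the identity for \<open>m\<close> in \<open>r\<close> gives the one for \<open>m + 1\<close>, whose new summand is the constant of
  integration.\<close>

lemma memory_kernel_convolution:
  assumes \<theta>: "0 < \<theta>" "\<theta> < 1" and a: "0 < a" and r: "0 < r"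
  shows "(\<integral>\<^sup>+\<tau>. ennreal (memory_kernel \<theta> a \<tau>) * ennreal (frac_kernel (\<theta> + real m) (r - \<tau>)) \<partial>lborel)
      + ennreal (taylor_part \<theta> m a r) = ennreal (frac_kernel (\<theta> + real m) (a + r))"
  using r
proof (induction m arbitrary: r)
  case 0
  then show ?case using memory_kernel_convolution_base[OF \<theta> a] by (simp add: taylor_part_def)
next
  case (Suc m)
  define s where "s = \<theta> + real m"
  have s: "0 < s" using \<theta> by (simp add: s_def)
  have s1: "\<theta> + real (Suc m) = s + 1" by (simp add: s_def)
  let ?conv = "\<lambda>x. \<integral>\<^sup>+\<tau>. ennreal (memory_kernel \<theta> a \<tau>) * ennreal (frac_kernel s (x - \<tau>)) \<partial>lborel"
  have "(\<integral>\<^sup>+\<tau>. ennreal (memory_kernel \<theta> a \<tau>) * ennreal (frac_kernel (s + 1) (r - \<tau>)) \<partial>lborel)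
      = (\<integral>\<^sup>+\<tau>. ennreal (memory_kernel \<theta> a \<tau>) * (\<integral>\<^sup>+\<rho>. ennreal (frac_kernel s \<rho>) * ennreal (frac_kernel 1 (r - (\<tau> + \<rho>))) \<partial>lborel) \<partial>lborel)"
    by (intro nn_integral_cong) (simp add: frac_kernel_convolution[OF s zero_less_one, symmetric] diff_diff_eq)
  also have "\<dots> = (\<integral>\<^sup>+x. ?conv x * ennreal (frac_kernel 1 (r - x)) \<partial>lborel)"
    by (rule nn_integral_convolution[of "\<lambda>\<tau>. ennreal (memory_kernel \<theta> a \<tau>)" "\<lambda>\<rho>. ennreal (frac_kernel s \<rho>)" "\<lambda>x. ennreal (frac_kernel 1 (r - x))"]) measurable
  finally have conv: "(\<integral>\<^sup>+\<tau>. ennreal (memory_kernel \<theta> a \<tau>) * ennreal (frac_kernel (s + 1) (r - \<tau>)) \<partial>lborel)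
      = (\<integral>\<^sup>+x. ?conv x * ennreal (frac_kernel 1 (r - x)) \<partial>lborel)" .
  let ?c = "\<lambda>k. a powr (\<theta> + real k - 1) / Gamma (\<theta> + real k)"
  have c0: "0 \<le> ?c k" for k using \<theta> by simp
  have taylor: "(\<integral>\<^sup>+x. ennreal (taylor_part \<theta> m a x) * ennreal (frac_kernel 1 (r - x)) \<partial>lborel)
      = ennreal (\<Sum>k=1..m. ?c k * frac_kernel (real (Suc m - k + 1)) r)"
  proof -
    have fk: "0 \<le> frac_kernel (real (m - k + 1)) x" for k x by (rule frac_kernel_nonneg) simp
    have "(\<integral>\<^sup>+x. ennreal (taylor_part \<theta> m a x) * ennreal (frac_kernel 1 (r - x)) \<partial>lborel)
      = (\<integral>\<^sup>+x. (\<Sum>k=1..m. ennreal (?c k) * (ennreal (frac_kernel (real (m - k + 1)) x) * ennreal (frac_kernel 1 (r - x)))) \<partial>lborel)"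
    proof (rule nn_integral_cong)
      fix x
      have "ennreal (taylor_part \<theta> m a x) = (\<Sum>k=1..m. ennreal (?c k * frac_kernel (real (m - k + 1)) x))"
        unfolding taylor_part_def by (intro sum_ennreal[symmetric] mult_nonneg_nonneg c0 fk)
      also have "\<dots> = (\<Sum>k=1..m. ennreal (?c k) * ennreal (frac_kernel (real (m - k + 1)) x))"
        by (intro sum.cong refl ennreal_mult c0 fk)
      finally show "ennreal (taylor_part \<theta> m a x) * ennreal (frac_kernel 1 (r - x))
        = (\<Sum>k=1..m. ennreal (?c k) * (ennreal (frac_kernel (real (m - k + 1)) x) * ennreal (frac_kernel 1 (r - x))))"
        by (simp add: sum_distrib_right mult.assoc)
    qed
    also have "\<dots> = (\<Sum>k=1..m. (\<integral>\<^sup>+x. ennreal (?c k) * (ennreal (frac_kernel (real (m - k + 1)) x) * ennreal (frac_kernel 1 (r - x))) \<partial>lborel))"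
      by (rule nn_integral_sum) measurable
    also have "\<dots> = (\<Sum>k=1..m. ennreal (?c k * frac_kernel (real (Suc m - k + 1)) r))"
    proof (rule sum.cong[OF refl])
      fix k assume k: "k \<in> {1..m}"
      have "(\<integral>\<^sup>+x. ennreal (?c k) * (ennreal (frac_kernel (real (m - k + 1)) x) * ennreal (frac_kernel 1 (r - x))) \<partial>lborel)
        = ennreal (?c k) * ennreal (frac_kernel (real (m - k + 1) + 1) r)"
        by (subst nn_integral_cmult) (simp_all add: frac_kernel_convolution del: of_nat_add)
      also have "real (m - k + 1) + 1 = real (Suc m - k + 1)" using k by simp
      finally show "(\<integral>\<^sup>+x. ennreal (?c k) * (ennreal (frac_kernel (real (m - k + 1)) x) * ennreal (frac_kernel 1 (r - x))) \<partial>lborel)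
        = ennreal (?c k * frac_kernel (real (Suc m - k + 1)) r)"
        by (simp only: ennreal_mult'[OF c0])
    qed
    also have "\<dots> = ennreal (\<Sum>k=1..m. ?c k * frac_kernel (real (Suc m - k + 1)) r)"
      using c0 by (intro sum_ennreal mult_nonneg_nonneg frac_kernel_nonneg) auto
    finally show ?thesis .
  qed
  have "(\<integral>\<^sup>+x. ?conv x * ennreal (frac_kernel 1 (r - x)) \<partial>lborel) + (\<integral>\<^sup>+x. ennreal (taylor_part \<theta> m a x) * ennreal (frac_kernel 1 (r - x)) \<partial>lborel)
      = (\<integral>\<^sup>+x. ?conv x * ennreal (frac_kernel 1 (r - x)) + ennreal (taylor_part \<theta> m a x) * ennreal (frac_kernel 1 (r - x)) \<partial>lborel)"
    by (rule nn_integral_add[symmetric]) measurable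
  also have "\<dots> = (\<integral>\<^sup>+x. ennreal ((a + x) powr (s - 1) / Gamma s) * indicator {0..r} x \<partial>lborel)"
  proof (rule nn_integral_cong_AE, rule AE_mp[OF AE_lborel_singleton[of 0]], rule AE_mp[OF AE_lborel_singleton[of r]], rule AE_I2, intro impI)
    fix x assume x: "x \<noteq> r" "x \<noteq> 0"
    show "?conv x * ennreal (frac_kernel 1 (r - x)) + ennreal (taylor_part \<theta> m a x) * ennreal (frac_kernel 1 (r - x))
        = ennreal ((a + x) powr (s - 1) / Gamma s) * indicator {0..r} x"
    proof (cases "0 < x")
      case True
      have "?conv x + ennreal (taylor_part \<theta> m a x) = ennreal (frac_kernel s (a + x))"
        using Suc.IH[OF True] by (simp add: s_def)
      then show ?thesis using True x a unfolding distrib_right[symmetric]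
        by (auto simp: frac_kernel_def indicator_def)
    next
      case False
      have "?conv x = (\<integral>\<^sup>+\<tau>. 0 \<partial>(lborel :: real measure))"
        using False by (intro nn_integral_cong) (auto simp: memory_kernel_def frac_kernel_def)
      moreover have "taylor_part \<theta> m a x = 0" using False by (simp add: taylor_part_def frac_kernel_def)
      ultimately show ?thesis using False x by (simp add: indicator_def)
    qed
  qed
  also have "\<dots> = ennreal ((a + r) powr s / Gamma (s + 1) - (a + 0) powr s / Gamma (s + 1))"
  proof (rule nn_integral_FTC_Icc)
    fix x assume x: "x \<in> {0..r}"
    have "((\<lambda>x. (a + x) powr s / Gamma (s + 1)) has_real_derivative s * (a + x) powr (s - 1) / Gamma (s + 1)) (at x)"
    proof -
      have "Gamma (s + 1) \<noteq> 0" by (intro less_imp_neq[THEN not_sym] Gamma_real_pos) (use s in simp)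
      then show ?thesis using a x by (auto intro!: derivative_eq_intros)
    qed
    moreover have "s * (a + x) powr (s - 1) / Gamma (s + 1) = (a + x) powr (s - 1) / Gamma s"
    proof -
      have "Gamma (s + 1) = s * Gamma s" by (rule Gamma_plus1) (use s in \<open>auto elim!: nonpos_Ints_cases\<close>)
      then show ?thesis using s by simp
    qed
    ultimately show "((\<lambda>x. (a + x) powr s / Gamma (s + 1)) has_real_derivative (a + x) powr (s - 1) / Gamma s) (at x)"
      by simp
  qed (use s Suc.prems in auto)
  finally have main: "(\<integral>\<^sup>+\<tau>. ennreal (memory_kernel \<theta> a \<tau>) * ennreal (frac_kernel (s + 1) (r - \<tau>)) \<partial>lborel)
      + ennreal (\<Sum>k=1..m. ?c k * frac_kernel (real (Suc m - k + 1)) r)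
      = ennreal ((a + r) powr s / Gamma (s + 1) - a powr s / Gamma (s + 1))"
    unfolding conv taylor by simp
  have "taylor_part \<theta> (Suc m) a r = (\<Sum>k=1..m. ?c k * frac_kernel (real (Suc m - k + 1)) r) + a powr s / Gamma (s + 1)"
    using Suc.prems by (simp add: taylor_part_def frac_kernel_1 s_def add_ac)
  then have "ennreal (taylor_part \<theta> (Suc m) a r) = ennreal (\<Sum>k=1..m. ?c k * frac_kernel (real (Suc m - k + 1)) r) + ennreal (a powr s / Gamma (s + 1))"
    using c0 s by (simp only:) (intro ennreal_plus sum_nonneg mult_nonneg_nonneg frac_kernel_nonneg; auto)
  then have "(\<integral>\<^sup>+\<tau>. ennreal (memory_kernel \<theta> a \<tau>) * ennreal (frac_kernel (s + 1) (r - \<tau>)) \<partial>lborel) + ennreal (taylor_part \<theta> (Suc m) a r)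
      = ennreal ((a + r) powr s / Gamma (s + 1) - a powr s / Gamma (s + 1)) + ennreal (a powr s / Gamma (s + 1))"
    using main by (simp add: add.assoc[symmetric])
  also have "\<dots> = ennreal ((a + r) powr s / Gamma (s + 1))"
  proof -
    have "a powr s \<le> (a + r) powr s" using a s Suc.prems by (intro powr_mono2) auto
    then have "a powr s / Gamma (s + 1) \<le> (a + r) powr s / Gamma (s + 1)" using s by (intro divide_right_mono) auto
    then show ?thesis using s by (subst ennreal_plus[symmetric]) auto
  qed
  also have "\<dots> = ennreal (frac_kernel (s + 1) (a + r))" using a Suc.prems by (simp add: frac_kernel_def)
  finally show ?case unfolding s1 .
qed

section \<open>Representation after the initial time\<close>

lemma frac_kernel_nat: "0 < n \<Longrightarrow> 0 < r \<Longrightarrow> frac_kernel (real n) r = r ^ (n - 1) / fact (n - 1)"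
proof -
  assume n: "0 < n" and r: "0 < r"
  have "Gamma (real n) = fact (n - 1)" using Gamma_fact[of "n - 1", where 'a=real] n by (simp add: of_nat_diff)
  moreover have "r powr (real n - 1) = r ^ (n - 1)"
    using powr_realpow[OF r, of "n - 1"] n by (simp add: of_nat_diff)
  ultimately show ?thesis using r by (simp add: frac_kernel_def)
qed

lemma frac_kernel_nat_add:
  assumes n: "0 < n" and a: "0 < a" and r: "0 < r"
  shows "frac_kernel (real n) (a + r) = (\<Sum>k<n. a ^ k / fact k * frac_kernel (real (n - k)) r)"
proof -
  define N where "N = n - 1"
  have n': "n = Suc N" using n by (simp add: N_def)
  have "frac_kernel (real n) (a + r) = (a + r) ^ N / fact N" using frac_kernel_nat[OF n, of "a + r"] a r by (simp add: N_def)
  also have "\<dots> = (\<Sum>k\<le>N. real (N choose k) * a ^ k * r ^ (N - k)) / fact N" by (simp add: binomial_ring)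
  also have "\<dots> = (\<Sum>k\<le>N. a ^ k / fact k * (r ^ (N - k) / fact (N - k)))"
    unfolding sum_divide_distrib by (intro sum.cong refl) (simp add: binomial_fact field_simps)
  also have "\<dots> = (\<Sum>k<n. a ^ k / fact k * frac_kernel (real (n - k)) r)"
    unfolding n' lessThan_Suc_atMost
  proof (intro sum.cong refl)
    fix k assume "k \<in> {..N}"
    then have "0 < Suc N - k" "Suc N - k - 1 = N - k" by auto
    then show "a ^ k / fact k * (r ^ (N - k) / fact (N - k)) = a ^ k / fact k * frac_kernel (real (Suc N - k)) r"
      using frac_kernel_nat[of "Suc N - k" r] r by simp
  qed
  finally show ?thesis .
qed

context stable_semigroup
begin

text \<open>Here \<open>f\<close> vanishes after \<open>t\<^sub>0\<close> and \<open>a\<close> is the time elapsed since \<open>t\<^sub>0\<close>. Shifting the integration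
  variable by \<open>a\<close> expresses the fractional integral at \<open>t\<^sub>0 + a\<close> by the history before \<open>t\<^sub>0\<close>, with a
  shifted kernel.\<close>

lemma future_functional:
  fixes \<psi> :: "'a \<Rightarrow>\<^sub>L real"
  assumes adm: "admissible p \<sigma>" and f: "Lp_fun p f" and zero: "\<And>t. t\<^sub>0 < t \<Longrightarrow> f t = 0" and a: "0 < a"
  shows "has_bochner_integral lborel (\<lambda>r. (if 0 < r then frac_kernel \<sigma> (a + r) else 0) * \<psi> (Sp (a + r) (f (t\<^sub>0 - r))))
    (\<psi> (frac_integral S \<sigma> f (t\<^sub>0 + a)))"
proof -
  have fM: "smeas borel f" using f by (simp add: Lp_fun_def)
  have h: "has_bochner_integral lborel (\<lambda>r. frac_kernel \<sigma> r * \<psi> (Sp r (f (t\<^sub>0 + a - r)))) (\<psi> (frac_integral S \<sigma> f (t\<^sub>0 + a)))"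
    by (rule frac_integral_functional(1)[OF admissible_pos(1)[OF adm] fM _ frac_norm_Lp_finite[OF adm f]]) simp
  have eq: "(\<lambda>r. frac_kernel \<sigma> (a + 1 * r) * \<psi> (Sp (a + 1 * r) (f (t\<^sub>0 + a - (a + 1 * r)))))
      = (\<lambda>r. frac_kernel \<sigma> (a + r) * \<psi> (Sp (a + r) (f (t\<^sub>0 - r))))" by simp
  have h': "has_bochner_integral lborel (\<lambda>r. frac_kernel \<sigma> (a + r) * \<psi> (Sp (a + r) (f (t\<^sub>0 - r)))) (\<psi> (frac_integral S \<sigma> f (t\<^sub>0 + a)))"
    using h lborel_integral_real_affine[of 1 "\<lambda>r. frac_kernel \<sigma> r * \<psi> (Sp r (f (t\<^sub>0 + a - r)))" a]
      lborel_integrable_real_affine[of "\<lambda>r. frac_kernel \<sigma> r * \<psi> (Sp r (f (t\<^sub>0 + a - r)))" 1 a]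
    unfolding has_bochner_integral_iff eq by simp
  have [measurable]: "(\<lambda>r. \<psi> (Sp (a + r) (f (t\<^sub>0 - r)))) \<in> borel_measurable borel"
    by (intro smeas_functional Sp_apply_smeas smeas_compose[OF fM]) measurable
  have "AE r in lborel. (if 0 < r then frac_kernel \<sigma> (a + r) else 0) * \<psi> (Sp (a + r) (f (t\<^sub>0 - r)))
        = frac_kernel \<sigma> (a + r) * \<psi> (Sp (a + r) (f (t\<^sub>0 - r)))"
    using AE_lborel_singleton[of 0]
  proof eventually_elim
    case (elim r)
    have "r < 0 \<Longrightarrow> f (t\<^sub>0 - r) = 0" by (rule zero) simp
    then show ?case using elim by (auto simp: blinfun.zero_right)
  qed
  moreover have "(\<lambda>r. (if 0 < r then frac_kernel \<sigma> (a + r) else 0) * \<psi> (Sp (a + r) (f (t\<^sub>0 - r)))) \<in> borel_measurable lborel"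
    "(\<lambda>r. frac_kernel \<sigma> (a + r) * \<psi> (Sp (a + r) (f (t\<^sub>0 - r)))) \<in> borel_measurable lborel"
    by measurable
  ultimately show ?thesis using h' by (subst has_bochner_integral_cong_AE) auto
qed

text \<open>The fractional integral at \<open>t\<^sub>0\<close>, transported by \<open>S a\<close>, involves the same orbits with the unshifted
  kernel.\<close>

lemma initial_functional:
  fixes \<psi> :: "'a \<Rightarrow>\<^sub>L real"
  assumes adm: "admissible p \<sigma>" and f: "Lp_fun p f" and a: "0 < a"
  shows "has_bochner_integral lborel (\<lambda>r. frac_kernel \<sigma> r * \<psi> (Sp (a + r) (f (t\<^sub>0 - r)))) (\<psi> (S a (frac_integral S \<sigma> f t\<^sub>0)))"
proof -
  have fM: "smeas borel f" using f by (simp add: Lp_fun_def)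
  have h: "has_bochner_integral lborel (\<lambda>r. frac_kernel \<sigma> r * (\<psi> o\<^sub>L S a) (Sp r (f (t\<^sub>0 - r)))) ((\<psi> o\<^sub>L S a) (frac_integral S \<sigma> f t\<^sub>0))"
    by (rule frac_integral_functional(1)[OF admissible_pos(1)[OF adm] fM _ frac_norm_Lp_finite[OF adm f]]) simp
  have "(\<lambda>r. frac_kernel \<sigma> r * (\<psi> o\<^sub>L S a) (Sp r (f (t\<^sub>0 - r)))) = (\<lambda>r. frac_kernel \<sigma> r * \<psi> (Sp (a + r) (f (t\<^sub>0 - r))))"
  proof
    fix r
    show "frac_kernel \<sigma> r * (\<psi> o\<^sub>L S a) (Sp r (f (t\<^sub>0 - r))) = frac_kernel \<sigma> r * \<psi> (Sp (a + r) (f (t\<^sub>0 - r)))"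
      using a Sp_add[of a r] by (cases "0 < r") (auto simp: frac_kernel_def Sp_def)
  qed
  with h show ?thesis by simp
qed

text \<open>The shifted kernel in \<open>future_functional\<close> is expanded by the binomial theorem.\<close>

lemma mild_formula_nat:
  assumes n: "0 < n" and p: "1 \<le> p" and f: "Lp_fun p f" and zero: "\<And>t. t\<^sub>0 < t \<Longrightarrow> f t = 0" and a: "0 < a"
  shows "frac_integral S (real n) f (t\<^sub>0 + a) = (\<Sum>k<n. (a ^ k / fact k) *\<^sub>R S a (frac_integral S (real (n - k)) f t\<^sub>0))"
proof (rule functionals_separate)
  fix \<psi> :: "'a \<Rightarrow>\<^sub>L real"
  let ?F = "\<lambda>r. \<psi> (Sp (a + r) (f (t\<^sub>0 - r)))"
  have adm: "admissible p (real i)" if "0 < i" for i by (rule admissible_ge_1[OF p]) (use that in simp)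
  have "has_bochner_integral lborel (\<lambda>r. \<Sum>k<n. a ^ k / fact k * (frac_kernel (real (n - k)) r * ?F r))
      (\<Sum>k<n. a ^ k / fact k * \<psi> (S a (frac_integral S (real (n - k)) f t\<^sub>0)))"
    by (intro has_bochner_integral_sum has_bochner_integral_mult_right initial_functional[OF adm f a]) auto
  also have "(\<lambda>r. \<Sum>k<n. a ^ k / fact k * (frac_kernel (real (n - k)) r * ?F r)) = (\<lambda>r. (if 0 < r then frac_kernel (real n) (a + r) else 0) * ?F r)"
  proof
    fix r
    show "(\<Sum>k<n. a ^ k / fact k * (frac_kernel (real (n - k)) r * ?F r)) = (if 0 < r then frac_kernel (real n) (a + r) else 0) * ?F r"
    proof (cases "0 < r")
      case True
      then show ?thesis by (simp only: frac_kernel_nat_add[OF n a True] if_True sum_distrib_right mult.assoc)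
    next
      case False
      then show ?thesis by (simp add: frac_kernel_def)
    qed
  qed
  finally have "\<psi> (frac_integral S (real n) f (t\<^sub>0 + a)) = (\<Sum>k<n. a ^ k / fact k * \<psi> (S a (frac_integral S (real (n - k)) f t\<^sub>0)))"
    using future_functional[OF adm[OF n] f zero a] by (rule has_bochner_integral_eq[rotated])
  then show "\<psi> (frac_integral S (real n) f (t\<^sub>0 + a)) = \<psi> (\<Sum>k<n. (a ^ k / fact k) *\<^sub>R S a (frac_integral S (real (n - k)) f t\<^sub>0))"
    by (simp add: blinfun.sum_right blinfun.scaleR_right)
qed

text \<open>The Taylor part of the shifted kernel in \<open>future_functional\<close> yields the sum. For the remainder, the
  integral against \<open>frac_kernel s\<close> inside the convolution is evaluated first; it gives \<open>U\<close> again,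
  transported by the semigroup.\<close>

lemma mild_formula_frac:
  fixes m :: nat
  assumes \<theta>: "0 < \<theta>" "\<theta> < 1" and s: "s = \<theta> + real m" and adm: "admissible p s"
    and f: "Lp_fun p f" and zero: "\<And>t. t\<^sub>0 < t \<Longrightarrow> f t = 0" and a: "0 < a"
  defines "U \<equiv> frac_integral S s f"
  defines "K \<equiv> \<lambda>\<tau>. (\<tau> powr (- \<theta>) / (\<tau> + 1)) *\<^sub>R S (a * (\<tau> + 1)) (U (t\<^sub>0 - a * \<tau>))"
  shows "bochner_integrable (lebesgue_on {0..}) K"
    and "U (t\<^sub>0 + a) = (sin (pi * \<theta>) / pi) *\<^sub>R bochner_integral (lebesgue_on {0..}) K
      + (\<Sum>k=1..m. (a powr (\<theta> + real k - 1) / Gamma (\<theta> + real k)) *\<^sub>R S a (frac_integral S (real (m - k + 1)) f t\<^sub>0))"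
proof -
  have p: "1 \<le> p" and s0: "0 < s" using admissible_pos[OF adm] by auto
  have fM: "smeas borel f" using f by (simp add: Lp_fun_def)
  have U_cont: "continuous_on UNIV U" unfolding U_def by (rule frac_integral_Lp_continuous[OF adm f])
  have UM: "smeas borel U" by (rule smeas_continuous[OF U_cont])
  obtain B where B: "\<And>t. norm (U t) \<le> B" using frac_integral_Lp_bounded[OF adm f] by (auto simp: U_def)
  have B0: "0 \<le> B" using B[of 0] norm_ge_zero order_trans by blast
  define q where "q \<tau> = (if 0 < \<tau> then \<tau> powr (- \<theta>) / (\<tau> + 1) else 0)" for \<tau> :: real
  have [measurable]: "q \<in> borel_measurable borel" unfolding q_def by measurable
  define K' where "K' \<tau> = q \<tau> *\<^sub>R Sp (a * (\<tau> + 1)) (U (t\<^sub>0 - a * \<tau>))" for \<tau>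
  have K'M: "smeas borel K'" unfolding K'_def
    by (intro smeas_scaleR Sp_apply_smeas smeas_compose[OF UM]) measurable
  have KK': "AE \<tau> in lborel. \<tau> \<in> {0..} \<longrightarrow> K \<tau> = K' \<tau>"
    using AE_lborel_singleton[of 0]
  proof eventually_elim
    case (elim \<tau>)
    show ?case
    proof
      assume "\<tau> \<in> {0..}"
      then have "0 < \<tau>" using elim by simp
      moreover have "0 < a * (\<tau> + 1)" using a \<open>0 < \<tau>\<close> by simp
      ultimately show "K \<tau> = K' \<tau>" by (simp add: K_def K'_def q_def Sp_def)
    qed
  qed
  have fin: "(\<integral>\<^sup>+\<tau>. indicator {0..} \<tau> * ennreal (norm (K' \<tau>)) \<partial>lborel) < \<infinity>"
  proof -
    let ?c = "Gamma (1 - \<theta>) * M * B"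
    have c0: "0 \<le> ?c" using \<theta> M B0 by simp
    have "(\<integral>\<^sup>+\<tau>. indicator {0..} \<tau> * ennreal (norm (K' \<tau>)) \<partial>lborel)
      \<le> (\<integral>\<^sup>+\<tau>. ennreal ?c * ennreal (frac_kernel (1 - \<theta>) \<tau> * exp (- (w * a) * \<tau>)) \<partial>lborel)"
    proof (rule nn_integral_mono)
      fix \<tau>
      have "norm (K' \<tau>) \<le> ?c * (frac_kernel (1 - \<theta>) \<tau> * exp (- (w * a) * \<tau>))"
      proof (cases "0 < \<tau>")
        case True
        have G: "Gamma (1 - \<theta>) \<noteq> 0" by (rule less_imp_neq[THEN not_sym]) (use \<theta> in simp)
        have "norm (K' \<tau>) = \<tau> powr (- \<theta>) / (\<tau> + 1) * norm (Sp (a * (\<tau> + 1)) (U (t\<^sub>0 - a * \<tau>)))"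
          using True by (simp add: K'_def q_def)
        also have "\<dots> \<le> \<tau> powr (- \<theta>) * (M * exp (- (w * a) * \<tau>) * B)"
        proof (rule mult_mono)
          show "\<tau> powr (- \<theta>) / (\<tau> + 1) \<le> \<tau> powr (- \<theta>)"
            using True mult_left_mono[of 1 "\<tau> + 1" "\<tau> powr (- \<theta>)"] by (simp add: divide_le_eq)
          have "w * (a * \<tau>) \<le> w * (a * (\<tau> + 1))" using w a by simp
          then have e: "exp (- w * (a * (\<tau> + 1))) \<le> exp (- (w * a) * \<tau>)" by (simp add: mult_ac)
          have "norm (Sp (a * (\<tau> + 1)) (U (t\<^sub>0 - a * \<tau>))) \<le> M * exp (- w * (a * (\<tau> + 1))) * norm (U (t\<^sub>0 - a * \<tau>))"
            by (rule Sp_norm)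
          also have "\<dots> \<le> M * exp (- (w * a) * \<tau>) * B"
            using M B B0 e by (intro mult_mono) auto
          finally show "norm (Sp (a * (\<tau> + 1)) (U (t\<^sub>0 - a * \<tau>))) \<le> M * exp (- (w * a) * \<tau>) * B" .
        qed auto
        also have "\<dots> = ?c * (frac_kernel (1 - \<theta>) \<tau> * exp (- (w * a) * \<tau>))"
          using True G by (simp add: frac_kernel_def)
        finally show ?thesis .
      qed (simp add: K'_def q_def frac_kernel_def)
      then have "ennreal (norm (K' \<tau>)) \<le> ennreal (?c * (frac_kernel (1 - \<theta>) \<tau> * exp (- (w * a) * \<tau>)))" by (rule ennreal_leI)
      also have "\<dots> = ennreal ?c * ennreal (frac_kernel (1 - \<theta>) \<tau> * exp (- (w * a) * \<tau>))" by (rule ennreal_mult'[OF c0])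
      finally show "indicator {0..} \<tau> * ennreal (norm (K' \<tau>)) \<le> ennreal ?c * ennreal (frac_kernel (1 - \<theta>) \<tau> * exp (- (w * a) * \<tau>))"
        by (auto simp: indicator_def)
    qed
    also have "\<dots> < \<infinity>"
      using nn_integral_frac_kernel_exp_finite[of "1 - \<theta>" "w * a"] \<theta> w a
      by (simp add: nn_integral_cmult ennreal_mult_less_top)
    finally show ?thesis .
  qed
  show "bochner_integrable (lebesgue_on {0..}) K" by (rule bochner_integral_on(1)[OF _ K'M KK' fin]) simp
  show "U (t\<^sub>0 + a) = (sin (pi * \<theta>) / pi) *\<^sub>R bochner_integral (lebesgue_on {0..}) K
      + (\<Sum>k=1..m. (a powr (\<theta> + real k - 1) / Gamma (\<theta> + real k)) *\<^sub>R S a (frac_integral S (real (m - k + 1)) f t\<^sub>0))"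
  proof (rule functionals_separate)
    fix \<psi> :: "'a \<Rightarrow>\<^sub>L real"
    define F where "F r = \<psi> (Sp (a + r) (f (t\<^sub>0 - r)))" for r
    have [measurable]: "F \<in> borel_measurable borel" unfolding F_def
      by (intro smeas_functional Sp_apply_smeas smeas_compose[OF fM]) measurable
    let ?c = "\<lambda>k. a powr (\<theta> + real k - 1) / Gamma (\<theta> + real k)"
    have mk: "0 \<le> memory_kernel \<theta> a \<tau>" for \<tau> by (rule memory_kernel_nonneg[OF \<theta> a])
    have ks: "0 \<le> frac_kernel s \<tau>" for \<tau> by (rule frac_kernel_nonneg[OF s0])
    have fut: "has_bochner_integral lborel (\<lambda>r. (if 0 < r then frac_kernel s (a + r) else 0) * F r) (\<psi> (U (t\<^sub>0 + a)))"
      unfolding F_def U_def by (rule future_functional[OF adm f zero a])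
    have tay: "has_bochner_integral lborel (\<lambda>r. taylor_part \<theta> m a r * F r)
        (\<Sum>k=1..m. ?c k * \<psi> (S a (frac_integral S (real (m - k + 1)) f t\<^sub>0)))"
    proof -
      have "has_bochner_integral lborel (\<lambda>r. \<Sum>k=1..m. ?c k * (frac_kernel (real (m - k + 1)) r * F r))
        (\<Sum>k=1..m. ?c k * \<psi> (S a (frac_integral S (real (m - k + 1)) f t\<^sub>0)))"
        unfolding F_def
        by (intro has_bochner_integral_sum has_bochner_integral_mult_right initial_functional[OF admissible_ge_1[OF p] f a]) simp
      then show ?thesis by (simp only: taylor_part_def sum_distrib_right mult.assoc)
    qed
    \<comment> \<open>The remainder of the Taylor expansion of the kernel is the convolution with the memory kernel.\<close>
    define C where "C r = (if 0 < r then frac_kernel s (a + r) else 0) - taylor_part \<theta> m a r" for r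
    have [measurable]: "C \<in> borel_measurable borel" unfolding C_def by measurable
    have tay_out: "taylor_part \<theta> m a r = 0" if "\<not> 0 < r" for r using that by (simp add: taylor_part_def frac_kernel_def)
    have conv: "(\<integral>\<^sup>+\<tau>. ennreal (memory_kernel \<theta> a \<tau>) * ennreal (frac_kernel s (r - \<tau>)) \<partial>lborel) = ennreal (C r) \<and> 0 \<le> C r" for r
    proof (cases "0 < r")
      case True
      have t0: "0 \<le> taylor_part \<theta> m a r" by (rule taylor_part_nonneg[OF \<theta>(1)])
      have e: "(\<integral>\<^sup>+\<tau>. ennreal (memory_kernel \<theta> a \<tau>) * ennreal (frac_kernel s (r - \<tau>)) \<partial>lborel) + ennreal (taylor_part \<theta> m a r) = ennreal (frac_kernel s (a + r))"
        unfolding s by (rule memory_kernel_convolution[OF \<theta> a True])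
      have "ennreal (taylor_part \<theta> m a r) \<le> ennreal (frac_kernel s (a + r))" unfolding e[symmetric] by simp
      then have le: "taylor_part \<theta> m a r \<le> frac_kernel s (a + r)" using ks by simp
      have "(\<integral>\<^sup>+\<tau>. ennreal (memory_kernel \<theta> a \<tau>) * ennreal (frac_kernel s (r - \<tau>)) \<partial>lborel)
        = (\<integral>\<^sup>+\<tau>. ennreal (memory_kernel \<theta> a \<tau>) * ennreal (frac_kernel s (r - \<tau>)) \<partial>lborel) + ennreal (taylor_part \<theta> m a r) - ennreal (taylor_part \<theta> m a r)"
        by simp
      also have "\<dots> = ennreal (C r)" unfolding e using True t0 by (simp add: C_def ennreal_minus)
      finally show ?thesis using le True by (simp add: C_def)
    next
      case False
      then have "(\<integral>\<^sup>+\<tau>. ennreal (memory_kernel \<theta> a \<tau>) * ennreal (frac_kernel s (r - \<tau>)) \<partial>lborel) = (\<integral>\<^sup>+\<tau>. 0 \<partial>(lborel :: real measure))"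
        by (intro nn_integral_cong) (auto simp: memory_kernel_def frac_kernel_def)
      then show ?thesis using False tay_out[OF False] by (simp add: C_def)
    qed
    have CF: "has_bochner_integral lborel (\<lambda>r. C r * F r)
        (\<psi> (U (t\<^sub>0 + a)) - (\<Sum>k=1..m. ?c k * \<psi> (S a (frac_integral S (real (m - k + 1)) f t\<^sub>0))))"
      unfolding C_def left_diff_distrib by (rule has_bochner_integral_diff[OF fut tay])
    have "has_bochner_integral lborel (\<lambda>\<tau>. indicator {0..} \<tau> * \<psi> (K' \<tau>)) (\<psi> (bochner_integral (lebesgue_on {0..}) K))"
      by (rule bochner_integral_on(2)[OF _ K'M KK' fin]) simp
    then have "\<psi> ((sin (pi * \<theta>) / pi) *\<^sub>R bochner_integral (lebesgue_on {0..}) K)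
        = sin (pi * \<theta>) / pi * (LINT \<tau>|lborel. indicator {0..} \<tau> * \<psi> (K' \<tau>))"
      by (simp add: has_bochner_integral_iff blinfun.scaleR_right)
    also have "\<dots> = (LINT \<tau>|lborel. sin (pi * \<theta>) / pi * (indicator {0..} \<tau> * \<psi> (K' \<tau>)))" by simp
    \<comment> \<open>Scaling the integration variable by \<open>a\<close> turns the weight into the memory kernel.\<close>
    also have "\<dots> = (LINT \<tau>|lborel. a * (memory_kernel \<theta> a (a * \<tau>) * \<psi> (Sp (a + a * \<tau>) (U (t\<^sub>0 - a * \<tau>)))))"
    proof (rule Bochner_Integration.integral_cong)
      fix \<tau>
      show "sin (pi * \<theta>) / pi * (indicator {0..} \<tau> * \<psi> (K' \<tau>)) = a * (memory_kernel \<theta> a (a * \<tau>) * \<psi> (Sp (a + a * \<tau>) (U (t\<^sub>0 - a * \<tau>))))"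
      proof (cases "0 < \<tau>")
        case True
        have "a * memory_kernel \<theta> a (a * \<tau>) = sin (pi * \<theta>) / pi * q \<tau>"
        proof -
          have "(a * \<tau>) powr (- \<theta>) * a powr \<theta> = \<tau> powr (- \<theta>) * (a powr (- \<theta>) * a powr \<theta>)"
            using True a by (simp add: powr_mult)
          also have "a powr (- \<theta>) * a powr \<theta> = 1" using a by (simp add: powr_minus)
          finally have pw: "(a * \<tau>) powr (- \<theta>) * a powr \<theta> = \<tau> powr (- \<theta>)" by simp
          have "a * \<tau> + a = a * (\<tau> + 1)" by (simp add: algebra_simps)
          then show ?thesis using True a by (simp add: memory_kernel_def q_def pw)
        qed
        moreover have "a * (\<tau> + 1) = a + a * \<tau>" by (simp add: algebra_simps)
        ultimately show ?thesis using True by (simp add: K'_def blinfun.scaleR_right mult.assoc[symmetric])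
      next
        case False
        then have "memory_kernel \<theta> a (a * \<tau>) = 0" using a by (simp add: memory_kernel_def zero_less_mult_iff)
        then show ?thesis using False by (simp add: K'_def q_def blinfun.zero_right)
      qed
    qed simp
    also have "\<dots> = (LINT \<tau>|lborel. memory_kernel \<theta> a \<tau> * \<psi> (Sp (a + \<tau>) (U (t\<^sub>0 - \<tau>))))"
      using lborel_integral_real_affine[of a "\<lambda>\<tau>. memory_kernel \<theta> a \<tau> * \<psi> (Sp (a + \<tau>) (U (t\<^sub>0 - \<tau>)))" 0] a by simp
    also have "\<dots> = (LINT \<tau>|lborel. memory_kernel \<theta> a \<tau> * (LINT \<rho>|lborel. frac_kernel s \<rho> * F (\<tau> + \<rho>)))"
    proof (rule Bochner_Integration.integral_cong)
      fix \<tau>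
      show "memory_kernel \<theta> a \<tau> * \<psi> (Sp (a + \<tau>) (U (t\<^sub>0 - \<tau>))) = memory_kernel \<theta> a \<tau> * (LINT \<rho>|lborel. frac_kernel s \<rho> * F (\<tau> + \<rho>))"
      proof (cases "0 < \<tau>")
        case True
        have "has_bochner_integral lborel (\<lambda>\<rho>. frac_kernel s \<rho> * (\<psi> o\<^sub>L Sp (a + \<tau>)) (Sp \<rho> (f (t\<^sub>0 - \<tau> - \<rho>)))) ((\<psi> o\<^sub>L Sp (a + \<tau>)) (U (t\<^sub>0 - \<tau>)))"
          unfolding U_def by (rule frac_integral_functional(1)[OF s0 fM _ frac_norm_Lp_finite[OF adm f]]) simp
        moreover have "(\<lambda>\<rho>. frac_kernel s \<rho> * (\<psi> o\<^sub>L Sp (a + \<tau>)) (Sp \<rho> (f (t\<^sub>0 - \<tau> - \<rho>)))) = (\<lambda>\<rho>. frac_kernel s \<rho> * F (\<tau> + \<rho>))"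
        proof
          fix \<rho>
          show "frac_kernel s \<rho> * (\<psi> o\<^sub>L Sp (a + \<tau>)) (Sp \<rho> (f (t\<^sub>0 - \<tau> - \<rho>))) = frac_kernel s \<rho> * F (\<tau> + \<rho>)"
            using True a Sp_add[of "a + \<tau>" \<rho>] by (cases "0 < \<rho>") (simp_all add: frac_kernel_def F_def diff_diff_eq add.assoc)
        qed
        ultimately have "(LINT \<rho>|lborel. frac_kernel s \<rho> * F (\<tau> + \<rho>)) = (\<psi> o\<^sub>L Sp (a + \<tau>)) (U (t\<^sub>0 - \<tau>))"
          by (simp only:) (rule has_bochner_integral_integral_eq)
        then show ?thesis by simp
      qed (simp add: memory_kernel_def)
    qed simp
    also have "\<dots> = (LINT r|lborel. C r * F r)"
    proof (rule integral_convolution[OF _ _ _ _ mk ks])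
      have "integrable lborel (\<lambda>r. C r * F r)" using CF by (simp add: has_bochner_integral_iff)
      then show "(\<integral>\<^sup>+r. ennreal (C r * \<bar>F r\<bar>) \<partial>lborel) < \<infinity>" using conv by (simp add: integrable_iff_bounded abs_mult)
    qed (use conv in auto)
    also have "\<dots> = \<psi> (U (t\<^sub>0 + a)) - (\<Sum>k=1..m. ?c k * \<psi> (S a (frac_integral S (real (m - k + 1)) f t\<^sub>0)))"
      by (rule has_bochner_integral_integral_eq[OF CF])
    finally show "\<psi> (U (t\<^sub>0 + a)) = \<psi> ((sin (pi * \<theta>) / pi) *\<^sub>R bochner_integral (lebesgue_on {0..}) K
      + (\<Sum>k=1..m. ?c k *\<^sub>R S a (frac_integral S (real (m - k + 1)) f t\<^sub>0)))"
      by (simp add: blinfun.add_right blinfun.sum_right blinfun.scaleR_right)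
  qed
qed

end

section \<open>Bochner spaces and Borel representatives\<close>

lemma AE_lebesgue_on_UNIV: "(AE t in lebesgue_on UNIV. P t) \<longleftrightarrow> (AE t in lborel. P t)"
  using AE_lebesgue_on_iff[of UNIV P] by simp

lemma simple_function_lebesgue_on:
  fixes s :: "real \<Rightarrow> 'a::real_normed_vector"
  assumes I: "I \<in> sets borel" and s: "simple_function lebesgue s"
  shows "simple_function (lebesgue_on I) s"
proof -
  have I': "I \<in> sets lebesgue" "I \<inter> space lebesgue \<in> sets lebesgue" using I by auto
  show ?thesis unfolding simple_function_restrict_space[OF I'(2)]
    by (rule simple_function_compose2[where h="(*\<^sub>R)", OF simple_function_indicator[OF I'(1)] s])
qed

lemma Lp_finite_on:
  assumes I: "I \<in> sets borel" and "Lp_finite (ennreal q) lebesgue r"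
  shows "Lp_finite (ennreal q) (lebesgue_on I) r"
proof -
  have I': "I \<inter> space lebesgue \<in> sets lebesgue" using I by auto
  have "(\<integral>\<^sup>+x. ennreal (\<bar>r x\<bar> powr enn2real (ennreal q)) \<partial>lebesgue_on I)
      = (\<integral>\<^sup>+x. ennreal (\<bar>r x\<bar> powr enn2real (ennreal q)) * indicator I x \<partial>lebesgue)"
    by (rule nn_integral_restrict_space[OF I'])
  also have "\<dots> \<le> (\<integral>\<^sup>+x. ennreal (\<bar>r x\<bar> powr enn2real (ennreal q)) \<partial>lebesgue)"
    by (intro nn_integral_mono) (auto simp: indicator_def)
  also have "\<dots> < \<infinity>" using assms(2) by (simp add: Lp_finite_def)
  finally show ?thesis by (simp add: Lp_finite_def)
qed

lemma Lp_cong: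
  assumes I: "I \<in> sets borel" and v: "Lp (ennreal q) I v" and eq: "AE t in lborel. t \<in> I \<longrightarrow> v t = v' t"
  shows "Lp (ennreal q) I v'"
proof -
  have ae: "AE t in lebesgue_on I. v t = v' t" using eq I by (simp add: AE_lebesgue_on_iff)
  have "strongly_measurable (lebesgue_on I) v'"
  proof -
    obtain s where s: "\<And>n::nat. simple_function (lebesgue_on I) (s n)" "AE x in lebesgue_on I. (\<lambda>n. s n x) \<longlonglongrightarrow> v x"
      using v unfolding Lp_def strongly_measurable_def by blast
    from s(2) ae have "AE x in lebesgue_on I. (\<lambda>n. s n x) \<longlonglongrightarrow> v' x" by eventually_elim simp
    with s(1) show ?thesis unfolding strongly_measurable_def by blast
  qed
  moreover have "(\<integral>\<^sup>+t. ennreal (\<bar>norm (v' t)\<bar> powr enn2real (ennreal q)) \<partial>lebesgue_on I)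
      = (\<integral>\<^sup>+t. ennreal (\<bar>norm (v t)\<bar> powr enn2real (ennreal q)) \<partial>lebesgue_on I)"
    by (rule nn_integral_cong_AE) (use ae in eventually_elim, simp)
  ultimately show ?thesis using v by (simp add: Lp_def Lp_finite_def)
qed

lemma Lp_on:
  assumes I: "I \<in> sets borel" and v: "Lp (ennreal q) UNIV v"
  shows "Lp (ennreal q) I v"
proof -
  have "strongly_measurable lebesgue v" using v by (simp add: Lp_def lebesgue_on_UNIV_eq)
  then obtain v1 where v1: "smeas borel v1" "AE t in lborel. v t = v1 t"
    by (rule strongly_measurable_lebesgue_smeas)
  from v1(2) have "AE t in lborel. t \<in> I \<longrightarrow> v t = v1 t" by eventually_elim simp
  then have "strongly_measurable (lebesgue_on I) v"
    using I v1(1) by (intro smeas_strongly_measurable_on) auto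
  then show ?thesis using v Lp_finite_on[OF I] by (simp add: Lp_def lebesgue_on_UNIV_eq)
qed

lemma (in stable_semigroup) Lp_representative:
  fixes v :: "real \<Rightarrow> 'a"
  assumes q: "1 \<le> q" and v: "Lp (ennreal q) UNIV v"
  obtains v1 where "Lp_fun q v1" "AE t in lborel. v t = v1 t"
proof -
  have "strongly_measurable lebesgue v" using v by (simp add: Lp_def lebesgue_on_UNIV_eq)
  then obtain v1 where v1: "smeas borel v1" "AE t in lborel. v t = v1 t"
    by (rule strongly_measurable_lebesgue_smeas)
  have "(\<integral>\<^sup>+t. ennreal (norm (v1 t) powr q) \<partial>lborel) = (\<integral>\<^sup>+t. ennreal (norm (v t) powr q) \<partial>lborel)"
    by (rule nn_integral_cong_AE) (use v1(2) in eventually_elim, simp)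
  also have "\<dots> < \<infinity>"
    using v q by (simp add: Lp_def Lp_finite_def lebesgue_on_UNIV_eq nn_integral_completion)
  finally show ?thesis using v1 by (intro that[of v1]) (simp_all add: Lp_fun_def)
qed

lemma test_function_props:
  assumes "test_function I \<phi>"
  obtains a b C where "continuous_on UNIV \<phi>" "continuous_on UNIV (deriv \<phi>)"
    "\<And>x. x \<notin> {a..b} \<Longrightarrow> \<phi> x = 0 \<and> deriv \<phi> x = 0" "\<And>x. x \<notin> I \<Longrightarrow> \<phi> x = 0 \<and> deriv \<phi> x = 0"
    "\<And>x. \<bar>\<phi> x\<bar> \<le> C \<and> \<bar>deriv \<phi> x\<bar> \<le> C"
proof -
  have smooth: "(deriv ^^ n) \<phi> differentiable (at x)" for n x using assms by (simp add: test_function_def)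
  obtain K where K: "compact K" "K \<subseteq> interior I" "\<And>x. x \<notin> K \<Longrightarrow> \<phi> x = 0" using assms by (auto simp: test_function_def)
  have c0: "continuous_on UNIV \<phi>"
    using smooth[of 0] by (auto intro!: continuous_at_imp_continuous_on differentiable_imp_continuous_within)
  have c1: "continuous_on UNIV (deriv \<phi>)"
    using smooth[of 1] by (auto intro!: continuous_at_imp_continuous_on differentiable_imp_continuous_within)
  have out: "\<phi> x = 0 \<and> deriv \<phi> x = 0" if "x \<notin> K" for x
  proof -
    have "((\<lambda>x. 0) has_real_derivative 0) (at x)" by simp
    then have "(\<phi> has_real_derivative 0) (at x)"
      by (rule has_field_derivative_transform_within_open[of _ _ _ "- K"])
         (use K compact_imp_closed that in \<open>auto simp: open_Compl\<close>)
    then show ?thesis using K(3) that by (auto dest: DERIV_imp_deriv)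
  qed
  obtain a b where ab: "K \<subseteq> {a..b}"
    using compact_imp_bounded[OF K(1)] bounded_subset_cbox_symmetric[of K] by (metis cbox_interval)
  have bd: "\<exists>C. \<forall>x. \<bar>h x\<bar> \<le> C" if "continuous_on UNIV h" "\<And>x. x \<notin> K \<Longrightarrow> h x = 0" for h :: "real \<Rightarrow> real"
  proof -
    have "compact (h ` K)" using that(1) K(1) by (intro compact_continuous_image) (auto intro: continuous_on_subset)
    then obtain C where C: "\<And>x. x \<in> K \<Longrightarrow> \<bar>h x\<bar> \<le> C" using compact_imp_bounded bounded_iff by (metis imageI real_norm_def)
    have "\<bar>h x\<bar> \<le> \<bar>C\<bar>" for x using C[of x] that(2)[of x] by (cases "x \<in> K") auto
    then show ?thesis by blast
  qed
  obtain C0 where C0: "\<And>x. \<bar>\<phi> x\<bar> \<le> C0" using bd[OF c0] out by blast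
  obtain C1 where C1: "\<And>x. \<bar>deriv \<phi> x\<bar> \<le> C1" using bd[OF c1] out by blast
  have KI: "K \<subseteq> I" using K(2) interior_subset by blast
  show ?thesis
  proof (rule that[OF c0 c1, of a b "max C0 C1"])
    show "\<bar>\<phi> x\<bar> \<le> max C0 C1 \<and> \<bar>deriv \<phi> x\<bar> \<le> max C0 C1" for x
      using C0[of x] C1[of x] by (simp add: le_max_iff_disj)
    show "\<phi> x = 0 \<and> deriv \<phi> x = 0" if "x \<notin> {a..b}" for x using out[of x] ab that by blast
    show "\<phi> x = 0 \<and> deriv \<phi> x = 0" if "x \<notin> I" for x using out[of x] KI that by blast
  qed
qed

lemma bochner_integral_weighted:
  fixes v v1 :: "real \<Rightarrow> 'a::complex_banach" and \<psi> :: "'a \<Rightarrow>\<^sub>L real"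
  assumes I: "I \<in> sets borel" and \<theta>: "continuous_on UNIV \<theta>" "\<And>x. x \<notin> {a..b} \<Longrightarrow> \<theta> x = 0" "\<And>x. x \<notin> I \<Longrightarrow> \<theta> x = 0"
      "\<And>x. \<bar>\<theta> x\<bar> \<le> C"
    and v1: "smeas borel v1" "AE t in lborel. v t = v1 t"
    and loc: "(\<integral>\<^sup>+x. indicator {a..b} x * ennreal (norm (v1 x)) \<partial>lborel) < \<infinity>"
  shows "\<psi> (bochner_integral (lebesgue_on I) (\<lambda>t. \<theta> t *\<^sub>R v t)) = (LINT t|lborel. \<theta> t * \<psi> (v1 t))"
proof -
  have [measurable]: "\<theta> \<in> borel_measurable borel" by (rule borel_measurable_continuous_onI[OF \<theta>(1)])
  have [measurable]: "(\<lambda>x. norm (v1 x)) \<in> borel_measurable borel" by (rule smeas_norm[OF v1(1)])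
  have C: "0 \<le> C" using \<theta>(4)[of 0] by linarith
  have sm: "smeas borel (\<lambda>t. \<theta> t *\<^sub>R v1 t)" by (intro smeas_scaleR v1) measurable
  have "(\<integral>\<^sup>+t. indicator I t * ennreal (norm (\<theta> t *\<^sub>R v1 t)) \<partial>lborel)
      \<le> (\<integral>\<^sup>+t. ennreal C * (indicator {a..b} t * ennreal (norm (v1 t))) \<partial>lborel)"
  proof (rule nn_integral_mono)
    fix t
    show "indicator I t * ennreal (norm (\<theta> t *\<^sub>R v1 t)) \<le> ennreal C * (indicator {a..b} t * ennreal (norm (v1 t)))"
    proof (cases "t \<in> {a..b}")
      case True
      have "ennreal (norm (\<theta> t *\<^sub>R v1 t)) \<le> ennreal (C * norm (v1 t))"
        using \<theta>(4) by (intro ennreal_leI) (simp add: mult_right_mono)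
      then show ?thesis using True C by (auto simp: indicator_def ennreal_mult)
    qed (simp add: \<theta>(2))
  qed
  also have "\<dots> < \<infinity>" using loc by (simp add: nn_integral_cmult ennreal_mult_less_top)
  finally have fin: "(\<integral>\<^sup>+t. indicator I t * ennreal (norm (\<theta> t *\<^sub>R v1 t)) \<partial>lborel) < \<infinity>" .
  have ae: "AE t in lborel. t \<in> I \<longrightarrow> \<theta> t *\<^sub>R v t = \<theta> t *\<^sub>R v1 t" using v1(2) by eventually_elim simp
  have "indicator I t * \<psi> (\<theta> t *\<^sub>R v1 t) = \<theta> t * \<psi> (v1 t)" for t
    using \<theta>(3)[of t] by (auto simp: indicator_def blinfun.scaleR_right)
  then show ?thesis
    using has_bochner_integral_integral_eq[OF bochner_integral_on(2)[OF I sm ae fin, of \<psi>]] by simp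
qed

section \<open>Powers of the parabolic operator\<close>

lemma parabolic_power_Lp: "parabolic_power p I D A n v f \<Longrightarrow> Lp p I v \<and> Lp p I f"
  by (induction n arbitrary: f) (auto simp: parabolic_op_def)

lemma parabolic_power_split:
  "parabolic_power p I D A (i + j) v f \<Longrightarrow> \<exists>h. parabolic_power p I D A i v h \<and> parabolic_power p I D A j h f"
proof (induction j arbitrary: f)
  case 0
  then show ?case using parabolic_power_Lp by fastforce
next
  case (Suc j)
  then obtain h' where h': "parabolic_power p I D A (i + j) v h'" "parabolic_op p I D A h' f" by auto
  from Suc.IH[OF h'(1)] h'(2) show ?case by auto
qed

lemma parabolic_power_cong_left:
  assumes "I \<in> sets borel" "AE t in lborel. t \<in> I \<longrightarrow> v t = v' t" "parabolic_power (ennreal q) I D A n v f"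
  shows "parabolic_power (ennreal q) I D A n v' f"
  using assms(3)
proof (induction n arbitrary: f)
  case 0
  have ae: "AE t in lebesgue_on I. v t = v' t" using assms(1,2) by (simp add: AE_lebesgue_on_iff)
  have "AE t in lebesgue_on I. f t = v t" using 0 by simp
  then have "AE t in lebesgue_on I. f t = v' t" using ae by eventually_elim simp
  then show ?case using 0 Lp_cong[OF assms(1) _ assms(2)] by simp
qed auto

lemma parabolic_power_cong_right:
  assumes I: "I \<in> sets borel" and eq: "AE t in lborel. t \<in> I \<longrightarrow> f t = f' t" and pp: "parabolic_power (ennreal q) I D A n v f"
  shows "parabolic_power (ennreal q) I D A n v f'"
proof -
  have ae: "AE t in lebesgue_on I. f t = f' t" using I eq by (simp add: AE_lebesgue_on_iff)
  show ?thesis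
  proof (cases n)
    case 0
    then have "AE t in lebesgue_on I. f t = v t" using pp by simp
    then have "AE t in lebesgue_on I. f' t = v t" using ae by eventually_elim simp
    then show ?thesis using 0 pp Lp_cong[OF I _ eq] by simp
  next
    case (Suc k)
    then obtain h v' where h: "parabolic_power (ennreal q) I D A k v h" "Lp_dom (ennreal q) I D A h" "Lp (ennreal q) I f"
      "W1p_deriv (ennreal q) I h v'" "AE t in lebesgue_on I. f t = v' t + A (h t)"
      using pp by (auto simp: parabolic_op_def)
    from h(5) ae have "AE t in lebesgue_on I. f' t = v' t + A (h t)" by eventually_elim simp
    then have "parabolic_op (ennreal q) I D A h f'"
      using h Lp_cong[OF I h(3) eq] by (auto simp: parabolic_op_def)
    then show ?thesis using h(1) Suc by auto
  qed
qed

context generated_semigroup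
begin

lemma W1p_deriv_functional:
  fixes \<psi> :: "'a \<Rightarrow>\<^sub>L real"
  assumes q: "1 \<le> q" and v: "Lp_fun q v1" "AE t in lborel. v t = v1 t" and v': "Lp_fun q v1'" "AE t in lborel. v' t = v1' t"
    and I: "I \<in> sets borel" and \<phi>: "test_function I \<phi>"
  shows "\<psi> (bochner_integral (lebesgue_on I) (\<lambda>t. deriv \<phi> t *\<^sub>R v t)) = (LINT t|lborel. deriv \<phi> t * \<psi> (v1 t))"
    and "\<psi> (bochner_integral (lebesgue_on I) (\<lambda>t. \<phi> t *\<^sub>R v' t)) = (LINT t|lborel. \<phi> t * \<psi> (v1' t))"
proof -
  obtain a b C where \<phi>': "continuous_on UNIV \<phi>" "continuous_on UNIV (deriv \<phi>)"
    "\<And>x. x \<notin> {a..b} \<Longrightarrow> \<phi> x = 0 \<and> deriv \<phi> x = 0" "\<And>x. x \<notin> I \<Longrightarrow> \<phi> x = 0 \<and> deriv \<phi> x = 0"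
    "\<And>x. \<bar>\<phi> x\<bar> \<le> C \<and> \<bar>deriv \<phi> x\<bar> \<le> C"
    by (rule test_function_props[OF \<phi>]) blast
  note t = tame_Lp[OF q v(1)] and t' = tame_Lp[OF q v'(1)]
  show "\<psi> (bochner_integral (lebesgue_on I) (\<lambda>t. deriv \<phi> t *\<^sub>R v t)) = (LINT t|lborel. deriv \<phi> t * \<psi> (v1 t))"
    by (rule bochner_integral_weighted[OF I \<phi>'(2) _ _ _ tame_smeas[OF t] v(2) tame_locally_integrable[OF t]]) (use \<phi>' in auto)
  show "\<psi> (bochner_integral (lebesgue_on I) (\<lambda>t. \<phi> t *\<^sub>R v' t)) = (LINT t|lborel. \<phi> t * \<psi> (v1' t))"
    by (rule bochner_integral_weighted[OF I \<phi>'(1) _ _ _ tame_smeas[OF t'] v'(2) tame_locally_integrable[OF t']]) (use \<phi>' in auto)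
qed

text \<open>A test function on \<open>I\<close> is one on the line, and its integrals over \<open>I\<close> are those over the line. The proof
  compares Borel representatives, tested with functionals.\<close>

lemma W1p_deriv_on:
  assumes q: "1 \<le> q" and I: "I \<in> sets borel" and W: "W1p_deriv (ennreal q) UNIV v v'"
  shows "W1p_deriv (ennreal q) I v (v' :: real \<Rightarrow> 'a)"
proof -
  have L: "Lp (ennreal q) UNIV v" "Lp (ennreal q) UNIV v'" using W by (auto simp: W1p_deriv_def)
  obtain v1 where v1: "Lp_fun q v1" "AE t in lborel. v t = v1 t" by (rule Lp_representative[OF q L(1)])
  obtain v1' where v1': "Lp_fun q v1'" "AE t in lborel. v' t = v1' t" by (rule Lp_representative[OF q L(2)])
  have "bochner_integral (lebesgue_on I) (\<lambda>t. deriv \<phi> t *\<^sub>R v t) = - bochner_integral (lebesgue_on I) (\<lambda>t. \<phi> t *\<^sub>R v' t)"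
    if \<phi>: "test_function I \<phi>" for \<phi>
  proof (rule functionals_separate)
    fix \<psi> :: "'a \<Rightarrow>\<^sub>L real"
    have \<phi>U: "test_function UNIV \<phi>" using \<phi> by (auto simp: test_function_def)
    then have "bochner_integral (lebesgue_on UNIV) (\<lambda>t. deriv \<phi> t *\<^sub>R v t) = - bochner_integral (lebesgue_on UNIV) (\<lambda>t. \<phi> t *\<^sub>R v' t)"
      using W unfolding W1p_deriv_def by blast
    then have "\<psi> (bochner_integral (lebesgue_on UNIV) (\<lambda>t. deriv \<phi> t *\<^sub>R v t)) = - \<psi> (bochner_integral (lebesgue_on UNIV) (\<lambda>t. \<phi> t *\<^sub>R v' t))"
      by (simp add: blinfun.minus_right)
    then have "(LINT t|lborel. deriv \<phi> t * \<psi> (v1 t)) = - (LINT t|lborel. \<phi> t * \<psi> (v1' t))"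
      using W1p_deriv_functional[OF q v1 v1' _ \<phi>U, of \<psi>] by simp
    then show "\<psi> (bochner_integral (lebesgue_on I) (\<lambda>t. deriv \<phi> t *\<^sub>R v t)) = \<psi> (- bochner_integral (lebesgue_on I) (\<lambda>t. \<phi> t *\<^sub>R v' t))"
      using W1p_deriv_functional[OF q v1 v1' I \<phi>, of \<psi>] by (simp add: blinfun.minus_right)
  qed
  then show ?thesis using Lp_on[OF I L(1)] Lp_on[OF I L(2)] by (simp add: W1p_deriv_def)
qed

lemma parabolic_op_on:
  fixes v :: "real \<Rightarrow> 'a"
  assumes q: "1 \<le> q" and I: "I \<in> sets borel" and P: "parabolic_op (ennreal q) UNIV D A v f"
  shows "parabolic_op (ennreal q) I D A v f"
proof -
  have AE_on: "AE t in lebesgue_on I. Q t" if "AE t in lebesgue_on UNIV. Q t" for Q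
    using that I by (simp add: AE_lebesgue_on_iff) (auto elim: eventually_mono)
  obtain v' where v': "W1p_deriv (ennreal q) UNIV v v'" "AE t in lebesgue_on UNIV. f t = v' t + A (v t)"
    and L: "Lp (ennreal q) UNIV f" and d: "Lp_dom (ennreal q) UNIV D A v"
    using P by (auto simp: parabolic_op_def)
  obtain s where s: "\<And>n::nat. simple_function (lebesgue_on UNIV) (s n) \<and> s n ` UNIV \<subseteq> D"
      "AE t in lebesgue_on UNIV. v t \<in> D \<and> (\<lambda>n. norm (s n t - v t) + norm (A (s n t) - A (v t))) \<longlonglongrightarrow> 0"
    using d unfolding Lp_dom_def by blast
  have fin: "Lp_finite (ennreal q) (lebesgue_on I) (\<lambda>t. norm (v t) + norm (A (v t)))"
    using d by (intro Lp_finite_on[OF I]) (simp add: Lp_dom_def lebesgue_on_UNIV_eq)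
  have "Lp_dom (ennreal q) I D A v" unfolding Lp_dom_def
  proof (intro conjI exI[of _ s] allI fin)
    show "simple_function (lebesgue_on I) (s n)" for n
      using s(1)[of n] by (intro simple_function_lebesgue_on[OF I]) (simp add: lebesgue_on_UNIV_eq)
    show "s n ` I \<subseteq> D" for n using s(1)[of n] by blast
  qed (rule AE_on[OF s(2)])
  then show ?thesis unfolding parabolic_op_def
    using W1p_deriv_on[OF q I v'(1)] AE_on[OF v'(2)] Lp_on[OF I L] by blast
qed

lemma parabolic_power_on:
  fixes v :: "real \<Rightarrow> 'a"
  assumes q: "1 \<le> q" and I: "I \<in> sets borel" and "parabolic_power (ennreal q) UNIV D A n v f"
  shows "parabolic_power (ennreal q) I D A n v f"
  using assms(3)
proof (induction n arbitrary: f)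
  case 0
  then have "AE t in lborel. f t = v t" by (simp add: AE_lebesgue_on_UNIV)
  then have "AE t in lebesgue_on I. f t = v t" using I by (simp add: AE_lebesgue_on_iff) (auto elim: eventually_mono)
  then show ?case using 0 Lp_on[OF I, of q v] Lp_on[OF I, of q f] by simp
next
  case (Suc n)
  then show ?case using parabolic_op_on[OF q I] by auto
qed

text \<open>A function with a weak derivative agrees almost everywhere with an antiderivative of it, to which the
  left inverse applies.\<close>

lemma parabolic_op_inverse:
  fixes v :: "real \<Rightarrow> 'a"
  assumes q: "1 \<le> q" and P: "parabolic_op (ennreal q) UNIV D A v f" and f: "Lp_fun q f1" "AE t in lborel. f t = f1 t"
  shows "AE t in lborel. v t = frac_integral S 1 f1 t"
proof -
  obtain v' where W: "W1p_deriv (ennreal q) UNIV v v'" and eq: "AE t in lborel. f t = v' t + A (v t)"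
    and d: "AE t in lborel. v t \<in> D"
  proof -
    obtain v' where v': "W1p_deriv (ennreal q) UNIV v v'" "AE t in lebesgue_on UNIV. f t = v' t + A (v t)"
      and dom: "Lp_dom (ennreal q) UNIV D A v" using P by (auto simp: parabolic_op_def)
    have "AE t in lebesgue_on UNIV. v t \<in> D" using dom unfolding Lp_dom_def by (auto elim: eventually_mono)
    then show ?thesis using v' by (intro that[of v']) (auto simp: AE_lebesgue_on_UNIV)
  qed
  have L: "Lp (ennreal q) UNIV v" "Lp (ennreal q) UNIV v'" using W by (auto simp: W1p_deriv_def)
  obtain v1 where v1: "Lp_fun q v1" "AE t in lborel. v t = v1 t" by (rule Lp_representative[OF q L(1)])
  obtain v1' where v1': "Lp_fun q v1'" "AE t in lborel. v' t = v1' t" by (rule Lp_representative[OF q L(2)])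
  note t = tame_Lp[OF q v1(1)] and t' = tame_Lp[OF q v1'(1)]
  have weak: "(LINT t|lborel. deriv \<phi> t * \<psi> (v1 t)) = - (LINT t|lborel. \<phi> t * \<psi> (v1' t))"
    if "test_function UNIV \<phi>" for \<phi> and \<psi> :: "'a \<Rightarrow>\<^sub>L real"
  proof -
    have "\<psi> (bochner_integral (lebesgue_on UNIV) (\<lambda>t. deriv \<phi> t *\<^sub>R v t)) = \<psi> (- bochner_integral (lebesgue_on UNIV) (\<lambda>t. \<phi> t *\<^sub>R v' t))"
      using W that unfolding W1p_deriv_def by metis
    then show ?thesis
      using W1p_deriv_functional[OF q v1 v1' _ that, of \<psi>] by (simp add: blinfun.minus_right)
  qed
  obtain V where V: "antiderivative v1' V" "AE t in lborel. v1 t = V t"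
    using weak_derivative_antiderivative[OF tame_smeas[OF t] tame_smeas[OF t'] tame_locally_integrable[OF t] tame_locally_integrable[OF t'] weak]
    by blast
  have "Lp_fun q V"
  proof -
    have "(\<integral>\<^sup>+t. ennreal (norm (V t) powr q) \<partial>lborel) = (\<integral>\<^sup>+t. ennreal (norm (v1 t) powr q) \<partial>lborel)"
      by (rule nn_integral_cong_AE) (use V(2) in eventually_elim, simp)
    then show ?thesis using v1(1) smeas_continuous[OF antiderivativeD(1)[OF V(1)]] by (simp add: Lp_fun_def)
  qed
  then have Vt: "tame V" by (rule tame_Lp[OF q])
  have "AE x in lborel. V x \<in> D \<and> A (V x) = f1 x - v1' x"
    using eq d v1(2) v1'(2) V(2) f(2) by eventually_elim auto
  then have "V t = frac_integral S 1 f1 t" for t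
    by (rule parabolic_left_inverse[OF tame_Lp[OF q f(1)] t' V(1) Vt])
  then show ?thesis using v1(2) V(2) by auto
qed

lemma Lp_fun_cong_AE:
  assumes "Lp_fun q u" "smeas borel v" "AE t in lborel. u t = v t"
  shows "Lp_fun q v"
proof -
  have "(\<integral>\<^sup>+t. ennreal (norm (v t) powr q) \<partial>lborel) = (\<integral>\<^sup>+t. ennreal (norm (u t) powr q) \<partial>lborel)"
    by (rule nn_integral_cong_AE) (use assms(3) in eventually_elim, simp)
  then show ?thesis using assms by (simp add: Lp_fun_def)
qed

lemma frac_integral_Lp_smeas:
  assumes "admissible q \<sigma>" "Lp_fun q f"
  shows "smeas borel (frac_integral S \<sigma> f)"
  by (rule smeas_continuous[OF frac_integral_Lp_continuous[OF assms]])

lemma parabolic_power_inverse: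
  fixes v :: "real \<Rightarrow> 'a"
  assumes q: "1 \<le> q" and P: "parabolic_power (ennreal q) UNIV D A n v f" and n: "0 < n"
    and f: "Lp_fun q f1" "AE t in lborel. f t = f1 t"
  shows "AE t in lborel. v t = frac_integral S (real n) f1 t"
  using P n f
proof (induction n arbitrary: f f1)
  case (Suc n)
  then obtain h where h: "parabolic_power (ennreal q) UNIV D A n v h" "parabolic_op (ennreal q) UNIV D A h f" by auto
  have h1: "AE t in lborel. h t = frac_integral S 1 f1 t"
    by (rule parabolic_op_inverse[OF q h(2) Suc.prems(3,4)])
  show ?case
  proof (cases "n = 0")
    case True
    then have "AE t in lborel. h t = v t" using h(1) by (simp add: AE_lebesgue_on_UNIV)
    then have "AE t in lborel. v t = frac_integral S 1 f1 t" using h1 by eventually_elim simp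
    then show ?thesis using True by simp
  next
    case False
    have adm1: "admissible q 1" by (rule admissible_ge_1[OF q]) simp
    have sm: "smeas borel (frac_integral S 1 f1)" by (rule frac_integral_Lp_smeas[OF adm1 Suc.prems(3)])
    obtain h2 where h2: "Lp_fun q h2" "AE t in lborel. h t = h2 t"
      using Lp_representative[OF q] parabolic_power_Lp[OF h(1)] by blast
    from h1 h2(2) have "AE t in lborel. h2 t = frac_integral S 1 f1 t" by eventually_elim simp
    from Lp_fun_cong_AE[OF h2(1) sm this] have Lh: "Lp_fun q (frac_integral S 1 f1)" .
    have "AE t in lborel. v t = frac_integral S (real n) (frac_integral S 1 f1) t"
      using False by (intro Suc.IH[OF h(1) _ Lh h1]) simp
    moreover have "frac_integral S (real n) (frac_integral S 1 f1) t = frac_integral S (real (Suc n)) f1 t" for t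
    proof -
      have adm: "admissible q (real n + 1)" by (rule admissible_ge_1[OF q]) simp
      have "frac_integral S (real n) (frac_integral S 1 f1) t = frac_integral S (real n + 1) f1 t"
        using Suc.prems(3) False
        by (intro frac_integral_compose(2) frac_norm_Lp_finite[OF adm] sm) (auto simp: Lp_fun_def)
      then show ?thesis by (simp add: add.commute)
    qed
    ultimately show ?thesis by simp
  qed
qed simp

end

section \<open>Solutions of the Dirichlet problem\<close>

context generated_semigroup
begin

text \<open>With \<open>\<alpha> = \<lceil>s\<rceil> - s\<close>, inverting the power of \<open>\<partial>\<^sub>t + A\<close> determines the fractional integral of order \<open>\<alpha>\<close> of \<open>u\<close>.
  Another fractional integral of order \<open>1 - \<alpha>\<close> completes the order to \<open>1\<close>, where fractional integrals are
  injective.\<close>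

lemma solution_is_frac_integral:
  fixes u f :: "real \<Rightarrow> 'a"
  assumes adm: "admissible q s" and u: "Lp (ennreal q) UNIV u"
    and P: "parabolic_power (ennreal q) UNIV D A (nat \<lceil>s\<rceil>) (frac_integral S (of_int \<lceil>s\<rceil> - s) u) f"
    and f: "Lp_fun q f1" "AE t in lborel. f t = f1 t"
  shows "AE t in lborel. u t = frac_integral S s f1 t"
proof -
  have q: "1 \<le> q" and s: "0 < s" using admissible_pos[OF adm] by auto
  define n where "n = nat \<lceil>s\<rceil>"
  define \<alpha> where "\<alpha> = of_int \<lceil>s\<rceil> - s"
  have n: "0 < n" "real n = s + \<alpha>" using s by (auto simp: n_def \<alpha>_def)
  have \<alpha>: "0 \<le> \<alpha>" "\<alpha> < 1" unfolding \<alpha>_def by linarith+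
  have inv: "AE t in lborel. frac_integral S \<alpha> u t = frac_integral S (real n) f1 t"
    using parabolic_power_inverse[OF q P _ f] n(1) by (simp add: n_def \<alpha>_def)
  show ?thesis
  proof (cases "\<alpha> = 0")
    case True
    then show ?thesis using inv n(2) by (simp add: frac_integral_def)
  next
    case False
    then have \<alpha>0: "0 < \<alpha>" "0 < 1 - \<alpha>" using \<alpha> by auto
    obtain u1 where u1: "Lp_fun q u1" "AE t in lborel. u t = u1 t" by (rule Lp_representative[OF q u])
    have u1M: "smeas borel u1" and f1M: "smeas borel f1" using u1(1) f(1) by (auto simp: Lp_fun_def)
    have admn: "admissible q (real n)" by (rule admissible_ge_1[OF q]) (use n in simp)
    have sm_n: "smeas borel (frac_integral S (real n) f1)" by (rule frac_integral_Lp_smeas[OF admn f(1)])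
    have sm_s: "smeas borel (frac_integral S s f1)" by (rule frac_integral_Lp_smeas[OF adm f(1)])
    have cong: "frac_integral S \<alpha> u t = frac_integral S \<alpha> u1 t" for t
      by (rule frac_integral_cong_history) (use u1(2) \<alpha>0 in \<open>auto elim: eventually_mono\<close>)
    have adms: "admissible q (1 - \<alpha> + real n)" "admissible q (1 + s)"
      by (rule admissible_ge_1[OF q], use \<alpha> n s in simp)+
    have same: "frac_integral S 1 u1 t = frac_integral S 1 (frac_integral S s f1) t" for t
    proof -
      have "frac_integral S (1 - \<alpha>) (frac_integral S (real n) f1) t = frac_integral S (1 - \<alpha> + \<alpha>) u1 t"
        using inv tame_finite[OF tame_Lp[OF q u1(1)]] by (intro frac_integral_compose(2) \<alpha>0 u1M sm_n) (auto simp: cong elim: eventually_mono)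
      moreover have "frac_integral S (1 - \<alpha>) (frac_integral S (real n) f1) t = frac_integral S (1 - \<alpha> + real n) f1 t"
        using n by (intro frac_integral_compose(2) \<alpha>0 f1M sm_n frac_norm_Lp_finite[OF adms(1) f(1)]) auto
      moreover have "frac_integral S 1 (frac_integral S s f1) t = frac_integral S (1 + s) f1 t"
        using s by (intro frac_integral_compose(2) f1M sm_s frac_norm_Lp_finite[OF adms(2) f(1)]) auto
      moreover have "1 - \<alpha> + real n = 1 + s" using n(2) by simp
      ultimately show ?thesis by simp
    qed
    obtain K where K: "\<And>t. norm (frac_integral S s f1 t) \<le> K" using frac_integral_Lp_bounded[OF adm f(1)] by blast
    have tU: "tame (frac_integral S s f1)" by (rule tame_bounded[OF sm_s K])
    have tu: "tame u1" by (rule tame_Lp[OF q u1(1)])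
    have td: "tame (\<lambda>t. u1 t - frac_integral S s f1 t)" by (rule tame_diff[OF tu tU])
    have "frac_integral S 1 (\<lambda>t. u1 t - frac_integral S s f1 t) t = 0" for t
      using frac_integral_diff[OF zero_less_one u1M sm_s tame_finite[OF tu] tame_finite[OF tU] tame_finite[OF td], of t] same by simp
    from frac_integral_1_injective[OF td this] u1(2) show ?thesis
      by eventually_elim simp
  qed
qed

text \<open>The continuous representatives are the fractional integrals of the source: that of order \<open>s\<close> for \<open>g\<close> and
  \<open>u\<close>, and that of order \<open>s - \<sigma>\<close> for the fractional power of order \<open>\<sigma>\<close> of \<open>g\<close>.\<close>

theorem Lp_solution_mild:
  fixes g u :: "real \<Rightarrow> 'a"
  assumes adm: "admissible q s" and g: "Lp (ennreal q) {..t\<^sub>0} g"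
    and sol: "Lp_solution (ennreal q) D A S s t\<^sub>0 g u"
  shows "mild_solution (ennreal q) D A S s t\<^sub>0 g u"
proof -
  have q: "1 \<le> q" and s: "0 < s" using admissible_pos[OF adm] by auto
  define n where "n = nat \<lceil>s\<rceil>"
  define \<alpha> where "\<alpha> = of_int \<lceil>s\<rceil> - s"
  let ?I = "{..t\<^sub>0}"
  have I: "?I \<in> sets borel" by simp
  obtain f where u: "Lp (ennreal q) UNIV u" and fp: "frac_parabolic (ennreal q) UNIV D A S s u f"
    and f0: "AE t in lebesgue_on {t\<^sub>0<..}. f t = 0" and ug: "AE t in lebesgue_on ?I. u t = g t"
    using sol unfolding Lp_solution_def by blast
  have P: "parabolic_power (ennreal q) UNIV D A n (frac_integral S \<alpha> u) f"
    using fp by (simp add: frac_parabolic_def n_def \<alpha>_def)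
  have ug': "AE t in lborel. t \<in> ?I \<longrightarrow> u t = g t" using ug by (simp add: AE_lebesgue_on_iff)
  have f0': "AE t in lborel. t \<in> {t\<^sub>0<..} \<longrightarrow> f t = 0" using f0 by (simp add: AE_lebesgue_on_iff)
  \<comment> \<open>A Borel representative of the source that vanishes everywhere after \<open>t\<^sub>0\<close>.\<close>
  obtain f1 where f1: "Lp_fun q f1" "AE t in lborel. f t = f1 t" and zero: "\<And>t. t\<^sub>0 < t \<Longrightarrow> f1 t = 0"
  proof -
    have "Lp (ennreal q) UNIV f" using parabolic_power_Lp[OF P] by simp
    then obtain f2 where f2: "Lp_fun q f2" "AE t in lborel. f t = f2 t" by (rule Lp_representative[OF q])
    let ?f = "\<lambda>t. indicator ?I t *\<^sub>R f2 t"
    have "AE t in lborel. f2 t = ?f t" using f2(2) f0' by eventually_elim (auto simp: indicator_def)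
    moreover have "smeas borel ?f" using f2(1) by (intro smeas_scaleR) (auto simp: Lp_fun_def)
    ultimately have "Lp_fun q ?f" using Lp_fun_cong_AE[OF f2(1)] by blast
    moreover have "AE t in lborel. f t = ?f t" using f2(2) f0' by eventually_elim (auto simp: indicator_def)
    ultimately show ?thesis by (rule that) simp
  qed
  define U where "U = frac_integral S s f1"
  have uU: "AE t in lborel. u t = U t"
    unfolding U_def by (rule solution_is_frac_integral[OF adm u P[unfolded n_def \<alpha>_def] f1])
  have gU: "AE t in lborel. t \<in> ?I \<longrightarrow> g t = U t" using uU ug' by eventually_elim auto
  have U_cont: "continuous_on X U" for X
    unfolding U_def by (rule continuous_on_subset[OF frac_integral_Lp_continuous[OF adm f1(1)]]) simp
  have bdd: "bounded (frac_integral S \<sigma> f1 ` X)" if "admissible q \<sigma>" for \<sigma> X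
    using frac_integral_Lp_bounded[OF that f1(1)] unfolding bounded_iff by blast
  define h where "h \<sigma> = frac_integral S (s - \<sigma>) f1" for \<sigma>
  have same_frac: "frac_integral S \<alpha> u t = frac_integral S \<alpha> g t" if "t \<in> ?I" "\<alpha> \<noteq> 0" for t
    by (rule frac_integral_cong_history) (use ug' that in \<open>auto elim: eventually_mono\<close>)
  \<comment> \<open>The intermediate stages of the power applied to \<open>u\<close>, restricted to the history, are powers applied to \<open>g\<close>.\<close>
  have stage: "frac_parabolic (ennreal q) ?I D A S (s - real i) g (frac_integral S (real i) f1)
      \<and> admissible q (real i)" if i: "1 \<le> i" "i \<le> n" for i
  proof -
    have adm_i: "admissible q (real i)" by (rule admissible_ge_1[OF q]) (use i in simp)
    have "parabolic_power (ennreal q) UNIV D A ((n - i) + i) (frac_integral S \<alpha> u) f" using P i by simp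
    then obtain k where k: "parabolic_power (ennreal q) UNIV D A (n - i) (frac_integral S \<alpha> u) k"
        "parabolic_power (ennreal q) UNIV D A i k f"
      using parabolic_power_split by blast
    have kJ: "AE t in lborel. k t = frac_integral S (real i) f1 t"
      by (rule parabolic_power_inverse[OF q k(2) _ f1]) (use i in simp)
    have pp: "parabolic_power (ennreal q) ?I D A (n - i) (frac_integral S \<alpha> u) k"
      by (rule parabolic_power_on[OF q I k(1)])
    have eq: "AE t in lborel. t \<in> ?I \<longrightarrow> frac_integral S \<alpha> u t = frac_integral S \<alpha> g t"
    proof (cases "\<alpha> = 0")
      case True then show ?thesis using ug' by (simp add: frac_integral_def)
    qed (use same_frac in auto)
    have pp: "parabolic_power (ennreal q) ?I D A (n - i) (frac_integral S \<alpha> g) k"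
      by (rule parabolic_power_cong_left[OF I eq pp])
    have eq: "AE t in lborel. t \<in> ?I \<longrightarrow> k t = frac_integral S (real i) f1 t" using kJ by eventually_elim simp
    have pp: "parabolic_power (ennreal q) ?I D A (n - i) (frac_integral S \<alpha> g) (frac_integral S (real i) f1)"
      by (rule parabolic_power_cong_right[OF I eq pp])
    have c: "\<lceil>s - real i\<rceil> = \<lceil>s\<rceil> - int i" by linarith
    have "nat \<lceil>s - real i\<rceil> = n - i" unfolding c n_def by (simp add: nat_diff_distrib')
    moreover have "of_int \<lceil>s - real i\<rceil> - (s - real i) = \<alpha>" unfolding c \<alpha>_def by simp
    ultimately show ?thesis using pp g adm_i by (simp add: frac_parabolic_def)
  qed
  \<comment> \<open>For \<open>s < 1\<close> the only order is \<open>0\<close>, and the power is \<open>g\<close> itself; otherwise \<open>s - \<sigma>\<close> is natural and positive.\<close>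
  have orders: "frac_parabolic (ennreal q) ?I D A S \<sigma> g (h \<sigma>) \<and> continuous_on ?I (h \<sigma>)"
    if \<sigma>: "\<sigma> \<in> {max (s - 1) 0} \<union> {frac s + real k - 1 | k. k \<in> {1..nat \<lfloor>s\<rfloor>}}" for \<sigma>
  proof (cases "s < 1 \<and> \<sigma> = 0")
    case True
    have "AE t in lebesgue_on ?I. U t = g t"
      using gU I by (simp add: AE_lebesgue_on_iff) (auto elim: eventually_mono)
    moreover have "frac_integral S 0 g = g" by (rule ext) (simp add: frac_integral_def)
    ultimately have "frac_parabolic (ennreal q) ?I D A S 0 g U"
      using g Lp_cong[OF I g gU] by (auto simp: frac_parabolic_def elim: eventually_mono)
    then show ?thesis using True U_cont by (simp add: h_def U_def)
  next
    case False
    have "\<exists>i. 1 \<le> i \<and> i \<le> n \<and> s - \<sigma> = real i"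
    proof (cases "\<sigma> = max (s - 1) 0")
      case True
      then have "1 \<le> s" "s - \<sigma> = real 1" using False by auto
      moreover have "1 \<le> n" using s unfolding n_def by linarith
      ultimately show ?thesis by blast
    next
      case False
      then obtain k where k: "k \<in> {1..nat \<lfloor>s\<rfloor>}" "\<sigma> = frac s + real k - 1" using \<sigma> by auto
      have fl: "real (nat \<lfloor>s\<rfloor>) = of_int \<lfloor>s\<rfloor>" using s by simp
      have "nat \<lfloor>s\<rfloor> \<le> n" unfolding n_def by (intro nat_mono) linarith
      moreover have "s - \<sigma> = real (nat \<lfloor>s\<rfloor> - k + 1)"
        using k fl by (simp add: frac_def of_nat_diff)
      ultimately show ?thesis using k(1) by (intro exI[of _ "nat \<lfloor>s\<rfloor> - k + 1"]) auto
    qed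
    then obtain i where i: "1 \<le> i" "i \<le> n" "s - \<sigma> = real i" by blast
    have \<sigma>_eq: "\<sigma> = s - real i" using i(3) by simp
    have "continuous_on ?I (frac_integral S (real i) f1)"
      using stage[OF i(1,2)] by (intro continuous_on_subset[OF frac_integral_Lp_continuous[OF _ f1(1)]]) auto
    then show ?thesis using stage[OF i(1,2)] by (simp add: h_def \<sigma>_eq)
  qed
  have bdd_h: "bounded (h (max (s - 1) 0) ` ?I)"
  proof (cases "s < 1")
    case True then show ?thesis using bdd[OF adm] by (simp add: h_def)
  next
    case False
    then have "s - max (s - 1) 0 = 1" by simp
    then show ?thesis using bdd[OF admissible_ge_1[OF q, of 1]] by (simp add: h_def)
  qed
  have nat_case: "U t = (\<Sum>k<n. ((t - t\<^sub>0) ^ k / fact k) *\<^sub>R S (t - t\<^sub>0) (h (real k) t\<^sub>0))"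
    if t: "t\<^sub>0 < t" and n: "s = real n" for t and n :: nat
  proof -
    have "U t = (\<Sum>k<n. ((t - t\<^sub>0) ^ k / fact k) *\<^sub>R S (t - t\<^sub>0) (frac_integral S (real (n - k)) f1 t\<^sub>0))"
      using mild_formula_nat[OF _ q f1(1) zero, of n t\<^sub>0 "t - t\<^sub>0"] s t by (simp add: U_def n)
    also have "\<dots> = (\<Sum>k<n. ((t - t\<^sub>0) ^ k / fact k) *\<^sub>R S (t - t\<^sub>0) (h (real k) t\<^sub>0))"
      by (intro sum.cong refl) (simp add: h_def n of_nat_diff)
    finally show ?thesis .
  qed
  have frac_case: "let K = (\<lambda>\<tau>. (\<tau> powr (- frac s) / (\<tau> + 1)) *\<^sub>R S ((t - t\<^sub>0) * (\<tau> + 1)) (U (t\<^sub>0 - (t - t\<^sub>0) * \<tau>)))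
     in bochner_integrable (lebesgue_on {0..}) K \<and>
        U t = (sin (pi * frac s) / pi) *\<^sub>R bochner_integral (lebesgue_on {0..}) K
          + (\<Sum>k=1..nat \<lfloor>s\<rfloor>. ((t - t\<^sub>0) powr (frac s + real k - 1) / Gamma (frac s + real k)) *\<^sub>R
               S (t - t\<^sub>0) (h (frac s + real k - 1) t\<^sub>0))"
    if t: "t\<^sub>0 < t" and ns: "s \<notin> \<nat>" for t
  proof -
    have "s \<notin> \<int>" using ns s by (auto simp: Nats_altdef2)
    then have \<theta>: "0 < frac s" "frac s < 1" using frac_gt_0_iff frac_lt_1 by auto
    have fl: "s = frac s + real (nat \<lfloor>s\<rfloor>)" using s by (simp add: frac_def)
    have a: "0 < t - t\<^sub>0" using t by simp
    have "(\<Sum>k=1..nat \<lfloor>s\<rfloor>. ((t - t\<^sub>0) powr (frac s + real k - 1) / Gamma (frac s + real k)) *\<^sub>R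
               S (t - t\<^sub>0) (h (frac s + real k - 1) t\<^sub>0))
        = (\<Sum>k=1..nat \<lfloor>s\<rfloor>. ((t - t\<^sub>0) powr (frac s + real k - 1) / Gamma (frac s + real k)) *\<^sub>R
               S (t - t\<^sub>0) (frac_integral S (real (nat \<lfloor>s\<rfloor> - k + 1)) f1 t\<^sub>0))"
    proof (intro sum.cong refl)
      fix k assume "k \<in> {1..nat \<lfloor>s\<rfloor>}"
      then have "s - (frac s + real k - 1) = real (nat \<lfloor>s\<rfloor> - k + 1)"
        using fl by (simp add: of_nat_diff)
      then show "((t - t\<^sub>0) powr (frac s + real k - 1) / Gamma (frac s + real k)) *\<^sub>R
               S (t - t\<^sub>0) (h (frac s + real k - 1) t\<^sub>0)
        = ((t - t\<^sub>0) powr (frac s + real k - 1) / Gamma (frac s + real k)) *\<^sub>R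
               S (t - t\<^sub>0) (frac_integral S (real (nat \<lfloor>s\<rfloor> - k + 1)) f1 t\<^sub>0)"
        by (simp only: h_def)
    qed
    moreover have "\<And>t. t\<^sub>0 < t \<Longrightarrow> f1 t = 0" by (rule zero)
    ultimately show ?thesis
      using mild_formula_frac[OF \<theta> fl adm f1(1) _ a, of t\<^sub>0] unfolding Let_def U_def by (simp only:) simp
  qed
  show ?thesis unfolding mild_solution_def
  proof (intro exI[of _ U] exI[of _ h] conjI)
    show "AE t in lebesgue_on ?I. g t = U t" using gU I by (simp add: AE_lebesgue_on_iff)
    show "AE t in lebesgue. u t = U t" using uU by (simp add: AE_completion_iff)
    show "bounded (U ` ?I)" "bounded (U ` (- {t\<^sub>0}))" unfolding U_def by (rule bdd[OF adm])+
    show "\<forall>\<sigma>\<in>{max (s - 1) 0} \<union> {frac s + real k - 1 |k. k \<in> {1..nat \<lfloor>s\<rfloor>}}.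
       frac_parabolic (ennreal q) ?I D A S \<sigma> g (h \<sigma>) \<and> continuous_on ?I (h \<sigma>)" using orders by blast
    show "continuous_on ?I U" "continuous_on (- {t\<^sub>0}) U" by (rule U_cont)+
    show "bounded (h (max (s - 1) 0) ` ?I)" by (rule bdd_h)
    show "\<forall>t\<le>t\<^sub>0. U t = U t" by simp
    show "s \<notin> \<nat> \<longrightarrow> (\<forall>t>t\<^sub>0. let K = (\<lambda>\<tau>. (\<tau> powr (- frac s) / (\<tau> + 1)) *\<^sub>R S ((t - t\<^sub>0) * (\<tau> + 1)) (U (t\<^sub>0 - (t - t\<^sub>0) * \<tau>)))
     in bochner_integrable (lebesgue_on {0..}) K \<and>
        U t = (sin (pi * frac s) / pi) *\<^sub>R bochner_integral (lebesgue_on {0..}) K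
          + (\<Sum>k=1..nat \<lfloor>s\<rfloor>. ((t - t\<^sub>0) powr (frac s + real k - 1) / Gamma (frac s + real k)) *\<^sub>R
               S (t - t\<^sub>0) (h (frac s + real k - 1) t\<^sub>0)))"
      by (intro impI allI frac_case)
    show "\<forall>n::nat. s = real n \<longrightarrow> (\<forall>t>t\<^sub>0. U t = (\<Sum>k<n. ((t - t\<^sub>0) ^ k / fact k) *\<^sub>R S (t - t\<^sub>0) (h (real k) t\<^sub>0)))"
      by (intro impI allI nat_case)
  qed
qed

end

theorem theorem4p5:
  fixes S :: "real \<Rightarrow> ('a::complex_banach \<Rightarrow>\<^sub>L 'a)"
    and D :: "'a set" and A :: "'a \<Rightarrow> 'a"
    and M\<^sub>0 w t\<^sub>0 s :: real and p :: ennreal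
    and g u :: "real \<Rightarrow> 'a"
  assumes "strongly_measurable_semigroup S"
    and "1 \<le> M\<^sub>0" and "0 < w"
    and "\<And>t. 0 \<le> t \<Longrightarrow> norm (S t) \<le> M\<^sub>0 * exp (- w * t)"
    and "infinitesimal_generator S w D (\<lambda>x. - A x)"
    and "0 < s" and "1 \<le> p"
    and "(p = 1 \<and> 1 \<le> s) \<or> (1 < p \<and> p < \<infinity> \<and> 1 / enn2real p < s)"
    and "Lp p {..t\<^sub>0} g"
    and "Lp_solution p D A S s t\<^sub>0 g u"
  shows "mild_solution p D A S s t\<^sub>0 g u"
proof -
  interpret generated_semigroup S M\<^sub>0 w D A
    using assms(1-5) by unfold_locales
  have "p \<noteq> \<infinity>" using assms(8) by auto
  then obtain q where q: "p = ennreal q" "0 \<le> q" by (cases p) auto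
  have "admissible q s"
    using assms(8) q by (auto simp: admissible_def ennreal_less_iff ennreal_eq_1 simp flip: ennreal_1)
  then show ?thesis using Lp_solution_mild[of q s t\<^sub>0 g u] assms(9,10) by (simp add: q)
qed

end
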